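(* Let $G$ be a finite group, $V$ a finite dimensional $\mathbb{C}G$-module, and $K$ the kernel of the action of $G$ on $V$. The Gerstenhaber square bracket of every $\alpha$ in $\mathrm{HH}^2(S(V)\#G)$ supported off of $K$ (i.e., on $G\setminus K$) is zero, $[\alpha,\alpha]=0$; that is, $\alpha$ defines a noncommutative Poisson structure on $S(V)\#G$.
   Context: $S(V)$ is the symmetric algebra with the induced $G$-action. The skew group algebra $A=S(V)\#G$ is $S(V)\otimes\mathbb{C}G$ (write $s\overline g$ for $s\otimes g$) with $(r\overline g)(s\overline h)=r({}^gs)\overline{gh}$. $\mathrm{HH}^\bullet(A,M)=\mathrm{Ext}^\bullet_{A\otimes A^{op}}(A,M)$, $\mathrm{HH}^\bullet(A)=\mathrm{HH}^\bullet(A,A)$, computed by bar cochains $\mathrm{Hom}_{\mathbb C}(A^{\otimes p},M)$. Gerstenhaber bracket: for $f,f'$ of degrees $p,q$, $[f,f']=f\,\overline\circ\, f'-(-1)^{(p-1)(q-1)}f'\,\overline\circ\, f$, where $(f\,\overline\circ\, f')(a_1\otimes\cdots\otimes a_{p+q-1})=\sum_{k=1}^p(-1)^{(q-1)(k-1)}f(a_1\otimes\cdots\otimes a_{k-1}\otimes f'(a_k\otimes\cdots\otimes a_{k+q-1})\otimes a_{k+q}\otimes\cdots\otimes a_{p+q-1})$. A noncommutative Poisson structure on an algebra $A$ is an element $\alpha\in\mathrm{HH}^2(A)$ with $[\alpha,\alpha]=0$ in $\mathrm{HH}^3(A)$. Support: restricting cochains along $S(V)\hookrightarrow A$ induces an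 isomorphism $\mathrm{HH}^\bullet(A)\cong\mathrm{HH}^\bullet(S(V),A)^G$, and $\mathrm{HH}^\bullet(S(V),A)=\bigoplus_{g\in G}\mathrm{HH}^\bullet(S(V),S(V)\overline g)$. An element of $\mathrm{HH}^\bullet(A)$ is supported on $X\subseteq G$ if its image lies in $\bigoplus_{g\in X}\mathrm{HH}^\bullet(S(V),S(V)\overline g)$. *)

theory Defs
  imports Complex_Main "HOL-Library.Poly_Mapping" "HOL-Algebra.Group_Action"
begin

section \<open>Hochschild cohomology and the Gerstenhaber bracket\<close>

text \<open>
  An associative complex algebra living in an ambient abelian group: the underlying space is a
  subset of the type, and the addition is that of the type.  The unit is not recorded, because the
  bar complex does not use it.
\<close>

record 'a cx_algebra =
  aspace :: "'a set"
  amult :: "'a \<Rightarrow> 'a \<Rightarrow> 'a"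
  ascale :: "complex \<Rightarrow> 'a \<Rightarrow> 'a"

definition tuples :: "'a set \<Rightarrow> nat \<Rightarrow> 'a list set" where
  "tuples B p = {xs. length xs = p \<and> set xs \<subseteq> B}"

definition signed :: "nat \<Rightarrow> 'a::ab_group_add \<Rightarrow> 'a" where
  "signed n x = (if even n then x else - x)"

text \<open>
  In the following definitions \<open>B\<close> is a subalgebra of \<open>A\<close> and \<open>M\<close> is a subspace of \<open>A\<close>
  that is a \<open>B\<close>-subbimodule; the Hochschild cohomology of \<open>A\<close> itself is the case where \<open>B\<close> and
  \<open>M\<close> are both \<open>aspace A\<close>.  A \<open>p\<close>-cochain, i.e. a linear map from the \<open>p\<close>-th tensor power of
  \<open>B\<close> to \<open>M\<close>, is given as a multilinear function of \<open>p\<close> arguments from \<open>B\<close>, with arbitrary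
  values elsewhere; those values are disregarded by \<open>hh_rel\<close> below.
\<close>

definition cochains ::
  "('a::ab_group_add) cx_algebra \<Rightarrow> 'a set \<Rightarrow> 'a set \<Rightarrow> nat \<Rightarrow> ('a list \<Rightarrow> 'a) set" where
  "cochains A B M p = {f. \<forall>xs\<in>tuples B p. f xs \<in> M \<and>
     (\<forall>i<p. \<forall>a\<in>B. \<forall>b\<in>B. f (xs[i := a + b]) = f (xs[i := a]) + f (xs[i := b])) \<and>
     (\<forall>i<p. \<forall>a\<in>B. \<forall>c. f (xs[i := ascale A c a]) = ascale A c (f (xs[i := a])))}"

definition hh_diff ::
  "('a::ab_group_add) cx_algebra \<Rightarrow> nat \<Rightarrow> ('a list \<Rightarrow> 'a) \<Rightarrow> 'a list \<Rightarrow> 'a" where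
  "hh_diff A p f xs =
     amult A (xs ! 0) (f (drop 1 xs))
     + (\<Sum>k<p. signed (k + 1)
          (f (take k xs @ [amult A (xs ! k) (xs ! (k + 1))] @ drop (k + 2) xs)))
     + signed (p + 1) (amult A (f (take p xs)) (xs ! p))"

definition cocycles ::
  "('a::ab_group_add) cx_algebra \<Rightarrow> 'a set \<Rightarrow> 'a set \<Rightarrow> nat \<Rightarrow> ('a list \<Rightarrow> 'a) set" where
  "cocycles A B M p = {f \<in> cochains A B M p. \<forall>xs\<in>tuples B (p + 1). hh_diff A p f xs = 0}"

definition coboundaries ::
  "('a::ab_group_add) cx_algebra \<Rightarrow> 'a set \<Rightarrow> 'a set \<Rightarrow> nat \<Rightarrow> ('a list \<Rightarrow> 'a) set" where
  "coboundaries A B M p = (case p of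
       0 \<Rightarrow> {f. \<forall>xs\<in>tuples B 0. f xs = 0}
     | Suc q \<Rightarrow> {f. \<exists>h\<in>cochains A B M q. \<forall>xs\<in>tuples B p. f xs = hh_diff A q h xs})"

definition hh_rel ::
  "('a::ab_group_add) cx_algebra \<Rightarrow> 'a set \<Rightarrow> 'a set \<Rightarrow> nat \<Rightarrow> ('a list \<Rightarrow> 'a) rel" where
  "hh_rel A B M p = {(f, f'). f \<in> cocycles A B M p \<and> f' \<in> cocycles A B M p \<and>
     (\<lambda>xs. f xs - f' xs) \<in> coboundaries A B M p}"

definition HH ::
  "('a::ab_group_add) cx_algebra \<Rightarrow> 'a set \<Rightarrow> 'a set \<Rightarrow> nat \<Rightarrow> ('a list \<Rightarrow> 'a) set set" where
  "HH A B M p = cocycles A B M p // hh_rel A B M p"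

definition HH_zero ::
  "('a::ab_group_add) cx_algebra \<Rightarrow> 'a set \<Rightarrow> 'a set \<Rightarrow> nat \<Rightarrow> ('a list \<Rightarrow> 'a) set" where
  "HH_zero A B M p = hh_rel A B M p `` {\<lambda>_. 0}"

abbreviation HH_self :: "('a::ab_group_add) cx_algebra \<Rightarrow> nat \<Rightarrow> ('a list \<Rightarrow> 'a) set set" where
  "HH_self A p \<equiv> HH A (aspace A) (aspace A) p"

text \<open>
  The argument position \<open>k\<close> is counted from 0, and the sign exponents \<open>(q - 1) k\<close> and
  \<open>(p - 1) (q - 1)\<close> are replaced by ones of the same parity that avoid truncated subtraction.
\<close>

definition circ ::
  "nat \<Rightarrow> nat \<Rightarrow> ('a::ab_group_add list \<Rightarrow> 'a) \<Rightarrow> ('a list \<Rightarrow> 'a) \<Rightarrow> 'a list \<Rightarrow> 'a" where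
  "circ p q f f' xs =
     (\<Sum>k<p. signed ((q + 1) * k) (f (take k xs @ [f' (take q (drop k xs))] @ drop (k + q) xs)))"

definition gerstenhaber ::
  "nat \<Rightarrow> nat \<Rightarrow> ('a::ab_group_add list \<Rightarrow> 'a) \<Rightarrow> ('a list \<Rightarrow> 'a) \<Rightarrow> 'a list \<Rightarrow> 'a" where
  "gerstenhaber p q f f' xs = circ p q f f' xs - signed ((p + 1) * (q + 1)) (circ q p f' f xs)"

text \<open>The induced bracket on cohomology classes of degrees \<open>p\<close> and \<open>q\<close>, not both 0.\<close>

definition HH_bracket ::
  "('a::ab_group_add) cx_algebra \<Rightarrow> nat \<Rightarrow> nat \<Rightarrow> ('a list \<Rightarrow> 'a) set \<Rightarrow> ('a list \<Rightarrow> 'a) set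
     \<Rightarrow> ('a list \<Rightarrow> 'a) set" where
  "HH_bracket A p q \<alpha> \<beta> =
     (\<Union>f\<in>\<alpha>. \<Union>f'\<in>\<beta>.
        hh_rel A (aspace A) (aspace A) (p + q - 1) `` {gerstenhaber p q f f'})"

definition noncommutative_poisson ::
  "('a::ab_group_add) cx_algebra \<Rightarrow> ('a list \<Rightarrow> 'a) set \<Rightarrow> bool" where
  "noncommutative_poisson A \<alpha> \<longleftrightarrow>
     \<alpha> \<in> HH_self A 2 \<and> HH_bracket A 2 2 \<alpha> \<alpha> = HH_zero A (aspace A) (aspace A) 3"


section \<open>The symmetric algebra\<close>

text \<open>
  The symmetric algebra of a complex vector space with basis \<open>Bs\<close> is the polynomial algebra in
  the elements of \<open>Bs\<close>; \<open>sym_embed\<close> is the inclusion of the vector space as the linear forms.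
  This does not depend on the basis: see \<open>sym_alg_universal\<close> and \<open>sym_alg_hom_unique\<close> below for
  the universal property.
\<close>

type_synonym 'v cpoly = "('v \<Rightarrow>\<^sub>0 nat) \<Rightarrow>\<^sub>0 complex"

definition pconst :: "complex \<Rightarrow> 'v cpoly" where
  "pconst c = Poly_Mapping.single 0 c"

definition pvar :: "'v \<Rightarrow> 'v cpoly" where
  "pvar b = Poly_Mapping.single (Poly_Mapping.single b 1) 1"

definition sym_alg :: "'v set \<Rightarrow> 'v cpoly set" where
  "sym_alg Bs = {s. \<forall>m\<in>Poly_Mapping.keys s. Poly_Mapping.keys m \<subseteq> Bs}"

definition sym_embed :: "(complex \<Rightarrow> 'v::ab_group_add \<Rightarrow> 'v) \<Rightarrow> 'v set \<Rightarrow> 'v \<Rightarrow> 'v cpoly" where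
  "sym_embed scl Bs v = (\<Sum>b\<in>Bs. pconst (module.representation scl Bs v b) * pvar b)"

text \<open>Evaluation of polynomials in a commutative algebra with structure map \<open>\<eta>\<close>.\<close>

definition peval :: "(complex \<Rightarrow> 'c::comm_ring_1) \<Rightarrow> ('v \<Rightarrow> 'c) \<Rightarrow> 'v cpoly \<Rightarrow> 'c" where
  "peval \<eta> \<phi> s =
     (\<Sum>m\<in>Poly_Mapping.keys s. \<eta> (Poly_Mapping.lookup s m) *
        (\<Prod>b\<in>Poly_Mapping.keys m. \<phi> b ^ Poly_Mapping.lookup m b))"

text \<open>The algebra endomorphism of the symmetric algebra induced by a linear map \<open>T\<close>.\<close>

definition sym_map ::
  "(complex \<Rightarrow> 'v::ab_group_add \<Rightarrow> 'v) \<Rightarrow> 'v set \<Rightarrow> ('v \<Rightarrow> 'v) \<Rightarrow> 'v cpoly \<Rightarrow> 'v cpoly" where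
  "sym_map scl Bs T = peval pconst (\<lambda>b. sym_embed scl Bs (T b))"

lemma sum_singles: "(\<Sum>k\<in>Poly_Mapping.keys p. Poly_Mapping.single k (Poly_Mapping.lookup p k)) = p"
  by (rule poly_mapping_eqI) (simp add: lookup_sum lookup_single when_def sum.delta in_keys_iff)

text \<open>Structure maps of commutative complex algebras.\<close>

locale cstruct =
  fixes \<eta> :: "complex \<Rightarrow> 'c::comm_ring_1"
  assumes eta_1: "\<eta> 1 = 1"
    and eta_add: "\<eta> (x + y) = \<eta> x + \<eta> y"
    and eta_mult: "\<eta> (x * y) = \<eta> x * \<eta> y"
begin

lemma eta_0: "\<eta> 0 = 0" using eta_add[of 0 0] by simp

lemma mon_superset:
  assumes "finite K" "Poly_Mapping.keys m \<subseteq> K"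
  shows "(\<Prod>b\<in>Poly_Mapping.keys m. \<phi> b ^ Poly_Mapping.lookup m b)
    = (\<Prod>b\<in>K. \<phi> b ^ Poly_Mapping.lookup m b)"
  using assms by (intro prod.mono_neutral_left) (auto simp: in_keys_iff)

lemma mon_add:
  fixes \<phi> :: "'v \<Rightarrow> 'c"
  shows "(\<Prod>b\<in>Poly_Mapping.keys (m + n). \<phi> b ^ Poly_Mapping.lookup (m + n) b) =
    (\<Prod>b\<in>Poly_Mapping.keys m. \<phi> b ^ Poly_Mapping.lookup m b) * (\<Prod>b\<in>Poly_Mapping.keys n. \<phi> b ^ Poly_Mapping.lookup n b)"
proof -
  let ?K = "Poly_Mapping.keys m \<union> Poly_Mapping.keys n"
  have "Poly_Mapping.keys (m+n) \<subseteq> ?K" by (rule Poly_Mapping.keys_add)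
  then show ?thesis
    using mon_superset[of ?K m \<phi>] mon_superset[of ?K n \<phi>] mon_superset[of ?K "m+n" \<phi>]
    by (simp add: lookup_add power_add prod.distrib)
qed

lemma peval_single:
  "peval \<eta> \<phi> (Poly_Mapping.single m c) = \<eta> c * (\<Prod>b\<in>Poly_Mapping.keys m. \<phi> b ^ Poly_Mapping.lookup m b)"
  by (simp add: peval_def eta_0)

lemma peval_0 [simp]: "peval \<eta> \<phi> 0 = 0" by (simp add: peval_def)

lemma peval_add: "peval \<eta> \<phi> (s + t) = peval \<eta> \<phi> s + peval \<eta> \<phi> t"
  unfolding peval_def
  by (rule setsum_keys_plus_distrib) (simp_all add: eta_0 eta_add distrib_right)

lemma peval_sum: "peval \<eta> \<phi> (sum f I) = (\<Sum>i\<in>I. peval \<eta> \<phi> (f i))"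
  by (induction I rule: infinite_finite_induct) (simp_all add: peval_add)

lemma peval_mult: "peval \<eta> \<phi> (s * t) = peval \<eta> \<phi> s * peval \<eta> \<phi> t"
proof -
  have "peval \<eta> \<phi> (s * t) =
    peval \<eta> \<phi> (\<Sum>k\<in>Poly_Mapping.keys s. \<Sum>l\<in>Poly_Mapping.keys t.
      Poly_Mapping.single (k + l) (Poly_Mapping.lookup s k * Poly_Mapping.lookup t l))"
    by (subst (1) sum_singles[of s, symmetric], subst (1) sum_singles[of t, symmetric])
       (simp add: sum_product mult_single)
  also have "\<dots> = peval \<eta> \<phi> s * peval \<eta> \<phi> t"
    by (simp add: peval_sum peval_single eta_mult mon_add)
       (simp add: peval_def sum_product mult_ac)
  finally show ?thesis .
qed

lemma peval_const: "peval \<eta> \<phi> (pconst c) = \<eta> c"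
  by (simp add: pconst_def peval_single)

lemma peval_var: "peval \<eta> \<phi> (pvar b) = \<phi> b"
  by (simp add: pvar_def peval_single eta_1)

end

lemma sym_alg_universal:
  fixes scl :: "complex \<Rightarrow> 'v::ab_group_add \<Rightarrow> 'v"
    and \<eta> :: "complex \<Rightarrow> 'c::comm_ring_1" and f :: "'v \<Rightarrow> 'c"
  assumes V: "finite_dimensional_vector_space scl Bs"
    and eta: "\<eta> 1 = 1" "\<And>x y. \<eta> (x + y) = \<eta> x + \<eta> y" "\<And>x y. \<eta> (x * y) = \<eta> x * \<eta> y"
    and f: "\<And>v w. f (v + w) = f v + f w" "\<And>c v. f (scl c v) = \<eta> c * f v"
  shows "peval \<eta> f (sym_embed scl Bs v) = f v"
    and "peval \<eta> f (pconst c) = \<eta> c"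
    and "peval \<eta> f (s + t) = peval \<eta> f s + peval \<eta> f t"
    and "peval \<eta> f (s * t) = peval \<eta> f s * peval \<eta> f t"
proof -
  interpret finite_dimensional_vector_space scl Bs by fact
  interpret cstruct \<eta> by standard (fact eta)+
  have f0: "f 0 = 0" using f(1)[of 0 0] by simp
  have fs: "f (sum g I) = (\<Sum>i\<in>I. f (g i))" for g and I :: "'v set"
    by (induction I rule: infinite_finite_induct) (simp_all add: f f0)
  have "(\<Sum>b\<in>Bs. scl (representation Bs v b) b) = v"
    by (rule sum_representation_eq) (use span_Basis independent_Basis finite_Basis in auto)
  then have "f v = (\<Sum>b\<in>Bs. \<eta> (representation Bs v b) * f b)"
    by (metis (no_types, lifting) fs f(2) sum.cong)
  then show "peval \<eta> f (sym_embed scl Bs v) = f v"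
    by (simp add: sym_embed_def peval_sum peval_mult peval_const peval_var)
qed (intro cstruct.peval_const cstruct.peval_add cstruct.peval_mult cstruct.intro eta)+

lemma single_eq_prod:
  "Poly_Mapping.single m c =
     pconst c * (\<Prod>b\<in>Poly_Mapping.keys m. pvar b ^ Poly_Mapping.lookup m b)"
proof -
  have pw: "pvar b ^ n = Poly_Mapping.single (Poly_Mapping.single b n) 1" for b :: 'a and n
    by (induction n) (simp_all add: pvar_def mult_single single_add[symmetric])
  have pr: "(\<Prod>b\<in>I. Poly_Mapping.single (h b) (1::complex)) = Poly_Mapping.single (sum h I) 1"
    for h :: "'a \<Rightarrow> 'a \<Rightarrow>\<^sub>0 nat" and I
    by (induction I rule: infinite_finite_induct) (simp_all add: mult_single)
  show ?thesis by (simp add: pw pr sum_singles pconst_def mult_single)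
qed

lemma sym_embed_basis:
  assumes "finite_dimensional_vector_space scl Bs" "b \<in> Bs"
  shows "sym_embed scl Bs b = pvar b"
proof -
  interpret finite_dimensional_vector_space scl Bs by fact
  have r: "representation Bs b x = (if x = b then 1 else 0)" for x
    using representation_basis[OF independent_Basis assms(2)] by simp
  have "sym_embed scl Bs b = (\<Sum>x\<in>Bs. if x = b then pvar b else 0)"
    unfolding sym_embed_def by (intro sum.cong) (simp_all add: r pconst_def)
  then show ?thesis using assms(2) finite_Basis by simp
qed

lemma sym_alg_hom_unique:
  fixes scl :: "complex \<Rightarrow> 'v::ab_group_add \<Rightarrow> 'v" and F F' :: "'v cpoly \<Rightarrow> 'c::comm_ring_1"
  assumes V: "finite_dimensional_vector_space scl Bs"
    and F: "\<And>s t. s \<in> sym_alg Bs \<Longrightarrow> t \<in> sym_alg Bs \<Longrightarrow> F (s + t) = F s + F t"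
      "\<And>s t. s \<in> sym_alg Bs \<Longrightarrow> t \<in> sym_alg Bs \<Longrightarrow> F (s * t) = F s * F t"
    and F': "\<And>s t. s \<in> sym_alg Bs \<Longrightarrow> t \<in> sym_alg Bs \<Longrightarrow> F' (s + t) = F' s + F' t"
      "\<And>s t. s \<in> sym_alg Bs \<Longrightarrow> t \<in> sym_alg Bs \<Longrightarrow> F' (s * t) = F' s * F' t"
    and eq: "\<And>c. F (pconst c) = F' (pconst c)"
      "\<And>v. F (sym_embed scl Bs v) = F' (sym_embed scl Bs v)"
    and s: "s \<in> sym_alg Bs"
  shows "F s = F' s"
proof -
  let ?E = "{t \<in> sym_alg Bs. F t = F' t}"
  have c: "pconst c \<in> ?E" for c
    using eq(1)[of c] by (simp add: sym_alg_def pconst_def)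
  have v: "pvar b \<in> ?E" if "b \<in> Bs" for b
    using eq(2)[of b] that
    by (simp add: sym_alg_def pvar_def[symmetric] sym_embed_basis[OF V]) (simp add: pvar_def)
  have add: "t + u \<in> ?E" if "t \<in> ?E" "u \<in> ?E" for t u
    using that F(1)[of t u] F'(1)[of t u] Poly_Mapping.keys_add[of t u]
    by (auto simp: sym_alg_def)
  have mult: "t * u \<in> ?E" if t: "t \<in> ?E" and u: "u \<in> ?E" for t u
  proof -
    have "Poly_Mapping.keys m \<subseteq> Bs" if m: "m \<in> Poly_Mapping.keys (t * u)" for m
    proof -
      obtain k l where "m = k + l" "k \<in> Poly_Mapping.keys t" "l \<in> Poly_Mapping.keys u"
        using keys_mult[of t u] m by blast
      then show ?thesis
        using t u Poly_Mapping.keys_add[of k l] unfolding sym_alg_def by blast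
    qed
    then have "t * u \<in> sym_alg Bs" by (simp add: sym_alg_def)
    then show ?thesis using t u F(2)[of t u] F'(2)[of t u] by simp
  qed
  have one: "1 \<in> ?E" using c[of 1] by (simp add: pconst_def)
  have zero: "0 \<in> ?E" using c[of 0] by (simp add: pconst_def)
  have pow: "t ^ n \<in> ?E" if "t \<in> ?E" for t n
    by (induction n) (use one mult that in auto)
  have prod: "prod h I \<in> ?E" if "\<And>i. i \<in> I \<Longrightarrow> h i \<in> ?E" for h and I :: "'v set"
    using that by (induction I rule: infinite_finite_induct) (use one mult in auto)
  have sum: "sum h I \<in> ?E" if "\<And>i. i \<in> I \<Longrightarrow> h i \<in> ?E" for h and I :: "('v \<Rightarrow>\<^sub>0 nat) set"
    using that by (induction I rule: infinite_finite_induct) (use zero add in auto)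
  have "(\<Sum>m\<in>Poly_Mapping.keys s. Poly_Mapping.single m (Poly_Mapping.lookup s m)) \<in> ?E"
  proof (rule sum)
    fix m assume "m \<in> Poly_Mapping.keys s"
    then have "Poly_Mapping.keys m \<subseteq> Bs" using s by (auto simp: sym_alg_def)
    then show "Poly_Mapping.single m (Poly_Mapping.lookup s m) \<in> ?E"
      unfolding single_eq_prod[of m] by (intro mult c prod pow v) auto
  qed
  then show ?thesis by (simp add: sum_singles)
qed


section \<open>The skew group algebra\<close>

text \<open>
  The element \<open>Poly_Mapping.single g s\<close> is the tensor product of \<open>s\<close> and \<open>g\<close>.
\<close>

definition skew_mult ::
  "('g, 'm) monoid_scheme \<Rightarrow> (complex \<Rightarrow> 'v::ab_group_add \<Rightarrow> 'v) \<Rightarrow> 'v set \<Rightarrow> ('g \<Rightarrow> 'v \<Rightarrow> 'v)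
     \<Rightarrow> ('g \<Rightarrow>\<^sub>0 'v cpoly) \<Rightarrow> ('g \<Rightarrow>\<^sub>0 'v cpoly) \<Rightarrow> ('g \<Rightarrow>\<^sub>0 'v cpoly)" where
  "skew_mult G scl Bs \<rho> a b =
     (\<Sum>g\<in>Poly_Mapping.keys a. \<Sum>h\<in>Poly_Mapping.keys b.
        Poly_Mapping.single (g \<otimes>\<^bsub>G\<^esub> h)
          (Poly_Mapping.lookup a g * sym_map scl Bs (\<rho> g) (Poly_Mapping.lookup b h)))"

definition skew_group_algebra ::
  "('g, 'm) monoid_scheme \<Rightarrow> (complex \<Rightarrow> 'v::ab_group_add \<Rightarrow> 'v) \<Rightarrow> 'v set \<Rightarrow> ('g \<Rightarrow> 'v \<Rightarrow> 'v)
     \<Rightarrow> ('g \<Rightarrow>\<^sub>0 'v cpoly) cx_algebra" where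
  "skew_group_algebra G scl Bs \<rho> =
     \<lparr>aspace = {a. Poly_Mapping.keys a \<subseteq> carrier G \<and>
                   (\<forall>g\<in>carrier G. Poly_Mapping.lookup a g \<in> sym_alg Bs)},
      amult = skew_mult G scl Bs \<rho>,
      ascale = (\<lambda>c. Poly_Mapping.map (\<lambda>s. pconst c * s))\<rparr>"

text \<open>
  The subspace of the skew group algebra formed by the elements \<open>s \<otimes> g\<close>, for fixed \<open>g\<close>.
  For \<open>g = \<one>\<close> it is the image of the symmetric algebra as a subalgebra.
\<close>

definition skew_component :: "'v set \<Rightarrow> 'g \<Rightarrow> ('g \<Rightarrow>\<^sub>0 'v cpoly) set" where
  "skew_component Bs g = Poly_Mapping.single g ` sym_alg Bs"

text \<open>
  The map from the cohomology of the skew group algebra to that of the symmetric algebra with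
  coefficients in the \<open>g\<close>-component: restrict cochains to the symmetric algebra and project the
  values to the \<open>g\<close>-component.  The restriction is implicit, since \<open>hh_rel\<close> only inspects values
  on tuples from the subalgebra.
\<close>

definition HH_component ::
  "('g, 'm) monoid_scheme \<Rightarrow> (complex \<Rightarrow> 'v::ab_group_add \<Rightarrow> 'v) \<Rightarrow> 'v set \<Rightarrow> ('g \<Rightarrow> 'v \<Rightarrow> 'v)
     \<Rightarrow> nat \<Rightarrow> 'g \<Rightarrow> (('g \<Rightarrow>\<^sub>0 'v cpoly) list \<Rightarrow> ('g \<Rightarrow>\<^sub>0 'v cpoly)) set
     \<Rightarrow> (('g \<Rightarrow>\<^sub>0 'v cpoly) list \<Rightarrow> ('g \<Rightarrow>\<^sub>0 'v cpoly)) set" where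
  "HH_component G scl Bs \<rho> p g \<alpha> =
     (\<Union>f\<in>\<alpha>. hh_rel (skew_group_algebra G scl Bs \<rho>)
        (skew_component Bs \<one>\<^bsub>G\<^esub>) (skew_component Bs g) p
        `` {\<lambda>xs. Poly_Mapping.single g (Poly_Mapping.lookup (f xs) g)})"

definition supported_on ::
  "('g, 'm) monoid_scheme \<Rightarrow> (complex \<Rightarrow> 'v::ab_group_add \<Rightarrow> 'v) \<Rightarrow> 'v set \<Rightarrow> ('g \<Rightarrow> 'v \<Rightarrow> 'v)
     \<Rightarrow> nat \<Rightarrow> 'g set \<Rightarrow> (('g \<Rightarrow>\<^sub>0 'v cpoly) list \<Rightarrow> ('g \<Rightarrow>\<^sub>0 'v cpoly)) set \<Rightarrow> bool" where
  "supported_on G scl Bs \<rho> p X \<alpha> \<longleftrightarrow>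
     (\<forall>g\<in>carrier G - X. HH_component G scl Bs \<rho> p g \<alpha> =
        HH_zero (skew_group_algebra G scl Bs \<rho>)
          (skew_component Bs \<one>\<^bsub>G\<^esub>) (skew_component Bs g) p)"

end

theory Submission
  imports Defs "HOL-Library.Function_Algebras" "HOL-Algebra.Multiplicative_Group"
begin

text \<open>
  A class in degree two is represented by its components \<open>c\<^sub>g\<close>, cocycles of \<open>S(V)\<close> with values in
  \<open>S(V)g\<close>.  Such a cocycle is cohomologous to one in radial gauge, and this is determined by the
  alternating form \<open>\<omega>\<^sub>g(u, v) = c\<^sub>g(u, v) - c\<^sub>g(v, u)\<close> on \<open>V\<close>, a cocycle of a Koszul complex twisted by
  \<open>g\<close>.  A Laplacian there shows that \<open>\<omega>\<^sub>g\<close> may be taken to have coefficients on \<open>V\<^sup>g\<close> and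
  full degree in \<open>W\<^sub>g = im (1 - g)\<close>.  Averaging over \<open>G\<close> keeps these properties and makes the family
  invariant; invariance under \<open>g\<close> itself then leaves \<open>\<omega>\<^sub>g = 0\<close> or \<open>codim V\<^sup>g = 2\<close> for \<open>g\<close> acting
  nontrivially; for \<open>g\<close> in the kernel the support hypothesis gives \<open>c\<^sub>g = 0\<close>.

  The alternating part on \<open>V\<close> of the \<open>x\<close>-component of the bracket is a sum over \<open>gh = x\<close>.  If
  \<open>V\<^sup>g + V\<^sup>h \<noteq> V\<close>, the summand vanishes pointwise.  If \<open>V\<^sup>g + V\<^sup>h = V\<close> and both codimensions are
  two, then \<open>codim V\<^sup>x = 4\<close>, and the twisted Koszul complex of \<open>x\<close> has no cohomology in degree
  three.  So the bracket is exact on \<open>S(V)\<close>, and by averaging on \<open>S(V)#G\<close>.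
\<close>

section \<open>Partial derivatives on the symmetric algebra\<close>

text \<open>The obstacle is that the bracket evaluates \<open>c\<^sub>g\<close> on the values of
  \<open>c\<^sub>h\<close>, so knowing the class of \<open>c\<^sub>g\<close> is not enough: a
  representative with computable values is needed. The radial gauge supplies it. It survives linear
  substitutions, hence averaging, and it recovers \<open>c\<^sub>g\<close> from
  \<open>\<omega>\<^sub>g\<close> by a recursion on the degree which, for every subspace U of V,
  stays within polynomials on U. So if \<open>\<omega>\<^sub>g\<close> vanishes on
  \<open>V\<^sup>h\<close>, then \<open>c\<^sub>g\<close> vanishes on the algebra generated by
  \<open>V\<^sup>h\<close>, and this is where the coefficients of \<open>\<omega>\<^sub>h\<close>
  live. The Laplacian is never inverted. On closed forms its values are exact and its relevant
  eigenvalues are natural numbers, so the product of (Laplacian - k) over the positive ones is a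
  nonzero scalar modulo exact forms, and its image consists of harmonic forms. Three-cocycles are
  treated by the same gauge argument after their last argument is made part of the coefficients.
  Codimensions add when \<open>V\<^sup>g + V\<^sup>h = V\<close> because an invariant Hermitian form
  makes \<open>W\<^sub>g\<close> and \<open>V\<^sup>g\<close> orthogonal.\<close>

interpretation pc: cstruct "pconst :: complex \<Rightarrow> 'v cpoly"
  by standard (simp_all add: pconst_def single_add mult_single)

lemma pconst_add: "pconst (x + y) = pconst x + pconst y" by (rule pc.eta_add)
lemma pconst_mult: "pconst (x * y) = pconst x * pconst y" by (rule pc.eta_mult)
lemma pconst_0 [simp]: "pconst 0 = 0" by (rule pc.eta_0)
lemma pconst_1 [simp]: "pconst 1 = 1" by (rule pc.eta_1)
lemma pconst_uminus: "pconst (- x) = - pconst x"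
  using pconst_add[of "- x" x] by (simp add: eq_neg_iff_add_eq_0)
lemma pconst_diff: "pconst (x - y) = pconst x - pconst y"
  using pconst_add[of x "- y"] by (simp add: pconst_uminus)
lemma pconst_of_nat: "pconst (of_nat n) = of_nat n"
  by (induction n) (simp_all add: pconst_add)
lemma pconst_sum: "pconst (sum f I) = (\<Sum>i\<in>I. pconst (f i))"
  by (induction I rule: infinite_finite_induct) (simp_all add: pconst_add)

lemma pconst_cancel: "k \<noteq> 0 \<Longrightarrow> pconst k * (pconst (1 / k) * s) = s"
  by (simp add: mult.assoc[symmetric] pconst_mult[symmetric])

lemma pconst_mult_eq_0: "(k::complex) \<noteq> 0 \<Longrightarrow> pconst k * s = 0 \<Longrightarrow> s = 0"
  by (metis mult.left_commute mult_zero_right pconst_cancel)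

text \<open>If \<open>i\<close> does not occur in the monomial \<open>m\<close>, the truncated
  subtraction leaves \<open>m\<close> unchanged, but the coefficient \<open>lookup m i\<close> is
  then 0, so no spurious term arises.\<close>

definition pd :: "'v \<Rightarrow> 'v cpoly \<Rightarrow> 'v cpoly" where
  "pd i s = (\<Sum>m\<in>Poly_Mapping.keys s. Poly_Mapping.single (m - Poly_Mapping.single i 1)
      (of_nat (Poly_Mapping.lookup m i) * Poly_Mapping.lookup s m))"

lemma pd_single: "pd i (Poly_Mapping.single m c) =
    Poly_Mapping.single (m - Poly_Mapping.single i 1) (of_nat (Poly_Mapping.lookup m i) * c)"
  by (simp add: pd_def)

lemma pd_add: "pd i (s + t) = pd i s + pd i t"
  unfolding pd_def
  by (rule setsum_keys_plus_distrib) (simp_all add: single_add distrib_left)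

lemma pd_0 [simp]: "pd i 0 = 0" by (simp add: pd_def)

lemma pd_sum: "pd i (sum f I) = (\<Sum>x\<in>I. pd i (f x))"
  by (induction I rule: infinite_finite_induct) (simp_all add: pd_add)

lemma pd_uminus: "pd i (- s) = - pd i s"
  using pd_add[of i s "- s"] by (simp add: eq_neg_iff_add_eq_0 add.commute)

lemma pd_diff: "pd i (s - t) = pd i s - pd i t"
  using pd_add[of i s "- t"] by (simp add: pd_uminus)

lemma pd_mult_single:
  "pd i (Poly_Mapping.single m a * Poly_Mapping.single n b) =
    pd i (Poly_Mapping.single m a) * Poly_Mapping.single n b +
    Poly_Mapping.single m a * pd i (Poly_Mapping.single n b)"
proof -
  let ?e = "Poly_Mapping.single i (1::nat)"
  have l: "(m + n) - ?e = (m - ?e) + n" if "Poly_Mapping.lookup m i \<noteq> 0" for m n :: "'a \<Rightarrow>\<^sub>0 nat"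
    using that by (intro poly_mapping_eqI) (auto simp: lookup_minus lookup_add lookup_single when_def)
  have r: "(m + n) - ?e = m + (n - ?e)" if "Poly_Mapping.lookup n i \<noteq> 0"
    using l[OF that, of m] by (simp add: add.commute)
  have 1: "pd i (Poly_Mapping.single m a) * Poly_Mapping.single n b =
      Poly_Mapping.single (m + n - ?e) (of_nat (Poly_Mapping.lookup m i) * (a * b))"
    by (cases "Poly_Mapping.lookup m i = 0") (simp_all add: mult_single pd_single l mult.assoc del: One_nat_def)
  have 2: "Poly_Mapping.single m a * pd i (Poly_Mapping.single n b) =
      Poly_Mapping.single (m + n - ?e) (of_nat (Poly_Mapping.lookup n i) * (a * b))"
    by (cases "Poly_Mapping.lookup n i = 0") (simp_all add: mult_single pd_single r mult.left_commute del: One_nat_def)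
  show ?thesis
    unfolding 1 2 by (simp add: mult_single pd_single lookup_add single_add[symmetric] distrib_right)
qed

lemma pd_mult: "pd i (s * t) = pd i s * t + s * pd i t"
proof -
  let ?sg = "\<lambda>s m. Poly_Mapping.single m (Poly_Mapping.lookup s m)"
  have "pd i (s * t) =
    pd i ((\<Sum>k\<in>Poly_Mapping.keys s. ?sg s k) * (\<Sum>l\<in>Poly_Mapping.keys t. ?sg t l))"
    by (simp add: sum_singles)
  also have "\<dots> = pd i (\<Sum>k\<in>Poly_Mapping.keys s. ?sg s k) * (\<Sum>l\<in>Poly_Mapping.keys t. ?sg t l)
     + (\<Sum>k\<in>Poly_Mapping.keys s. ?sg s k) * pd i (\<Sum>l\<in>Poly_Mapping.keys t. ?sg t l)"
    by (simp only: pd_sum sum_product pd_mult_single sum.distrib)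
  finally show ?thesis by (simp add: sum_singles)
qed

lemma pd_pconst [simp]: "pd i (pconst c) = 0"
  by (simp add: pconst_def pd_single)

lemma pd_1 [simp]: "pd i 1 = 0"
  using pd_pconst[of i 1] by simp

lemma pd_pconst_mult: "pd i (pconst c * s) = pconst c * pd i s"
  by (simp add: pd_mult)

lemma pd_pvar: "pd i (pvar j) = (if i = j then 1 else 0)"
  by (auto simp: pvar_def pd_single lookup_single when_def)

text \<open>Serves identities about \<open>th T\<close>, which is defined on polynomials in all
  elements of the type; \<open>S_induct\<close> is the counterpart for polynomials in the
  basis.\<close>

lemma poly_full_induct [case_names const var add mult]:
  assumes "\<And>c. P (pconst c)" "\<And>b. P (pvar b)"
    "\<And>s t. P s \<Longrightarrow> P t \<Longrightarrow> P (s + t)" "\<And>s t. P s \<Longrightarrow> P t \<Longrightarrow> P (s * t)"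
  shows "P s"
proof -
  have 0: "P 0" and 1: "P 1" using assms(1)[of 0] assms(1)[of 1] by simp_all
  have pow: "P (t ^ n)" if "P t" for t n
    by (induction n) (use 1 assms(4) that in auto)
  have prod: "P (prod h I)" if "\<And>i. i \<in> I \<Longrightarrow> P (h i)" for h and I :: "'a set"
    using that by (induction I rule: infinite_finite_induct) (use 1 assms(4) in auto)
  have sum: "P (sum h I)" if "\<And>i. i \<in> I \<Longrightarrow> P (h i)" for h and I :: "('a \<Rightarrow>\<^sub>0 nat) set"
    using that by (induction I rule: infinite_finite_induct) (use 0 assms(3) in auto)
  have "P (\<Sum>m\<in>Poly_Mapping.keys s. Poly_Mapping.single m (Poly_Mapping.lookup s m))"
    by (rule sum, subst single_eq_prod) (intro assms(1,4) prod pow assms(2))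
  then show ?thesis by (simp add: sum_singles)
qed

definition mdeg :: "('v \<Rightarrow>\<^sub>0 nat) \<Rightarrow> nat" where
  "mdeg m = (\<Sum>b\<in>Poly_Mapping.keys m. Poly_Mapping.lookup m b)"

lemma mdeg_superset: "finite B \<Longrightarrow> Poly_Mapping.keys m \<subseteq> B \<Longrightarrow> mdeg m = (\<Sum>b\<in>B. Poly_Mapping.lookup m b)"
  unfolding mdeg_def by (rule sum.mono_neutral_left) (auto simp: in_keys_iff)

lemma mdeg_add: "mdeg (m + n) = mdeg m + mdeg n"
  using mdeg_superset[of "Poly_Mapping.keys m \<union> Poly_Mapping.keys n" m]
    mdeg_superset[of "Poly_Mapping.keys m \<union> Poly_Mapping.keys n" n]
    mdeg_superset[of "Poly_Mapping.keys m \<union> Poly_Mapping.keys n" "m + n"]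
    Poly_Mapping.keys_add[of m n]
  by (simp add: lookup_add sum.distrib)

lemma mdeg_single: "mdeg (Poly_Mapping.single i k) = k"
  by (simp add: mdeg_def)

lemma keys_diff_single: "Poly_Mapping.keys (m - Poly_Mapping.single i (k::nat)) \<subseteq> Poly_Mapping.keys m"
  by (auto simp: in_keys_iff lookup_minus)

lemma single_add_diff: "Poly_Mapping.lookup m i \<noteq> 0 \<Longrightarrow> Poly_Mapping.single i 1 + (m - Poly_Mapping.single i (1::nat)) = m"
  by (intro poly_mapping_eqI) (auto simp: lookup_minus lookup_add lookup_single when_def)

locale fdvs = finite_dimensional_vector_space scl Bs
  for scl :: "complex \<Rightarrow> 'v::ab_group_add \<Rightarrow> 'v" and Bs :: "'v set"
begin

abbreviation S :: "'v cpoly set" where "S \<equiv> sym_alg Bs"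
abbreviation emb :: "'v \<Rightarrow> 'v cpoly" where "emb \<equiv> sym_embed scl Bs"
abbreviation crd :: "'v \<Rightarrow> 'v \<Rightarrow> complex" where "crd \<equiv> representation Bs"
abbreviation th :: "('v \<Rightarrow> 'v) \<Rightarrow> 'v cpoly \<Rightarrow> 'v cpoly" where "th \<equiv> sym_map scl Bs"
abbreviation lin :: "('v \<Rightarrow> 'v) \<Rightarrow> bool" where "lin \<equiv> Vector_Spaces.linear scl scl"

lemma fdvs: "finite_dimensional_vector_space scl Bs" by unfold_locales

lemma S_add [simp, intro]: "s \<in> S \<Longrightarrow> t \<in> S \<Longrightarrow> s + t \<in> S"
  using Poly_Mapping.keys_add[of s t] by (auto simp: sym_alg_def)

lemma S_mult [simp, intro]: assumes "s \<in> S" "t \<in> S" shows "s * t \<in> S"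
proof -
  have "Poly_Mapping.keys m \<subseteq> Bs" if m: "m \<in> Poly_Mapping.keys (s * t)" for m
  proof -
    obtain k l where "m = k + l" "k \<in> Poly_Mapping.keys s" "l \<in> Poly_Mapping.keys t"
      using keys_mult[of s t] m by blast
    then show ?thesis
      using assms Poly_Mapping.keys_add[of k l] unfolding sym_alg_def by blast
  qed
  then show ?thesis by (simp add: sym_alg_def)
qed

lemma S_pconst [simp, intro]: "pconst c \<in> S" by (simp add: sym_alg_def pconst_def)
lemma S_0 [simp, intro]: "0 \<in> S" using S_pconst[of 0] by simp
lemma S_1 [simp, intro]: "1 \<in> S" using S_pconst[of 1] by simp
lemma S_pvar [simp, intro]: "b \<in> Bs \<Longrightarrow> pvar b \<in> S" by (simp add: sym_alg_def pvar_def)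
lemma S_uminus [simp, intro]: "s \<in> S \<Longrightarrow> - s \<in> S"
  using S_mult[OF S_pconst[of "-1"], of s] by (simp add: pconst_uminus)
lemma S_diff [simp, intro]: "s \<in> S \<Longrightarrow> t \<in> S \<Longrightarrow> s - t \<in> S"
  using S_add[of s "- t"] by simp
lemma S_sum [simp, intro]: "(\<And>i. i \<in> I \<Longrightarrow> f i \<in> S) \<Longrightarrow> sum f I \<in> S"
  by (induction I rule: infinite_finite_induct) simp_all
lemma S_emb [simp, intro]: "emb v \<in> S" by (simp add: sym_embed_def)

lemma S_single: "Poly_Mapping.keys m \<subseteq> Bs \<Longrightarrow> Poly_Mapping.single m c \<in> S"
  by (auto simp: sym_alg_def)

lemma S_pd [simp, intro]: "s \<in> S \<Longrightarrow> pd i s \<in> S"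
  unfolding pd_def
  by (rule S_sum, rule S_single) (use keys_diff_single in \<open>fastforce simp: sym_alg_def\<close>)

lemma S_induct [consumes 1, case_names const var add mult]:
  assumes "s \<in> S" "\<And>c. P (pconst c)" "\<And>b. b \<in> Bs \<Longrightarrow> P (pvar b)"
    "\<And>s t. s \<in> S \<Longrightarrow> t \<in> S \<Longrightarrow> P s \<Longrightarrow> P t \<Longrightarrow> P (s + t)"
    "\<And>s t. s \<in> S \<Longrightarrow> t \<in> S \<Longrightarrow> P s \<Longrightarrow> P t \<Longrightarrow> P (s * t)"
  shows "P s"
proof -
  let ?P = "\<lambda>s. s \<in> S \<and> P s"
  have c: "?P (pconst c)" and v: "b \<in> Bs \<Longrightarrow> ?P (pvar b)"
    and a: "?P s \<Longrightarrow> ?P t \<Longrightarrow> ?P (s + t)" and m: "?P s \<Longrightarrow> ?P t \<Longrightarrow> ?P (s * t)" for b c s t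
    using assms by auto
  have 0: "?P 0" and 1: "?P 1" using c[of 0] c[of 1] by simp_all
  have pow: "?P (t ^ n)" if "?P t" for t n
    by (induction n) (use 1 m that in auto)
  have prod: "?P (prod h I)" if "\<And>i. i \<in> I \<Longrightarrow> ?P (h i)" for h and I :: "'v set"
    using that
  proof (induction I rule: infinite_finite_induct)
    case (insert x F)
    then show ?case using m[of "h x" "prod h F"] by simp
  qed (use 1 in simp_all)
  have sum: "?P (sum h I)" if "\<And>i. i \<in> I \<Longrightarrow> ?P (h i)" for h and I :: "('v \<Rightarrow>\<^sub>0 nat) set"
    using that
  proof (induction I rule: infinite_finite_induct)
    case (insert x F)
    then show ?case using a[of "h x" "sum h F"] by simp
  qed (use 0 in simp_all)
  have "?P (\<Sum>m\<in>Poly_Mapping.keys s. Poly_Mapping.single m (Poly_Mapping.lookup s m))"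
  proof (rule sum)
    fix k assume "k \<in> Poly_Mapping.keys s"
    then have "Poly_Mapping.keys k \<subseteq> Bs" using assms(1) by (auto simp: sym_alg_def)
    then show "?P (Poly_Mapping.single k (Poly_Mapping.lookup s k))"
      unfolding single_eq_prod[of k] by (intro m c prod pow v) auto
  qed
  then show ?thesis by (simp add: sum_singles)
qed

lemma crd_expand: "(\<Sum>b\<in>Bs. scl (crd v b) b) = v"
  by (rule sum_representation_eq) (use span_Basis independent_Basis finite_Basis in auto)

lemma crd_add: "crd (v + w) b = crd v b + crd w b"
  using representation_add[of Bs w v] by (simp add: independent_Basis span_Basis)
lemma crd_scl: "crd (scl k v) b = k * crd v b"
  using representation_scale[of Bs v k] by (simp add: independent_Basis span_Basis)

lemma emb_add: "emb (v + w) = emb v + emb w"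
  by (simp add: sym_embed_def crd_add pconst_add distrib_right sum.distrib)
lemma emb_scl: "emb (scl k v) = pconst k * emb v"
  by (simp add: sym_embed_def crd_scl pconst_mult sum_distrib_left mult.assoc)
lemma emb_0 [simp]: "emb 0 = 0" using emb_add[of 0 0] by simp
lemma emb_uminus: "emb (- v) = - emb v"
  using emb_add[of v "- v"] by (simp add: eq_neg_iff_add_eq_0 add.commute)
lemma emb_diff: "emb (v - w) = emb v - emb w"
  using emb_add[of v "- w"] by (simp add: emb_uminus)
lemma emb_sum: "emb (sum f I) = (\<Sum>i\<in>I. emb (f i))"
  by (induction I rule: infinite_finite_induct) (simp_all add: emb_add)
lemma emb_Bs: "b \<in> Bs \<Longrightarrow> emb b = pvar b"
  by (rule sym_embed_basis[OF fdvs])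

lemma th_add: "th T (s + t) = th T s + th T t"
  unfolding sym_map_def by (rule pc.peval_add)
lemma th_mult: "th T (s * t) = th T s * th T t"
  unfolding sym_map_def by (rule pc.peval_mult)
lemma th_pconst [simp]: "th T (pconst c) = pconst c"
  unfolding sym_map_def by (rule pc.peval_const)
lemma th_pvar: "th T (pvar b) = emb (T b)"
  unfolding sym_map_def by (rule pc.peval_var)
lemma th_0 [simp]: "th T 0 = 0" using th_pconst[of T 0] by simp
lemma th_1 [simp]: "th T 1 = 1" using th_pconst[of T 1] by simp
lemma th_uminus: "th T (- s) = - th T s"
  using th_add[of T s "- s"] by (simp add: eq_neg_iff_add_eq_0 add.commute)
lemma th_diff: "th T (s - t) = th T s - th T t"
  using th_add[of T s "- t"] by (simp add: th_uminus)
lemma th_sum: "th T (sum f I) = (\<Sum>i\<in>I. th T (f i))"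
  by (induction I rule: infinite_finite_induct) (simp_all add: th_add)

lemma th_emb: assumes "lin T" shows "th T (emb v) = emb (T v)"
proof -
  interpret T: Vector_Spaces.linear scl scl T by fact
  have "emb (T v) = emb (T (\<Sum>b\<in>Bs. scl (crd v b) b))" by (simp add: crd_expand)
  also have "\<dots> = (\<Sum>b\<in>Bs. pconst (crd v b) * emb (T b))"
    by (simp add: T.sum T.scale emb_sum emb_scl)
  finally show ?thesis by (simp add: sym_embed_def[of _ _ v] th_sum th_mult th_pvar)
qed

lemma th_S [simp, intro]: "th T s \<in> S"
  by (induction s rule: poly_full_induct) (auto simp: th_add th_mult th_pvar)

lemma th_comp: assumes "lin T" shows "th T (th U s) = th (T \<circ> U) s"
  by (induction s rule: poly_full_induct) (auto simp: th_add th_mult th_pvar th_emb[OF assms])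

lemma th_id: assumes "s \<in> S" "\<And>b. b \<in> Bs \<Longrightarrow> T b = b" shows "th T s = s"
  using assms by (induction s rule: S_induct) (auto simp: th_add th_mult th_pvar emb_Bs)

section \<open>Homogeneous components and the Euler identity\<close>

definition Hn :: "nat \<Rightarrow> 'v cpoly set" where
  "Hn n = {s \<in> S. \<forall>m\<in>Poly_Mapping.keys s. mdeg m = n}"

lemma Hn_S: "s \<in> Hn n \<Longrightarrow> s \<in> S" by (simp add: Hn_def)

lemma Hn_0 [simp]: "0 \<in> Hn n" by (simp add: Hn_def)

lemma Hn_add: "s \<in> Hn n \<Longrightarrow> t \<in> Hn n \<Longrightarrow> s + t \<in> Hn n"
  using Poly_Mapping.keys_add[of s t] by (auto simp: Hn_def)

lemma Hn_sum: "(\<And>i. i \<in> I \<Longrightarrow> f i \<in> Hn n) \<Longrightarrow> sum f I \<in> Hn n"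
  by (induction I rule: infinite_finite_induct) (simp_all add: Hn_add)

lemma Hn_single: "Poly_Mapping.keys m \<subseteq> Bs \<Longrightarrow> Poly_Mapping.single m c \<in> Hn (mdeg m)"
  by (auto simp: Hn_def S_single)

lemma Hn_pvar: "b \<in> Bs \<Longrightarrow> pvar b \<in> Hn 1"
  using Hn_single[of "Poly_Mapping.single b 1" 1] by (simp add: mdeg_single pvar_def)

lemma Hn_mult: assumes "s \<in> Hn n" "t \<in> Hn k" shows "s * t \<in> Hn (n + k)"
proof -
  have "mdeg m = n + k" if m: "m \<in> Poly_Mapping.keys (s * t)" for m
  proof -
    obtain a b where "m = a + b" "a \<in> Poly_Mapping.keys s" "b \<in> Poly_Mapping.keys t"
      using keys_mult[of s t] m by blast
    then show ?thesis using assms by (auto simp: Hn_def mdeg_add)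
  qed
  then show ?thesis using assms by (auto simp: Hn_def)
qed

lemma Hn_pvar_mult: "b \<in> Bs \<Longrightarrow> s \<in> Hn n \<Longrightarrow> pvar b * s \<in> Hn (Suc n)"
  using Hn_mult[OF Hn_pvar, of b s n] by simp

text \<open>Reduces a property closed under addition to homogeneous polynomials, on which the Euler
  operator is a scalar and recursion on the degree is possible.\<close>

lemma S_sum_Hn:
  assumes "s \<in> S" and "\<And>s t. P s \<Longrightarrow> P t \<Longrightarrow> P (s + t)" and "\<And>n s. s \<in> Hn n \<Longrightarrow> P s"
  shows "P s"
proof -
  have sum: "P (sum h I)" if "\<And>i. i \<in> I \<Longrightarrow> P (h i)" for h and I :: "('v \<Rightarrow>\<^sub>0 nat) set"
    using that
  proof (induction I rule: infinite_finite_induct)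
    case (insert x F)
    then show ?case using assms(2)[of "h x" "sum h F"] by simp
  qed (use assms(3)[OF Hn_0] in simp_all)
  have "P (\<Sum>m\<in>Poly_Mapping.keys s. Poly_Mapping.single m (Poly_Mapping.lookup s m))"
    by (rule sum, rule assms(3), rule Hn_single) (use assms(1) in \<open>auto simp: sym_alg_def\<close>)
  then show ?thesis by (simp add: sum_singles)
qed

lemma pd_Hn: assumes "s \<in> Hn (Suc n)" shows "pd i s \<in> Hn n"
  unfolding pd_def
proof (rule Hn_sum)
  fix m assume m: "m \<in> Poly_Mapping.keys s"
  then have k: "Poly_Mapping.keys m \<subseteq> Bs" "mdeg m = Suc n" using assms by (auto simp: Hn_def sym_alg_def)
  show "Poly_Mapping.single (m - Poly_Mapping.single i 1)
      (of_nat (Poly_Mapping.lookup m i) * Poly_Mapping.lookup s m) \<in> Hn n"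
  proof (cases "Poly_Mapping.lookup m i = 0")
    case False
    have "mdeg (m - Poly_Mapping.single i 1) = n"
      using mdeg_add[of "Poly_Mapping.single i 1" "m - Poly_Mapping.single i 1"] single_add_diff[OF False] k
      by (simp add: mdeg_single)
    then show ?thesis
      using Hn_single[of "m - Poly_Mapping.single i 1"] k keys_diff_single[of m i 1] by auto
  qed simp
qed

lemma Hn_zero_iff: "s \<in> Hn 0 \<Longrightarrow> s = pconst (Poly_Mapping.lookup s 0)"
proof -
  assume s: "s \<in> Hn 0"
  have "m = 0" if "m \<in> Poly_Mapping.keys s" for m
  proof -
    have "mdeg m = 0" using s that by (auto simp: Hn_def)
    then show ?thesis by (auto simp: mdeg_def in_keys_iff intro!: poly_mapping_eqI)
  qed
  then show ?thesis
    by (intro poly_mapping_eqI) (auto simp: pconst_def lookup_single when_def in_keys_iff)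
qed

lemma pd_Hn_0: "s \<in> Hn 0 \<Longrightarrow> pd i s = 0"
  by (subst Hn_zero_iff) simp_all

lemma Euler: assumes "s \<in> Hn n" shows "(\<Sum>i\<in>Bs. pvar i * pd i s) = of_nat n * s"
proof -
  let ?sg = "\<lambda>s m. Poly_Mapping.single m (Poly_Mapping.lookup s m)"
  have 1: "pvar i * pd i (Poly_Mapping.single m c) = of_nat (Poly_Mapping.lookup m i) * Poly_Mapping.single m c" for i m c
  proof (cases "Poly_Mapping.lookup m i = 0")
    case False
    then show ?thesis
      unfolding pvar_def pd_single mult_single single_add_diff[OF False]
      by (simp only: of_nat_single o_apply mult_single add_0 mult_1)
  qed (simp add: pd_single)
  have "(\<Sum>i\<in>Bs. pvar i * pd i (\<Sum>m\<in>Poly_Mapping.keys s. ?sg s m))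
      = (\<Sum>m\<in>Poly_Mapping.keys s. \<Sum>i\<in>Bs. of_nat (Poly_Mapping.lookup m i) * ?sg s m)"
    by (subst sum.swap) (simp add: pd_sum sum_distrib_left 1)
  also have "\<dots> = (\<Sum>m\<in>Poly_Mapping.keys s. of_nat n * ?sg s m)"
  proof (rule sum.cong[OF refl])
    fix m assume "m \<in> Poly_Mapping.keys s"
    then have "Poly_Mapping.keys m \<subseteq> Bs" "mdeg m = n" using assms by (auto simp: Hn_def sym_alg_def)
    then have "(\<Sum>i\<in>Bs. Poly_Mapping.lookup m i) = n" using mdeg_superset[OF finite_Basis] by simp
    then show "(\<Sum>i\<in>Bs. of_nat (Poly_Mapping.lookup m i) * ?sg s m) = of_nat n * ?sg s m"
      by (simp only: sum_distrib_right[symmetric] of_nat_sum[symmetric])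
  qed
  also have "\<dots> = of_nat n * s" by (simp add: sum_distrib_left[symmetric] sum_singles)
  finally show ?thesis by (simp add: sum_singles)
qed

lemma pd_commute: "pd i (pd j s) = pd j (pd i s)"
  by (induction s rule: poly_full_induct) (auto simp: pd_add pd_mult pd_pvar algebra_simps)

lemma pd_emb: "i \<in> Bs \<Longrightarrow> pd i (emb v) = pconst (crd v i)"
  by (simp add: sym_embed_def pd_sum pd_mult pd_pvar if_distrib[of "\<lambda>x. _ * x"] finite_Basis cong: if_cong)

text \<open>Invariance of the operator \<open>\<Sum>\<^sub>i \<partial>\<^sub>i \<otimes> x\<^sub>i\<close> under linear maps.\<close>

lemma pd_th:
  fixes B :: "'v cpoly \<Rightarrow> 'v cpoly \<Rightarrow> 'b::ab_group_add"
  assumes T: "lin T" and s: "s \<in> S"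
    and B: "\<And>s s' t. B (s + s') t = B s t + B s' t" "\<And>s t t'. B s (t + t') = B s t + B s t'"
      "\<And>k s t. B (pconst k * s) t = B s (pconst k * t)"
  shows "(\<Sum>i\<in>Bs. B (pd i (th T s)) (pvar i)) = (\<Sum>i\<in>Bs. B (th T (pd i s)) (th T (pvar i)))"
  using s B
proof (induction s arbitrary: B rule: S_induct)
  case (const c)
  have "B 0 s = 0" for s using const.prems(1)[of 0 0 s] by simp
  then show ?case by simp
next
  case (var b)
  have z: "B s 0 = 0" "B 0 s = 0" for s using var.prems(1)[of 0 0 s] var.prems(2)[of s 0 0] by auto
  have sum: "(\<Sum>i\<in>I. B s (f i)) = B s (sum f I)" for f s and I :: "'v set"
    by (induction I rule: infinite_finite_induct) (auto simp: z var.prems)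
  have "(\<Sum>i\<in>Bs. B (pd i (th T (pvar b))) (pvar i)) = (\<Sum>i\<in>Bs. B 1 (pconst (crd (T b) i) * pvar i))"
    using var.prems(3)[of _ 1] by (intro sum.cong) (simp_all add: th_pvar pd_emb)
  also have "\<dots> = B 1 (emb (T b))" by (simp add: sum sym_embed_def)
  also have "\<dots> = (\<Sum>i\<in>Bs. if i = b then B 1 (emb (T b)) else 0)"
    using var.hyps finite_Basis by simp
  also have "\<dots> = (\<Sum>i\<in>Bs. B (th T (pd i (pvar b))) (th T (pvar i)))"
    by (intro sum.cong) (auto simp: pd_pvar th_pvar z)
  finally show ?case .
next
  case (add s t)
  then show ?case by (simp add: th_add pd_add sum.distrib)
next
  case (mult s t)
  \<comment> \<open>The Leibniz rule multiplies the derivative by an extra factor. As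
    \<open>B\<close> is arbitrary in the induction, the factor is absorbed into the bilinear map
    \<open>\<lambda>x. B (th T u * x)\<close>.\<close>
  have 1: "(\<Sum>i\<in>Bs. B (th T u * pd i (th T w)) (pvar i)) = (\<Sum>i\<in>Bs. B (th T u * th T (pd i w)) (th T (pvar i)))"
    if "\<And>B :: 'v cpoly \<Rightarrow> 'v cpoly \<Rightarrow> 'b. (\<And>s s' t. B (s + s') t = B s t + B s' t) \<Longrightarrow>
       (\<And>s t t'. B s (t + t') = B s t + B s t') \<Longrightarrow>
      (\<And>k s t. B (pconst k * s) t = B s (pconst k * t)) \<Longrightarrow>
     (\<Sum>i\<in>Bs. B (pd i (th T w)) (pvar i)) = (\<Sum>i\<in>Bs. B (th T (pd i w)) (th T (pvar i)))" for u w
    by (rule that[of "\<lambda>x. B (th T u * x)"])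
      (simp_all add: distrib_left mult.prems mult.left_commute)
  show ?case
    using 1[OF mult.IH(1), of t] 1[OF mult.IH(2), of s]
    by (simp add: th_mult pd_mult th_add mult.prems sum.distrib mult.commute)
qed

end

section \<open>Two-cocycles in radial gauge\<close>

text \<open>Abstract because two bimodules are needed: \<open>S\<close> with its right action
  twisted by a linear map, and the space \<open>hom_bim\<close> of linear maps that carries the
  dimension shift. \<open>rm_pconst\<close> makes scalars act in the same way from both
  sides.\<close>

locale bim = fdvs scl Bs for scl :: "complex \<Rightarrow> 'v::ab_group_add \<Rightarrow> 'v" and Bs :: "'v set" +
  fixes Mc :: "'m::ab_group_add set" and lm :: "'v cpoly \<Rightarrow> 'm \<Rightarrow> 'm" and rm :: "'m \<Rightarrow> 'v cpoly \<Rightarrow> 'm"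
  assumes M_0 [simp]: "0 \<in> Mc" and M_add [simp]: "\<And>m n. m \<in> Mc \<Longrightarrow> n \<in> Mc \<Longrightarrow> m + n \<in> Mc"
    and M_uminus [simp]: "\<And>m. m \<in> Mc \<Longrightarrow> - m \<in> Mc"
    and lm_M [simp]: "\<And>s m. s \<in> S \<Longrightarrow> m \<in> Mc \<Longrightarrow> lm s m \<in> Mc"
    and rm_M [simp]: "\<And>s m. s \<in> S \<Longrightarrow> m \<in> Mc \<Longrightarrow> rm m s \<in> Mc"
    and lm_add: "\<And>s m n. m \<in> Mc \<Longrightarrow> n \<in> Mc \<Longrightarrow> lm s (m + n) = lm s m + lm s n"
    and lm_addl: "\<And>s t m. m \<in> Mc \<Longrightarrow> lm (s + t) m = lm s m + lm t m"
    and rm_add: "\<And>s m n. m \<in> Mc \<Longrightarrow> n \<in> Mc \<Longrightarrow> rm (m + n) s = rm m s + rm n s"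
    and rm_addr: "\<And>s t m. m \<in> Mc \<Longrightarrow> rm m (s + t) = rm m s + rm m t"
    and lm_lm: "\<And>s t m. m \<in> Mc \<Longrightarrow> lm s (lm t m) = lm (s * t) m"
    and rm_rm: "\<And>s t m. m \<in> Mc \<Longrightarrow> rm (rm m s) t = rm m (s * t)"
    and rm_lm: "\<And>s t m. m \<in> Mc \<Longrightarrow> rm (lm s m) t = lm s (rm m t)"
    and lm_1 [simp]: "\<And>m. m \<in> Mc \<Longrightarrow> lm 1 m = m"
    and rm_1 [simp]: "\<And>m. m \<in> Mc \<Longrightarrow> rm m 1 = m"
    and rm_pconst: "\<And>m k. m \<in> Mc \<Longrightarrow> rm m (pconst k) = lm (pconst k) m"
begin

lemma M_diff [simp]: "m \<in> Mc \<Longrightarrow> n \<in> Mc \<Longrightarrow> m - n \<in> Mc"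
  using M_add[of m "- n"] by simp
lemma M_sum [simp]: "(\<And>i. i \<in> I \<Longrightarrow> f i \<in> Mc) \<Longrightarrow> sum f I \<in> Mc"
  by (induction I rule: infinite_finite_induct) simp_all

lemma lm_0 [simp]: "lm s 0 = 0" using lm_add[of 0 0 s] by simp
lemma rm_0 [simp]: "rm 0 s = 0" using rm_add[of 0 0 s] by simp
lemma lm_0l [simp]: "m \<in> Mc \<Longrightarrow> lm 0 m = 0" using lm_addl[of m 0 0] by simp
lemma lm_uminus: "m \<in> Mc \<Longrightarrow> lm s (- m) = - lm s m"
  using lm_add[of "- m" m s] by (simp add: eq_neg_iff_add_eq_0)
lemma rm_uminus: "m \<in> Mc \<Longrightarrow> rm (- m) s = - rm m s"
  using rm_add[of "- m" m s] by (simp add: eq_neg_iff_add_eq_0)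
lemma lm_diff: "m \<in> Mc \<Longrightarrow> n \<in> Mc \<Longrightarrow> lm s (m - n) = lm s m - lm s n"
  using lm_add[of m "- n" s] by (simp add: lm_uminus)
lemma rm_diff: "m \<in> Mc \<Longrightarrow> n \<in> Mc \<Longrightarrow> rm (m - n) s = rm m s - rm n s"
  using rm_add[of m "- n" s] by (simp add: rm_uminus)
lemma lm_sum: "(\<And>i. i \<in> I \<Longrightarrow> f i \<in> Mc) \<Longrightarrow> lm s (sum f I) = (\<Sum>i\<in>I. lm s (f i))"
  by (induction I rule: infinite_finite_induct) (simp_all add: lm_add)
lemma rm_sum: "(\<And>i. i \<in> I \<Longrightarrow> f i \<in> Mc) \<Longrightarrow> rm (sum f I) s = (\<Sum>i\<in>I. rm (f i) s)"
  by (induction I rule: infinite_finite_induct) (simp_all add: rm_add)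
lemma lm_lm_commute: "m \<in> Mc \<Longrightarrow> lm s (lm t m) = lm t (lm s m)"
  by (simp add: lm_lm mult.commute)

text \<open>Linearity is required on all polynomials, so that its laws carry no membership
  conditions; cochains are made total by projecting their arguments to \<open>S\<close>.\<close>

definition mlin :: "('v cpoly \<Rightarrow> 'm) \<Rightarrow> bool" where
  "mlin b \<longleftrightarrow> (\<forall>s t. b (s + t) = b s + b t) \<and> (\<forall>k s. b (pconst k * s) = lm (pconst k) (b s)) \<and> (\<forall>s. b s \<in> Mc)"

lemma mlin_add: "mlin b \<Longrightarrow> b (s + t) = b s + b t" by (simp add: mlin_def)
lemma mlin_pconst: "mlin b \<Longrightarrow> b (pconst k * s) = lm (pconst k) (b s)" by (simp add: mlin_def)
lemma mlin_M: "mlin b \<Longrightarrow> b s \<in> Mc" by (simp add: mlin_def)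
lemma mlin_of_nat: "mlin b \<Longrightarrow> b (of_nat k * s) = lm (of_nat k) (b s)"
  by (metis mlin_pconst pconst_of_nat)
lemma mlin_0: "mlin b \<Longrightarrow> b 0 = 0" using mlin_add[of b 0 0] by simp
lemma mlin_sum: "mlin b \<Longrightarrow> b (sum f I) = (\<Sum>i\<in>I. b (f i))"
  by (induction I rule: infinite_finite_induct) (simp_all add: mlin_0 mlin_add)

lemma mlinI: "(\<And>s t. b (s + t) = b s + b t) \<Longrightarrow> (\<And>k s. b (pconst k * s) = lm (pconst k) (b s)) \<Longrightarrow> (\<And>s. b s \<in> Mc) \<Longrightarrow> mlin b"
  by (simp add: mlin_def)

lemma mlin_plus: "mlin b \<Longrightarrow> mlin b' \<Longrightarrow> mlin (\<lambda>s. b s + b' s)"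
  by (intro mlinI) (simp_all add: mlin_add mlin_pconst mlin_M lm_add)
lemma mlin_minus: "mlin b \<Longrightarrow> mlin b' \<Longrightarrow> mlin (\<lambda>s. b s - b' s)"
  by (intro mlinI) (simp_all add: mlin_add mlin_pconst mlin_M lm_diff)
lemma mlin_neg: "mlin b \<Longrightarrow> mlin (\<lambda>s. - b s)"
  by (intro mlinI) (simp_all add: mlin_add mlin_pconst mlin_M lm_uminus)
lemma mlin_fsum: "(\<And>i. i \<in> I \<Longrightarrow> mlin (f i)) \<Longrightarrow> mlin (\<lambda>s. \<Sum>i\<in>I. f i s)"
  by (intro mlinI) (simp_all add: mlin_add mlin_pconst mlin_M lm_sum sum.distrib)
lemma mlin_lm: "mlin b \<Longrightarrow> t \<in> S \<Longrightarrow> mlin (\<lambda>s. lm t (b s))"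
  by (intro mlinI) (simp_all add: mlin_add mlin_pconst mlin_M lm_add lm_lm_commute)
lemma mlin_rm: "mlin b \<Longrightarrow> t \<in> S \<Longrightarrow> mlin (\<lambda>s. rm (b s) t)"
  by (intro mlinI) (simp_all add: mlin_add mlin_pconst mlin_M rm_add rm_lm)
lemma mlin_pd: "mlin b \<Longrightarrow> mlin (\<lambda>s. b (pd i s))"
  by (intro mlinI) (simp_all add: mlin_add mlin_pconst mlin_M pd_add pd_pconst_mult)

text \<open>Glues linear maps \<open>B n\<close>, each meant for degree \<open>n\<close>, into one
  linear map. This turns a recursion on the degree, with a division by the degree at each stage,
  into a linear cochain.\<close>

definition comb :: "(nat \<Rightarrow> 'v cpoly \<Rightarrow> 'm) \<Rightarrow> 'v cpoly \<Rightarrow> 'm" where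
  "comb B s = (\<Sum>m\<in>Poly_Mapping.keys s. B (mdeg m) (Poly_Mapping.single m (Poly_Mapping.lookup s m)))"

lemma comb_mlin: assumes "\<And>n. mlin (B n)" shows "mlin (comb B)"
proof -
  have add: "comb B (s + t) = comb B s + comb B t" for s t
    unfolding comb_def
    by (rule setsum_keys_plus_distrib) (simp_all add: mlin_0[OF assms] single_add mlin_add[OF assms])
  have z: "comb B 0 = 0" by (simp add: comb_def)
  have sum: "comb B (sum f I) = (\<Sum>i\<in>I. comb B (f i))" for f and I :: "('v \<Rightarrow>\<^sub>0 nat) set"
    by (induction I rule: infinite_finite_induct) (simp_all add: add z)
  have single: "comb B (Poly_Mapping.single m a) = B (mdeg m) (Poly_Mapping.single m a)" for m a
    by (simp add: comb_def mlin_0[OF assms])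
  have M: "comb B s \<in> Mc" for s unfolding comb_def by (simp add: mlin_M[OF assms])
  have "comb B (pconst k * s) = lm (pconst k) (comb B s)" for k s
  proof -
    let ?sg = "\<lambda>m. Poly_Mapping.single m (Poly_Mapping.lookup s m)"
    have "comb B (pconst k * s) = comb B (pconst k * (\<Sum>m\<in>Poly_Mapping.keys s. ?sg m))"
      by (simp add: sum_singles)
    also have "\<dots> = (\<Sum>m\<in>Poly_Mapping.keys s. B (mdeg m) (pconst k * ?sg m))"
      by (simp add: sum_distrib_left sum pconst_def mult_single single)
    also have "\<dots> = lm (pconst k) (comb B s)"
      by (simp add: mlin_pconst[OF assms] comb_def lm_sum mlin_M[OF assms])
    finally show ?thesis .
  qed
  then show ?thesis using add M by (intro mlinI)
qed

lemma comb_Hn: assumes "mlin (B n)" "s \<in> Hn n" shows "comb B s = B n s"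
proof -
  have "comb B s = (\<Sum>m\<in>Poly_Mapping.keys s. B n (Poly_Mapping.single m (Poly_Mapping.lookup s m)))"
    unfolding comb_def by (rule sum.cong) (use assms(2) in \<open>auto simp: Hn_def\<close>)
  also have "\<dots> = B n s" by (simp add: mlin_sum[OF assms(1), symmetric] sum_singles)
  finally show ?thesis .
qed

definition cocyc :: "('v cpoly \<Rightarrow> 'v cpoly \<Rightarrow> 'm) \<Rightarrow> bool" where
  "cocyc c \<longleftrightarrow> (\<forall>t. mlin (\<lambda>s. c s t)) \<and> (\<forall>s. mlin (c s)) \<and>
     (\<forall>s\<in>S. \<forall>t\<in>S. \<forall>u\<in>S. lm s (c t u) - c (s * t) u + c s (t * u) - rm (c s t) u = 0)"

definition db :: "('v cpoly \<Rightarrow> 'm) \<Rightarrow> 'v cpoly \<Rightarrow> 'v cpoly \<Rightarrow> 'm" where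
  "db b s t = lm s (b t) - b (s * t) + rm (b s) t"

lemma cocycD:
  assumes "cocyc c"
  shows "mlin (\<lambda>s. c s t)" "mlin (c s)"
    "s \<in> S \<Longrightarrow> t \<in> S \<Longrightarrow> u \<in> S \<Longrightarrow> c (s * t) u = lm s (c t u) + c s (t * u) - rm (c s t) u"
    "c s t \<in> Mc"
proof -
  show 1: "mlin (\<lambda>s. c s t)" "mlin (c s)" using assms unfolding cocyc_def by blast+
  show "c s t \<in> Mc" using 1(2) by (rule mlin_M)
  assume "s \<in> S" "t \<in> S" "u \<in> S"
  then have "lm s (c t u) - c (s * t) u + c s (t * u) - rm (c s t) u = 0"
    using assms unfolding cocyc_def by blast
  then show "c (s * t) u = lm s (c t u) + c s (t * u) - rm (c s t) u"
    by (simp add: algebra_simps)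
qed

text \<open>
  Besides unit normalisation this is the radial gauge \<open>\<Sum>\<^sub>i c(\<partial>\<^sub>i s, x\<^sub>i) = 0\<close>.  It is invariant
  under linear changes of coordinates, and it makes \<open>c\<close> a function of its antisymmetric part on \<open>V\<close>.
\<close>

definition normal :: "('v cpoly \<Rightarrow> 'v cpoly \<Rightarrow> 'm) \<Rightarrow> bool" where
  "normal c \<longleftrightarrow> (\<forall>s\<in>S. c 1 s = 0 \<and> c s 1 = 0 \<and> (\<Sum>i\<in>Bs. c (pd i s) (pvar i)) = 0)"

definition asym :: "('v cpoly \<Rightarrow> 'v cpoly \<Rightarrow> 'm) \<Rightarrow> 'v \<Rightarrow> 'v \<Rightarrow> 'm" where
  "asym c i j = c (pvar i) (pvar j) - c (pvar j) (pvar i)"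

lemma asym_M [simp]: "cocyc c \<Longrightarrow> asym c i j \<in> Mc"
  by (simp add: asym_def cocycD)

text \<open>Arguments outside the symmetric algebra are first projected to it.\<close>

abbreviation pj :: "'v cpoly \<Rightarrow> 'v cpoly" where "pj \<equiv> th id"

lemma pj_S [simp]: "s \<in> S \<Longrightarrow> pj s = s" by (rule th_id) auto

lemma db_cocyc:
  assumes "mlin b"
  shows "cocyc (\<lambda>s t. db b (pj s) (pj t))"
  unfolding cocyc_def
proof (intro conjI allI ballI)
  note b [simp] = mlin_add[OF assms] mlin_pconst[OF assms] mlin_M[OF assms]
  have M [simp]: "db b (pj s) (pj t) \<in> Mc" for s t
    by (simp add: db_def)
  show "mlin (\<lambda>s. db b (pj s) (pj t))" for t
    by (intro mlinI M) (simp_all add: db_def th_add th_mult lm_addl rm_add distrib_right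
        lm_diff lm_add lm_lm rm_lm mult.assoc)
  show "mlin (\<lambda>t. db b (pj s) (pj t))" for s
  proof (intro mlinI M)
    show "db b (pj s) (pj (t + u)) = db b (pj s) (pj t) + db b (pj s) (pj u)" for t u
      by (simp add: db_def th_add lm_add rm_addr distrib_left)
    show "db b (pj s) (pj (pconst k * t)) = lm (pconst k) (db b (pj s) (pj t))" for t k
      using rm_rm[of "b (pj s)" "pconst k" "pj t"]
      by (simp add: db_def th_mult lm_diff lm_add lm_lm_commute[of _ "pj s"] rm_pconst rm_lm
          mult.left_commute[of "pj s"])
  qed
  fix s t u assume "s \<in> S" "t \<in> S" "u \<in> S"
  then show "lm s (db b (pj t) (pj u)) - db b (pj (s * t)) (pj u) + db b (pj s) (pj (t * u))
      - rm (db b (pj s) (pj t)) u = 0"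
    by (simp add: db_def lm_add lm_diff rm_add rm_diff lm_lm rm_rm rm_lm mult.assoc)
qed

lemma cocyc_add:
  assumes c: "cocyc c" and c': "cocyc c'"
  shows "cocyc (\<lambda>s t. c s t + c' s t)"
  unfolding cocyc_def
proof (intro conjI allI ballI)
  show "mlin (\<lambda>s. c s t + c' s t)" "mlin (\<lambda>t. c s t + c' s t)" for s t
    by (intro mlin_plus cocycD c c')+
  fix s t u assume "s \<in> S" "t \<in> S" "u \<in> S"
  then show "lm s (c t u + c' t u) - (c (s * t) u + c' (s * t) u) + (c s (t * u) + c' s (t * u))
      - rm (c s t + c' s t) u = 0"
    by (simp add: lm_add rm_add cocycD[OF c] cocycD[OF c'])
qed

text \<open>For \<open>b\<close> vanishing on the variables, the radial condition for
  \<open>c + db b\<close> at a homogeneous \<open>s\<close> of degree \<open>n\<close> becomes, by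
  the Euler identity, \<open>n b(s) = \<Sum>\<^sub>i (c(\<partial>\<^sub>i s, x\<^sub>i) +
  b(\<partial>\<^sub>i s) x\<^sub>i)\<close>. This determines \<open>b\<close> degree by degree from
  its value on constants.\<close>

lemma normal_exists_aux:
  assumes c: "cocyc c"
  shows "\<exists>b. mlin b \<and> normal (\<lambda>s t. c s t + db b (pj s) (pj t)) \<and> (\<forall>i\<in>Bs. b (pvar i) = 0)"
proof -
  note cl = cocycD(1)[OF c] and cr = cocycD(2)[OF c] and cM [simp] = cocycD(4)[OF c]
  have c1: "c 1 s = rm (c 1 1) s" if "s \<in> S" for s
    using cocycD(3)[OF c, of 1 1 s] that by simp
  have c2: "c s 1 = lm s (c 1 1)" if "s \<in> S" for s
    using cocycD(3)[OF c, of s 1 1] that by simp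
  \<comment> \<open>In degree 0 this is \<open>b(1) = - c(1, 1)\<close>, the value for which
    \<open>c + db b\<close> vanishes as soon as one argument is 1.\<close>
  define B where "B = rec_nat (\<lambda>s. - lm (pj s) (c 1 1))
    (\<lambda>n b s. lm (pconst (1 / of_nat (Suc n))) (\<Sum>i\<in>Bs. c (pd i s) (pvar i) + rm (b (pd i s)) (pvar i)))"
  have B0: "B 0 s = - lm (pj s) (c 1 1)" for s by (simp add: B_def)
  have BS: "B (Suc n) s = lm (pconst (1 / of_nat (Suc n))) (\<Sum>i\<in>Bs. c (pd i s) (pvar i) + rm (B n (pd i s)) (pvar i))" for n s
    by (simp add: B_def)
  have B: "mlin (B n)" for n
  proof (induction n)
    case 0
    have "mlin (\<lambda>s. - lm (pj s) (c 1 1))"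
      by (intro mlinI) (simp_all add: th_add lm_addl th_mult lm_lm lm_uminus)
    then show ?case by (simp add: B0[abs_def])
  next
    case (Suc n)
    have "mlin (\<lambda>s. lm (pconst (1 / of_nat (Suc n))) (\<Sum>i\<in>Bs. c (pd i s) (pvar i) + rm (B n (pd i s)) (pvar i)))"
      by (intro mlin_lm mlin_fsum mlin_plus mlin_rm mlin_pd[of "\<lambda>s. c s _"] mlin_pd[of "B n"] cl Suc) auto
    then show ?case by (simp add: BS[abs_def])
  qed
  define b where "b = comb B"
  have b: "mlin b" unfolding b_def by (rule comb_mlin[OF B])
  have bH: "b s = B n s" if "s \<in> Hn n" for n s unfolding b_def by (rule comb_Hn[OF B that])
  note bM [simp] = mlin_M[OF b]
  have "(1::'v cpoly) \<in> Hn 0" using Hn_single[of 0 1] by (simp add: mdeg_def)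
  then have b1: "b 1 = - c 1 1" using bH[of 1 0] by (simp add: B0)
  \<comment> \<open>In degree 1 the recursion yields
    \<open>c(1, x\<^sub>i) - c(1, 1) x\<^sub>i\<close>, which the cocycle identity makes zero. This
    confirms the assumption on \<open>b\<close> under which the recursion was derived.\<close>
  have bx: "b (pvar i) = 0" if i: "i \<in> Bs" for i
  proof -
    have "b (pvar i) = (\<Sum>j\<in>Bs. c (pd j (pvar i)) (pvar j) + rm (B 0 (pd j (pvar i))) (pvar j))"
      using bH[OF Hn_pvar[OF i]] by (simp add: BS mlin_M[OF B])
    also have "\<dots> = (\<Sum>j\<in>Bs. if j = i then c 1 (pvar j) + rm (B 0 1) (pvar j) else 0)"
      by (rule sum.cong) (auto simp: pd_pvar mlin_0[OF cl] mlin_0[OF B])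
    also have "\<dots> = c 1 (pvar i) + rm (B 0 1) (pvar i)" using i finite_Basis by simp
    also have "\<dots> = 0" using i by (simp add: B0 c1[of "pvar i"] rm_uminus)
    finally show ?thesis .
  qed
  have Eb: "(\<Sum>i\<in>Bs. c (pd i s) (pvar i) + rm (b (pd i s)) (pvar i)) = b (\<Sum>i\<in>Bs. pvar i * pd i s)" if s: "s \<in> Hn n" for s n
  proof (cases n)
    case 0
    then show ?thesis using s by (simp add: pd_Hn_0 mlin_0[OF cl] mlin_0[OF b])
  next
    case (Suc k)
    have "b (\<Sum>i\<in>Bs. pvar i * pd i s) = lm (pconst (of_nat (Suc k))) (B (Suc k) s)"
      using Euler[OF s] bH[OF s] Suc by (simp add: mlin_pconst[OF b] pconst_of_nat[symmetric])
    also have "\<dots> = (\<Sum>i\<in>Bs. c (pd i s) (pvar i) + rm (B k (pd i s)) (pvar i))"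
      unfolding BS
      by (subst lm_lm) (auto simp: pconst_mult[symmetric] mlin_M[OF B] simp del: of_nat_Suc)
    also have "\<dots> = (\<Sum>i\<in>Bs. c (pd i s) (pvar i) + rm (b (pd i s)) (pvar i))"
      using bH[OF pd_Hn] s Suc by (intro sum.cong) simp_all
    finally show ?thesis by simp
  qed
  let ?c = "\<lambda>s t. c s t + db b (pj s) (pj t)"
  have rl: "mlin (\<lambda>s. \<Sum>i\<in>Bs. ?c (pd i s) (pvar i))"
    by (intro mlin_fsum mlin_pd[of "\<lambda>s. ?c s _"] cocycD(1)[OF cocyc_add[OF c db_cocyc[OF b]]])
  have rad: "(\<Sum>i\<in>Bs. ?c (pd i s) (pvar i)) = 0" if "s \<in> S" for s
  proof (rule S_sum_Hn[OF that])
    show "(\<Sum>i\<in>Bs. ?c (pd i (s + t)) (pvar i)) = 0"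
      if "(\<Sum>i\<in>Bs. ?c (pd i s) (pvar i)) = 0" "(\<Sum>i\<in>Bs. ?c (pd i t) (pvar i)) = 0" for s t
      using that mlin_add[OF rl, of s t] by simp
  next
    fix n s assume s: "s \<in> Hn n"
    have "(\<Sum>i\<in>Bs. ?c (pd i s) (pvar i)) = (\<Sum>i\<in>Bs. c (pd i s) (pvar i) + rm (b (pd i s)) (pvar i) - b (pvar i * pd i s))"
      using Hn_S[OF s] by (intro sum.cong) (simp_all add: db_def bx mult.commute)
    also have "\<dots> = 0" by (simp add: sum_subtractf Eb[OF s] mlin_sum[OF b])
    finally show "(\<Sum>i\<in>Bs. ?c (pd i s) (pvar i)) = 0" .
  qed
  have "normal ?c"
    unfolding normal_def
  proof (intro ballI conjI)
    fix s assume s: "s \<in> S"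
    show "?c 1 s = 0" "?c s 1 = 0"
      using s by (simp_all add: db_def c1[of s] c2[of s] b1 lm_uminus rm_uminus)
  qed (rule rad)
  then show ?thesis using b bx by blast
qed

text \<open>The coboundary of a map with linear part \<open>\<beta>\<close> changes the alternating
  part by the Koszul differential of \<open>\<beta>\<close>. The subsequent correction into radial
  gauge vanishes on the variables and therefore leaves the alternating part alone.\<close>

lemma normal_exists:
  assumes c: "cocyc c" and \<beta>: "\<And>i. i \<in> Bs \<Longrightarrow> \<beta> i \<in> Mc"
  shows "\<exists>b c'. mlin b \<and> c' = (\<lambda>s t. c s t + db b (pj s) (pj t)) \<and> cocyc c' \<and> normal c' \<and>
    (\<forall>i\<in>Bs. \<forall>j\<in>Bs. asym c' i j = asym c i j + lm (pvar i) (\<beta> j) + rm (\<beta> i) (pvar j)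
       - lm (pvar j) (\<beta> i) - rm (\<beta> j) (pvar i))"
proof -
  \<comment> \<open>Extends \<open>\<beta>\<close> by reading off the linear coefficients; every
    other monomial is sent to zero.\<close>
  define b0 :: "'v cpoly \<Rightarrow> 'm" where "b0 s = (\<Sum>i\<in>Bs. lm (pconst (Poly_Mapping.lookup s (Poly_Mapping.single i 1))) (\<beta> i))" for s
  have lk: "Poly_Mapping.lookup (pconst k * s) m = k * Poly_Mapping.lookup s m" for k m and s :: "'v cpoly"
    unfolding pconst_def mult_map_scale_conv_mult[symmetric] by (simp add: map.rep_eq when_def)
  have b0: "mlin b0"
    unfolding b0_def[abs_def] 
    by (intro mlin_fsum mlinI) (simp_all add: lookup_add pconst_add lm_addl \<beta> lk pconst_mult lm_lm)
  have b0x: "b0 (pvar i) = \<beta> i" if "i \<in> Bs" for i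
  proof -
    have "b0 (pvar i) = (\<Sum>j\<in>Bs. if j = i then \<beta> i else 0)"
      unfolding b0_def pvar_def
      by (rule sum.cong) (auto simp: lookup_single when_def \<beta> dest!: arg_cong[of _ _ "\<lambda>m. Poly_Mapping.lookup m i"] split: if_splits)
    then show ?thesis using that finite_Basis by simp
  qed
  let ?c = "\<lambda>s t. c s t + db b0 (pj s) (pj t)"
  have c1: "cocyc ?c" by (intro cocyc_add c db_cocyc b0)
  obtain b1 where b1: "mlin b1" "normal (\<lambda>s t. ?c s t + db b1 (pj s) (pj t))" "\<And>i. i \<in> Bs \<Longrightarrow> b1 (pvar i) = 0"
    using normal_exists_aux[OF c1] by blast
  let ?b = "\<lambda>s. b0 s + b1 s"
  have b: "mlin ?b" by (intro mlin_plus b0 b1)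
  have eq: "(\<lambda>s t. c s t + db ?b (pj s) (pj t)) = (\<lambda>s t. ?c s t + db b1 (pj s) (pj t))"
    by (intro ext) (simp add: db_def lm_add rm_add mlin_M[OF b0] mlin_M[OF b1(1)])
  show ?thesis
  proof (intro exI[of _ ?b] exI conjI ballI)
    show "cocyc (\<lambda>s t. c s t + db ?b (pj s) (pj t))" by (intro cocyc_add c db_cocyc b)
    show "normal (\<lambda>s t. c s t + db ?b (pj s) (pj t))" using b1(2) eq by simp
    fix i j assume "i \<in> Bs" "j \<in> Bs"
    then show "asym (\<lambda>s t. c s t + db ?b (pj s) (pj t)) i j = asym c i j + lm (pvar i) (\<beta> j) + rm (\<beta> i) (pvar j)
       - lm (pvar j) (\<beta> i) - rm (\<beta> j) (pvar i)"
      by (simp add: asym_def db_def b0x b1(3) mult.commute)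
  qed (use b in auto)
qed

text \<open>The radial condition at \<open>x\<^sub>j t\<close> involves
  \<open>c(\<partial>\<^sub>i t x\<^sub>j, x\<^sub>i)\<close>. Subtracting the cocycle identities
  for \<open>(\<partial>\<^sub>i t, x\<^sub>j, x\<^sub>i)\<close> and
  \<open>(\<partial>\<^sub>i t, x\<^sub>i, x\<^sub>j)\<close> eliminates
  \<open>c(\<partial>\<^sub>i t, x\<^sub>i x\<^sub>j)\<close> and brings in \<open>asym\<close>. The
  Euler identity and the radial condition at \<open>t\<close> then leave only terms of lower
  degree.\<close>

lemma radial_recursion:
  assumes c: "cocyc c" "normal c" and t: "t \<in> Hn n" and j: "j \<in> Bs"
  shows "lm (of_nat (Suc n)) (c t (pvar j)) =
    (\<Sum>i\<in>Bs. rm (c (pd i t) (pvar j)) (pvar i)) - (\<Sum>i\<in>Bs. lm (pd i t) (asym c j i))"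
proof -
  note cl = cocycD(1)[OF c(1)] and cr = cocycD(2)[OF c(1)] and cM [simp] = cocycD(4)[OF c(1)]
  note tS = Hn_S[OF t]
  have "0 = (\<Sum>i\<in>Bs. c (pd i (pvar j * t)) (pvar i))"
    using c(2) tS j unfolding normal_def by simp
  also have "\<dots> = (\<Sum>i\<in>Bs. if i = j then c t (pvar j) else 0) + (\<Sum>i\<in>Bs. c (pd i t * pvar j) (pvar i))"
    unfolding sum.distrib[symmetric]
    by (rule sum.cong) (auto simp: pd_mult pd_pvar mlin_add[OF cl] mlin_0[OF cl] mult.commute)
  also have "(\<Sum>i\<in>Bs. if i = j then c t (pvar j) else 0) = c t (pvar j)" using j finite_Basis by simp
  also have "(\<Sum>i\<in>Bs. c (pd i t * pvar j) (pvar i)) = (\<Sum>i\<in>Bs. lm (pd i t) (asym c j i)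
       + c (pd i t * pvar i) (pvar j) + rm (c (pd i t) (pvar i)) (pvar j) - rm (c (pd i t) (pvar j)) (pvar i))"
  proof (rule sum.cong)
    fix i assume "i \<in> Bs"
    then show "c (pd i t * pvar j) (pvar i) = lm (pd i t) (asym c j i)
       + c (pd i t * pvar i) (pvar j) + rm (c (pd i t) (pvar i)) (pvar j) - rm (c (pd i t) (pvar j)) (pvar i)"
      using j tS
      by (simp add: cocycD(3)[OF c(1)] asym_def lm_diff) (simp add: mult.commute)
  qed simp
  also have "\<dots> = (\<Sum>i\<in>Bs. lm (pd i t) (asym c j i)) + c (\<Sum>i\<in>Bs. pvar i * pd i t) (pvar j)
       + rm (\<Sum>i\<in>Bs. c (pd i t) (pvar i)) (pvar j) - (\<Sum>i\<in>Bs. rm (c (pd i t) (pvar j)) (pvar i))"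
    using j by (simp add: sum.distrib sum_subtractf mlin_sum[OF cl] rm_sum mult.commute)
  also have "(\<Sum>i\<in>Bs. c (pd i t) (pvar i)) = 0" using c(2) tS unfolding normal_def by simp
  also have "(\<Sum>i\<in>Bs. pvar i * pd i t) = of_nat n * t" by (rule Euler[OF t])
  also have "c (of_nat n * t) (pvar j) = lm (of_nat n) (c t (pvar j))" by (rule mlin_of_nat[OF cl])
  finally show ?thesis
    using j by (simp add: lm_addl algebra_simps)
qed

lemma lm_of_nat_cancel: "m \<in> Mc \<Longrightarrow> lm (of_nat (Suc n)) m = 0 \<Longrightarrow> m = 0"
proof -
  assume "m \<in> Mc" "lm (of_nat (Suc n)) m = 0"
  then have "lm (pconst (1 / of_nat (Suc n))) (lm (pconst (of_nat (Suc n))) m) = 0" by (simp add: pconst_of_nat del: of_nat_Suc)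
  then show "m = 0" using \<open>m \<in> Mc\<close> by (simp add: lm_lm pconst_mult[symmetric] del: of_nat_Suc)
qed

text \<open>With \<open>asym\<close> zero, the recursion gives \<open>c(t, x\<^sub>j) = 0\<close> by
  induction on the degree of \<open>t\<close>. The cocycle identity then builds up the second
  argument, since it expresses \<open>c(s, t u)\<close> by \<open>c(s t, u)\<close>,
  \<open>c(t, u)\<close> and \<open>c(s, t)\<close>.\<close>

lemma normal_zero:
  assumes c: "cocyc c" "normal c" and a: "\<And>i j. i \<in> Bs \<Longrightarrow> j \<in> Bs \<Longrightarrow> asym c i j = 0"
    and s: "s \<in> S" and t: "t \<in> S"
  shows "c s t = 0"
proof -
  note cl = cocycD(1)[OF c(1)] and cr = cocycD(2)[OF c(1)] and cM [simp] = cocycD(4)[OF c(1)]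
  have H: "c t (pvar j) = 0" if "j \<in> Bs" "t \<in> Hn n" for n t j
    using that
  proof (induction n arbitrary: t)
    case 0
    then show ?case using radial_recursion[OF c 0(2,1)] by (simp add: pd_Hn_0 mlin_0[OF cl] c(1))
  next
    case (Suc n)
    then have "lm (of_nat (Suc (Suc n))) (c t (pvar j)) = 0"
      using Suc.IH[OF _ pd_Hn] unfolding radial_recursion[OF c Suc.prems(2,1)]
      by (simp add: a sum.neutral)
    then show ?case by (rule lm_of_nat_cancel[rotated]) simp
  qed
  have v: "c s (pvar j) = 0" if "j \<in> Bs" "s \<in> S" for s j
    by (rule S_sum_Hn[OF that(2)]) (simp_all add: mlin_add[OF cl] H[OF that(1)])
  show ?thesis
    using t s
  proof (induction t arbitrary: s rule: S_induct)
    case (const k)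
    then show ?case using mlin_pconst[OF cr, of s k 1] c(2) by (simp add: normal_def)
  next
    case (mult t u)
    then show ?case using cocycD(3)[OF c(1), of s t u] by simp
  qed (auto simp: v mlin_add[OF cr])
qed

text \<open>Moving to radial gauge with linear part \<open>- \<beta>\<close> cancels the alternating
  part, and a radial cocycle without alternating part is zero.\<close>

lemma coboundary_of_asym:
  assumes c: "cocyc c" and \<beta>: "\<And>i. i \<in> Bs \<Longrightarrow> \<beta> i \<in> Mc"
    and a: "\<And>i j. i \<in> Bs \<Longrightarrow> j \<in> Bs \<Longrightarrow>
      asym c i j = lm (pvar i) (\<beta> j) + rm (\<beta> i) (pvar j) - lm (pvar j) (\<beta> i) - rm (\<beta> j) (pvar i)"
  shows "\<exists>b. mlin b \<and> (\<forall>s\<in>S. \<forall>t\<in>S. c s t = db b s t)"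
proof -
  obtain b c' where b: "mlin b" and c': "c' = (\<lambda>s t. c s t + db b (pj s) (pj t))" "cocyc c'" "normal c'"
    and a': "\<And>i j. i \<in> Bs \<Longrightarrow> j \<in> Bs \<Longrightarrow> asym c' i j = asym c i j + lm (pvar i) (- \<beta> j) + rm (- \<beta> i) (pvar j)
       - lm (pvar j) (- \<beta> i) - rm (- \<beta> j) (pvar i)"
    using normal_exists[OF c, of "\<lambda>i. - \<beta> i"] \<beta> by force
  have "asym c' i j = 0" if "i \<in> Bs" "j \<in> Bs" for i j
    using a'[OF that] a[OF that] that \<beta> by (simp add: lm_uminus rm_uminus)
  then have z: "c' s t = 0" if "s \<in> S" "t \<in> S" for s t
    using normal_zero[OF c'(2,3)] that by blast
  have "c s t = db (\<lambda>s. - b s) s t" if "s \<in> S" "t \<in> S" for s t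
    using z[OF that] that unfolding c'(1)
    by (simp add: db_def lm_uminus rm_uminus mlin_M[OF b] add_eq_0_iff algebra_simps)
  then show ?thesis using mlin_neg[OF b] by blast
qed

end

context bim
begin

text \<open>The commutator action of \<open>s\<close>. At the variables these operators are the
  coefficients of the Koszul differential of the bimodule.\<close>

definition dm :: "'v cpoly \<Rightarrow> 'm \<Rightarrow> 'm" where
  "dm s m = lm s m - rm m s"

lemma dm_diff: "m \<in> Mc \<Longrightarrow> n \<in> Mc \<Longrightarrow> dm s (m - n) = dm s m - dm s n"
  by (simp add: dm_def lm_diff rm_diff)

lemma dm_commute: "s \<in> S \<Longrightarrow> t \<in> S \<Longrightarrow> m \<in> Mc \<Longrightarrow> dm s (dm t m) = dm t (dm s m)"
  by (simp add: dm_def lm_diff rm_diff lm_lm rm_rm rm_lm mult.commute[of s t])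

text \<open>The signed sum of the six cocycle identities for the permutations of \<open>s\<close>,
  \<open>t\<close>, \<open>u\<close>. Terms with a product of two arguments cancel because
  \<open>S\<close> is commutative.\<close>

lemma asym_closed:
  assumes c: "cocyc c" and S: "s \<in> S" "t \<in> S" "u \<in> S"
  shows "dm s (c t u - c u t) + dm t (c u s - c s u) + dm u (c s t - c t s) = 0"
proof -
  let ?E = "\<lambda>s t u. lm s (c t u) - c (s * t) u + c s (t * u) - rm (c s t) u"
  have E: "?E s t u = 0" if "s \<in> S" "t \<in> S" "u \<in> S" for s t u
    using cocycD(3)[OF c that] by simp
  have "dm s (c t u - c u t) + dm t (c u s - c s u) + dm u (c s t - c t s) =
      ?E s t u + ?E t u s + ?E u s t - ?E t s u - ?E s u t - ?E u t s"
    by (simp add: dm_def lm_diff rm_diff cocycD(4)[OF c] mult.commute[of t s] mult.commute[of u s] mult.commute[of u t])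
  then show ?thesis using S by (simp only: E)simp
qed

end

section \<open>Three-cocycles\<close>

context fdvs
begin

lemma twisted_bim: "bim scl Bs S (*) (\<lambda>m s. m * th T s)"
  by unfold_locales (simp_all add: algebra_simps th_add th_mult)

text \<open>Invariance under \<open>th id\<close> makes a map determined by its values on
  \<open>S\<close>, so equality in the bimodule is equality of functions. The condition at 1 is
  preserved by the right action \<open>\<phi>(s u) - \<phi>(s) T u\<close> used below, and it is
  what makes 1 act as the identity from the right.\<close>

definition hom_bim :: "('v cpoly \<Rightarrow> 'v cpoly) set" where
  "hom_bim = {\<phi>. (\<forall>s t. \<phi> (s + t) = \<phi> s + \<phi> t) \<and> (\<forall>k s. \<phi> (pconst k * s) = pconst k * \<phi> s) \<and>
     (\<forall>s. \<phi> s \<in> S) \<and> (\<forall>s. \<phi> (th id s) = \<phi> s) \<and> \<phi> 1 = 0}"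

lemma hom_bimD:
  assumes "\<phi> \<in> hom_bim"
  shows "\<phi> (s + t) = \<phi> s + \<phi> t" "\<phi> (pconst k * s) = pconst k * \<phi> s" "\<phi> s \<in> S" "\<phi> 1 = 0"
    "\<phi> (pconst k) = 0" "\<phi> (th id s) = \<phi> s"
  using assms unfolding hom_bim_def by auto (metis mult.right_neutral mult_zero_right)

text \<open>
  The dimension shift: Hochschild \<open>3\<close>-cochains with values in the twisted bimodule \<open>S\<close>
  that vanish if their last argument is \<open>1\<close> are \<open>2\<close>-cochains with values in this bimodule.
\<close>

lemma hom_bim: assumes T: "lin T" shows "bim scl Bs hom_bim (\<lambda>s \<phi> u. s * \<phi> u) (\<lambda>\<phi> s u. \<phi> (s * u) - \<phi> s * th T u)"
proof unfold_locales
  show "0 \<in> hom_bim" by (simp add: hom_bim_def)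
  fix \<phi> assume \<phi>: "\<phi> \<in> hom_bim"
  note \<phi>D = hom_bimD[OF \<phi>]
  show "- \<phi> \<in> hom_bim" using \<phi> by (simp add: hom_bim_def)
  show "(\<lambda>u. 1 * \<phi> u) = \<phi>" by simp
  show "(\<lambda>u. \<phi> (1 * u) - \<phi> 1 * th T u) = \<phi>" by (simp add: \<phi>D)
  show "(\<lambda>u. \<phi> (pconst k * u) - \<phi> (pconst k) * th T u) = (\<lambda>u. pconst k * \<phi> u)" for k
    by (simp add: \<phi>D)
  show "(\<lambda>u. (s + t) * \<phi> u) = (\<lambda>u. s * \<phi> u) + (\<lambda>u. t * \<phi> u)" for s t
    by (simp add: fun_eq_iff distrib_right)
  show "(\<lambda>u. \<phi> ((s + t) * u) - \<phi> (s + t) * th T u) =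
      (\<lambda>u. \<phi> (s * u) - \<phi> s * th T u) + (\<lambda>u. \<phi> (t * u) - \<phi> t * th T u)" for s t
    by (simp add: fun_eq_iff distrib_right \<phi>D)
  show "(\<lambda>u. s * (t * \<phi> u)) = (\<lambda>u. s * t * \<phi> u)" for s t by (simp add: mult.assoc)
  show "(\<lambda>u. \<phi> (s * (t * u)) - \<phi> s * th T (t * u) - (\<phi> (s * t) - \<phi> s * th T t) * th T u) =
      (\<lambda>u. \<phi> (s * t * u) - \<phi> (s * t) * th T u)" for s t
    by (simp add: fun_eq_iff th_mult algebra_simps)
  show "(\<lambda>u. s * \<phi> (t * u) - s * \<phi> t * th T u) = (\<lambda>u. s * (\<phi> (t * u) - \<phi> t * th T u))" for s t
    by (simp add: fun_eq_iff algebra_simps)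
  have pp: "\<phi> (s * th id u) = \<phi> (s * u)" for s u
    using \<phi>D(6)[of "s * th id u"] \<phi>D(6)[of "s * u"] by (simp add: th_mult th_id)
  have Tp: "th T (th id u) = th T u" for u using th_comp[OF T, of id u] by simp
  fix s
  { assume s: "s \<in> S"
    show "(\<lambda>u. s * \<phi> u) \<in> hom_bim"
      using s by (simp add: hom_bim_def \<phi>D distrib_left mult.left_commute)
    show "(\<lambda>u. \<phi> (s * u) - \<phi> s * th T u) \<in> hom_bim"
      using s by (auto simp: hom_bim_def \<phi>D pp Tp th_add th_mult distrib_left mult.left_commute[of s] right_diff_distrib) }
  fix \<psi> assume \<psi>: "\<psi> \<in> hom_bim"
  show "\<phi> + \<psi> \<in> hom_bim" by (simp add: hom_bim_def \<phi>D hom_bimD[OF \<psi>] distrib_left)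
  show "(\<lambda>u. s * (\<phi> + \<psi>) u) = (\<lambda>u. s * \<phi> u) + (\<lambda>u. s * \<psi> u)"
    by (simp add: fun_eq_iff algebra_simps)
  show "(\<lambda>u. (\<phi> + \<psi>) (s * u) - (\<phi> + \<psi>) s * th T u) =
      (\<lambda>u. \<phi> (s * u) - \<phi> s * th T u) + (\<lambda>u. \<psi> (s * u) - \<psi> s * th T u)"
    by (simp add: fun_eq_iff algebra_simps)
qed

text \<open>A primitive \<open>\<beta>\<close> is sought with
  \<open>\<beta>\<^sub>j(x\<^sub>k) = 0\<close> and
  \<open>\<Sum>\<^sub>j \<beta>\<^sub>j(\<partial>\<^sub>j u) = 0\<close>. Contracting the equation
  for \<open>\<beta>\<close> with the derivatives then gives \<open>(n + 1) \<beta>\<^sub>j(u) =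
  \<Sum>\<^sub>i x\<^sub>i \<beta>\<^sub>j(\<partial>\<^sub>i u) - \<Sum>\<^sub>i
  \<omega>\<^sub>i\<^sub>j(\<partial>\<^sub>i u)\<close> in degree \<open>n\<close>, and this serves
  as definition. The remainder \<open>\<eta>\<close> is closed with vanishing contraction, so
  contracting its closedness gives a homogeneous recursion, which forces
  \<open>\<eta> = 0\<close>.\<close>

lemma radial_form_exact:
  fixes \<omega> :: "'v \<Rightarrow> 'v \<Rightarrow> 'v cpoly \<Rightarrow> 'v cpoly"
  assumes T: "lin T" and \<omega>: "\<And>i j. \<omega> i j \<in> hom_bim" and alt: "\<And>i j u. \<omega> i j u = - \<omega> j i u"
    and closed: "\<And>i j k. i \<in> Bs \<Longrightarrow> j \<in> Bs \<Longrightarrow> k \<in> Bs \<Longrightarrow>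
      bim.dm (\<lambda>s \<phi> u. s * \<phi> u) (\<lambda>\<phi> s u. \<phi> (s * u) - \<phi> s * th T u) (pvar i) (\<omega> j k)
      + bim.dm (\<lambda>s \<phi> u. s * \<phi> u) (\<lambda>\<phi> s u. \<phi> (s * u) - \<phi> s * th T u) (pvar j) (\<omega> k i)
      + bim.dm (\<lambda>s \<phi> u. s * \<phi> u) (\<lambda>\<phi> s u. \<phi> (s * u) - \<phi> s * th T u) (pvar k) (\<omega> i j) = 0"
    and cyc: "\<And>i j k. i \<in> Bs \<Longrightarrow> j \<in> Bs \<Longrightarrow> k \<in> Bs \<Longrightarrow>
      \<omega> i j (pvar k) + \<omega> j k (pvar i) + \<omega> k i (pvar j) = 0"
  shows "\<exists>\<beta>. (\<forall>j. \<beta> j \<in> hom_bim) \<and> (\<forall>i\<in>Bs. \<forall>j\<in>Bs. \<omega> i j =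
      bim.dm (\<lambda>s \<phi> u. s * \<phi> u) (\<lambda>\<phi> s u. \<phi> (s * u) - \<phi> s * th T u) (pvar i) (\<beta> j)
    - bim.dm (\<lambda>s \<phi> u. s * \<phi> u) (\<lambda>\<phi> s u. \<phi> (s * u) - \<phi> s * th T u) (pvar j) (\<beta> i))"
proof -
  interpret M: bim scl Bs S "(*)" "\<lambda>m s. m * th T s" by (rule twisted_bim)
  interpret N: bim scl Bs hom_bim "\<lambda>s \<phi> u. s * \<phi> u" "\<lambda>\<phi> s u. \<phi> (s * u) - \<phi> s * th T u" by (rule hom_bim[OF T])
  note \<omega>D = hom_bimD[OF \<omega>]
  have Nlin: "M.mlin \<phi>" if "\<phi> \<in> hom_bim" for \<phi>
    using hom_bimD[OF that] by (intro M.mlinI) auto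
  \<comment> \<open>In the step for \<open>Suc n\<close> the argument has degree
    \<open>n + 1\<close>. The Euler identity contributes \<open>n + 1\<close> to the divisor, the
    term evaluated in \<open>rad2\<close> contributes the remaining 1.\<close>
  define B where "B = rec_nat (\<lambda>j s. 0) (\<lambda>n b j u. pconst (1 / of_nat (n + 2)) *
    ((\<Sum>i\<in>Bs. pvar i * b j (pd i u)) - (\<Sum>i\<in>Bs. \<omega> i j (pd i u))))"
  have B0: "B 0 j u = 0" for j u by (simp add: B_def)
  have BS: "B (Suc n) j u = pconst (1 / of_nat (n + 2)) *
    ((\<Sum>i\<in>Bs. pvar i * B n j (pd i u)) - (\<Sum>i\<in>Bs. \<omega> i j (pd i u)))" for n j u by (simp add: B_def)
  have B: "M.mlin (B n j)" for n j
  proof (induction n)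
    case 0
    have "M.mlin (\<lambda>u. 0)" by (intro M.mlinI) auto
    then show ?case by (simp add: B0[abs_def])
  next
    case (Suc n)
    have "M.mlin (\<lambda>u. pconst (1 / of_nat (n + 2)) *
    ((\<Sum>i\<in>Bs. pvar i * B n j (pd i u)) - (\<Sum>i\<in>Bs. \<omega> i j (pd i u))))"
      by (intro M.mlin_lm M.mlin_minus M.mlin_fsum M.mlin_pd[of "B n j"] M.mlin_pd[of "\<omega> _ j"] Suc Nlin \<omega>) auto
    then show ?case by (simp add: BS[abs_def])
  qed
  define \<beta> where "\<beta> j u = M.comb (\<lambda>n. B n j) (th id u)" for j u
  have \<beta>: "M.mlin (\<beta> j)" for j
    using M.comb_mlin[of "\<lambda>n. B n j", OF B] unfolding \<beta>_def M.mlin_def by (simp add: th_add th_mult)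
  have \<beta>H: "\<beta> j u = B n j u" if "u \<in> Hn n" for n j u
    using Hn_S[OF that] M.comb_Hn[of "\<lambda>n. B n j", OF B that] by (simp add: \<beta>_def)
  have one: "(1::'v cpoly) \<in> Hn 0" using Hn_single[of 0 1] by (simp add: mdeg_def)
  have \<beta>N: "\<beta> j \<in> hom_bim" for j
    using \<beta>H[OF one, of j] M.mlin_add[OF \<beta>[of j]] M.mlin_pconst[OF \<beta>[of j]] M.mlin_M[OF \<beta>[of j]]
    by (simp add: hom_bim_def B0) (simp add: \<beta>_def)
  note \<beta>D = hom_bimD[OF \<beta>N]
  have \<beta>x: "\<beta> j (pvar k) = 0" if "k \<in> Bs" for j k
    using \<beta>H[OF Hn_pvar[OF that], of j] 
    by (simp add: BS B0 pd_pvar if_distrib[of "\<omega> _ _"] \<omega>D M.mlin_0[OF Nlin[OF \<omega>]] cong: if_cong)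
  have main: "of_nat (Suc n) * \<beta> j u = (\<Sum>i\<in>Bs. pvar i * \<beta> j (pd i u)) - (\<Sum>i\<in>Bs. \<omega> i j (pd i u))"
    if u: "u \<in> Hn n" for n j u
  proof (cases n)
    case 0
    then show ?thesis using u by (simp add: pd_Hn_0 M.mlin_0[OF \<beta>] M.mlin_0[OF Nlin[OF \<omega>]] \<beta>H B0)
  next
    case (Suc m)
    have "of_nat (Suc n) * \<beta> j u = pconst (of_nat (m + 2)) * B (Suc m) j u"
      using Suc \<beta>H[OF u] by (simp add: pconst_of_nat[symmetric] pconst_add)
    also have "\<dots> = (\<Sum>i\<in>Bs. pvar i * B m j (pd i u)) - (\<Sum>i\<in>Bs. \<omega> i j (pd i u))"
      unfolding BS by (rule pconst_cancel) (simp del: of_nat_add of_nat_Suc)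
    also have "(\<Sum>i\<in>Bs. pvar i * B m j (pd i u)) = (\<Sum>i\<in>Bs. pvar i * \<beta> j (pd i u))"
      using u Suc by (intro sum.cong) (simp_all add: \<beta>H[OF pd_Hn])
    finally show ?thesis .
  qed
  have cancel: "a = 0" if "of_nat (Suc n) * a = 0" for n and a :: "'v cpoly"
    using pconst_mult_eq_0[of "of_nat (Suc n)" a] that by (simp add: pconst_of_nat del: of_nat_Suc)
  \<comment> \<open>Applying the recursion at \<open>\<partial>\<^sub>j u\<close> pairs the
    alternating \<open>\<omega>\<close> with symmetric second derivatives, which gives zero; what is
    left is the same sum in lower degree.\<close>
  have rad: "(\<Sum>j\<in>Bs. \<beta> j (pd j u)) = 0" if "u \<in> Hn n" for n u
    using that
  proof (induction n arbitrary: u)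
    case 0
    then show ?case by (simp add: pd_Hn_0 M.mlin_0[OF \<beta>])
  next
    case (Suc n)
    have z: "(\<Sum>j\<in>Bs. \<Sum>i\<in>Bs. \<omega> i j (pd i (pd j u))) = 0"
    proof -
      have "(\<Sum>j\<in>Bs. \<Sum>i\<in>Bs. \<omega> i j (pd i (pd j u))) = (\<Sum>i\<in>Bs. \<Sum>j\<in>Bs. \<omega> i j (pd i (pd j u)))"
        by (rule sum.swap)
      also have "\<dots> = (\<Sum>i\<in>Bs. \<Sum>j\<in>Bs. - \<omega> j i (pd j (pd i u)))"
        by (intro sum.cong refl, subst alt, subst pd_commute, rule refl)
      also have "\<dots> = - (\<Sum>j\<in>Bs. \<Sum>i\<in>Bs. \<omega> i j (pd i (pd j u)))"
        by (simp only: sum_negf)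
      finally have "(\<Sum>j\<in>Bs. \<Sum>i\<in>Bs. \<omega> i j (pd i (pd j u))) + (\<Sum>j\<in>Bs. \<Sum>i\<in>Bs. \<omega> i j (pd i (pd j u))) = 0"
        by (simp only: eq_neg_iff_add_eq_0)
      then have "of_nat (Suc (Suc 0)) * (\<Sum>j\<in>Bs. \<Sum>i\<in>Bs. \<omega> i j (pd i (pd j u))) = 0"
        by (simp only: of_nat_Suc of_nat_0 add_0_right distrib_right mult_1)
      then show ?thesis by (rule cancel)
    qed
    have "of_nat (Suc n) * (\<Sum>j\<in>Bs. \<beta> j (pd j u)) =
        (\<Sum>j\<in>Bs. \<Sum>i\<in>Bs. pvar i * \<beta> j (pd i (pd j u))) - (\<Sum>j\<in>Bs. \<Sum>i\<in>Bs. \<omega> i j (pd i (pd j u)))"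
      by (simp only: sum_distrib_left main[OF pd_Hn[OF Suc.prems]] sum_subtractf)
    also have "(\<Sum>j\<in>Bs. \<Sum>i\<in>Bs. pvar i * \<beta> j (pd i (pd j u))) = (\<Sum>i\<in>Bs. pvar i * (\<Sum>j\<in>Bs. \<beta> j (pd j (pd i u))))"
      unfolding sum_distrib_left
      by (subst sum.swap, intro sum.cong refl, subst pd_commute, rule refl)
    also have "\<dots> = 0" using Suc.IH[OF pd_Hn[OF Suc.prems]] by simp
    finally have "of_nat (Suc n) * (\<Sum>j\<in>Bs. \<beta> j (pd j u)) = 0" unfolding z by simp
    then show ?case by (rule cancel)
  qed
  have rad2: "(\<Sum>i\<in>Bs. \<beta> i (pvar j * pd i u)) = - \<beta> j u" if u: "u \<in> Hn n" and j: "j \<in> Bs" for n u j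
  proof -
    have "0 = (\<Sum>i\<in>Bs. \<beta> i (pd i (pvar j * u)))" using rad[OF Hn_pvar_mult[OF j u]] by simp
    also have "\<dots> = (\<Sum>i\<in>Bs. if i = j then \<beta> j u else 0) + (\<Sum>i\<in>Bs. \<beta> i (pvar j * pd i u))"
      unfolding sum.distrib[symmetric]
      by (rule sum.cong) (auto simp: pd_mult pd_pvar \<beta>D M.mlin_0[OF \<beta>])
    finally show ?thesis using j finite_Basis by (simp add: eq_neg_iff_add_eq_0 add.commute)
  qed
  define \<delta> where "\<delta> i j = N.dm (pvar i) (\<beta> j) - N.dm (pvar j) (\<beta> i)" for i j
  have dmN: "N.dm s \<phi> \<in> hom_bim" if "s \<in> S" "\<phi> \<in> hom_bim" for s \<phi>
    unfolding N.dm_def using that by (intro N.M_diff N.lm_M N.rm_M)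
  define \<eta> where "\<eta> i j = \<omega> i j - \<delta> i j" for i j
  have \<delta>N: "\<delta> i j \<in> hom_bim" if "i \<in> Bs" "j \<in> Bs" for i j
    unfolding \<delta>_def using that by (intro N.M_diff dmN \<beta>N) auto
  have \<eta>N: "\<eta> i j \<in> hom_bim" if "i \<in> Bs" "j \<in> Bs" for i j
    unfolding \<eta>_def by (intro N.M_diff \<omega> \<delta>N that)
  have \<eta>e: "\<eta> i j u = \<omega> i j u - pvar i * \<beta> j u + \<beta> j (pvar i * u) + pvar j * \<beta> i u - \<beta> i (pvar j * u)"
    if "i \<in> Bs" "j \<in> Bs" for i j u
    using that by (simp add: \<eta>_def \<delta>_def N.dm_def \<beta>x algebra_simps)
  have \<eta>alt: "\<eta> i j u = - \<eta> j i u" if "i \<in> Bs" "j \<in> Bs" for i j u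
    using alt[of i j u] that by (simp add: \<eta>e algebra_simps)
  have \<eta>closed: "N.dm (pvar i) (\<eta> j k) + N.dm (pvar j) (\<eta> k i) + N.dm (pvar k) (\<eta> i j) = 0"
    if "i \<in> Bs" "j \<in> Bs" "k \<in> Bs" for i j k
  proof -
    have "N.dm (pvar i) (\<delta> j k) + N.dm (pvar j) (\<delta> k i) + N.dm (pvar k) (\<delta> i j) = 0"
      using that N.dm_commute[of "pvar i" "pvar j" "\<beta> k"] N.dm_commute[of "pvar i" "pvar k" "\<beta> j"]
        N.dm_commute[of "pvar j" "pvar k" "\<beta> i"]
      by (simp add: \<delta>_def N.dm_diff dmN \<beta>N)
    moreover have "N.dm (pvar i) (\<eta> j k) + N.dm (pvar j) (\<eta> k i) + N.dm (pvar k) (\<eta> i j) =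
        (N.dm (pvar i) (\<omega> j k) + N.dm (pvar j) (\<omega> k i) + N.dm (pvar k) (\<omega> i j)) -
        (N.dm (pvar i) (\<delta> j k) + N.dm (pvar j) (\<delta> k i) + N.dm (pvar k) (\<delta> i j))"
      using that by (simp add: \<eta>_def N.dm_diff \<omega> \<delta>N)
    ultimately show ?thesis by (simp only: closed[OF that] diff_zero)
  qed
  \<comment> \<open>As \<open>\<beta>\<close> vanishes on the variables, \<open>\<delta>\<close>
    contributes only values of \<open>\<beta>\<close> on products of two variables, and these cancel
    in the cyclic sum.\<close>
  have \<eta>cyc: "\<eta> i j (pvar k) + \<eta> j k (pvar i) + \<eta> k i (pvar j) = 0" if "i \<in> Bs" "j \<in> Bs" "k \<in> Bs" for i j k
    using cyc[OF that] that by (simp add: \<eta>e \<beta>x algebra_simps)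
  have \<eta>rad: "(\<Sum>i\<in>Bs. \<eta> i j (pd i u)) = 0" if u: "u \<in> Hn n" and j: "j \<in> Bs" for n j u
  proof -
    have "(\<Sum>i\<in>Bs. \<eta> i j (pd i u)) = (\<Sum>i\<in>Bs. \<omega> i j (pd i u) - pvar i * \<beta> j (pd i u) + \<beta> j (pvar i * pd i u)
        + pvar j * \<beta> i (pd i u) - \<beta> i (pvar j * pd i u))"
      by (rule sum.cong) (use j in \<open>simp_all add: \<eta>e\<close>)
    also have "\<dots> = (\<Sum>i\<in>Bs. \<omega> i j (pd i u)) - (\<Sum>i\<in>Bs. pvar i * \<beta> j (pd i u)) + \<beta> j (of_nat n * u)
        + pvar j * (\<Sum>i\<in>Bs. \<beta> i (pd i u)) + \<beta> j u"
      by (simp add: sum.distrib sum_subtractf Euler[OF u, symmetric] M.mlin_sum[OF \<beta>] sum_distrib_left rad2[OF u j])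
    also have "\<dots> = 0"
      unfolding M.mlin_of_nat[OF \<beta>] rad[OF u] using main[OF u, of j] by (simp add: algebra_simps)
    finally show ?thesis .
  qed
  have \<eta>rad2: "(\<Sum>i\<in>Bs. \<eta> i j (pvar k * pd i u)) = - \<eta> k j u"
    if u: "u \<in> Hn n" and j: "j \<in> Bs" "k \<in> Bs" for n u j k
  proof -
    have "0 = (\<Sum>i\<in>Bs. \<eta> i j (pd i (pvar k * u)))" using \<eta>rad[OF Hn_pvar_mult[OF j(2) u] j(1)] by simp
    also have "\<dots> = (\<Sum>i\<in>Bs. if i = k then \<eta> k j u else 0) + (\<Sum>i\<in>Bs. \<eta> i j (pvar k * pd i u))"
      unfolding sum.distrib[symmetric]
      by (rule sum.cong) (use j in \<open>auto simp: pd_mult pd_pvar hom_bimD(1)[OF \<eta>N] M.mlin_0[OF Nlin[OF \<eta>N]]\<close>)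
    finally show ?thesis using j finite_Basis by (simp add: eq_neg_iff_add_eq_0 add.commute)
  qed
  \<comment> \<open>Closedness for \<open>i, j, k\<close> is evaluated at
    \<open>\<partial>\<^sub>i u\<close> and summed over \<open>i\<close>. The contractions
    \<open>\<eta>rad\<close> and \<open>\<eta>rad2\<close> evaluate the sums, and
    \<open>\<eta>cyc\<close> removes the terms that contain \<open>th T\<close>.\<close>
  have rec: "of_nat (Suc (Suc n)) * \<eta> j k u = (\<Sum>i\<in>Bs. pvar i * \<eta> j k (pd i u))"
    if u: "u \<in> Hn n" and jk: "j \<in> Bs" "k \<in> Bs" for n u j k
  proof -
    have e: "pvar i * \<eta> j k v - (\<eta> j k (pvar i * v) + \<eta> k i (pvar j * v) + \<eta> i j (pvar k * v))
        + pvar j * \<eta> k i v + pvar k * \<eta> i j v = 0" if i: "i \<in> Bs" for i v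
    proof -
      have "N.dm (pvar i) (\<eta> j k) v + N.dm (pvar j) (\<eta> k i) v + N.dm (pvar k) (\<eta> i j) v = 0"
        using fun_cong[OF \<eta>closed[OF i jk], of v] by simp
      moreover have "(\<eta> i j (pvar k) + \<eta> j k (pvar i) + \<eta> k i (pvar j)) * th T v = 0"
        using \<eta>cyc[OF i jk] by simp
      ultimately show ?thesis by (simp add: N.dm_def algebra_simps)
    qed
    have s1: "(\<Sum>i\<in>Bs. \<eta> j k (pvar i * pd i u)) = of_nat n * \<eta> j k u"
      using M.mlin_sum[OF Nlin[OF \<eta>N[OF jk]], of "\<lambda>i. pvar i * pd i u" Bs] Euler[OF u]
        M.mlin_of_nat[OF Nlin[OF \<eta>N[OF jk]]] by simp
    have s2: "(\<Sum>i\<in>Bs. \<eta> k i (pvar j * pd i u)) = \<eta> j k u"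
    proof -
      have "(\<Sum>i\<in>Bs. \<eta> k i (pvar j * pd i u)) = - (\<Sum>i\<in>Bs. \<eta> i k (pvar j * pd i u))"
        unfolding sum_negf[symmetric] by (intro sum.cong refl \<eta>alt jk)
      then show ?thesis using \<eta>rad2[OF u jk(2) jk(1)] by simp
    qed
    have s3: "(\<Sum>i\<in>Bs. \<eta> i j (pvar k * pd i u)) = \<eta> j k u"
      using \<eta>rad2[OF u jk] \<eta>alt[OF jk(2) jk(1)] by simp
    have s4: "(\<Sum>i\<in>Bs. pvar j * \<eta> k i (pd i u)) = 0"
    proof -
      have "(\<Sum>i\<in>Bs. \<eta> k i (pd i u)) = - (\<Sum>i\<in>Bs. \<eta> i k (pd i u))"
        unfolding sum_negf[symmetric] by (intro sum.cong refl \<eta>alt jk)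
      then show ?thesis using \<eta>rad[OF u jk(2)] by (simp add: sum_distrib_left[symmetric])
    qed
    have s5: "(\<Sum>i\<in>Bs. pvar k * \<eta> i j (pd i u)) = 0"
      using \<eta>rad[OF u jk(1)] by (simp add: sum_distrib_left[symmetric])
    have "(\<Sum>i\<in>Bs. pvar i * \<eta> j k (pd i u) - (\<eta> j k (pvar i * pd i u) + \<eta> k i (pvar j * pd i u) + \<eta> i j (pvar k * pd i u))
        + pvar j * \<eta> k i (pd i u) + pvar k * \<eta> i j (pd i u)) = 0"
      by (rule sum.neutral) (use e in blast)
    then show ?thesis
      unfolding sum.distrib sum_subtractf s1 s2 s3 s4 s5 by (simp add: algebra_simps)
  qed
  have z: "\<eta> j k u = 0" if "u \<in> Hn n" "j \<in> Bs" "k \<in> Bs" for n u j k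
    using that
  proof (induction n arbitrary: u)
    case 0
    have "of_nat (Suc (Suc 0)) * \<eta> j k u = 0"
      unfolding rec[OF 0] using 0 by (simp add: pd_Hn_0 M.mlin_0[OF Nlin[OF \<eta>N]])
    then show ?case by (rule cancel)
  next
    case (Suc n)
    have "of_nat (Suc (Suc (Suc n))) * \<eta> j k u = 0"
      unfolding rec[OF Suc.prems] using Suc.IH[OF pd_Hn[OF Suc.prems(1)]] Suc.prems by simp
    then show ?case by (rule cancel)
  qed
  have "\<omega> i j = \<delta> i j" if ij: "i \<in> Bs" "j \<in> Bs" for i j
  proof
    fix u
    have "\<eta> i j (th id u) = 0"
    proof (rule S_sum_Hn[OF th_S])
      show "\<eta> i j (s + t) = 0" if "\<eta> i j s = 0" "\<eta> i j t = 0" for s t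
        using that hom_bimD(1)[OF \<eta>N[OF ij]] by simp
    qed (rule z[OF _ ij])
    then have "\<eta> i j u = 0" using hom_bimD(6)[OF \<eta>N[OF ij]] by simp
    then show "\<omega> i j u = \<delta> i j u" by (simp add: \<eta>_def)
  qed
  then show ?thesis using \<beta>N unfolding \<delta>_def by blast
qed

text \<open>Hochschild 3-cocycles with values in \<open>S\<close> twisted by \<open>T\<close>,
  normalised in the last argument. The curried form makes \<open>\<gamma> s t\<close> an element of
  \<open>hom_bim\<close>, so the dimension shift leaves the function itself unchanged.\<close>

definition coc3 :: "('v \<Rightarrow> 'v) \<Rightarrow> ('v cpoly \<Rightarrow> 'v cpoly \<Rightarrow> 'v cpoly \<Rightarrow> 'v cpoly) \<Rightarrow> bool" where
  "coc3 T \<gamma> \<longleftrightarrow>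
     (\<forall>s s' t u. \<gamma> (s + s') t u = \<gamma> s t u + \<gamma> s' t u) \<and> (\<forall>k s t u. \<gamma> (pconst k * s) t u = pconst k * \<gamma> s t u) \<and>
     (\<forall>s t t' u. \<gamma> s (t + t') u = \<gamma> s t u + \<gamma> s t' u) \<and> (\<forall>k s t u. \<gamma> s (pconst k * t) u = pconst k * \<gamma> s t u) \<and>
     (\<forall>s t. \<gamma> s t \<in> hom_bim) \<and>
     (\<forall>s\<in>S. \<forall>t\<in>S. \<forall>u\<in>S. \<forall>v\<in>S. s * \<gamma> t u v - \<gamma> (s * t) u v + \<gamma> s (t * u) v - \<gamma> s t (u * v) + \<gamma> s t u * th T v = 0)"

text \<open>The right action on \<open>hom_bim\<close> is chosen so that the 2-cocycle identity in
  \<open>s\<close>, \<open>t\<close>, \<open>u\<close>, evaluated at \<open>v\<close>, is the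
  3-cocycle identity. The latter is given for \<open>v\<close> in \<open>S\<close>; the projection
  extends it to all \<open>v\<close>, as equality of functions requires.\<close>

lemma coc3_cocyc:
  assumes T: "lin T" and g: "coc3 T \<gamma>"
  shows "bim.cocyc Bs hom_bim (\<lambda>s \<phi> u. s * \<phi> u) (\<lambda>\<phi> s u. \<phi> (s * u) - \<phi> s * th T u) \<gamma>"
proof -
  interpret N: bim scl Bs hom_bim "\<lambda>s \<phi> u. s * \<phi> u" "\<lambda>\<phi> s u. \<phi> (s * u) - \<phi> s * th T u" by (rule hom_bim[OF T])
  have N: "\<gamma> s t \<in> hom_bim" for s t using g by (auto simp: coc3_def)
  note ND = hom_bimD[OF N]
  have pp: "\<gamma> s t (u * th id v) = \<gamma> s t (u * v)" for s t u v
    using ND(6)[of s t "u * th id v"] ND(6)[of s t "u * v"] by (simp add: th_mult th_id)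
  have Tp: "th T (th id u) = th T u" for u using th_comp[OF T, of id u] by simp
  have e: "s * \<gamma> t u v - \<gamma> (s * t) u v + \<gamma> s (t * u) v - \<gamma> s t (u * v) + \<gamma> s t u * th T v = 0"
    if "s \<in> S" "t \<in> S" "u \<in> S" for s t u v
  proof -
    have "s * \<gamma> t u (th id v) - \<gamma> (s * t) u (th id v) + \<gamma> s (t * u) (th id v) - \<gamma> s t (u * th id v) + \<gamma> s t u * th T (th id v) = 0"
      using g that unfolding coc3_def by blast
    then show ?thesis by (simp add: ND pp Tp)
  qed
  show ?thesis
    unfolding N.cocyc_def
  proof (intro conjI allI ballI N.mlinI N)
    fix s t u assume S: "s \<in> S" "t \<in> S" "u \<in> S"
    show "(\<lambda>v. s * \<gamma> t u v) - \<gamma> (s * t) u + \<gamma> s (t * u) - (\<lambda>v. \<gamma> s t (u * v) - \<gamma> s t u * th T v) = 0"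
      using e[OF S] by (simp add: fun_eq_iff algebra_simps)
  qed (use g in \<open>auto simp: coc3_def fun_eq_iff\<close>)
qed

definition coc3_alt where
  "coc3_alt \<gamma> s t u = \<gamma> s t u - \<gamma> t s u + (\<gamma> t u s - \<gamma> u t s) + (\<gamma> u s t - \<gamma> s u t)" for \<gamma> :: "'v cpoly \<Rightarrow> 'v cpoly \<Rightarrow> 'v cpoly \<Rightarrow> 'v cpoly"

text \<open>Vanishing of the alternating part is exactly the cyclic condition of
  \<open>radial_form_exact\<close> for the form \<open>asym \<gamma>\<close>; the resulting
  primitive is what \<open>coboundary_of_asym\<close> asks for.\<close>

theorem coc3_coboundary:
  assumes T: "lin T"
    and c: "bim.cocyc Bs hom_bim (\<lambda>s \<phi> u. s * \<phi> u) (\<lambda>\<phi> s u. \<phi> (s * u) - \<phi> s * th T u) \<gamma>"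
    and alt: "\<And>i j k. i \<in> Bs \<Longrightarrow> j \<in> Bs \<Longrightarrow> k \<in> Bs \<Longrightarrow> coc3_alt \<gamma> (pvar i) (pvar j) (pvar k) = 0"
  shows "\<exists>h. (\<forall>s. h s \<in> hom_bim) \<and> (\<forall>s t u. h (s + t) u = h s u + h t u) \<and> (\<forall>k s u. h (pconst k * s) u = pconst k * h s u) \<and>
    (\<forall>s\<in>S. \<forall>t\<in>S. \<forall>u\<in>S. \<gamma> s t u = s * h t u - h (s * t) u + h s (t * u) - h s t * th T u)"
proof -
  interpret N: bim scl Bs hom_bim "\<lambda>s \<phi> u. s * \<phi> u" "\<lambda>\<phi> s u. \<phi> (s * u) - \<phi> s * th T u" by (rule hom_bim[OF T])
  obtain \<beta> where \<beta>: "\<And>j. \<beta> j \<in> hom_bim" and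
    \<beta>e: "\<And>i j. i \<in> Bs \<Longrightarrow> j \<in> Bs \<Longrightarrow> N.asym \<gamma> i j = N.dm (pvar i) (\<beta> j) - N.dm (pvar j) (\<beta> i)"
  proof (rule exE[OF radial_form_exact[OF T, of "N.asym \<gamma>"]])
    show "N.asym \<gamma> i j \<in> hom_bim" for i j by (rule N.asym_M[OF c])
    show "N.asym \<gamma> i j u = - N.asym \<gamma> j i u" for i j u by (simp add: N.asym_def)
    show "N.dm (pvar i) (N.asym \<gamma> j k) + N.dm (pvar j) (N.asym \<gamma> k i) + N.dm (pvar k) (N.asym \<gamma> i j) = 0"
      if "i \<in> Bs" "j \<in> Bs" "k \<in> Bs" for i j k
      unfolding N.asym_def using that by (intro N.asym_closed[OF c]) auto
    show "N.asym \<gamma> i j (pvar k) + N.asym \<gamma> j k (pvar i) + N.asym \<gamma> k i (pvar j) = 0"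
      if "i \<in> Bs" "j \<in> Bs" "k \<in> Bs" for i j k
      using alt[OF that] by (simp add: N.asym_def coc3_alt_def)
  qed blast
  have "\<exists>b. N.mlin b \<and> (\<forall>s\<in>S. \<forall>t\<in>S. \<gamma> s t = N.db b s t)"
  proof (rule N.coboundary_of_asym[OF c \<beta>])
    fix i j assume "i \<in> Bs" "j \<in> Bs"
    from \<beta>e[OF this] show "N.asym \<gamma> i j = (\<lambda>u. pvar i * \<beta> j u) + (\<lambda>u. \<beta> i (pvar j * u) - \<beta> i (pvar j) * th T u) -
           (\<lambda>u. pvar j * \<beta> i u) - (\<lambda>u. \<beta> j (pvar i * u) - \<beta> j (pvar i) * th T u)"
      by (simp add: N.dm_def fun_eq_iff algebra_simps)
  qed
  then obtain b where b: "N.mlin b" and bg: "\<And>s t. s \<in> S \<Longrightarrow> t \<in> S \<Longrightarrow> \<gamma> s t = N.db b s t" by blast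
  show ?thesis
    using N.mlin_M[OF b] N.mlin_add[OF b] N.mlin_pconst[OF b] bg
    by (intro exI[of _ b]) (simp add: N.db_def fun_eq_iff algebra_simps)
qed

text \<open>An alternating part that is exact in the Koszul complex is cancelled by the coboundary
  of a bilinear cochain living on the linear terms, which reduces the claim to
  \<open>coc3_coboundary\<close>.\<close>

theorem coc3_coboundary_exact:
  assumes T: "lin T"
    and c: "bim.cocyc Bs hom_bim (\<lambda>s \<phi> u. s * \<phi> u) (\<lambda>\<phi> s u. \<phi> (s * u) - \<phi> s * th T u) \<gamma>"
    and \<beta>: "\<And>i j. i \<in> Bs \<Longrightarrow> j \<in> Bs \<Longrightarrow> \<beta> i j \<in> S" "\<And>i j. \<beta> i j = - \<beta> j i"
    and alt: "\<And>i j k. i \<in> Bs \<Longrightarrow> j \<in> Bs \<Longrightarrow> k \<in> Bs \<Longrightarrow> coc3_alt \<gamma> (pvar i) (pvar j) (pvar k) =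
      (pvar i - th T (pvar i)) * \<beta> j k + (pvar j - th T (pvar j)) * \<beta> k i + (pvar k - th T (pvar k)) * \<beta> i j"
  shows "\<exists>h. (\<forall>s. h s \<in> hom_bim) \<and> (\<forall>s t u. h (s + t) u = h s u + h t u) \<and> (\<forall>k s u. h (pconst k * s) u = pconst k * h s u) \<and>
    (\<forall>s\<in>S. \<forall>t\<in>S. \<forall>u\<in>S. \<gamma> s t u = s * h t u - h (s * t) u + h s (t * u) - h s t * th T u)"
proof -
  interpret N: bim scl Bs hom_bim "\<lambda>s \<phi> u. s * \<phi> u" "\<lambda>\<phi> s u. \<phi> (s * u) - \<phi> s * th T u" by (rule hom_bim[OF T])
  define x1 :: "'v \<Rightarrow> 'v cpoly \<Rightarrow> 'v cpoly" where "x1 i s = pconst (Poly_Mapping.lookup (th id s) (Poly_Mapping.single i 1))" for i s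
  have lk: "Poly_Mapping.lookup (pconst k * s) m = k * Poly_Mapping.lookup s m" for k m and s :: "'v cpoly"
    unfolding pconst_def mult_map_scale_conv_mult[symmetric] by (simp add: map.rep_eq when_def)
  have x1a: "x1 i (s + t) = x1 i s + x1 i t" for i s t by (simp add: x1_def th_add lookup_add pconst_add)
  have x1p: "x1 i (pconst k * s) = pconst k * x1 i s" for i k s by (simp add: x1_def th_mult lk pconst_mult)
  have x1p': "x1 i (s * pconst k) = pconst k * x1 i s" for i k s using x1p by (simp add: mult.commute)
  have x1j: "x1 i (th id s) = x1 i s" for i s by (simp add: x1_def)
  have x11: "x1 i 1 = 0" for i
    by (simp add: x1_def lookup_one when_def) (metis One_nat_def lookup_single_eq lookup_zero zero_neq_one pconst_0)
  have x1x: "x1 i (pvar j) = (if i = j then 1 else 0)" if "j \<in> Bs" for i j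
    using that by (auto simp: x1_def pvar_def[symmetric]) (auto simp: pvar_def lookup_single when_def dest!: arg_cong[of _ _ "\<lambda>m. Poly_Mapping.lookup m j"] split: if_splits)
  have x1S: "x1 i s \<in> S" for i s by (simp add: x1_def)
  \<comment> \<open>The factor \<open>-1/2\<close> compensates for alternation: since
    \<open>\<beta>\<close> is alternating,
    \<open>h0(x\<^sub>i, x\<^sub>j) - h0(x\<^sub>j, x\<^sub>i)\<close> is twice the value of
    \<open>h0\<close>, hence \<open>- \<beta>\<^sub>i\<^sub>j\<close>.\<close>
  define h0 where "h0 s t = (\<Sum>i\<in>Bs. \<Sum>j\<in>Bs. x1 i s * x1 j t * (pconst (-1/2) * \<beta> i j))" for s t
  have h0N: "h0 s \<in> hom_bim" for s
    unfolding hom_bim_def h0_def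
    by (auto intro!: S_sum S_mult x1S \<beta> simp: x1a x1p x1p' x1j x11 distrib_left distrib_right sum.distrib sum_distrib_left mult_ac)
  have h0l: "N.mlin h0"
    by (intro N.mlinI h0N) (auto simp: fun_eq_iff h0_def x1a x1p x1p' algebra_simps sum.distrib sum_distrib_left)
  have h0x: "h0 (pvar i) (pvar j) = pconst (-1/2) * \<beta> i j" if "i \<in> Bs" "j \<in> Bs" for i j
  proof -
    have "h0 (pvar i) (pvar j) = (\<Sum>i'\<in>Bs. if i' = i then (\<Sum>j'\<in>Bs. if j' = j then pconst (-1/2) * \<beta> i j else 0) else 0)"
      unfolding h0_def by (intro sum.cong refl) (use that in \<open>auto simp: x1x intro!: sum.cong\<close>)
    then show ?thesis using that finite_Basis by simp
  qed
  define \<gamma>' where "\<gamma>' s t = \<gamma> s t + N.db h0 (th id s) (th id t)" for s t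
  have c': "N.cocyc \<gamma>'"
    unfolding \<gamma>'_def by (intro N.cocyc_add c N.db_cocyc h0l)
  have half: "h0 (pvar i) (pvar j) - h0 (pvar j) (pvar i) = - \<beta> i j" if "i \<in> Bs" "j \<in> Bs" for i j
  proof -
    have "h0 (pvar i) (pvar j) - h0 (pvar j) (pvar i) = pconst (-1/2) * \<beta> i j + pconst (-1/2) * \<beta> i j"
      using \<beta>(2)[of j i] that by (simp add: h0x)
    also have "\<dots> = - \<beta> i j"
      unfolding distrib_right[symmetric] pconst_add[symmetric] by (simp add: pconst_uminus)
    finally show ?thesis .
  qed
  have "coc3_alt \<gamma>' (pvar i) (pvar j) (pvar k) = 0" if ijk: "i \<in> Bs" "j \<in> Bs" "k \<in> Bs" for i j k
  proof -
    have "coc3_alt \<gamma>' (pvar i) (pvar j) (pvar k) = coc3_alt \<gamma> (pvar i) (pvar j) (pvar k)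
      + (pvar i - th T (pvar i)) * (h0 (pvar j) (pvar k) - h0 (pvar k) (pvar j))
      + (pvar j - th T (pvar j)) * (h0 (pvar k) (pvar i) - h0 (pvar i) (pvar k))
      + (pvar k - th T (pvar k)) * (h0 (pvar i) (pvar j) - h0 (pvar j) (pvar i))"
      using ijk mult.commute[of "pvar j" "pvar i :: 'v cpoly"] mult.commute[of "pvar k" "pvar i :: 'v cpoly"] mult.commute[of "pvar k" "pvar j :: 'v cpoly"]
      by (simp add: coc3_alt_def \<gamma>'_def N.db_def algebra_simps)
    also have "\<dots> = 0" unfolding alt[OF ijk] half[OF ijk(2,3)] half[OF ijk(3,1)] half[OF ijk(1,2)] by simp
    finally show ?thesis .
  qed
  from coc3_coboundary[OF T c' this] obtain h where h: "\<forall>s. h s \<in> hom_bim" "\<forall>s t u. h (s + t) u = h s u + h t u"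
     "\<forall>k s u. h (pconst k * s) u = pconst k * h s u"
    "\<And>s t u. s \<in> S \<Longrightarrow> t \<in> S \<Longrightarrow> u \<in> S \<Longrightarrow> \<gamma>' s t u = s * h t u - h (s * t) u + h s (t * u) - h s t * th T u"
    by blast
  show ?thesis
  proof (intro exI[of _ "\<lambda>s u. h s u - h0 s u"] conjI allI ballI)
    show "(\<lambda>u. h s u - h0 s u) \<in> hom_bim" for s
      using N.M_diff[of "h s" "h0 s"] h(1) h0N by (simp add: fun_diff_def)
    show "h (s + t) u - h0 (s + t) u = h s u - h0 s u + (h t u - h0 t u)" for s t u
      using h(2) N.mlin_add[OF h0l, of s t] by (simp add: fun_eq_iff)
    show "h (pconst k * s) u - h0 (pconst k * s) u = pconst k * (h s u - h0 s u)" for k s u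
      using h(3) N.mlin_pconst[OF h0l, of k s] by (simp add: fun_eq_iff right_diff_distrib)
    fix s t u assume "s \<in> S" "t \<in> S" "u \<in> S"
    from h(4)[OF this] show "\<gamma> s t u = s * (h t u - h0 t u) - (h (s * t) u - h0 (s * t) u) +
        (h s (t * u) - h0 s (t * u)) - (h s t - h0 s t) * th T u"
      using \<open>s \<in> S\<close> \<open>t \<in> S\<close> by (simp add: \<gamma>'_def N.db_def algebra_simps)
  qed
qed

end

section \<open>The twisted Koszul complex\<close>

text \<open>
  Here \<open>T\<close> is the action of a group element \<open>g\<close>, \<open>P\<close> the projection of \<open>V\<close> onto the fixed space
  with kernel the image \<open>W\<close> of \<open>1 - T\<close>, and \<open>Q\<close> inverts \<open>1 - T\<close> on \<open>W\<close>.  The differential on forms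
  with values in the symmetric algebra is the exterior product with \<open>N\<close>.
\<close>

locale koszul = fdvs scl Bs for scl :: "complex \<Rightarrow> 'v::ab_group_add \<Rightarrow> 'v" and Bs :: "'v set" +
  fixes T P Q :: "'v \<Rightarrow> 'v"
  assumes linT: "lin T" and linP: "lin P" and linQ: "lin Q"
    and QT: "\<And>v. Q (v - T v) = v - P v" and TQ: "\<And>v. Q v - T (Q v) = v - P v"
    and PP: "\<And>v. P (P v) = P v"
begin

definition N :: "'v \<Rightarrow> 'v cpoly" where "N v = emb (v - T v)"
text \<open>The trace of the projection \<open>1 - P\<close> onto \<open>W\<close>, thus the
  dimension of \<open>W\<close> as a complex number; in this form it falls out of differentiating
  the coefficients of the Koszul differential.\<close>

definition tr :: complex where "tr = (\<Sum>b\<in>Bs. crd (b - P b) b)"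
text \<open>The derivation of the symmetric algebra that extends \<open>1 - P\<close>, so the Euler
  operator along \<open>W\<close>. It is written in the given basis, which need not be adapted to
  the splitting of V.\<close>

definition EW :: "'v cpoly \<Rightarrow> 'v cpoly" where "EW s = (\<Sum>b\<in>Bs. emb (b - P b) * pd b s)"

lemma EW_add: "EW (s + t) = EW s + EW t"
  by (simp add: EW_def pd_add distrib_left sum.distrib)
lemma EW_mult: "EW (s * t) = EW s * t + s * EW t"
  by (simp add: EW_def pd_mult algebra_simps sum.distrib sum_distrib_left)
lemma EW_pconst [simp]: "EW (pconst c) = 0" by (simp add: EW_def)
lemma EW_0 [simp]: "EW 0 = 0" by (simp add: EW_def)
lemma EW_uminus: "EW (- s) = - EW s"
  using EW_add[of s "- s"] by (simp add: eq_neg_iff_add_eq_0 add.commute)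
lemma EW_S [simp]: "s \<in> S \<Longrightarrow> EW s \<in> S" by (simp add: EW_def)

definition vlin :: "('v \<Rightarrow> 'v cpoly) \<Rightarrow> bool" where
  "vlin F \<longleftrightarrow> (\<forall>u v. F (u + v) = F u + F v) \<and> (\<forall>k v. F (scl k v) = pconst k * F v) \<and> (\<forall>v. F v \<in> S)"

lemma vlinD:
  assumes "vlin F"
  shows "F (u + v) = F u + F v" "F (scl k v) = pconst k * F v" "F v \<in> S" "F 0 = 0" "F (- v) = - F v" "F (u - v) = F u - F v"
proof -
  show 1: "F (u + v) = F u + F v" "F (scl k v) = pconst k * F v" "F v \<in> S" for u v using assms by (auto simp: vlin_def)
  show 0: "F 0 = 0" using 1(1)[of 0 0] by simp
  show m: "F (- v) = - F v" for v using 1(1)[of v "- v"] by (simp add: 0 eq_neg_iff_add_eq_0 add.commute)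
  show "F (u - v) = F u - F v" using 1(1)[of u "- v"] by (simp add: m)
qed

lemma vlin_crd: assumes "vlin F" shows "(\<Sum>b\<in>Bs. pconst (crd v b) * F b) = F v"
proof -
  have sum: "F (sum f I) = (\<Sum>i\<in>I. F (f i))" for f and I :: "'v set"
    by (induction I rule: infinite_finite_induct) (simp_all add: vlinD[OF assms])
  have "F v = F (\<Sum>b\<in>Bs. scl (crd v b) b)" by (simp add: crd_expand)
  then show ?thesis by (simp only: sum vlinD(2)[OF assms])
qed

lemma vlin_comp: assumes "vlin F" "lin L" shows "vlin (\<lambda>v. F (L v))"
proof -
  interpret L: Vector_Spaces.linear scl scl L by fact
  show ?thesis using assms(1) by (simp add: vlin_def L.add L.scale)
qed

lemma lin_minus: assumes "lin L" shows "L (u - v) = L u - L v" "L (u + v) = L u + L v" "L (scl k u) = scl k (L u)"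
proof -
  interpret L: Vector_Spaces.linear scl scl L by fact
  show "L (u - v) = L u - L v" "L (u + v) = L u + L v" "L (scl k u) = scl k (L u)"
    by (simp_all add: L.diff L.add L.scale)
qed

lemma vlin_lin:
  "vlin F \<Longrightarrow> vlin G \<Longrightarrow> vlin (\<lambda>v. F v + G v)" "vlin F \<Longrightarrow> vlin G \<Longrightarrow> vlin (\<lambda>v. F v - G v)"
  "vlin F \<Longrightarrow> vlin (\<lambda>v. - F v)"
  "s \<in> S \<Longrightarrow> vlin F \<Longrightarrow> vlin (\<lambda>v. s * F v)" "s \<in> S \<Longrightarrow> vlin F \<Longrightarrow> vlin (\<lambda>v. F v * s)" "vlin F \<Longrightarrow> vlin (\<lambda>v. EW (F v))"
  by (simp_all add: vlin_def algebra_simps EW_add EW_mult)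

lemma vlin_W: assumes "vlin F" shows "vlin (\<lambda>v. F (v - P v))"
  using vlin_lin(2)[OF assms vlin_comp[OF assms linP]] by (simp add: vlinD(6)[OF assms])

lemma vlin_sum: "(\<And>i. i \<in> I \<Longrightarrow> vlin (F i)) \<Longrightarrow> vlin (\<lambda>v. \<Sum>i\<in>I. F i v)"
  by (simp add: vlin_def sum.distrib sum_distrib_left)

lemma vlin_pd: "vlin F \<Longrightarrow> vlin (\<lambda>v. pd b (F v))"
  by (simp add: vlin_def pd_add pd_pconst_mult)

lemma vlin_emb: "vlin emb" by (simp add: vlin_def emb_add emb_scl)

lemma EW_emb: "EW (emb v) = emb (v - P v)"
proof -
  have "EW (emb v) = (\<Sum>b\<in>Bs. pconst (crd v b) * emb (b - P b))"
    unfolding EW_def by (rule sum.cong) (simp_all add: pd_emb)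
  also have "\<dots> = emb (v - P v)" by (rule vlin_crd[OF vlin_W[OF vlin_emb]])
  finally show ?thesis .
qed

text \<open>
  The contraction \<open>\<Sum>\<^sub>b \<partial>\<^sub>b \<iota>\<^bsub>Q b\<^esub>\<close> applied to a product with a coefficient
  of the Koszul differential.
\<close>

lemma contract_N: assumes "vlin F" shows
  "(\<Sum>b\<in>Bs. pd b (N v * F (Q b))) = F (v - P v) + N v * (\<Sum>b\<in>Bs. pd b (F (Q b)))"
proof -
  have "(\<Sum>b\<in>Bs. pd b (N v * F (Q b))) = (\<Sum>b\<in>Bs. pconst (crd (v - T v) b) * F (Q b)) + N v * (\<Sum>b\<in>Bs. pd b (F (Q b)))"
    by (simp add: N_def pd_mult pd_emb sum.distrib sum_distrib_left)
  also have "(\<Sum>b\<in>Bs. pconst (crd (v - T v) b) * F (Q b)) = F (v - P v)"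
    using vlin_crd[OF vlin_comp[OF assms linQ], of "v - T v"] by (simp add: QT)
  finally show ?thesis .
qed

text \<open>The composite of \<open>1 - T\<close> with \<open>Q\<close> is \<open>1 - P\<close>.
  Differentiating its coefficients produces the trace, differentiating \<open>s\<close> produces the
  Euler operator.\<close>

lemma contract_top: "(\<Sum>b\<in>Bs. pd b (N (Q b) * s)) = pconst tr * s + EW s"
  by (simp add: N_def TQ pd_mult pd_emb sum.distrib EW_def tr_def pconst_sum sum_distrib_right)

section \<open>Closed and exact forms of degree two and three, and the Laplacian\<close>

definition form2 :: "('v \<Rightarrow> 'v \<Rightarrow> 'v cpoly) \<Rightarrow> bool" where
  "form2 \<omega> \<longleftrightarrow> (\<forall>v. vlin (\<lambda>u. \<omega> u v)) \<and> (\<forall>u. vlin (\<omega> u)) \<and> (\<forall>u v. \<omega> u v = - \<omega> v u)"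

definition closed2 :: "('v \<Rightarrow> 'v \<Rightarrow> 'v cpoly) \<Rightarrow> bool" where
  "closed2 \<omega> \<longleftrightarrow> (\<forall>u v w. N u * \<omega> v w - N v * \<omega> u w + N w * \<omega> u v = 0)"

definition exact2 :: "('v \<Rightarrow> 'v \<Rightarrow> 'v cpoly) \<Rightarrow> bool" where
  "exact2 \<omega> \<longleftrightarrow> (\<exists>\<beta>. vlin \<beta> \<and> (\<forall>u v. \<omega> u v = N u * \<beta> v - N v * \<beta> u))"

text \<open>
  The anticommutator of the differential with the contraction by \<open>\<Sum>\<^sub>b \<partial>\<^sub>b \<iota>\<^bsub>Q b\<^esub>\<close> is
  \<open>dim W + E - F\<close>, where \<open>E\<close> is the Euler operator of \<open>W\<close> on the coefficients and \<open>F\<close> counts the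
  arguments in \<open>W\<close>.
\<close>

definition lap2 :: "('v \<Rightarrow> 'v \<Rightarrow> 'v cpoly) \<Rightarrow> 'v \<Rightarrow> 'v \<Rightarrow> 'v cpoly" where
  "lap2 \<omega> u v = pconst tr * \<omega> u v + EW (\<omega> u v) - \<omega> (u - P u) v - \<omega> u (v - P v)"

definition form3 :: "('v \<Rightarrow> 'v \<Rightarrow> 'v \<Rightarrow> 'v cpoly) \<Rightarrow> bool" where
  "form3 \<eta> \<longleftrightarrow> (\<forall>v w. vlin (\<lambda>u. \<eta> u v w)) \<and> (\<forall>u w. vlin (\<lambda>v. \<eta> u v w)) \<and> (\<forall>u v. vlin (\<eta> u v)) \<and>
     (\<forall>u v w. \<eta> u v w = - \<eta> v u w) \<and> (\<forall>u v w. \<eta> u v w = - \<eta> u w v)"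

definition closed3 :: "('v \<Rightarrow> 'v \<Rightarrow> 'v \<Rightarrow> 'v cpoly) \<Rightarrow> bool" where
  "closed3 \<eta> \<longleftrightarrow> (\<forall>u v w x. N u * \<eta> v w x - N v * \<eta> u w x + N w * \<eta> u v x - N x * \<eta> u v w = 0)"

definition exact3 :: "('v \<Rightarrow> 'v \<Rightarrow> 'v \<Rightarrow> 'v cpoly) \<Rightarrow> bool" where
  "exact3 \<eta> \<longleftrightarrow> (\<exists>\<beta>. form2 \<beta> \<and> (\<forall>u v w. \<eta> u v w = N u * \<beta> v w - N v * \<beta> u w + N w * \<beta> u v))"

definition lap3 :: "('v \<Rightarrow> 'v \<Rightarrow> 'v \<Rightarrow> 'v cpoly) \<Rightarrow> 'v \<Rightarrow> 'v \<Rightarrow> 'v \<Rightarrow> 'v cpoly" where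
  "lap3 \<eta> u v w = pconst tr * \<eta> u v w + EW (\<eta> u v w) - \<eta> (u - P u) v w - \<eta> u (v - P v) w - \<eta> u v (w - P w)"

lemma lap2_form: "form2 \<omega> \<Longrightarrow> form2 (lap2 \<omega>)"
proof -
  assume f: "form2 \<omega>"
  then have l: "vlin (\<lambda>u. \<omega> u v)" and r: "vlin (\<lambda>v. \<omega> u v)" and a: "\<omega> u v = - \<omega> v u" for u v
    unfolding form2_def by blast+
  have "vlin (\<lambda>u. lap2 \<omega> u v)" for v
    unfolding lap2_def by (intro vlin_lin l vlin_W[of "\<lambda>u. \<omega> u v"]) auto
  moreover have "vlin (lap2 \<omega> u)" for u
    unfolding lap2_def[abs_def] by (intro vlin_lin r vlin_W[of "\<omega> u"]) auto
  moreover have "lap2 \<omega> u v = - lap2 \<omega> v u" for u v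
    using a[of u v] a[of "u - P u" v] a[of u "v - P v"] by (simp add: lap2_def EW_uminus)
  ultimately show ?thesis unfolding form2_def by blast
qed

text \<open>A Cartan homotopy formula: the anticommutator applied to a closed form is the
  differential of its contraction, which is \<open>\<beta>\<close>.\<close>

lemma lap2_exact: assumes f: "form2 \<omega>" and c: "closed2 \<omega>" shows "exact2 (lap2 \<omega>)"
proof -
  have l: "vlin (\<lambda>u. \<omega> u v)" and r: "vlin (\<lambda>v. \<omega> u v)" and a: "\<omega> u v = - \<omega> v u" for u v
    using f unfolding form2_def by blast+
  define \<beta> where "\<beta> v = (\<Sum>b\<in>Bs. pd b (\<omega> (Q b) v))" for v
  have "vlin \<beta>" unfolding \<beta>_def[abs_def] by (intro vlin_sum vlin_pd r)
  moreover have "lap2 \<omega> u v = N u * \<beta> v - N v * \<beta> u" for u v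
  proof -
    have "(\<Sum>b\<in>Bs. pd b (N (Q b) * \<omega> u v - N u * \<omega> (Q b) v + N v * \<omega> (Q b) u)) = 0"
      using c by (simp add: closed2_def)
    then have "pconst tr * \<omega> u v + EW (\<omega> u v) - (\<omega> (u - P u) v + N u * \<beta> v) + (\<omega> (v - P v) u + N v * \<beta> u) = 0"
      by (simp add: pd_add pd_diff sum.distrib sum_subtractf contract_top contract_N[OF l] \<beta>_def)
    then show ?thesis using a[of "v - P v" u] by (simp add: lap2_def algebra_simps)
  qed
  ultimately show ?thesis unfolding exact2_def by blast
qed

lemma exact2_closed: "exact2 \<omega> \<Longrightarrow> closed2 \<omega>"
proof -
  assume "exact2 \<omega>"
  then obtain \<beta> where e: "\<And>u v. \<omega> u v = N u * \<beta> v - N v * \<beta> u"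
    unfolding exact2_def by blast
  show ?thesis unfolding closed2_def e by (simp add: algebra_simps)
qed

lemma exact2_add: "exact2 \<omega> \<Longrightarrow> exact2 \<omega>' \<Longrightarrow> exact2 (\<lambda>u v. \<omega> u v + \<omega>' u v)"
proof -
  assume "exact2 \<omega>" "exact2 \<omega>'"
  then obtain \<beta> \<beta>' where b: "vlin \<beta>" "vlin \<beta>'" and e: "\<And>u v. \<omega> u v = N u * \<beta> v - N v * \<beta> u"
      "\<And>u v. \<omega>' u v = N u * \<beta>' v - N v * \<beta>' u"
    unfolding exact2_def by blast
  show ?thesis unfolding exact2_def e
    by (rule exI[of _ "\<lambda>v. \<beta> v + \<beta>' v"]) (simp add: vlin_lin b algebra_simps)
qed

lemma exact2_mult: "exact2 \<omega> \<Longrightarrow> exact2 (\<lambda>u v. pconst k * \<omega> u v)"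
proof -
  assume "exact2 \<omega>"
  then obtain \<beta> where b: "vlin \<beta>" and e: "\<And>u v. \<omega> u v = N u * \<beta> v - N v * \<beta> u"
    unfolding exact2_def by blast
  show ?thesis unfolding exact2_def e
    by (rule exI[of _ "\<lambda>v. pconst k * \<beta> v"]) (simp add: vlin_lin b algebra_simps)
qed

text \<open>The product of the operators \<open>lap2 - k\<close>. Since \<open>lap2\<close> is zero
  on cohomology, the product acts there as the scalar \<open>\<Prod>(- k)\<close>, while it
  annihilates every eigenvector whose eigenvalue is in the list.\<close>

fun opl2 :: "complex list \<Rightarrow> ('v \<Rightarrow> 'v \<Rightarrow> 'v cpoly) \<Rightarrow> 'v \<Rightarrow> 'v \<Rightarrow> 'v cpoly" where
  "opl2 [] \<omega> = \<omega>"
| "opl2 (k # ks) \<omega> = opl2 ks (\<lambda>u v. lap2 \<omega> u v - pconst k * \<omega> u v)"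

lemma form2_lin:
  assumes f: "form2 \<omega>" and g: "form2 \<omega>'"
  shows "form2 (\<lambda>u v. \<omega> u v - pconst k * \<omega>' u v)"
  unfolding form2_def
proof (intro conjI allI)
  show "\<omega> u v - pconst k * \<omega>' u v = - (\<omega> v u - pconst k * \<omega>' v u)" for u v
  proof -
    have "\<omega> u v = - \<omega> v u" "\<omega>' u v = - \<omega>' v u" using f g unfolding form2_def by blast+
    then show ?thesis by simp
  qed
qed (use f g in \<open>unfold form2_def, intro vlin_lin S_pconst; blast\<close>)+

lemma closed2_lin: "closed2 \<omega> \<Longrightarrow> closed2 \<omega>' \<Longrightarrow> closed2 (\<lambda>u v. \<omega> u v - pconst k * \<omega>' u v)"
proof -
  assume "closed2 \<omega>" "closed2 \<omega>'"
  then have "N u * \<omega> v w - N v * \<omega> u w + N w * \<omega> u v = 0" "N u * \<omega>' v w - N v * \<omega>' u w + N w * \<omega>' u v = 0" for u v w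
    by (auto simp: closed2_def)
  then have "(N u * \<omega> v w - N v * \<omega> u w + N w * \<omega> u v) - pconst k * (N u * \<omega>' v w - N v * \<omega>' u w + N w * \<omega>' u v) = 0" for u v w
    by simp
  then show ?thesis by (simp add: closed2_def algebra_simps)
qed

lemma opl2_exact:
  assumes "form2 \<omega>" "closed2 \<omega>"
  shows "form2 (opl2 ks \<omega>) \<and> exact2 (\<lambda>u v. opl2 ks \<omega> u v - pconst (prod_list (map uminus ks)) * \<omega> u v)"
  using assms
proof (induction ks arbitrary: \<omega>)
  case Nil
  have "exact2 (\<lambda>u v. 0)" unfolding exact2_def by (rule exI[of _ "\<lambda>v. 0"]) (simp add: vlin_def)
  then show ?case using Nil by simp
next
  case (Cons k ks)
  let ?w = "\<lambda>u v. lap2 \<omega> u v - pconst k * \<omega> u v" and ?c = "prod_list (map uminus ks)"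
  have ex: "exact2 (lap2 \<omega>)" by (rule lap2_exact[OF Cons.prems])
  have f: "form2 ?w" by (intro form2_lin lap2_form Cons.prems)
  have c: "closed2 ?w" by (intro closed2_lin exact2_closed[OF ex] Cons.prems)
  have "exact2 (\<lambda>u v. (opl2 ks ?w u v - pconst ?c * ?w u v) + pconst ?c * lap2 \<omega> u v)"
    by (intro exact2_add exact2_mult ex conjunct2[OF Cons.IH[OF f c]])
  moreover have "(opl2 ks ?w u v - pconst ?c * ?w u v) + pconst ?c * lap2 \<omega> u v =
      opl2 (k # ks) \<omega> u v - pconst (prod_list (map uminus (k # ks))) * \<omega> u v" for u v
    by (simp add: pconst_mult pconst_uminus algebra_simps)
  ultimately show ?case using Cons.IH[OF f c] by simp
qed

lemma form3D:
  assumes "form3 \<eta>"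
  shows "vlin (\<lambda>u. \<eta> u v w)" "vlin (\<lambda>v. \<eta> u v w)" "vlin (\<lambda>w. \<eta> u v w)"
    "\<eta> u v w = - \<eta> v u w" "\<eta> u v w = - \<eta> u w v"
  using assms[unfolded form3_def, THEN conjunct1] assms[unfolded form3_def, THEN conjunct2, THEN conjunct1]
    assms[unfolded form3_def, THEN conjunct2, THEN conjunct2, THEN conjunct1]
    assms[unfolded form3_def, THEN conjunct2, THEN conjunct2, THEN conjunct2, THEN conjunct1]
    assms[unfolded form3_def, THEN conjunct2, THEN conjunct2, THEN conjunct2, THEN conjunct2]
  by blast+

lemma lap3_form: "form3 \<eta> \<Longrightarrow> form3 (lap3 \<eta>)"
proof -
  assume f: "form3 \<eta>"
  then have 1: "vlin (\<lambda>u. \<eta> u v w)" and 2: "vlin (\<lambda>v. \<eta> u v w)" and 3: "vlin (\<lambda>w. \<eta> u v w)"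
    and a: "\<eta> u v w = - \<eta> v u w" and b: "\<eta> u v w = - \<eta> u w v" for u v w
    unfolding form3_def by blast+
  have "vlin (\<lambda>u. lap3 \<eta> u v w)" for v w
    unfolding lap3_def by (intro vlin_lin 1 vlin_W[of "\<lambda>u. \<eta> u v w"]) auto
  moreover have "vlin (\<lambda>v. lap3 \<eta> u v w)" for u w
    unfolding lap3_def by (intro vlin_lin 2 vlin_W[of "\<lambda>v. \<eta> u v w"]) auto
  moreover have "vlin (lap3 \<eta> u v)" for u v
    unfolding lap3_def[abs_def] by (intro vlin_lin 3 vlin_W[of "\<eta> u v"]) auto
  moreover have "lap3 \<eta> u v w = - lap3 \<eta> v u w" for u v w
    using a[of u v w] a[of "u - P u" v w] a[of u "v - P v" w] a[of u v "w - P w"]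
    by (simp add: lap3_def EW_uminus)
  moreover have "lap3 \<eta> u v w = - lap3 \<eta> u w v" for u v w
    using b[of u v w] b[of "u - P u" v w] b[of u "v - P v" w] b[of u v "w - P w"]
    by (simp add: lap3_def EW_uminus)
  ultimately show ?thesis unfolding form3_def by blast
qed

lemma lap3_exact: assumes f: "form3 \<eta>" and c: "closed3 \<eta>" shows "exact3 (lap3 \<eta>)"
proof -
  have 1: "vlin (\<lambda>u. \<eta> u v w)" and 2: "vlin (\<lambda>v. \<eta> u v w)" and 3: "vlin (\<lambda>w. \<eta> u v w)"
    and a: "\<eta> u v w = - \<eta> v u w" and b: "\<eta> u v w = - \<eta> u w v" for u v w
    using f unfolding form3_def by blast+
  define \<beta> where "\<beta> v w = (\<Sum>b\<in>Bs. pd b (\<eta> (Q b) v w))" for v w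
  have "form2 \<beta>"
    unfolding form2_def
  proof (intro conjI allI)
    show "vlin (\<lambda>u. \<beta> u v)" for v unfolding \<beta>_def[abs_def] by (intro vlin_sum vlin_pd 2)
    show "vlin (\<beta> u)" for u unfolding \<beta>_def[abs_def] by (intro vlin_sum vlin_pd 3)
    show "\<beta> u v = - \<beta> v u" for u v
      unfolding \<beta>_def sum_negf[symmetric] by (intro sum.cong refl, subst b) (rule pd_uminus)
  qed
  moreover have "lap3 \<eta> u v w = N u * \<beta> v w - N v * \<beta> u w + N w * \<beta> u v" for u v w
  proof -
    have "(\<Sum>b\<in>Bs. pd b (N (Q b) * \<eta> u v w - N u * \<eta> (Q b) v w + N v * \<eta> (Q b) u w - N w * \<eta> (Q b) u v)) = 0"
      using c by (simp add: closed3_def)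
    then have "pconst tr * \<eta> u v w + EW (\<eta> u v w) - (\<eta> (u - P u) v w + N u * \<beta> v w)
        + (\<eta> (v - P v) u w + N v * \<beta> u w) - (\<eta> (w - P w) u v + N w * \<beta> u v) = 0"
      by (simp add: pd_add pd_diff sum.distrib sum_subtractf contract_top contract_N[OF 1] \<beta>_def)
    then show ?thesis
      using a[of "v - P v" u w] a[of "w - P w" u v] b[of u "w - P w" v] by (simp add: lap3_def algebra_simps)
  qed
  ultimately show ?thesis unfolding exact3_def by blast
qed

lemma exact3_closed: "exact3 \<eta> \<Longrightarrow> closed3 \<eta>"
proof -
  assume "exact3 \<eta>"
  then obtain \<beta> where \<beta>: "form2 \<beta>" and e: "\<And>u v w. \<eta> u v w = N u * \<beta> v w - N v * \<beta> u w + N w * \<beta> u v"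
    unfolding exact3_def by blast
  show ?thesis unfolding closed3_def e by (simp add: algebra_simps)
qed

lemma form2_add: "form2 \<omega> \<Longrightarrow> form2 \<omega>' \<Longrightarrow> form2 (\<lambda>u v. \<omega> u v + \<omega>' u v)"
  using form2_lin[of \<omega> \<omega>' "-1"] by (simp add: pconst_uminus)

lemma form2_0: "form2 (\<lambda>u v. 0)" by (simp add: form2_def vlin_def)

lemma form2_mult: "form2 \<omega> \<Longrightarrow> form2 (\<lambda>u v. pconst k * \<omega> u v)"
  using form2_lin[OF form2_0, of \<omega> "- k"] by (simp add: pconst_uminus)

lemma exact3_add: "exact3 \<eta> \<Longrightarrow> exact3 \<eta>' \<Longrightarrow> exact3 (\<lambda>u v w. \<eta> u v w + \<eta>' u v w)"
proof -
  assume "exact3 \<eta>" "exact3 \<eta>'"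
  then obtain \<beta> \<beta>' where b: "form2 \<beta>" "form2 \<beta>'"
    and e: "\<And>u v w. \<eta> u v w = N u * \<beta> v w - N v * \<beta> u w + N w * \<beta> u v"
      "\<And>u v w. \<eta>' u v w = N u * \<beta>' v w - N v * \<beta>' u w + N w * \<beta>' u v"
    unfolding exact3_def by blast
  show ?thesis unfolding exact3_def e
    by (rule exI[of _ "\<lambda>u v. \<beta> u v + \<beta>' u v"]) (simp add: form2_add b algebra_simps)
qed

lemma exact3_mult: "exact3 \<eta> \<Longrightarrow> exact3 (\<lambda>u v w. pconst k * \<eta> u v w)"
proof -
  assume "exact3 \<eta>"
  then obtain \<beta> where b: "form2 \<beta>"
    and e: "\<And>u v w. \<eta> u v w = N u * \<beta> v w - N v * \<beta> u w + N w * \<beta> u v"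
    unfolding exact3_def by blast
  show ?thesis unfolding exact3_def e
    by (rule exI[of _ "\<lambda>u v. pconst k * \<beta> u v"]) (simp add: form2_mult b algebra_simps)
qed

fun opl3 :: "complex list \<Rightarrow> ('v \<Rightarrow> 'v \<Rightarrow> 'v \<Rightarrow> 'v cpoly) \<Rightarrow> 'v \<Rightarrow> 'v \<Rightarrow> 'v \<Rightarrow> 'v cpoly" where
  "opl3 [] \<eta> = \<eta>"
| "opl3 (k # ks) \<eta> = opl3 ks (\<lambda>u v w. lap3 \<eta> u v w - pconst k * \<eta> u v w)"

lemma form3_lin:
  assumes f: "form3 \<omega>" and g: "form3 \<omega>'"
  shows "form3 (\<lambda>u v w. \<omega> u v w - pconst k * \<omega>' u v w)"
  unfolding form3_def
proof (intro conjI allI)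
  show "\<omega> u v w - pconst k * \<omega>' u v w = - (\<omega> v u w - pconst k * \<omega>' v u w)" for u v w
    using form3D(4)[OF f, of u v w] form3D(4)[OF g, of u v w] by simp
  show "\<omega> u v w - pconst k * \<omega>' u v w = - (\<omega> u w v - pconst k * \<omega>' u w v)" for u v w
    using form3D(5)[OF f, of u v w] form3D(5)[OF g, of u v w] by simp
qed (intro vlin_lin S_pconst form3D f g)+

lemma closed3_lin:
  assumes "closed3 \<omega>" "closed3 \<omega>'"
  shows "closed3 (\<lambda>u v w. \<omega> u v w - pconst k * \<omega>' u v w)"
  unfolding closed3_def
proof (intro allI)
  fix u v w x
  have z: "N u * \<omega> v w x - N v * \<omega> u w x + N w * \<omega> u v x - N x * \<omega> u v w = 0"
     "N u * \<omega>' v w x - N v * \<omega>' u w x + N w * \<omega>' u v x - N x * \<omega>' u v w = 0"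
    using assms unfolding closed3_def by blast+
  have "N u * (\<omega> v w x - pconst k * \<omega>' v w x) - N v * (\<omega> u w x - pconst k * \<omega>' u w x)
      + N w * (\<omega> u v x - pconst k * \<omega>' u v x) - N x * (\<omega> u v w - pconst k * \<omega>' u v w)
    = (N u * \<omega> v w x - N v * \<omega> u w x + N w * \<omega> u v x - N x * \<omega> u v w)
     - pconst k * (N u * \<omega>' v w x - N v * \<omega>' u w x + N w * \<omega>' u v x - N x * \<omega>' u v w)"
    by (simp add: algebra_simps)
  then show "N u * (\<omega> v w x - pconst k * \<omega>' v w x) - N v * (\<omega> u w x - pconst k * \<omega>' u w x)
      + N w * (\<omega> u v x - pconst k * \<omega>' u v x) - N x * (\<omega> u v w - pconst k * \<omega>' u v w) = 0"
    unfolding z by simp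
qed

lemma opl3_exact:
  assumes "form3 \<omega>" "closed3 \<omega>"
  shows "form3 (opl3 ks \<omega>) \<and> exact3 (\<lambda>u v w. opl3 ks \<omega> u v w - pconst (prod_list (map uminus ks)) * \<omega> u v w)"
  using assms
proof (induction ks arbitrary: \<omega>)
  case Nil
  have "exact3 (\<lambda>u v w. 0)" unfolding exact3_def by (rule exI[of _ "\<lambda>u v. 0"]) (simp add: form2_0)
  then show ?case using Nil by simp
next
  case (Cons k ks)
  let ?w = "\<lambda>u v w. lap3 \<omega> u v w - pconst k * \<omega> u v w" and ?c = "prod_list (map uminus ks)"
  have ex: "exact3 (lap3 \<omega>)" by (rule lap3_exact[OF Cons.prems])
  have f: "form3 ?w" by (intro form3_lin lap3_form Cons.prems)
  have c: "closed3 ?w" by (intro closed3_lin exact3_closed[OF ex] Cons.prems)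
  have "exact3 (\<lambda>u v w. (opl3 ks ?w u v w - pconst ?c * ?w u v w) + pconst ?c * lap3 \<omega> u v w)"
    by (intro exact3_add exact3_mult ex conjunct2[OF Cons.IH[OF f c]])
  moreover have "(opl3 ks ?w u v w - pconst ?c * ?w u v w) + pconst ?c * lap3 \<omega> u v w =
      opl3 (k # ks) \<omega> u v w - pconst (prod_list (map uminus (k # ks))) * \<omega> u v w" for u v w
    by (simp add: pconst_mult pconst_uminus algebra_simps)
  ultimately show ?case using Cons.IH[OF f c] by simp
qed


text \<open>Eigenvectors of the Euler operator along \<open>W\<close>. For the eigenvalue 0 the
  condition with \<open>th P\<close> records that \<open>s\<close> is a polynomial in fixed vectors;
  harmonic forms inherit this property.\<close>

definition Ev :: "nat \<Rightarrow> 'v cpoly set" where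
  "Ev i = {s \<in> S. EW s = of_nat i * s \<and> (i = 0 \<longrightarrow> th P s = s)}"

text \<open>The bound \<open>n\<close> on the eigenvalues is what makes a finite list of factors in
  \<open>opl2\<close> and \<open>opl3\<close> sufficient.\<close>

definition Dn :: "nat \<Rightarrow> 'v cpoly set" where
  "Dn n = {s. \<exists>f. s = (\<Sum>i\<le>n. f i) \<and> (\<forall>i. f i \<in> Ev i)}"

lemma Ev_lin: "s \<in> Ev i \<Longrightarrow> t \<in> Ev i \<Longrightarrow> s + t \<in> Ev i" "s \<in> Ev i \<Longrightarrow> pconst k * s \<in> Ev i"
  "0 \<in> Ev i"
  by (auto simp: Ev_def EW_add th_add distrib_left EW_mult th_mult mult.left_commute)

lemma Ev_mult: "s \<in> Ev i \<Longrightarrow> t \<in> Ev j \<Longrightarrow> s * t \<in> Ev (i + j)"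
  by (auto simp: Ev_def EW_mult th_mult algebra_simps)

lemma Dn_add: assumes "s \<in> Dn n" "t \<in> Dn n" shows "s + t \<in> Dn n"
proof -
  obtain f g where "s = (\<Sum>i\<le>n. f i)" "\<forall>i. f i \<in> Ev i" "t = (\<Sum>i\<le>n. g i)" "\<forall>i. g i \<in> Ev i"
    using assms unfolding Dn_def by blast
  then show ?thesis
    unfolding Dn_def by (intro CollectI exI[of _ "\<lambda>i. f i + g i"]) (simp add: sum.distrib Ev_lin)
qed

lemma Dn_pconst: assumes "s \<in> Dn n" shows "pconst k * s \<in> Dn n"
proof -
  obtain f where "s = (\<Sum>i\<le>n. f i)" "\<forall>i. f i \<in> Ev i" using assms unfolding Dn_def by blast
  then show ?thesis
    unfolding Dn_def by (intro CollectI exI[of _ "\<lambda>i. pconst k * f i"]) (simp add: sum_distrib_left Ev_lin)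
qed

lemma Ev_Dn: assumes "s \<in> Ev i" "i \<le> n" shows "s \<in> Dn n"
  unfolding Dn_def using assms
  by (intro CollectI exI[of _ "\<lambda>j. if j = i then s else 0"]) (auto simp: Ev_lin)

lemma Dn_0: "0 \<in> Dn n" by (rule Ev_Dn[of 0 0]) (simp_all add: Ev_lin)

lemma Dn_sum: "(\<And>i. i \<in> I \<Longrightarrow> f i \<in> Dn n) \<Longrightarrow> sum f I \<in> Dn n"
  by (induction I rule: infinite_finite_induct) (simp_all add: Dn_add Dn_0)

lemma Dn_mono: assumes "s \<in> Dn n" "n \<le> n'" shows "s \<in> Dn n'"
proof -
  obtain f where f: "s = (\<Sum>i\<le>n. f i)" "\<forall>i. f i \<in> Ev i" using assms unfolding Dn_def by blast
  show ?thesis unfolding f(1)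
  proof (rule Dn_sum)
    show "f i \<in> Dn n'" if "i \<in> {..n}" for i by (rule Ev_Dn[of _ i]) (use f(2) assms(2) that in auto)
  qed
qed

lemma Dn_mult: assumes "s \<in> Dn n" "t \<in> Dn n'" shows "s * t \<in> Dn (n + n')"
proof -
  obtain f g where fg: "s = (\<Sum>i\<le>n. f i)" "\<forall>i. f i \<in> Ev i" "t = (\<Sum>i\<le>n'. g i)" "\<forall>i. g i \<in> Ev i"
    using assms unfolding Dn_def by blast
  show ?thesis
    unfolding fg(1,3) sum_product by (intro Dn_sum Ev_Dn[OF Ev_mult]) (use fg in auto)
qed

text \<open>A variable is the sum of \<open>P b\<close> and \<open>b - P b\<close>, with eigenvalues
  0 and 1, and eigenvalues add under multiplication. In this way the eigenspace decomposition is
  obtained without a basis adapted to the splitting.\<close>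

lemma S_Dn: "s \<in> S \<Longrightarrow> \<exists>n. s \<in> Dn n"
proof (induction s rule: S_induct)
  case (const c)
  have "pconst c \<in> Ev 0" by (simp add: Ev_def)
  then show ?case using Ev_Dn by blast
next
  case (var b)
  have "emb (P b) \<in> Ev 0" "emb (b - P b) \<in> Ev 1"
    by (simp_all add: Ev_def EW_emb PP th_emb[OF linP] lin_minus[OF linP])
  then have "emb (P b) + emb (b - P b) \<in> Dn 1" by (intro Dn_add Ev_Dn) auto
  then show ?case using var by (auto simp: emb_add[symmetric] emb_Bs)
next
  case (add s t)
  then obtain n n' where "s \<in> Dn n" "t \<in> Dn n'" by blast
  then have "s + t \<in> Dn (max n n')" by (intro Dn_add) (auto intro: Dn_mono)
  then show ?case ..
next
  case (mult s t)
  then show ?case using Dn_mult by blast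
qed

lemma finite_Dn: assumes "finite X" "\<And>x. x \<in> X \<Longrightarrow> f x \<in> S" shows "\<exists>n. \<forall>x\<in>X. f x \<in> Dn n"
  using assms
proof (induction X)
  case (insert x X)
  then obtain n n' where "\<forall>x\<in>X. f x \<in> Dn n" "f x \<in> Dn n'" using S_Dn[of "f x"] by auto
  then have "\<forall>y\<in>insert x X. f y \<in> Dn (max n n')" by (auto intro: Dn_mono)
  then show ?case ..
qed simp

text \<open>The action of \<open>opl2\<close> and \<open>opl3\<close> on a single coefficient. On
  arguments of fixed weights the Laplacian is \<open>EW + c\<close>, where \<open>c\<close> is
  \<open>tr\<close> minus the number of arguments in \<open>W\<close>.\<close>

fun opS :: "complex \<Rightarrow> complex list \<Rightarrow> 'v cpoly \<Rightarrow> 'v cpoly" where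
  "opS c [] s = s"
| "opS c (k # ks) s = opS c ks (EW s + pconst (c - k) * s)"

lemma opS_add: "opS c ks (s + t) = opS c ks s + opS c ks t"
  by (induction ks arbitrary: s t) (simp_all add: EW_add distrib_left add_ac)

lemma opS_0 [simp]: "opS c ks 0 = 0" using opS_add[of c ks 0 0] by simp

lemma opS_sum: "opS c ks (sum f I) = (\<Sum>i\<in>I. opS c ks (f i))"
  by (induction I rule: infinite_finite_induct) (simp_all add: opS_add)

lemma opS_Ev: "s \<in> Ev i \<Longrightarrow> opS c ks s = pconst (\<Prod>k\<leftarrow>ks. of_nat i + c - k) * s"
proof (induction ks arbitrary: s)
  case (Cons k ks)
  have "EW s + pconst (c - k) * s = pconst (of_nat i + c - k) * s"
    using Cons.prems by (simp add: Ev_def pconst_add pconst_diff pconst_of_nat algebra_simps)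
  then show ?case using Cons.IH[OF Ev_lin(2)[OF Cons.prems]] by (simp add: pconst_mult mult_ac)
qed simp

text \<open>Pure arguments: weight 0 on the fixed space, weight 1 on \<open>W\<close>. The zero
  vector has both weights. Multilinear statements are checked on pure arguments only.\<close>

definition wt :: "'v \<Rightarrow> nat \<Rightarrow> bool" where
  "wt u a \<longleftrightarrow> (a = 0 \<and> P u = u) \<or> (a = 1 \<and> P u = 0)"

lemma wt_P: "wt (P u) 0" "wt (u - P u) 1"
  by (simp_all add: wt_def PP lin_minus[OF linP])

lemma wt_vlin: "vlin F \<Longrightarrow> wt u a \<Longrightarrow> F (u - P u) = of_nat a * F u"
  by (auto simp: wt_def vlinD)

lemma opl2_opS:
  assumes "form2 \<omega>" "wt u a" "wt v c"
  shows "opl2 ks \<omega> u v = opS (tr - of_nat (a + c)) ks (\<omega> u v)"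
  using assms(1)
proof (induction ks arbitrary: \<omega>)
  case (Cons k ks)
  have l: "vlin (\<lambda>u. \<omega> u v)" and r: "vlin (\<lambda>v. \<omega> u v)" for u v
    using Cons.prems unfolding form2_def by blast+
  have "lap2 \<omega> u v - pconst k * \<omega> u v = EW (\<omega> u v) + pconst (tr - of_nat (a + c) - k) * \<omega> u v"
    using wt_vlin[OF l assms(2)] wt_vlin[OF r assms(3)]
    by (simp add: lap2_def pconst_diff pconst_of_nat pconst_add algebra_simps)
  then show ?case using Cons.IH[OF form2_lin[OF lap2_form]] Cons.prems by simp
qed simp

lemma opl3_opS:
  assumes "form3 \<eta>" "wt u a" "wt v c" "wt w d"
  shows "opl3 ks \<eta> u v w = opS (tr - of_nat (a + c + d)) ks (\<eta> u v w)"
  using assms(1)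
proof (induction ks arbitrary: \<eta>)
  case (Cons k ks)
  have 1: "vlin (\<lambda>u. \<eta> u v w)" and 2: "vlin (\<lambda>v. \<eta> u v w)" and 3: "vlin (\<lambda>w. \<eta> u v w)" for u v w
    using Cons.prems unfolding form3_def by blast+
  have "lap3 \<eta> u v w - pconst k * \<eta> u v w = EW (\<eta> u v w) + pconst (tr - of_nat (a + c + d) - k) * \<eta> u v w"
    using wt_vlin[OF 1 assms(2)] wt_vlin[OF 2 assms(3)] wt_vlin[OF 3 assms(4)]
    by (simp add: lap3_def pconst_diff pconst_of_nat pconst_add algebra_simps)
  then show ?case using Cons.IH[OF form3_lin[OF lap3_form]] Cons.prems by simp
qed simp

text \<open>One bound serves all coefficients because a form is determined by its finitely many
  values on basis vectors.\<close>

lemma form2_Dn: assumes "form2 \<omega>" shows "\<exists>n. \<forall>u v. \<omega> u v \<in> Dn n"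
proof -
  have l: "vlin (\<lambda>u. \<omega> u v)" and r: "vlin (\<lambda>v. \<omega> u v)" for u v
    using assms unfolding form2_def by blast+
  obtain n where n: "\<forall>x\<in>Bs \<times> Bs. \<omega> (fst x) (snd x) \<in> Dn n"
    using finite_Dn[of "Bs \<times> Bs" "\<lambda>x. \<omega> (fst x) (snd x)"] vlinD(3)[OF l] finite_Basis by auto
  have "\<omega> u v \<in> Dn n" for u v
  proof -
    have "(\<Sum>b\<in>Bs. pconst (crd u b) * (\<Sum>b'\<in>Bs. pconst (crd v b') * \<omega> b b')) \<in> Dn n"
      by (intro Dn_sum Dn_pconst) (use n in auto)
    then show ?thesis by (simp add: vlin_crd[OF r] vlin_crd[OF l])
  qed
  then show ?thesis by blast
qed

lemma form3_Dn: assumes "form3 \<eta>" shows "\<exists>n. \<forall>u v w. \<eta> u v w \<in> Dn n"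
proof -
  have 1: "vlin (\<lambda>u. \<eta> u v w)" and 2: "vlin (\<lambda>v. \<eta> u v w)" and 3: "vlin (\<lambda>w. \<eta> u v w)" for u v w
    using assms unfolding form3_def by blast+
  obtain n where n: "\<forall>x\<in>Bs \<times> Bs \<times> Bs. \<eta> (fst x) (fst (snd x)) (snd (snd x)) \<in> Dn n"
    using finite_Dn[of "Bs \<times> Bs \<times> Bs" "\<lambda>x. \<eta> (fst x) (fst (snd x)) (snd (snd x))"] vlinD(3)[OF 1] finite_Basis by auto
  have "\<eta> u v w \<in> Dn n" for u v w
  proof -
    have "(\<Sum>b\<in>Bs. pconst (crd u b) * (\<Sum>b'\<in>Bs. pconst (crd v b') * (\<Sum>b''\<in>Bs. pconst (crd w b'') * \<eta> b b' b''))) \<in> Dn n"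
      by (intro Dn_sum Dn_pconst) (use n in auto)
    then show ?thesis by (simp add: vlin_crd[OF 3] vlin_crd[OF 2] vlin_crd[OF 1])
  qed
  then show ?thesis by blast
qed

lemma prod_list_zero: "k \<in> set ks \<Longrightarrow> (\<Prod>j\<leftarrow>ks. k - j) = (0::complex)"
  by (induction ks) auto

lemma prod_list_neg_nonzero: "0 \<notin> set ks \<Longrightarrow> prod_list (map uminus ks) \<noteq> (0::complex)"
  by (induction ks) auto

definition specl :: "nat \<Rightarrow> complex list" where "specl n = map of_nat [1..<Suc n]"

lemma specl: "0 \<notin> set (specl n)" "1 \<le> i \<Longrightarrow> i \<le> n \<Longrightarrow> of_nat i \<in> set (specl n)"
  by (auto simp: specl_def)

text \<open>A coefficient with Euler eigenvalue \<open>i\<close>, at \<open>a\<close> arguments in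
  \<open>W\<close>, has Laplacian eigenvalue \<open>i + m - a\<close>; by \<open>a \<le> m\<close>
  it lies between 0 and \<open>n + m\<close>. The roots \<open>1, ..., n + m\<close> thus remove
  everything except the eigenvalue 0, which means \<open>i = 0\<close> and
  \<open>a = m\<close>.\<close>

lemma opS_specl:
  assumes "s \<in> Dn n" "tr = of_nat m" "a \<le> m \<or> s = 0"
  shows "opS (tr - of_nat a) (specl (n + m)) s \<in> Ev 0 \<and> (a \<noteq> m \<longrightarrow> opS (tr - of_nat a) (specl (n + m)) s = 0)"
proof (cases "s = 0")
  case True
  then show ?thesis by (simp add: Ev_lin)
next
  case False
  then have am: "a \<le> m" using assms by auto
  obtain f where f: "s = (\<Sum>i\<le>n. f i)" "\<And>i. f i \<in> Ev i" using assms unfolding Dn_def by blast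
  have z: "opS (tr - of_nat a) (specl (n + m)) (f i) = 0" if "i \<le> n" "i + m \<noteq> a" for i
  proof -
    have "of_nat (i + m - a) \<in> set (specl (n + m))"
      by (rule specl(2)) (use that am in auto)
    moreover have "of_nat i + (tr - of_nat a) = (of_nat (i + m - a) :: complex)"
      using am assms(2) by (simp add: of_nat_diff)
    ultimately show ?thesis
      using opS_Ev[OF f(2)] prod_list_zero[of "of_nat (i + m - a)" "specl (n + m)"] by simp
  qed
  have "opS (tr - of_nat a) (specl (n + m)) s = (\<Sum>i\<le>n. if i = 0 then opS (tr - of_nat a) (specl (n + m)) (f 0) else 0)"
    unfolding f(1) opS_sum by (rule sum.cong) (use z am in auto)
  also have "\<dots> = opS (tr - of_nat a) (specl (n + m)) (f 0)" by simp
  finally have e: "opS (tr - of_nat a) (specl (n + m)) s = opS (tr - of_nat a) (specl (n + m)) (f 0)" .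
  show ?thesis
    unfolding e using z[of 0] opS_Ev[OF f(2), of _ _ 0] Ev_lin(2)[OF f(2)] by auto
qed

lemma vlin_th: "vlin F \<Longrightarrow> vlin (\<lambda>v. th L (F v))"
  by (simp add: vlin_def th_add th_mult)

lemma vlin_pure: assumes "vlin F" shows "F u = F (P u) + F (u - P u)"
  using vlinD(1)[OF assms, of "P u" "u - P u"] by simp

lemma bilinear_pure_zero:
  assumes "\<And>v. vlin (\<lambda>u. F u v)" "\<And>u. vlin (F u)"
    and z: "\<And>u v a c. wt u a \<Longrightarrow> wt v c \<Longrightarrow> F u v = 0"
  shows "F u v = 0"
  using vlin_pure[OF assms(1), of u v] vlin_pure[OF assms(2), of "P u" v] vlin_pure[OF assms(2), of "u - P u" v]
    z[OF wt_P(1) wt_P(1), of u v] z[OF wt_P(1) wt_P(2), of u v] z[OF wt_P(2) wt_P(1), of u v] z[OF wt_P(2) wt_P(2), of u v]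
  by simp

text \<open>The harmonic form is \<open>opl2\<close> with the roots \<open>1, ..., n + m\<close>,
  divided by the scalar \<open>c0\<close> with which this operator acts on cohomology. The
  hypothesis \<open>one\<close> excludes two arguments in a one-dimensional \<open>W\<close>: they
  could produce the eigenvalue -1, which is not among the roots.\<close>

theorem harmonic2:
  assumes f: "form2 \<omega>" and c: "closed2 \<omega>" and m: "tr = of_nat m" "m \<ge> 1"
    and one: "\<And>u v. m = 1 \<Longrightarrow> \<omega> (u - P u) (v - P v) = 0"
  shows "\<exists>\<omega>'. form2 \<omega>' \<and> exact2 (\<lambda>u v. \<omega>' u v - \<omega> u v) \<and>
    (\<forall>u v. th P (\<omega>' u v) = \<omega>' u v \<and> \<omega>' (u - P u) v + \<omega>' u (v - P v) = of_nat m * \<omega>' u v)"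
proof -
  obtain n where n: "\<And>u v. \<omega> u v \<in> Dn n" using form2_Dn[OF f] by blast
  define ks where "ks = specl (n + m)"
  define c0 where "c0 = prod_list (map uminus ks)"
  have c0: "c0 \<noteq> 0" unfolding c0_def ks_def by (rule prod_list_neg_nonzero[OF specl(1)])
  define \<omega>' where "\<omega>' u v = pconst (1 / c0) * opl2 ks \<omega> u v" for u v
  have f': "form2 \<omega>'"
    unfolding \<omega>'_def[abs_def] by (intro form2_mult) (use opl2_exact[OF f c] in blast)
  have "exact2 (\<lambda>u v. pconst (1 / c0) * (opl2 ks \<omega> u v - pconst c0 * \<omega> u v))"
    unfolding c0_def by (intro exact2_mult) (use opl2_exact[OF f c] in blast)
  moreover have "pconst (1 / c0) * (opl2 ks \<omega> u v - pconst c0 * \<omega> u v) = \<omega>' u v - \<omega> u v" for u v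
    using pconst_cancel[OF c0, of "\<omega> u v"] by (simp add: \<omega>'_def right_diff_distrib mult.left_commute)
  ultimately have ex: "exact2 (\<lambda>u v. \<omega>' u v - \<omega> u v)" by simp
  have l: "vlin (\<lambda>u. \<omega>' u v)" and r: "vlin (\<omega>' u)" for u v
    using f' unfolding form2_def by blast+
  have pure: "\<omega>' u v \<in> Ev 0 \<and> (a + e \<noteq> m \<longrightarrow> \<omega>' u v = 0)" if w: "wt u a" "wt v e" for u v a e
  proof -
    have "a + e \<le> m \<or> \<omega> u v = 0"
    proof (rule disjCI)
      assume "\<omega> u v \<noteq> 0"
      then have "\<not> (m = 1 \<and> a = 1 \<and> e = 1)" using w one[of u v] by (auto simp: wt_def)
      then show "a + e \<le> m" using w m(2) by (auto simp: wt_def)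
    qed
    from opS_specl[OF n m(1) this] show ?thesis
      unfolding \<omega>'_def using Ev_lin(2) opl2_opS[OF f w] by (auto simp: ks_def)
  qed
  have "th P (\<omega>' u v) - \<omega>' u v = 0" for u v
    by (rule bilinear_pure_zero[of "\<lambda>u v. th P (\<omega>' u v) - \<omega>' u v"])
      (use pure in \<open>auto intro!: vlin_lin vlin_th l r simp: Ev_def\<close>)
  moreover have "\<omega>' (u - P u) v + \<omega>' u (v - P v) - of_nat m * \<omega>' u v = 0" for u v
  proof (rule bilinear_pure_zero[of "\<lambda>u v. \<omega>' (u - P u) v + \<omega>' u (v - P v) - of_nat m * \<omega>' u v"])
    have [simp]: "of_nat m \<in> S" using S_pconst[of "of_nat m"] by (simp add: pconst_of_nat)
    show "vlin (\<lambda>u. \<omega>' (u - P u) v + \<omega>' u (v - P v) - of_nat m * \<omega>' u v)" for v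
      by (intro vlin_lin l vlin_W[of "\<lambda>u. \<omega>' u v"]) simp
    show "vlin (\<lambda>v. \<omega>' (u - P u) v + \<omega>' u (v - P v) - of_nat m * \<omega>' u v)" for u
      by (intro vlin_lin r vlin_W[of "\<omega>' u"]) simp
    show "\<omega>' (u - P u) v + \<omega>' u (v - P v) - of_nat m * \<omega>' u v = 0" if w: "wt u a" "wt v e" for u v a e
      using pure[OF w] wt_vlin[OF l w(1)] wt_vlin[OF r w(2)]
      by (cases "a + e = m") (auto simp: algebra_simps)
  qed
  ultimately show ?thesis using f' ex by auto
qed

text \<open>Three arguments have total weight at most 3, so for \<open>m \<ge> 4\<close> every
  eigenvalue is positive and the operator annihilates \<open>\<eta>\<close>. As it also equals the
  nonzero multiple \<open>c0\<close> of \<open>\<eta>\<close> modulo exact forms,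
  \<open>\<eta>\<close> is exact.\<close>

theorem exact3_of_codim:
  assumes f: "form3 \<eta>" and c: "closed3 \<eta>" and m: "tr = of_nat m" "m \<ge> 4"
  shows "exact3 \<eta>"
proof -
  obtain n where n: "\<And>u v w. \<eta> u v w \<in> Dn n" using form3_Dn[OF f] by blast
  define ks where "ks = specl (n + m)"
  define c0 where "c0 = prod_list (map uminus ks)"
  have c0: "c0 \<noteq> 0" unfolding c0_def ks_def by (rule prod_list_neg_nonzero[OF specl(1)])
  have f': "form3 (opl3 ks \<eta>)" using opl3_exact[OF f c] by blast
  have pure: "opl3 ks \<eta> u v w = 0" if w: "wt u a" "wt v d" "wt w e" for u v w a d e
  proof -
    have le: "a + d + e \<le> m" "a + d + e \<noteq> m" using w m(2) by (auto simp: wt_def)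
    then show ?thesis
      unfolding opl3_opS[OF f w] ks_def using opS_specl[OF n m(1)] by blast
  qed
  have z: "opl3 ks \<eta> u v w = 0" if "wt u a" for u v w a
    by (rule bilinear_pure_zero[of "opl3 ks \<eta> u"]) (auto intro: form3D[OF f'] pure that)
  have "opl3 ks \<eta> u v w = 0" for u v w
    using vlin_pure[OF form3D(1)[OF f'], of u v w] z[OF wt_P(1)] z[OF wt_P(2)] by simp
  then have "exact3 (\<lambda>u v w. - (pconst c0 * \<eta> u v w))"
    using opl3_exact[OF f c, of ks] by (simp add: c0_def)
  moreover have "pconst c0 * (pconst (1 / c0) * \<eta> u v w) = \<eta> u v w" for u v w
    by (rule pconst_cancel[OF c0])
  ultimately show ?thesis
    using exact3_mult[of "\<lambda>u v w. - (pconst c0 * \<eta> u v w)" "- 1 / c0"]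
    by (simp add: pconst_uminus mult.left_commute)
qed

end

section \<open>Fixed spaces of group elements\<close>

context fdvs
begin

lemma linI: "(\<And>u v. L (u + v) = L u + L v) \<Longrightarrow> (\<And>k v. L (scl k v) = scl k (L v)) \<Longrightarrow> lin L"
  by (simp add: Vector_Spaces.linear_iff vector_space_axioms)

lemma subspace_range_lin: "lin L \<Longrightarrow> subspace (range L)"
proof -
  assume "lin L"
  then interpret L: Vector_Spaces.linear scl scl L .
  show ?thesis by (rule L.subspace_image) (rule subspace_UNIV)
qed

lemma lin_compl: "lin L \<Longrightarrow> lin (\<lambda>v. v - L v)"
proof -
  assume "lin L"
  then interpret L: Vector_Spaces.linear scl scl L .
  show ?thesis by (rule linI) (simp_all add: L.add L.scale scale_right_diff_distrib)
qed

text \<open>Cyclicity of the trace: \<open>E\<close> factors through the coordinates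
  \<open>\<xi>\<close> with respect to a basis \<open>B\<close> of its range, and exchanging the two
  sums gives the trace of the identity on that range.\<close>

lemma trace_idempotent:
  assumes E: "lin E" and EE: "\<And>v. E (E v) = E v"
  shows "(\<Sum>b\<in>Bs. crd (E b) b) = of_nat (dim (range E))"
proof -
  interpret E: Vector_Spaces.linear scl scl E by fact
  obtain B where B: "B \<subseteq> range E" "independent B" "range E \<subseteq> span B" "card B = dim (range E)"
    using basis_exists by blast
  have finB: "finite B" by (rule finiteI_independent[OF B(2)])
  have sp: "E v \<in> span B" for v using B(3) by blast
  define \<xi> where "\<xi> v k = representation B (E v) k" for v k
  have Ev: "E v = (\<Sum>k\<in>B. scl (\<xi> v k) k)" for v
    unfolding \<xi>_def by (rule sum_representation_eq[symmetric]) (use B finB sp in auto)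
  have \<xi>a: "\<xi> (u + v) k = \<xi> u k + \<xi> v k" for u v k
    using representation_add[OF B(2) sp sp, of u v] by (simp add: \<xi>_def E.add)
  have \<xi>s: "\<xi> (scl c v) k = c * \<xi> v k" for c v k
    using representation_scale[OF B(2) sp, of c v] by (simp add: \<xi>_def E.scale)
  have \<xi>0: "\<xi> 0 k = 0" for k using \<xi>a[of 0 0 k] by simp
  have \<xi>sum: "\<xi> (sum f I) k = (\<Sum>i\<in>I. \<xi> (f i) k)" for f k and I :: "'v set"
    by (induction I rule: infinite_finite_induct) (simp_all add: \<xi>a \<xi>0)
  have \<xi>k: "\<xi> k k = 1" if "k \<in> B" for k
  proof -
    have "E k = k" using that B(1) EE by auto
    then show ?thesis using representation_basis[OF B(2) that] by (simp add: \<xi>_def)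
  qed
  have crd0: "crd 0 b = 0" for b using crd_add[of 0 0 b] by simp
  have crdsum: "crd (sum f I) b = (\<Sum>i\<in>I. crd (f i) b)" for f b and I :: "'v set"
    by (induction I rule: infinite_finite_induct) (simp_all add: crd_add crd0)
  have "(\<Sum>b\<in>Bs. crd (E b) b) = (\<Sum>b\<in>Bs. \<Sum>k\<in>B. crd k b * \<xi> b k)"
    by (subst Ev) (simp add: crdsum crd_scl mult.commute)
  also have "\<dots> = (\<Sum>k\<in>B. \<xi> (\<Sum>b\<in>Bs. scl (crd k b) b) k)"
    by (subst sum.swap) (simp add: \<xi>sum \<xi>s)
  also have "\<dots> = of_nat (card B)" by (simp add: crd_expand \<xi>k)
  finally show ?thesis using B(4) by simp
qed

lemma dim1_multiple:
  assumes U: "dim U = 1" "u \<in> U" "v \<in> U" and u: "u \<noteq> 0"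
  shows "\<exists>k. v = scl k u"
proof -
  have "independent {u}" using u by (simp add: independent_insert dependent_def)
  then have "U \<subseteq> span {u}" using card_ge_dim_independent[of "{u}" U] U by auto
  then show ?thesis using U(3) by (auto simp: span_singleton)
qed

text \<open>The case distinction for alternating forms on a plane: in the first two cases the form
  vanishes on \<open>u\<close>, \<open>v\<close>, in the third the two vectors reach the whole
  plane.\<close>

lemma dim2_cases:
  assumes U: "dim U = 2" "u \<in> U" "v \<in> U"
  obtains "u = 0" | k where "v = scl k u" | "\<And>w. w \<in> U \<Longrightarrow> \<exists>k l. w = scl k u + scl l v"
proof (cases "u = 0 \<or> v \<in> span {u}")
  case True
  then show ?thesis using that by (auto simp: span_singleton)
next
  case False
  have "u \<notin> span {v}"
  proof
    assume "u \<in> span {v}"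
    then obtain k where k: "u = scl k v" by (auto simp: span_singleton)
    with False have "k \<noteq> 0" by auto
    then have "v = scl (inverse k) u" by (simp add: k)
    then show False using False by (auto simp: span_singleton)
  qed
  moreover have "v \<noteq> 0" using False span_zero by auto
  then have "independent {v}" by (simp add: independent_insert dependent_def)
  moreover have "u \<noteq> v" using False span_base by auto
  ultimately have "independent {u, v}" "card {u, v} = 2" by (auto simp: independent_insert)
  then have "U \<subseteq> span {u, v}" using card_ge_dim_independent[of "{u, v}" U] U by auto
  moreover have "\<exists>k l. w = scl k u + scl l v" if w: "w \<in> span {u, v}" for w
  proof -
    obtain k where "w - scl k u \<in> span {v}" using span_breakdown_eq[of w u "{v}"] w by auto
    then obtain l where "w - scl k u = scl l v" by (auto simp: span_singleton)
    then have "w = scl k u + scl l v" by (simp add: algebra_simps)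
    then show ?thesis by blast
  qed
  ultimately show ?thesis using that(3) by blast
qed

end

locale skew = group G + fdvs scl Bs for G :: "('g, 'm) monoid_scheme" (structure)
    and scl :: "complex \<Rightarrow> 'v::ab_group_add \<Rightarrow> 'v" and Bs :: "'v set" +
  fixes \<rho> :: "'g \<Rightarrow> 'v \<Rightarrow> 'v"
  assumes fin: "finite (carrier G)" and rho_lin: "\<And>g. g \<in> carrier G \<Longrightarrow> lin (\<rho> g)"
    and rho_mult: "\<And>g h v. g \<in> carrier G \<Longrightarrow> h \<in> carrier G \<Longrightarrow> \<rho> (g \<otimes> h) v = \<rho> g (\<rho> h v)"
    and rho_one: "\<And>v. \<rho> \<one> v = v"
begin

abbreviation CG :: "'g set" where "CG \<equiv> carrier G"

lemma card_pos: "card CG > 0" using fin one_closed by (auto simp: card_gt_0_iff)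

lemma rhoD:
  assumes "g \<in> CG"
  shows "\<rho> g (u + v) = \<rho> g u + \<rho> g v" "\<rho> g (u - v) = \<rho> g u - \<rho> g v" "\<rho> g (scl k u) = scl k (\<rho> g u)"
    "\<rho> g (sum f I) = (\<Sum>i\<in>I. \<rho> g (f i))" "\<rho> g 0 = 0"
proof -
  interpret L: Vector_Spaces.linear scl scl "\<rho> g" by (rule rho_lin[OF assms])
  show "\<rho> g (u + v) = \<rho> g u + \<rho> g v" "\<rho> g (u - v) = \<rho> g u - \<rho> g v" "\<rho> g (scl k u) = scl k (\<rho> g u)"
    "\<rho> g (sum f I) = (\<Sum>i\<in>I. \<rho> g (f i))" "\<rho> g 0 = 0"
    by (simp_all add: L.add L.diff L.scale L.sum L.zero)
qed

lemma rho_inv [simp]: "g \<in> CG \<Longrightarrow> \<rho> (inv g) (\<rho> g v) = v" "g \<in> CG \<Longrightarrow> \<rho> g (\<rho> (inv g) v) = v"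
  by (simp_all add: rho_mult[symmetric] rho_one)

text \<open>The mean runs over as many powers as the group has elements, a multiple of the order of
  \<open>g\<close>. This gives the projection onto the fixed space with the same denominator for all
  \<open>g\<close>.\<close>

definition fixp :: "'g \<Rightarrow> 'v \<Rightarrow> 'v" where
  "fixp g v = scl (1 / of_nat (card CG)) (\<Sum>i<card CG. \<rho> (g [^] i) v)"

text \<open>By telescoping, \<open>1 - g\<close> times the inner sum is \<open>1 - g^i\<close>, and
  the mean over \<open>i\<close> of these is \<open>1 - fixp g\<close>. So \<open>resolv g\<close>
  inverts \<open>1 - g\<close> on its image and plays the part of \<open>Q\<close>.\<close>

definition resolv :: "'g \<Rightarrow> 'v \<Rightarrow> 'v" where
  "resolv g v = scl (1 / of_nat (card CG)) (\<Sum>i<card CG. \<Sum>j<i. \<rho> (g [^] j) v)"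

abbreviation moved :: "'g \<Rightarrow> 'v set" where "moved g \<equiv> range (\<lambda>v. v - \<rho> g v)"

abbreviation codim :: "'g \<Rightarrow> nat" where "codim g \<equiv> dim (moved g)"

lemma scl_card: "scl (1 / of_nat (card CG)) (\<Sum>i<card CG. v) = v"
proof -
  have "(\<Sum>i<n. v) = scl (of_nat n) v" for n :: nat
    by (induction n) (simp_all add: scale_left_distrib add.commute)
  then show ?thesis using card_pos by simp
qed

lemma telescope: "(\<Sum>j<i. \<rho> (g [^] j) v - \<rho> (g [^] Suc j) v) = v - \<rho> (g [^] i) v"
  using sum_lessThan_telescope'[of "\<lambda>j. \<rho> (g [^] j) v" i] by (simp only: nat_pow_0 rho_one)

lemma resolv_rho: assumes "g \<in> CG" shows "resolv g (v - \<rho> g v) = v - fixp g v"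
proof -
  have "\<rho> (g [^] j) (v - \<rho> g v) = \<rho> (g [^] j) v - \<rho> (g [^] Suc j) v" for j :: nat
    using assms by (simp add: rhoD rho_mult)
  then show ?thesis
    by (simp only: resolv_def telescope) (simp add: sum_subtractf scale_right_diff_distrib scl_card fixp_def)
qed

lemma rho_pow_commute: assumes "g \<in> CG" shows "\<rho> g (\<rho> (g [^] (j::nat)) v) = \<rho> (g [^] j) (\<rho> g v)"
proof -
  have "g \<otimes> g [^] j = g [^] j \<otimes> g" using assms by (metis nat_pow_Suc nat_pow_Suc2)
  then show ?thesis using assms by (simp add: rho_mult[symmetric])
qed

lemma rho_resolv: assumes "g \<in> CG" shows "resolv g v - \<rho> g (resolv g v) = v - fixp g v"
proof -
  have "\<rho> g (resolv g v) = resolv g (\<rho> g v)"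
    using assms by (simp add: resolv_def rhoD rho_pow_commute)
  moreover have "resolv g (v - \<rho> g v) = resolv g v - resolv g (\<rho> g v)"
    using assms by (simp add: resolv_def rhoD sum_subtractf scale_right_diff_distrib)
  ultimately show ?thesis using resolv_rho[OF assms, of v] by simp
qed

lemma rho_fixp: assumes "g \<in> CG" shows "\<rho> g (fixp g v) = fixp g v"
proof -
  have "(\<Sum>i<card CG. \<rho> (g [^] Suc i) v) = (\<Sum>i<card CG. \<rho> (g [^] i) v)"
  proof -
    have "(\<Sum>i<card CG. \<rho> (g [^] i) v) - (\<Sum>i<card CG. \<rho> (g [^] Suc i) v) = v - \<rho> (g [^] card CG) v"
      using telescope by (simp only: sum_subtractf[symmetric])
    also have "\<dots> = 0" using pow_order_eq_1[OF assms] by (simp add: order_def rho_one)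
    finally show ?thesis by simp
  qed
  moreover have "\<rho> g (\<rho> (g [^] i) v) = \<rho> (g [^] Suc i) v" for i :: nat
    using assms by (simp add: rho_pow_commute rho_mult)
  ultimately show ?thesis using assms by (simp add: fixp_def rhoD)
qed

lemma fixp_fixed: assumes "g \<in> CG" "\<rho> g v = v" shows "fixp g v = v"
proof -
  have "\<rho> (g [^] i) v = v" for i :: nat
    by (induction i) (use assms in \<open>simp_all add: rho_one rho_mult\<close>)
  then show ?thesis by (simp add: fixp_def scl_card)
qed

lemma fixp_lin: "g \<in> CG \<Longrightarrow> lin (fixp g)"
  by (rule linI) (simp_all add: fixp_def rhoD sum.distrib scale_right_distrib scale_sum_right mult.commute)

lemma resolv_lin: "g \<in> CG \<Longrightarrow> lin (resolv g)"
  by (rule linI) (simp_all add: resolv_def rhoD sum.distrib scale_right_distrib scale_sum_right mult.commute)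

lemma koszul: "g \<in> CG \<Longrightarrow> koszul scl Bs (\<rho> g) (fixp g) (resolv g)"
  by (intro koszul.intro koszul_axioms.intro fdvs_axioms rho_lin fixp_lin resolv_lin resolv_rho
      rho_resolv fixp_fixed rho_fixp)

lemma range_fixp: assumes "g \<in> CG" shows "range (\<lambda>v. v - fixp g v) = moved g"
proof -
  interpret P: Vector_Spaces.linear scl scl "fixp g" by (rule fixp_lin[OF assms])
  have "v - fixp g v \<in> moved g" for v using rho_resolv[OF assms, of v] by (metis rangeI)
  moreover have "v - \<rho> g v = (v - \<rho> g v) - fixp g (v - \<rho> g v)" for v
  proof -
    have "fixp g (v - \<rho> g v) = fixp g v - \<rho> g (fixp g v)"
      using assms by (simp add: P.diff) (simp add: fixp_def rhoD rho_pow_commute)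
    then show ?thesis by (simp add: rho_fixp[OF assms])
  qed
  ultimately show ?thesis by blast
qed

lemma trace_codim: assumes "g \<in> CG" shows "koszul.tr scl Bs (fixp g) = of_nat (codim g)"
proof -
  interpret P: Vector_Spaces.linear scl scl "fixp g" by (rule fixp_lin[OF assms])
  show ?thesis
    unfolding koszul.tr_def[OF koszul[OF assms]] range_fixp[OF assms, symmetric]
    by (rule trace_idempotent[of "\<lambda>v. v - fixp g v", OF lin_compl[OF fixp_lin[OF assms]]])
      (simp add: P.diff fixp_fixed[OF assms rho_fixp[OF assms]])
qed

lemma subspace_moved: "g \<in> CG \<Longrightarrow> subspace (moved g)"
  by (intro subspace_range_lin lin_compl rho_lin)

lemma codim_conj: assumes "g \<in> CG" "x \<in> CG" shows "codim (x \<otimes> g \<otimes> inv x) = codim g"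
proof -
  have le: "codim (x \<otimes> g \<otimes> inv x) \<le> codim g" if "g \<in> CG" "x \<in> CG" for g x
  proof -
    interpret L: Vector_Spaces.linear scl scl "\<rho> x" by (rule rho_lin[OF that(2)])
    have "v - \<rho> (x \<otimes> g \<otimes> inv x) v = \<rho> x (\<rho> (inv x) v - \<rho> g (\<rho> (inv x) v))" for v
      using that by (simp add: rho_mult rhoD)
    then have "moved (x \<otimes> g \<otimes> inv x) \<subseteq> \<rho> x ` moved g" by auto
    obtain B where B: "B \<subseteq> moved g" "independent B" "moved g \<subseteq> span B" "card B = codim g"
      using basis_exists by blast
    have fB: "finite B" by (rule finiteI_independent[OF B(2)])
    have "moved (x \<otimes> g \<otimes> inv x) \<subseteq> span (\<rho> x ` B)"
      using \<open>moved (x \<otimes> g \<otimes> inv x) \<subseteq> \<rho> x ` moved g\<close> B(3) L.span_image by blast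
    then have "codim (x \<otimes> g \<otimes> inv x) \<le> card (\<rho> x ` B)" by (intro dim_le_card) (use fB in auto)
    then show ?thesis using card_image_le[OF fB, of "\<rho> x"] B(4) by simp
  qed
  have "inv x \<otimes> (x \<otimes> g \<otimes> inv x) \<otimes> inv (inv x) = g"
    using assms by (simp add: m_assoc) (simp add: m_assoc[symmetric])
  then show ?thesis using le[OF assms] le[of "x \<otimes> g \<otimes> inv x" "inv x"] assms by simp
qed

section \<open>An invariant Hermitian form and the additivity of codimensions\<close>

definition herm :: "'v \<Rightarrow> 'v \<Rightarrow> complex" where
  "herm u v = (\<Sum>x\<in>CG. \<Sum>b\<in>Bs. crd (\<rho> x u) b * cnj (crd (\<rho> x v) b))"

lemma crd_diff: "crd (u - v) b = crd u b - crd v b"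
  using crd_add[of "u - v" v b] by simp

lemma herm_diff: "herm (u - v) w = herm u w - herm v w"
  by (simp add: herm_def rhoD crd_diff sum_subtractf left_diff_distrib)

lemma herm_add: "herm w (u + v) = herm w u + herm w v"
  by (simp add: herm_def rhoD crd_add sum.distrib distrib_left)

lemma bij_right_mult: "g \<in> CG \<Longrightarrow> bij_betw (\<lambda>x. x \<otimes> g) CG CG"
  by (rule bij_betw_byWitness[where f' = "\<lambda>x. x \<otimes> inv g"]) (auto simp: m_assoc)

lemma bij_left_mult: "g \<in> CG \<Longrightarrow> bij_betw (\<lambda>x. g \<otimes> x) CG CG"
  by (rule bij_betw_byWitness[where f' = "\<lambda>x. inv g \<otimes> x"]) (auto simp: m_assoc[symmetric])

lemma herm_rho: assumes "g \<in> CG" shows "herm (\<rho> g u) (\<rho> g v) = herm u v"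
  unfolding herm_def
  using sum.reindex_bij_betw[OF bij_right_mult[OF assms], of "\<lambda>x. \<Sum>b\<in>Bs. crd (\<rho> x u) b * cnj (crd (\<rho> x v) b)"] assms
  by (simp add: rho_mult cong: sum.cong)

lemma herm_zero: assumes "herm v v = 0" shows "v = 0"
proof -
  have "herm v v = of_real (\<Sum>x\<in>CG. \<Sum>b\<in>Bs. (cmod (crd (\<rho> x v) b))\<^sup>2)"
    by (simp only: herm_def of_real_sum complex_norm_square)
  then have "(\<Sum>x\<in>CG. \<Sum>b\<in>Bs. (cmod (crd (\<rho> x v) b))\<^sup>2) = 0" using assms by (metis of_real_eq_0_iff)
  then have "\<forall>x\<in>CG. (\<Sum>b\<in>Bs. (cmod (crd (\<rho> x v) b))\<^sup>2) = 0"
    using fin by (subst (asm) sum_nonneg_eq_0_iff) (auto intro: sum_nonneg)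
  then have "(\<Sum>b\<in>Bs. (cmod (crd v b))\<^sup>2) = 0" by (metis one_closed rho_one)
  then have "\<forall>b\<in>Bs. crd v b = 0" using finite_Basis by (subst (asm) sum_nonneg_eq_0_iff) auto
  then have "(\<Sum>b\<in>Bs. scl (crd v b) b) = 0" by simp
  then show ?thesis by (simp add: crd_expand)
qed

text \<open>The invariant form makes the moved space of an element orthogonal to its fixed space. A
  vector moved by both \<open>g\<close> and \<open>h\<close> is therefore orthogonal to
  \<open>V\<^sup>g + V\<^sup>h = V\<close> and vanishes, while the decomposition of vectors shows
  that the two moved spaces add up to that of the product.\<close>

lemma codim_mult:
  assumes g: "g \<in> CG" and h: "h \<in> CG" and dec: "\<And>v. \<exists>a b. v = a + b \<and> \<rho> g a = a \<and> \<rho> h b = b"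
  shows "codim (g \<otimes> h) = codim g + codim h"
proof -
  have perp: "herm u a = 0" if "u \<in> moved k" "\<rho> k a = a" "k \<in> CG" for u a k
    using that herm_rho[of k _ a] by (auto simp: herm_diff)
  have "u = 0" if u: "u \<in> moved g" "u \<in> moved h" for u
  proof -
    obtain a b where "u = a + b" "\<rho> g a = a" "\<rho> h b = b" using dec by blast
    then have "herm u u = 0" using perp[OF u(1) _ g, of a] perp[OF u(2) _ h, of b] herm_add[of u a b] by simp
    then show ?thesis by (rule herm_zero)
  qed
  then have int: "moved g \<inter> moved h \<subseteq> {0}" by blast
  have inv_fix: "\<rho> (inv k) a = a" if "\<rho> k a = a" "k \<in> CG" for k a
    using rho_inv(1)[OF that(2), of a] that(1) by simp
  have eq: "moved (g \<otimes> h) = {x + y |x y. x \<in> moved g \<and> y \<in> moved h}" (is "_ = ?R")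
  proof
    have "v - \<rho> (g \<otimes> h) v = (\<rho> h v - \<rho> g (\<rho> h v)) + (v - \<rho> h v)" for v
      using g h by (simp add: rho_mult)
    then show "moved (g \<otimes> h) \<subseteq> ?R" by blast
    have sub: "subspace (moved (g \<otimes> h))" using g h by (intro subspace_moved) simp
    \<comment> \<open>With \<open>v = a + b\<close> one has
      \<open>v - g v = b - g b = b - g h b\<close>, as \<open>b\<close> is fixed by
      \<open>h\<close>.\<close>
    have 1: "v - \<rho> g v \<in> moved (g \<otimes> h)" for v
    proof -
      obtain a b where "v = a + b" "\<rho> g a = a" "\<rho> h b = b" using dec by blast
      then have "v - \<rho> g v = b - \<rho> (g \<otimes> h) b" using g h by (simp add: rhoD rho_mult)
      then show ?thesis by blast
    qed
    \<comment> \<open>Here \<open>h v\<close> is decomposed instead of \<open>v\<close>. From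
      \<open>h v = a + b\<close> follows \<open>v - h v = h\<^sup>-\<^sup>1 a - a\<close>, and
      \<open>g h\<close> maps \<open>h\<^sup>-\<^sup>1 a\<close> to \<open>a\<close>.\<close>
    have 2: "v - \<rho> h v \<in> moved (g \<otimes> h)" for v
    proof -
      obtain a b where ab: "\<rho> h v = a + b" "\<rho> g a = a" "\<rho> h b = b" using dec by blast
      have v: "v = \<rho> (inv h) a + b"
        using rho_inv(1)[OF h, of v] inv_fix[OF ab(3) h] h by (simp add: ab(1) rhoD)
      have "\<rho> (g \<otimes> h) (\<rho> (inv h) a) = a" using g h ab(2) by (simp add: rho_mult)
      then have "v - \<rho> h v = \<rho> (inv h) a - \<rho> (g \<otimes> h) (\<rho> (inv h) a)"
        using v ab(1) by (metis add_diff_cancel_right)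
      then show ?thesis by blast
    qed
    show "?R \<subseteq> moved (g \<otimes> h)" using 1 2 subspace_add[OF sub] by auto
  qed
  have "dim (moved g \<inter> moved h) = 0" using int dim_eq_0 by blast
  then show ?thesis
    unfolding eq using dim_sums_Int[OF subspace_moved[OF g] subspace_moved[OF h]] by linarith
qed

lemma codim_0: assumes "codim g = 0" shows "\<rho> g v = v"
proof -
  have "moved g \<subseteq> {0}" using assms by (simp only: dim_eq_0)
  then have "v - \<rho> g v \<in> {0}" by (rule subsetD) (rule rangeI)
  then show ?thesis by simp
qed

end

section \<open>Group components of two-cocycles\<close>

context skew
begin

abbreviation \<theta> :: "'g \<Rightarrow> 'v cpoly \<Rightarrow> 'v cpoly" where "\<theta> g \<equiv> th (\<rho> g)"

lemma theta_mult: "g \<in> CG \<Longrightarrow> h \<in> CG \<Longrightarrow> \<theta> g (\<theta> h s) = \<theta> (g \<otimes> h) s"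
proof -
  assume gh: "g \<in> CG" "h \<in> CG"
  then have "\<rho> (g \<otimes> h) = \<rho> g \<circ> \<rho> h" by (simp add: fun_eq_iff rho_mult)
  then show ?thesis using th_comp[OF rho_lin[OF gh(1)]] by simp
qed

lemma theta_one: "s \<in> S \<Longrightarrow> \<theta> \<one> s = s"
  by (rule th_id) (simp_all add: rho_one)

lemma th_pj: "lin L \<Longrightarrow> th L (th id s) = th L s"
  using th_comp[of L id s] by simp

lemma pj_S' [simp]: "s \<in> S \<Longrightarrow> th id s = s" by (rule th_id) auto

abbreviation rmul :: "'g \<Rightarrow> 'v cpoly \<Rightarrow> 'v cpoly \<Rightarrow> 'v cpoly" where "rmul g \<equiv> \<lambda>m s. m * \<theta> g s"

abbreviation coc :: "'g \<Rightarrow> ('v cpoly \<Rightarrow> 'v cpoly \<Rightarrow> 'v cpoly) \<Rightarrow> bool" where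
  "coc g \<equiv> bim.cocyc Bs S (*) (rmul g)"

definition plin :: "('v cpoly \<Rightarrow> 'v cpoly) \<Rightarrow> bool" where
  "plin f \<longleftrightarrow> (\<forall>s t. f (s + t) = f s + f t) \<and> (\<forall>k s. f (pconst k * s) = pconst k * f s) \<and> (\<forall>s. f s \<in> S)"

text \<open>Linearity is one notion for all twists of the right action; the instance at
  \<open>id\<close> identifies it with \<open>plin\<close>, which is then shared by all
  components.\<close>

lemma mlin_plin: "bim.mlin S (*) = plin"
  by (simp add: fun_eq_iff plin_def bim.mlin_def[OF twisted_bim[of id]])

lemma plinD:
  assumes "plin f"
  shows "f (s + t) = f s + f t" "f (pconst k * s) = pconst k * f s" "f s \<in> S" "f 0 = 0" "f (- s) = - f s" "f (s - t) = f s - f t"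
    "f (sum F I) = (\<Sum>i\<in>I. f (F i))"
proof -
  show 1: "f (s + t) = f s + f t" "f (pconst k * s) = pconst k * f s" "f s \<in> S" for s t k
    using assms by (auto simp: plin_def)
  show 0: "f 0 = 0" using 1(1)[of 0 0] by simp
  show m: "f (- s) = - f s" for s using 1(1)[of s "- s"] by (simp add: 0 eq_neg_iff_add_eq_0 add.commute)
  show "f (s - t) = f s - f t" using 1(1)[of s "- t"] by (simp add: m)
  show "f (sum F I) = (\<Sum>i\<in>I. f (F i))"
    by (induction I rule: infinite_finite_induct) (simp_all add: 0 1)
qed

lemma coc_def: "coc g c \<longleftrightarrow> (\<forall>t. plin (\<lambda>s. c s t)) \<and> (\<forall>s. plin (c s)) \<and>
     (\<forall>s\<in>S. \<forall>t\<in>S. \<forall>u\<in>S. s * c t u - c (s * t) u + c s (t * u) - c s t * \<theta> g u = 0)"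
  by (simp add: bim.cocyc_def[OF twisted_bim] mlin_plin)

lemma cocD:
  assumes "coc g c"
  shows "plin (\<lambda>s. c s t)" "plin (c s)"
    "s \<in> S \<Longrightarrow> t \<in> S \<Longrightarrow> u \<in> S \<Longrightarrow> s * c t u - c (s * t) u + c s (t * u) - c s t * \<theta> g u = 0"
  using assms unfolding coc_def by blast+

abbreviation radial :: "('v cpoly \<Rightarrow> 'v cpoly \<Rightarrow> 'v cpoly) \<Rightarrow> bool" where
  "radial \<equiv> bim.normal Bs"

lemma radial_def: "radial c \<longleftrightarrow> (\<forall>s\<in>S. c 1 s = 0 \<and> c s 1 = 0 \<and> (\<Sum>i\<in>Bs. c (pd i s) (pvar i)) = 0)"
  by (rule bim.normal_def[OF twisted_bim])

abbreviation dcob :: "'g \<Rightarrow> ('v cpoly \<Rightarrow> 'v cpoly) \<Rightarrow> 'v cpoly \<Rightarrow> 'v cpoly \<Rightarrow> 'v cpoly" where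
  "dcob g \<equiv> bim.db (*) (rmul g)"

lemma dcob_def: "dcob g b s t = s * b t - b (s * t) + b s * \<theta> g t"
  by (rule bim.db_def[OF twisted_bim])

definition om :: "('v cpoly \<Rightarrow> 'v cpoly \<Rightarrow> 'v cpoly) \<Rightarrow> 'v \<Rightarrow> 'v \<Rightarrow> 'v cpoly" where
  "om c u v = c (emb u) (emb v) - c (emb v) (emb u)"

lemma asym_om: "i \<in> Bs \<Longrightarrow> j \<in> Bs \<Longrightarrow> bim.asym c i j = om c i j"
  by (simp add: bim.asym_def[OF twisted_bim[of id]] om_def emb_Bs)

definition vl :: "('v \<Rightarrow> 'v cpoly) \<Rightarrow> bool" where
  "vl F \<longleftrightarrow> (\<forall>u v. F (u + v) = F u + F v) \<and> (\<forall>k v. F (scl k v) = pconst k * F v) \<and> (\<forall>v. F v \<in> S)"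

text \<open>Linear and alternating forms are the same for every group element, so the Koszul
  instance at the identity speaks for all of them, and forms of different elements can be
  compared.\<close>

lemma vlin_vl: "koszul.vlin scl Bs = vl"
  using koszul[OF one_closed] by (simp add: fun_eq_iff vl_def koszul.vlin_def)

lemma om_vl: assumes "coc g c" shows "vl (\<lambda>u. om c u v)" "vl (om c u)"
  using plinD[OF cocD(1)[OF assms]] plinD[OF cocD(2)[OF assms]]
  by (simp_all add: vl_def om_def emb_add emb_scl add_diff_add right_diff_distrib)

lemma om_form2: "coc g c \<Longrightarrow> koszul.form2 scl Bs (om c)"
  unfolding koszul.form2_def[OF koszul[OF one_closed]] vlin_vl
  using om_vl by (auto simp: om_def)

lemma om_closed:
  assumes g: "g \<in> CG" and c: "coc g c"
  shows "koszul.closed2 scl Bs (\<rho> g) (om c)"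
proof -
  interpret K: koszul scl Bs "\<rho> g" "fixp g" "resolv g" by (rule koszul[OF g])
  interpret M: bim scl Bs S "(*)" "rmul g" by (rule twisted_bim)
  \<comment> \<open>Since \<open>S\<close> is commutative, the commutator action of a vector
    \<open>u\<close> on the bimodule twisted by \<open>g\<close> is multiplication by
    \<open>u - g u\<close>. This identifies the two Koszul differentials.\<close>
  have N: "M.dm (emb u) m = K.N u * m" for u m
    by (simp add: M.dm_def K.N_def th_emb[OF rho_lin[OF g]] emb_diff algebra_simps)
  have "K.N u * om c v w - K.N v * om c u w + K.N w * om c u v = 0" for u v w
    using M.asym_closed[OF c, of "emb u" "emb v" "emb w"] unfolding N by (simp add: om_def algebra_simps)
  then show ?thesis unfolding K.closed2_def by blast
qed

lemma vl_eqI: assumes "vl F" "vl F'" "\<And>b. b \<in> Bs \<Longrightarrow> F b = F' b" shows "F v = F' v"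
proof -
  interpret K: koszul scl Bs "\<rho> \<one>" "fixp \<one>" "resolv \<one>" by (rule koszul[OF one_closed])
  have "(\<Sum>b\<in>Bs. pconst (crd v b) * F b) = (\<Sum>b\<in>Bs. pconst (crd v b) * F' b)"
    by (rule sum.cong) (simp_all add: assms)
  then show ?thesis using K.vlin_crd[of F v] K.vlin_crd[of F' v] assms by (simp add: vlin_vl)
qed

text \<open>The two properties delivered by \<open>harmonic2\<close>. Both are equivariant under
  conjugation of \<open>g\<close>, and this is what averaging requires of them.\<close>

definition harm :: "'g \<Rightarrow> ('v \<Rightarrow> 'v \<Rightarrow> 'v cpoly) \<Rightarrow> bool" where
  "harm g \<omega> \<longleftrightarrow> (\<forall>u v. th (fixp g) (\<omega> u v) = \<omega> u v \<and>
     \<omega> (u - fixp g u) v + \<omega> u (v - fixp g v) = of_nat (codim g) * \<omega> u v)"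

definition pjinv :: "('v cpoly \<Rightarrow> 'v cpoly \<Rightarrow> 'v cpoly) \<Rightarrow> bool" where
  "pjinv c \<longleftrightarrow> (\<forall>s t. c (th id s) (th id t) = c s t)"

text \<open>The harmonic form differs from \<open>om c\<close> by the Koszul differential of some
  \<open>\<beta>\<close>, and \<open>normal_exists\<close> realises precisely this change by a
  coboundary while reaching radial gauge. Agreement on basis vectors extends to all vectors by
  linearity.\<close>

lemma normal_form:
  assumes g: "g \<in> CG" and c: "coc g c" and pj: "pjinv c" and nt: "\<exists>v. \<rho> g v \<noteq> v"
  shows "\<exists>b c'. plin b \<and> c' = (\<lambda>s t. c s t + dcob g b (th id s) (th id t)) \<and> coc g c' \<and> radial c' \<and> pjinv c' \<and> harm g (om c')"
proof -
  interpret K: koszul scl Bs "\<rho> g" "fixp g" "resolv g" by (rule koszul[OF g])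
  interpret M: bim scl Bs S "(*)" "rmul g" by (rule twisted_bim)
  have f: "K.form2 (om c)" by (rule om_form2[OF c])
  have m1: "codim g \<ge> 1"
    using nt codim_0[of g] by (metis less_one linorder_not_le)
  \<comment> \<open>An alternating form vanishes on a line; this settles the exceptional case of
    \<open>harmonic2\<close>.\<close>
  have one: "om c (u - fixp g u) (v - fixp g v) = 0" if "codim g = 1" for u v
  proof (cases "u - fixp g u = 0")
    case True
    show ?thesis unfolding True by (rule K.vlinD(4)[OF om_vl(1)[OF c, folded vlin_vl]])
  next
    case False
    have "u - fixp g u \<in> moved g" "v - fixp g v \<in> moved g" using range_fixp[OF g] by blast+
    from dim1_multiple[OF that this False] obtain k where k: "v - fixp g v = scl k (u - fixp g u)" by blast
    have "om c (u - fixp g u) (scl k (u - fixp g u)) = pconst k * om c (u - fixp g u) (u - fixp g u)"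
      using om_vl(2)[OF c] unfolding vl_def by blast
    then show ?thesis by (simp add: k om_def)
  qed
  obtain \<omega>' where w: "K.form2 \<omega>'" "K.exact2 (\<lambda>u v. \<omega>' u v - om c u v)"
    "\<forall>u v. th (fixp g) (\<omega>' u v) = \<omega>' u v \<and> \<omega>' (u - fixp g u) v + \<omega>' u (v - fixp g v) = of_nat (codim g) * \<omega>' u v"
    using K.harmonic2[OF f om_closed[OF g c] trace_codim[OF g] m1 one] by blast
  obtain \<beta> where \<beta>: "vl \<beta>" and e: "\<And>u v. \<omega>' u v - om c u v = K.N u * \<beta> v - K.N v * \<beta> u"
    using w(2) unfolding K.exact2_def vlin_vl by blast
  have "\<beta> i \<in> S" for i using \<beta> by (simp add: vl_def)
  from M.normal_exists[of c \<beta>, OF c this, unfolded mlin_plin]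
  obtain b c' where bc: "plin b \<and> c' = (\<lambda>s t. c s t + dcob g b (th id s) (th id t)) \<and> coc g c' \<and> radial c' \<and>
    (\<forall>i\<in>Bs. \<forall>j\<in>Bs. M.asym c' i j = M.asym c i j + pvar i * \<beta> j + \<beta> i * \<theta> g (pvar j) - pvar j * \<beta> i - \<beta> j * \<theta> g (pvar i))"
    by (elim exE) (rule that)
  note b = bc[THEN conjunct1] and c' = bc[THEN conjunct2, THEN conjunct1]
    bc[THEN conjunct2, THEN conjunct2, THEN conjunct1] bc[THEN conjunct2, THEN conjunct2, THEN conjunct2, THEN conjunct1]
    and a = bc[THEN conjunct2, THEN conjunct2, THEN conjunct2, THEN conjunct2]
  have eq: "om c' i j = \<omega>' i j" if ij: "i \<in> Bs" "j \<in> Bs" for i j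
  proof -
    have "om c' i j = om c i j + (K.N i * \<beta> j - K.N j * \<beta> i)"
      using a[rule_format, OF ij] asym_om[OF ij, of c] asym_om[OF ij, of c'] ij
      by (simp add: K.N_def emb_diff emb_Bs th_pvar algebra_simps)
    then show ?thesis by (simp only: e[symmetric]) simp
  qed
  have l: "vl (\<lambda>u. \<omega>' u v)" and r: "vl (\<omega>' u)" for u v
    using w(1) unfolding K.form2_def vlin_vl by blast+
  have eq1: "om c' i v = \<omega>' i v" if "i \<in> Bs" for i v
    by (rule vl_eqI[OF om_vl(2)[OF c'(2)] r eq[OF that]])
  have "om c' u v = \<omega>' u v" for u v
    by (rule vl_eqI[OF om_vl(1)[OF c'(2)] l eq1])
  then have "harm g (om c')" using w(3) by (simp add: harm_def)
  moreover have "pjinv c'" using pj by (simp add: pjinv_def c'(1))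
  ultimately show ?thesis using b c' by blast
qed

section \<open>Averaging a family of cocycles\<close>

definition avg :: "('g \<Rightarrow> 'v cpoly \<Rightarrow> 'v cpoly \<Rightarrow> 'v cpoly) \<Rightarrow> 'g \<Rightarrow> 'v cpoly \<Rightarrow> 'v cpoly \<Rightarrow> 'v cpoly" where
  "avg c g s t = pconst (1 / of_nat (card CG)) *
     (\<Sum>x\<in>CG. \<theta> x (c (inv x \<otimes> g \<otimes> x) (\<theta> (inv x) s) (\<theta> (inv x) t)))"

lemma plin_theta: "plin f \<Longrightarrow> plin (\<lambda>s. \<theta> x (f s))" "plin f \<Longrightarrow> plin (\<lambda>s. f (\<theta> x s))"
  by (simp_all add: plin_def th_add th_mult)

lemma plin_sum: "(\<And>i. i \<in> I \<Longrightarrow> plin (f i)) \<Longrightarrow> plin (\<lambda>s. \<Sum>i\<in>I. f i s)"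
  by (simp add: plin_def sum.distrib sum_distrib_left)

lemma plin_mult: "plin f \<Longrightarrow> t \<in> S \<Longrightarrow> plin (\<lambda>s. t * f s)"
  "plin f \<Longrightarrow> t \<in> S \<Longrightarrow> plin (\<lambda>s. f s * t)"
  by (simp_all add: plin_def distrib_left distrib_right mult.left_commute mult.assoc)

lemma theta_inv: assumes "x \<in> CG" shows "\<theta> x (\<theta> (inv x) s) = th id s" "\<theta> (inv x) (\<theta> x s) = th id s"
proof -
  have "\<rho> \<one> = id" by (simp add: fun_eq_iff rho_one)
  then show "\<theta> x (\<theta> (inv x) s) = th id s" "\<theta> (inv x) (\<theta> x s) = th id s"
    using assms by (simp_all add: theta_mult)
qed

lemma conj_closed [simp]: "x \<in> CG \<Longrightarrow> g \<in> CG \<Longrightarrow> inv x \<otimes> g \<otimes> x \<in> CG" by simp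

lemma avg_coc:
  assumes c: "\<And>g. g \<in> CG \<Longrightarrow> coc g (c g)" and g: "g \<in> CG"
  shows "coc g (avg c g)"
  unfolding coc_def
proof (intro conjI allI ballI)
  note cg = c[OF conj_closed[OF _ g]]
  have "plin (\<lambda>s. c (inv x \<otimes> g \<otimes> x) (\<theta> (inv x) s) t)" if "x \<in> CG" for x t
    using plin_theta(2)[OF cocD(1)[OF cg[OF that]]] .
  then show "plin (\<lambda>s. avg c g s t)" for t
    unfolding avg_def by (intro plin_mult plin_sum plin_theta(1)) auto
  show "plin (avg c g s)" for s
    unfolding avg_def[abs_def] by (intro plin_mult plin_sum plin_theta(1) plin_theta(2)[OF cocD(2)[OF cg]]) auto
  fix s t u assume S: "s \<in> S" "t \<in> S" "u \<in> S"
  have "\<theta> x (\<theta> (inv x) s * c (inv x \<otimes> g \<otimes> x) (\<theta> (inv x) t) (\<theta> (inv x) u)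
      - c (inv x \<otimes> g \<otimes> x) (\<theta> (inv x) s * \<theta> (inv x) t) (\<theta> (inv x) u)
      + c (inv x \<otimes> g \<otimes> x) (\<theta> (inv x) s) (\<theta> (inv x) t * \<theta> (inv x) u)
      - c (inv x \<otimes> g \<otimes> x) (\<theta> (inv x) s) (\<theta> (inv x) t) * \<theta> (inv x \<otimes> g \<otimes> x) (\<theta> (inv x) u)) = 0" if "x \<in> CG" for x
    using cocD(3)[OF cg[OF that], of "\<theta> (inv x) s" "\<theta> (inv x) t" "\<theta> (inv x) u"] by simp
  moreover have "\<theta> x (\<theta> (inv x \<otimes> g \<otimes> x) (\<theta> (inv x) u)) = \<theta> g u" if "x \<in> CG" for x
    using that g by (simp add: theta_mult m_assoc) (simp add: m_assoc[symmetric])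
  ultimately have e: "s * \<theta> x (c (inv x \<otimes> g \<otimes> x) (\<theta> (inv x) t) (\<theta> (inv x) u))
      - \<theta> x (c (inv x \<otimes> g \<otimes> x) (\<theta> (inv x) (s * t)) (\<theta> (inv x) u))
      + \<theta> x (c (inv x \<otimes> g \<otimes> x) (\<theta> (inv x) s) (\<theta> (inv x) (t * u)))
      - \<theta> x (c (inv x \<otimes> g \<otimes> x) (\<theta> (inv x) s) (\<theta> (inv x) t)) * \<theta> g u = 0" if "x \<in> CG" for x
    using that S by (simp add: th_add th_diff th_mult theta_inv)
  have "s * avg c g t u - avg c g (s * t) u + avg c g s (t * u) - avg c g s t * \<theta> g u =
    pconst (1 / of_nat (card CG)) * (\<Sum>x\<in>CG. s * \<theta> x (c (inv x \<otimes> g \<otimes> x) (\<theta> (inv x) t) (\<theta> (inv x) u))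
      - \<theta> x (c (inv x \<otimes> g \<otimes> x) (\<theta> (inv x) (s * t)) (\<theta> (inv x) u))
      + \<theta> x (c (inv x \<otimes> g \<otimes> x) (\<theta> (inv x) s) (\<theta> (inv x) (t * u)))
      - \<theta> x (c (inv x \<otimes> g \<otimes> x) (\<theta> (inv x) s) (\<theta> (inv x) t)) * \<theta> g u)"
    unfolding sum.distrib sum_subtractf sum_distrib_left[symmetric] sum_distrib_right[symmetric]
    by (simp add: avg_def right_diff_distrib distrib_left mult_ac)
  also have "\<dots> = 0" by (simp only: e sum.neutral_const mult_zero_right cong: sum.cong)
  finally show "s * avg c g t u - avg c g (s * t) u + avg c g s (t * u) - avg c g s t * \<theta> g u = 0" .
qed

lemma avg_invariant:
  assumes y: "y \<in> CG" and g: "g \<in> CG"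
  shows "\<theta> y (avg c g s t) = avg c (y \<otimes> g \<otimes> inv y) (\<theta> y s) (\<theta> y t)"
proof -
  have "(\<Sum>x\<in>CG. \<theta> x (c (inv x \<otimes> (y \<otimes> g \<otimes> inv y) \<otimes> x) (\<theta> (inv x) (\<theta> y s)) (\<theta> (inv x) (\<theta> y t)))) =
     (\<Sum>x\<in>CG. \<theta> (y \<otimes> x) (c (inv (y \<otimes> x) \<otimes> (y \<otimes> g \<otimes> inv y) \<otimes> (y \<otimes> x)) (\<theta> (inv (y \<otimes> x)) (\<theta> y s)) (\<theta> (inv (y \<otimes> x)) (\<theta> y t))))"
    by (rule sum.reindex_bij_betw[OF bij_left_mult[OF y], symmetric])
  also have "\<dots> = (\<Sum>x\<in>CG. \<theta> y (\<theta> x (c (inv x \<otimes> g \<otimes> x) (\<theta> (inv x) s) (\<theta> (inv x) t))))"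
  proof (rule sum.cong[OF refl])
    fix x assume x: "x \<in> CG"
    have 1: "inv (y \<otimes> x) \<otimes> (y \<otimes> g \<otimes> inv y) \<otimes> (y \<otimes> x) = inv x \<otimes> g \<otimes> x"
    proof -
      have "inv (y \<otimes> x) \<otimes> (y \<otimes> g \<otimes> inv y) \<otimes> (y \<otimes> x) = inv x \<otimes> ((inv y \<otimes> y) \<otimes> (g \<otimes> ((inv y \<otimes> y) \<otimes> x)))"
        using x y g by (simp only: inv_mult_group m_assoc m_closed inv_closed)
      then show ?thesis using x y g by (simp add: m_assoc)
    qed
    have 2: "inv (y \<otimes> x) \<otimes> y = inv x"
      using x y by (simp add: inv_mult_group m_assoc)
    show "\<theta> (y \<otimes> x) (c (inv (y \<otimes> x) \<otimes> (y \<otimes> g \<otimes> inv y) \<otimes> (y \<otimes> x)) (\<theta> (inv (y \<otimes> x)) (\<theta> y s)) (\<theta> (inv (y \<otimes> x)) (\<theta> y t)))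
        = \<theta> y (\<theta> x (c (inv x \<otimes> g \<otimes> x) (\<theta> (inv x) s) (\<theta> (inv x) t)))"
      using x y by (simp only: 1 theta_mult inv_closed m_closed 2)
  qed
  finally show ?thesis by (simp add: avg_def th_mult th_sum)
qed

text \<open>By \<open>pd_th\<close> a substitution can be moved across
  \<open>\<Sum>\<^sub>i \<partial>\<^sub>i \<otimes> x\<^sub>i\<close>, so each transported cocycle
  is radial even though the group does not preserve the basis.\<close>

lemma avg_radial:
  assumes c: "\<And>g. g \<in> CG \<Longrightarrow> coc g (c g)" "\<And>g. g \<in> CG \<Longrightarrow> radial (c g)" and g: "g \<in> CG"
  shows "radial (avg c g)"
  unfolding radial_def
proof (intro ballI conjI)
  fix s assume s: "s \<in> S"
  have r: "c (inv x \<otimes> g \<otimes> x) 1 t = 0" "c (inv x \<otimes> g \<otimes> x) t 1 = 0"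
    "(\<Sum>i\<in>Bs. c (inv x \<otimes> g \<otimes> x) (pd i t) (pvar i)) = 0" if "x \<in> CG" "t \<in> S" for x t
    using c(2)[OF conj_closed[OF that(1) g]] that(2) unfolding radial_def by blast+
  show "avg c g 1 s = 0" "avg c g s 1 = 0" by (simp_all add: avg_def r)
  have "(\<Sum>i\<in>Bs. c (inv x \<otimes> g \<otimes> x) (\<theta> (inv x) (pd i s)) (\<theta> (inv x) (pvar i))) = 0" if x: "x \<in> CG" for x
  proof -
    note p = plinD[OF cocD(1)[OF c(1)[OF conj_closed[OF x g]]]] plinD[OF cocD(2)[OF c(1)[OF conj_closed[OF x g]]]]
    have "(\<Sum>i\<in>Bs. c (inv x \<otimes> g \<otimes> x) (\<theta> (inv x) (pd i s)) (\<theta> (inv x) (pvar i))) =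
      (\<Sum>i\<in>Bs. c (inv x \<otimes> g \<otimes> x) (pd i (\<theta> (inv x) s)) (pvar i))"
      by (rule pd_th[OF rho_lin s, symmetric]) (simp_all add: x p)
    then show ?thesis using r(3)[OF x, of "\<theta> (inv x) s"] by simp
  qed
  then have "(\<Sum>x\<in>CG. \<theta> x (\<Sum>i\<in>Bs. c (inv x \<otimes> g \<otimes> x) (\<theta> (inv x) (pd i s)) (\<theta> (inv x) (pvar i)))) = 0"
    by simp
  then have "(\<Sum>i\<in>Bs. \<Sum>x\<in>CG. \<theta> x (c (inv x \<otimes> g \<otimes> x) (\<theta> (inv x) (pd i s)) (\<theta> (inv x) (pvar i)))) = 0"
    by (subst sum.swap) (simp add: th_sum)
  then show "(\<Sum>i\<in>Bs. avg c g (pd i s) (pvar i)) = 0"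
    by (simp add: avg_def sum_distrib_left[symmetric])
qed

lemma fixp_conj: assumes "x \<in> CG" "g \<in> CG"
  shows "fixp g (\<rho> x v) = \<rho> x (fixp (inv x \<otimes> g \<otimes> x) v)"
proof -
  have "\<rho> (g [^] i) (\<rho> x v) = \<rho> x (\<rho> ((inv x \<otimes> g \<otimes> x) [^] i) v)" for i :: nat
  proof (induction i arbitrary: v)
    case (Suc i)
    have "\<rho> (g [^] Suc i) (\<rho> x v) = \<rho> (g [^] i) (\<rho> x (\<rho> (inv x \<otimes> g \<otimes> x) v))"
      using assms by (simp add: rho_mult)
    also have "\<dots> = \<rho> x (\<rho> ((inv x \<otimes> g \<otimes> x) [^] i) (\<rho> (inv x \<otimes> g \<otimes> x) v))" by (rule Suc)
    also have "\<dots> = \<rho> x (\<rho> ((inv x \<otimes> g \<otimes> x) [^] Suc i) v)"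
      using assms rho_mult[of "(inv x \<otimes> g \<otimes> x) [^] i" "inv x \<otimes> g \<otimes> x" v] by simp
    finally show ?case .
  qed (simp add: rho_one)
  then show ?thesis using assms by (simp add: fixp_def rhoD)
qed

lemma om_avg:
  assumes "g \<in> CG"
  shows "om (avg c g) u v = pconst (1 / of_nat (card CG)) *
     (\<Sum>x\<in>CG. \<theta> x (om (c (inv x \<otimes> g \<otimes> x)) (\<rho> (inv x) u) (\<rho> (inv x) v)))"
  unfolding om_def avg_def right_diff_distrib[symmetric] sum_subtractf[symmetric]
  by (intro arg_cong2[where f = "(*)"] sum.cong refl) (simp add: th_emb rho_lin th_diff)

text \<open>Transport by \<open>x\<close> carries the fixed-space projection of
  \<open>x\<^sup>-\<^sup>1 g x\<close> to that of \<open>g\<close> and preserves the codimension, so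
  every summand is harmonic for \<open>g\<close>.\<close>

lemma avg_harm:
  assumes c: "\<And>g. g \<in> CG \<Longrightarrow> \<exists>v. \<rho> g v \<noteq> v \<Longrightarrow> harm g (om (c g))" and g: "g \<in> CG" and nt: "\<exists>v. \<rho> g v \<noteq> v"
  shows "harm g (om (avg c g))"
proof -
  have nt': "\<exists>v. \<rho> (inv x \<otimes> g \<otimes> x) v \<noteq> v" if x: "x \<in> CG" for x
  proof -
    obtain v where "\<rho> g v \<noteq> v" using nt by blast
    then have "\<rho> (inv x \<otimes> g \<otimes> x) (\<rho> (inv x) v) \<noteq> \<rho> (inv x) v"
      using x g by (simp add: rho_mult) (metis rho_inv(2))
    then show ?thesis by blast
  qed
  have cd: "codim (inv x \<otimes> g \<otimes> x) = codim g" if "x \<in> CG" for x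
    using codim_conj[OF g inv_closed[OF that]] that by simp
  note h = c[OF conj_closed[OF _ g] nt', unfolded harm_def cd, rule_format]
  have W: "\<rho> (inv x) (u - fixp g u) = \<rho> (inv x) u - fixp (inv x \<otimes> g \<otimes> x) (\<rho> (inv x) u)" if x: "x \<in> CG" for x u
    using fixp_conj[OF x g, of "\<rho> (inv x) u"] x by (simp add: rhoD)
  have t: "th (fixp g) (\<theta> x s) = \<theta> x (th (fixp (inv x \<otimes> g \<otimes> x)) s)" if x: "x \<in> CG" for x s
  proof -
    have "fixp g \<circ> \<rho> x = \<rho> x \<circ> fixp (inv x \<otimes> g \<otimes> x)" using fixp_conj[OF x g] by (simp add: fun_eq_iff)
    then show ?thesis using x g by (simp add: th_comp fixp_lin rho_lin)
  qed
  have t2: "th (fixp g) (om (avg c g) u v) = om (avg c g) u v" for u v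
    by (simp add: om_avg[OF g] th_mult th_sum t h)
  moreover have "om (avg c g) (u - fixp g u) v + om (avg c g) u (v - fixp g v) = of_nat (codim g) * om (avg c g) u v" for u v
  proof -
    have "(\<Sum>x\<in>CG. \<theta> x (om (c (inv x \<otimes> g \<otimes> x)) (\<rho> (inv x) (u - fixp g u)) (\<rho> (inv x) v)))
       + (\<Sum>x\<in>CG. \<theta> x (om (c (inv x \<otimes> g \<otimes> x)) (\<rho> (inv x) u) (\<rho> (inv x) (v - fixp g v))))
      = (\<Sum>x\<in>CG. \<theta> x (of_nat (codim g) * om (c (inv x \<otimes> g \<otimes> x)) (\<rho> (inv x) u) (\<rho> (inv x) v)))"
      unfolding sum.distrib[symmetric] by (intro sum.cong refl) (simp add: W th_add[symmetric] h cd)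
    also have "\<dots> = of_nat (codim g) * (\<Sum>x\<in>CG. \<theta> x (om (c (inv x \<otimes> g \<otimes> x)) (\<rho> (inv x) u) (\<rho> (inv x) v)))"
      by (simp add: th_mult pconst_of_nat[symmetric] sum_distrib_left)
    finally show ?thesis
      unfolding om_avg[OF g] distrib_left[symmetric] by (simp add: mult.left_commute)
  qed
  ultimately show ?thesis unfolding harm_def by blast
qed

text \<open>A harmonic form lives on arguments of total weight \<open>codim g\<close>, and two
  arguments have weight at most 2. In codimension 1 one argument is fixed and the other lies in the
  moved space. There invariance enters: the values are polynomials in fixed vectors, on which
  \<open>g\<close> acts trivially, so \<open>om c u (g w) = om c u w\<close> for fixed
  \<open>u\<close>, and the form vanishes on the image of \<open>1 - g\<close>.\<close>

lemma om_cases: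
  assumes g: "g \<in> CG" and c: "coc g c" and h: "harm g (om c)" and nt: "\<exists>v. \<rho> g v \<noteq> v"
    and inv: "\<And>s t. \<theta> g (c s t) = c (\<theta> g s) (\<theta> g t)"
  shows "(\<forall>u v. om c u v = 0) \<or> (codim g = 2 \<and> (\<forall>u v. \<rho> g u = u \<longrightarrow> om c u v = 0))"
proof -
  interpret K: koszul scl Bs "\<rho> g" "fixp g" "resolv g" by (rule koszul[OF g])
  note l = om_vl(1)[OF c, unfolded vlin_vl[symmetric]] and r = om_vl(2)[OF c, unfolded vlin_vl[symmetric]]
  have a: "om c u v = - om c v u" for u v by (simp add: om_def)
  have H: "(of_nat d + of_nat e) * om c u v = of_nat (codim g) * om c u v" if "K.wt u d" "K.wt v e" for u v d e
    using h[unfolded harm_def, rule_format, THEN conjunct2, of u v]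
    unfolding K.wt_vlin[OF l that(1)] K.wt_vlin[OF r that(2)] by (simp add: distrib_right)
  have canc: "m = 0" if "of_nat n * m = of_nat k * m" "n \<noteq> k" for n k :: nat and m :: "'v cpoly"
  proof -
    have "pconst (of_nat n - of_nat k) * m = 0" using that(1) by (simp add: pconst_diff pconst_of_nat left_diff_distrib)
    then show ?thesis by (rule pconst_mult_eq_0[rotated]) (use that(2) in simp)
  qed
  have P: "om c u v = 0" if "K.wt u d" "K.wt v e" "d + e \<noteq> codim g" for u v d e
    by (rule canc[of "d + e" _ "codim g"]) (use H[OF that(1,2)] that(3) in simp_all)
  have m1: "codim g \<ge> 1" using nt codim_0[of g] by (metis less_one linorder_not_le)
  consider "codim g = 1" | "codim g = 2" | "codim g \<ge> 3" using m1 by linarith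
  then show ?thesis
  proof cases
    case 1
    have I: "om c (\<rho> g u) (\<rho> g v) = om c u v" for u v
    proof -
      have "om c (\<rho> g u) (\<rho> g v) = \<theta> g (om c u v)"
        using g by (simp add: om_def th_diff inv th_emb rho_lin)
      also have "\<dots> = \<theta> g (th (fixp g) (om c u v))" using h by (simp add: harm_def)
      also have "\<dots> = th (fixp g) (om c u v)"
      proof -
        have "\<rho> g \<circ> fixp g = fixp g" using rho_fixp[OF g] by (simp add: fun_eq_iff)
        then show ?thesis by (simp add: th_comp rho_lin g)
      qed
      finally show ?thesis using h by (simp add: harm_def)
    qed
    have F: "om c u (v - fixp g v) = 0" if u: "\<rho> g u = u" for u v
    proof -
      obtain w where w: "v - fixp g v = w - \<rho> g w" using range_fixp[OF g] by blast
      have "om c u (\<rho> g w) = om c u w" using I[of u w] u by simp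
      then show ?thesis unfolding w by (simp add: K.vlinD(6)[OF r])
    qed
    have "om c u v = 0" if "K.wt u d" "K.wt v e" for u v d e
    proof -
      consider "d + e \<noteq> 1" | "d = 0" "e = 1" | "d = 1" "e = 0" by linarith
      then show ?thesis
      proof cases
        case 2
        then have "fixp g u = u" "fixp g v = 0" using that by (auto simp: K.wt_def)
        then show ?thesis using F[of u v] rho_fixp[OF g, of u] by simp
      next
        case 3
        then have "fixp g v = v" "fixp g u = 0" using that by (auto simp: K.wt_def)
        then show ?thesis using F[of v u] rho_fixp[OF g, of v] a[of u v] by simp
      qed (use P[OF that] 1 in simp)
    qed
    then have "om c u v = 0" for u v
      by (rule K.bilinear_pure_zero[of "om c", OF l r])
    then show ?thesis by blast
  next
    case 2
    have "om c u v = 0" if "\<rho> g u = u" for u v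
    proof -
      have "K.wt u 0" using fixp_fixed[OF g that] by (simp add: K.wt_def)
      then have "om c u (fixp g v) = 0" "om c u (v - fixp g v) = 0"
        using P K.wt_P[of v] 2 by fastforce+
      then show ?thesis using K.vlin_pure[OF r, of u v] by simp
    qed
    then show ?thesis using 2 by blast
  next
    case 3
    have "om c u v = 0" if "K.wt u d" "K.wt v e" for u v d e
      by (rule P[OF that]) (use that 3 in \<open>auto simp: K.wt_def\<close>)
    then have "om c u v = 0" for u v
      by (rule K.bilinear_pure_zero[of "om c", OF l r])
    then show ?thesis by blast
  qed
qed

end

context fdvs
begin

lemma Hn_1: "1 \<in> Hn 0"
  using Hn_single[of 0 1] by (simp add: mdeg_def)

lemma Hn_pconst: "s \<in> Hn n \<Longrightarrow> pconst k * s \<in> Hn n"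
  using Hn_mult[of "pconst k" 0 s n] Hn_single[of 0 k] by (simp add: mdeg_def pconst_def)

lemma Hn_emb: "emb v \<in> Hn 1"
  unfolding sym_embed_def by (intro Hn_sum Hn_pconst Hn_pvar)

lemma Hn_power: "s \<in> Hn k \<Longrightarrow> s ^ n \<in> Hn (n * k)"
  by (induction n) (simp_all add: Hn_1 Hn_mult)

lemma Hn_prod: "finite I \<Longrightarrow> (\<And>i. i \<in> I \<Longrightarrow> f i \<in> Hn (d i)) \<Longrightarrow> prod f I \<in> Hn (sum d I)"
  by (induction I rule: finite_induct) (simp_all add: Hn_1 Hn_mult)

lemma th_Hn: assumes "s \<in> Hn n" shows "th T s \<in> Hn n"
  unfolding sym_map_def peval_def
proof (intro Hn_sum Hn_pconst)
  fix m assume "m \<in> Poly_Mapping.keys s"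
  then have "mdeg m = n" using assms by (simp add: Hn_def)
  moreover have "(\<Prod>b\<in>Poly_Mapping.keys m. emb (T b) ^ Poly_Mapping.lookup m b) \<in> Hn (\<Sum>b\<in>Poly_Mapping.keys m. Poly_Mapping.lookup m b * 1)"
    by (intro Hn_prod Hn_power Hn_emb) simp
  ultimately show "(\<Prod>b\<in>Poly_Mapping.keys m. emb (T b) ^ Poly_Mapping.lookup m b) \<in> Hn n"
    by (simp add: mdeg_def)
qed

end

section \<open>The bracket of invariant radial cocycles\<close>

text \<open>What good representatives provide after averaging. Elements that act trivially satisfy
  \<open>c_cases\<close> through its first alternative, since their component will be zero.\<close>

locale skew_family = skew G scl Bs \<rho> for G :: "('g, 'm) monoid_scheme" (structure)
    and scl :: "complex \<Rightarrow> 'v::ab_group_add \<Rightarrow> 'v" and Bs :: "'v set" and \<rho> :: "'g \<Rightarrow> 'v \<Rightarrow> 'v" +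
  fixes c :: "'g \<Rightarrow> 'v cpoly \<Rightarrow> 'v cpoly \<Rightarrow> 'v cpoly"
  assumes c_coc: "\<And>g. g \<in> CG \<Longrightarrow> coc g (c g)" and c_radial: "\<And>g. g \<in> CG \<Longrightarrow> radial (c g)"
    and c_pj: "\<And>g. g \<in> CG \<Longrightarrow> pjinv (c g)"
    and c_inv: "\<And>y g s t. y \<in> CG \<Longrightarrow> g \<in> CG \<Longrightarrow> \<theta> y (c g s t) = c (y \<otimes> g \<otimes> inv y) (\<theta> y s) (\<theta> y t)"
    and c_cases: "\<And>g. g \<in> CG \<Longrightarrow> (\<forall>u v. om (c g) u v = 0) \<or>
      (codim g = 2 \<and> (\<forall>u v. \<rho> g u = u \<longrightarrow> om (c g) u v = 0) \<and> (\<forall>u v. th (fixp g) (om (c g) u v) = om (c g) u v))"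
begin

lemma c_l: "g \<in> CG \<Longrightarrow> plin (\<lambda>s. c g s t)" and c_r: "g \<in> CG \<Longrightarrow> plin (c g s)"
  using cocD(1,2)[OF c_coc] by blast+

lemma c_cocyc: "g \<in> CG \<Longrightarrow> s \<in> S \<Longrightarrow> t \<in> S \<Longrightarrow> u \<in> S \<Longrightarrow>
    s * c g t u - c g (s * t) u + c g s (t * u) - c g s t * \<theta> g u = 0"
  using cocD(3)[OF c_coc] .

lemma c_S: "g \<in> CG \<Longrightarrow> c g s t \<in> S" using plinD(3)[OF c_r] .

lemma c_1: assumes g: "g \<in> CG" shows "c g 1 s = 0" "c g s 1 = 0"
proof -
  have "c g 1 (th id s) = 0" "c g (th id s) 1 = 0"
    using c_radial[OF g] th_S[of id s] unfolding radial_def by blast+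
  moreover have "c g 1 (th id s) = c g 1 s" "c g (th id s) 1 = c g s 1"
    using c_pj[OF g] unfolding pjinv_def by (metis th_1)+
  ultimately show "c g 1 s = 0" "c g s 1 = 0" by simp_all
qed

lemma c_pj_r: "g \<in> CG \<Longrightarrow> c g s (th id t) = c g s t" "g \<in> CG \<Longrightarrow> c g (th id s) t = c g s t"
  using c_pj unfolding pjinv_def by (metis th_S pj_S')+

text \<open>The argument of \<open>normal_zero\<close>, confined to polynomials in the image of
  \<open>L\<close>: \<open>pd_th\<close> turns derivatives of \<open>th L t\<close> into images of
  derivatives of \<open>t\<close>, so the recursion meets the form only on the image of
  \<open>L\<close>.\<close>

lemma isotropic_zero:
  assumes g: "g \<in> CG" and L: "lin L" and iso: "\<And>u v. om (c g) (L u) (L v) = 0" and s: "s \<in> S" and t: "t \<in> S"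
  shows "c g (th L s) (th L t) = 0"
proof -
  interpret M: bim scl Bs S "(*)" "rmul g" by (rule twisted_bim)
  note l = plinD[OF c_l[OF g]] and r = plinD[OF c_r[OF g]]
  have vl1: "vl (\<lambda>v. of_nat (Suc n) * c g t (emb v))" for n t
    using plinD(1,2,3)[OF c_r[OF g]] S_pconst[of "of_nat (Suc n)"] unfolding vl_def pconst_of_nat[symmetric]
    by (simp add: emb_add emb_scl distrib_left mult.left_commute del: of_nat_Suc)
  have vl2: "vl (\<lambda>v. (\<Sum>i\<in>Bs. c g (pd i t) (emb v) * \<theta> g (pvar i)) - (\<Sum>i\<in>Bs. pd i t * om (c g) v i))" if "t \<in> S" for t
  proof -
    have 0: "vl (\<lambda>v. F v - F' v)" if "vl F" "vl F'" for F F' using that by (simp add: vl_def right_diff_distrib add_diff_add)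
    have 1: "vl (\<lambda>v. \<Sum>i\<in>Bs. F i v)" if "\<And>i. vl (F i)" for F using that by (simp add: vl_def sum.distrib sum_distrib_left)
    have 2: "vl (\<lambda>v. F v * a)" "vl (\<lambda>v. a * F v)" if "vl F" "a \<in> S" for F a
      using that by (simp_all add: vl_def distrib_left distrib_right mult.assoc mult.left_commute)
    have 3: "vl (\<lambda>v. c g a (emb v))" for a
      using plinD(1,2,3)[OF c_r[OF g]] by (simp add: vl_def emb_add emb_scl)
    show ?thesis by (intro 0 1 2 3 om_vl(1)[OF c_coc[OF g]]) (use that in auto)
  qed
  \<comment> \<open>Both sides are linear in \<open>v\<close>, so the recursion passes from
    variables to arbitrary vectors; it is needed at \<open>L v\<close>, which need not be a basis
    vector.\<close>
  have rec: "of_nat (Suc n) * c g t (emb v) = (\<Sum>i\<in>Bs. c g (pd i t) (emb v) * \<theta> g (pvar i)) - (\<Sum>i\<in>Bs. pd i t * om (c g) v i)"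
    if t: "t \<in> Hn n" for n t v
  proof (rule vl_eqI[OF vl1 vl2[OF Hn_S[OF t]]])
    fix b assume b: "b \<in> Bs"
    show "of_nat (Suc n) * c g t (emb b) = (\<Sum>i\<in>Bs. c g (pd i t) (emb b) * \<theta> g (pvar i)) - (\<Sum>i\<in>Bs. pd i t * om (c g) b i)"
      using M.radial_recursion[OF c_coc[OF g] c_radial[OF g] t b] b asym_om[OF b, of _ "c g"]
      by (simp add: emb_Bs cong: sum.cong)
  qed
  have H: "c g (th L t) (emb (L v)) = 0" if "t \<in> Hn n" for n t v
    using that
  proof (induction n arbitrary: t)
    case 0
    then show ?case using rec[OF th_Hn[OF 0], of L "L v"] pd_Hn_0[OF th_Hn[OF 0]] by (simp add: l)
  next
    case (Suc n)
    note tS = Hn_S[OF Suc.prems]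
    have "(\<Sum>i\<in>Bs. c g (pd i (th L t)) (emb (L v)) * \<theta> g (pvar i)) =
        (\<Sum>i\<in>Bs. c g (th L (pd i t)) (emb (L v)) * \<theta> g (th L (pvar i)))"
      by (rule pd_th[OF L tS]) (simp_all add: l th_add th_mult distrib_right distrib_left mult.left_commute mult.assoc)
    also have "\<dots> = 0" using Suc.IH[OF pd_Hn[OF Suc.prems]] by simp
    finally have 1: "(\<Sum>i\<in>Bs. c g (pd i (th L t)) (emb (L v)) * \<theta> g (pvar i)) = 0" .
    have "(\<Sum>i\<in>Bs. pd i (th L t) * (c g (emb (L v)) (pvar i) - c g (pvar i) (emb (L v)))) =
      (\<Sum>i\<in>Bs. th L (pd i t) * (c g (emb (L v)) (th L (pvar i)) - c g (th L (pvar i)) (emb (L v))))"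
      by (rule pd_th[OF L tS]) (simp_all add: l r distrib_right distrib_left right_diff_distrib mult.left_commute mult.assoc)
    also have "\<dots> = 0"
    proof (rule sum.neutral, rule ballI)
      fix i assume "i \<in> Bs"
      show "th L (pd i t) * (c g (emb (L v)) (th L (pvar i)) - c g (th L (pvar i)) (emb (L v))) = 0"
        using iso[of v i] by (simp add: om_def th_pvar)
    qed
    finally have "(\<Sum>i\<in>Bs. pd i (th L t) * om (c g) (L v) i) = 0"
      by (simp add: om_def emb_Bs cong: sum.cong)
    then have "of_nat (Suc (Suc n)) * c g (th L t) (emb (L v)) = 0"
      unfolding rec[OF th_Hn[OF Suc.prems]] 1 by simp
    then have "pconst (of_nat (Suc (Suc n))) * c g (th L t) (emb (L v)) = 0" by (simp only: pconst_of_nat)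
    then show ?case by (rule pconst_mult_eq_0[rotated]) (simp del: of_nat_Suc)
  qed
  have v: "c g (th L s) (emb (L v)) = 0" if "s \<in> S" for s v
    by (rule S_sum_Hn[OF that]) (simp_all add: th_add l H)
  show ?thesis
    using t s
  proof (induction t arbitrary: s rule: S_induct)
    case (const k)
    then show ?case using r(2)[of "th L s" k 1] c_1[OF g] by simp
  next
    case (var b)
    then show ?case by (simp add: th_pvar v)
  next
    case (mult t u)
    then have "c g (th L s * th L t) (th L u) = 0" using mult.IH(2)[of "s * t"] by (simp add: th_mult)
    then show ?case
      using c_cocyc[OF g, of "th L s" "th L t" "th L u"] mult by (simp add: th_mult)
  qed (simp_all add: th_add r)
qed

text \<open>The \<open>x\<close>-component on \<open>S\<close> of the circle product of the cochain
  with itself, with \<open>h = g\<^sup>-\<^sup>1 x\<close>; the square bracket is twice this. The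
  factor \<open>\<theta> h\<close> arises when the group part of the value of \<open>c h\<close> is
  moved past \<open>u\<close>.\<close>

definition gam :: "'g \<Rightarrow> 'v cpoly \<Rightarrow> 'v cpoly \<Rightarrow> 'v cpoly \<Rightarrow> 'v cpoly" where
  "gam x s t u = (\<Sum>g\<in>CG. c g (c (inv g \<otimes> x) s t) (\<theta> (inv g \<otimes> x) u) - c g s (c (inv g \<otimes> x) t u))"

text \<open>The terms of \<open>gam\<close> in which \<open>c h\<close> receives \<open>u\<close>
  and \<open>v\<close>, antisymmetrised in these two; \<open>psi\<close> completes the alternation
  by a cyclic sum.\<close>

definition zet :: "'g \<Rightarrow> 'g \<Rightarrow> 'v \<Rightarrow> 'v \<Rightarrow> 'v \<Rightarrow> 'v cpoly" where
  "zet g h u v w = c g (om (c h) u v) (emb (\<rho> h w)) - c g (emb w) (om (c h) u v)"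

definition psi :: "'g \<Rightarrow> 'g \<Rightarrow> 'v \<Rightarrow> 'v \<Rightarrow> 'v \<Rightarrow> 'v cpoly" where
  "psi g h u v w = zet g h u v w + zet g h v w u + zet g h w u v"

lemma gam_alt:
  assumes x: "x \<in> CG"
  shows "coc3_alt (gam x) (emb u) (emb v) (emb w) = (\<Sum>g\<in>CG. psi g (inv g \<otimes> x) u v w)"
proof -
  have "coc3_alt (\<lambda>s t u. c g (c h s t) (\<theta> h u) - c g s (c h t u)) (emb u) (emb v) (emb w) = psi g h u v w"
    if g: "g \<in> CG" and h: "h \<in> CG" for g h
    by (simp add: coc3_alt_def psi_def zet_def om_def plinD[OF c_l[OF g]] plinD[OF c_r[OF g]] th_emb rho_lin h)
  then have "(\<Sum>g\<in>CG. coc3_alt (\<lambda>s t u. c g (c (inv g \<otimes> x) s t) (\<theta> (inv g \<otimes> x) u) - c g s (c (inv g \<otimes> x) t u)) (emb u) (emb v) (emb w))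
      = (\<Sum>g\<in>CG. psi g (inv g \<otimes> x) u v w)"
    using x by (intro sum.cong) auto
  then show ?thesis
    by (simp add: coc3_alt_def gam_def sum.distrib sum_subtractf)
qed

abbreviation transversal :: "'g \<Rightarrow> 'g \<Rightarrow> bool" where
  "transversal g h \<equiv> (\<forall>v. \<exists>a b. v = a + b \<and> \<rho> g a = a \<and> \<rho> h b = b)"

text \<open>Modulo \<open>V\<^sup>g\<close>, the fixed space of \<open>h\<close> lies in a plane. If
  it filled the plane, \<open>V\<^sup>g + V\<^sup>h\<close> would be V; so its image is at most a
  line, where an alternating form vanishes.\<close>

lemma isotropic:
  assumes g: "g \<in> CG" and h: "h \<in> CG" and nt: "\<not> transversal g h" and cd: "codim g = 2"
    and z: "\<And>u v. \<rho> g u = u \<Longrightarrow> om (c g) u v = 0"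
  shows "om (c g) (fixp h u) (fixp h v) = 0"
proof -
  interpret K: koszul scl Bs "\<rho> g" "fixp g" "resolv g" by (rule koszul[OF g])
  note l = om_vl(1)[OF c_coc[OF g], unfolded vlin_vl[symmetric]] and r = om_vl(2)[OF c_coc[OF g], unfolded vlin_vl[symmetric]]
  have a: "om (c g) u v = - om (c g) v u" for u v by (simp add: om_def)
  define a' where "a' = fixp h u - fixp g (fixp h u)"
  define b' where "b' = fixp h v - fixp g (fixp h v)"
  have z2: "om (c g) w (fixp g v) = 0" "om (c g) (fixp g v) w = 0" for w v
    using z[OF rho_fixp[OF g, of v], of w] a[of w "fixp g v"] by simp_all
  have e: "om (c g) (fixp h u) (fixp h v) = om (c g) a' b'"
    by (simp add: a'_def b'_def K.vlinD(6)[OF l] K.vlinD(6)[OF r] z2)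
  have m: "w - fixp g w \<in> moved g" for w using range_fixp[OF g] by blast
  have "a' \<in> moved g" "b' \<in> moved g" unfolding a'_def b'_def by (rule m)+
  from cd this show ?thesis
  proof (cases rule: dim2_cases)
    case 1
    then show ?thesis unfolding e using K.vlinD(4)[OF l] by simp
  next
    case (2 k)
    then show ?thesis unfolding e by (simp add: K.vlinD(2)[OF r]) (simp add: om_def)
  next
    case 3
    have "\<exists>a b. w = a + b \<and> \<rho> g a = a \<and> \<rho> h b = b" for w
    proof -
      obtain k l where kl: "w - fixp g w = scl k a' + scl l b'" using 3[OF m] by blast
      have "w = (fixp g w - scl k (fixp g (fixp h u)) - scl l (fixp g (fixp h v))) + (scl k (fixp h u) + scl l (fixp h v))"
        using kl by (simp add: a'_def b'_def scale_right_diff_distrib algebra_simps)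
      moreover have "\<rho> g (fixp g w - scl k (fixp g (fixp h u)) - scl l (fixp g (fixp h v))) = fixp g w - scl k (fixp g (fixp h u)) - scl l (fixp g (fixp h v))"
        by (simp add: rhoD[OF g] rho_fixp[OF g])
      moreover have "\<rho> h (scl k (fixp h u) + scl l (fixp h v)) = scl k (fixp h u) + scl l (fixp h v)"
        by (simp add: rhoD[OF h] rho_fixp[OF h])
      ultimately show ?thesis by blast
    qed
    then show ?thesis using nt by blast
  qed
qed

lemma om_zero_c_zero: assumes "g \<in> CG" "\<And>u v. om (c g) u v = 0" "s \<in> S" "t \<in> S" shows "c g s t = 0"
proof -
  have "lin id" by (rule linI) simp_all
  from isotropic_zero[OF assms(1) this _ assms(3,4)] show ?thesis using assms by simp
qed

lemma psi_vl:
  assumes g: "g \<in> CG" and h: "h \<in> CG"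
  shows "vl (\<lambda>u. psi g h u v w)" "vl (\<lambda>v. psi g h u v w)" "vl (\<lambda>w. psi g h u v w)"
proof -
  note l = plinD[OF c_l[OF g]] and r = plinD[OF c_r[OF g]]
  note ol = om_vl(1)[OF c_coc[OF h], unfolded vl_def] and orr = om_vl(2)[OF c_coc[OF h], unfolded vl_def]
  show "vl (\<lambda>u. psi g h u v w)" "vl (\<lambda>v. psi g h u v w)" "vl (\<lambda>w. psi g h u v w)"
    using ol orr
    by (simp_all add: vl_def psi_def zet_def l r emb_add emb_scl rhoD[OF h] distrib_left right_diff_distrib)
qed

text \<open>If neither form is zero, both codimensions are 2, so the pair is not transversal and
  \<open>om (c g)\<close> vanishes on \<open>V\<^sup>h\<close>. Then \<open>c g\<close> vanishes on
  polynomials in \<open>V\<^sup>h\<close>, which include the coefficients of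
  \<open>om (c h)\<close>, and \<open>zet\<close> is zero once an argument is fixed by
  \<open>h\<close>. Hence \<open>psi\<close> is an alternating form in three arguments on the plane
  \<open>moved h\<close>, and so zero.\<close>

lemma psi_zero:
  assumes g: "g \<in> CG" and h: "h \<in> CG"
    and nt: "\<not> (transversal g h \<and> codim g = 2 \<and> codim h = 2)"
  shows "psi g h u v w = 0"
proof -
  note l = plinD[OF c_l[OF g]] and r = plinD[OF c_r[OF g]]
  have oS: "om (c h) u v \<in> S" for u v by (simp add: om_def c_S[OF h])
  show ?thesis
  proof (rule disjE[OF c_cases[OF h]], goal_cases)
    case 1
    then show ?case by (simp add: psi_def zet_def l r)
  next
    case h2: 2
    show ?case
    proof (rule disjE[OF c_cases[OF g]], goal_cases)
    case 1
    then show ?case using om_zero_c_zero[OF g] oS by (simp add: psi_def zet_def)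
  next
    case g2: 2
    note 3 = g2[THEN conjunct1] g2[THEN conjunct2, THEN conjunct1, rule_format]
      h2[THEN conjunct1] h2[THEN conjunct2, THEN conjunct1, rule_format] h2[THEN conjunct2, THEN conjunct2, rule_format]
    interpret K: koszul scl Bs "\<rho> h" "fixp h" "resolv h" by (rule koszul[OF h])
    have nt': "\<not> transversal g h" using nt 3 by blast
    have iso: "c g (th (fixp h) s) (th (fixp h) t) = 0" if "s \<in> S" "t \<in> S" for s t
      by (rule isotropic_zero[OF g fixp_lin[OF h] isotropic[OF g h nt' 3(1,2)] that])
    have oa: "om (c h) u v = - om (c h) v u" for u v by (simp add: om_def)
    have z1: "zet g h u v w = 0" if "\<rho> h w = w" for u v w
    proof -
      have "fixp h w = w" by (rule fixp_fixed[OF h that])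
      then have "emb w = th (fixp h) (emb w)" by (simp add: th_emb fixp_lin h)
      then have "c g (om (c h) u v) (emb w) = 0" "c g (emb w) (om (c h) u v) = 0"
        using iso[OF oS[of u v] S_emb[of w]] iso[OF S_emb[of w] oS[of u v]] 3(5)[of u v] by simp_all
      then show ?thesis by (simp add: zet_def that)
    qed
    have z2: "zet g h u v w = 0" if "\<rho> h u = u" for u v w
      using 3(4)[OF that] by (simp add: zet_def l r)
    have z3: "zet g h u v w = 0" if "\<rho> h v = v" for u v w
      using 3(4)[OF that, of u] oa[of u v] by (simp add: zet_def l r)
    note V = psi_vl[OF g h, unfolded vlin_vl[symmetric]]
    have cyc: "psi g h u v w = psi g h v w u" for u v w by (simp add: psi_def)
    have fx: "psi g h (fixp h u) v w = 0" for u v w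
      using z1[OF rho_fixp[OF h]] z2[OF rho_fixp[OF h]] z3[OF rho_fixp[OF h]] by (simp add: psi_def)
    have red: "psi g h u v w = psi g h (u - fixp h u) v w" for u v w
      by (simp add: K.vlinD(6)[OF V(1)] fx)
    have dd: "psi g h a a b = 0" for a b
    proof -
      have "om (c h) a a = 0" "om (c h) a b = - om (c h) b a" by (simp_all add: om_def)
      then show ?thesis by (simp add: psi_def zet_def l r)
    qed
    have "psi g h u v w = psi g h (u - fixp h u) (v - fixp h v) (w - fixp h w)"
      using red[of u v w] red[of v w "u - fixp h u"] red[of w "u - fixp h u" "v - fixp h v"] by (metis cyc)
    moreover have "psi g h a b d = 0" if mm: "a \<in> moved h" "b \<in> moved h" "d \<in> moved h" for a b d
      using 3(3) mm(1,2)
    proof (cases rule: dim2_cases)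
      case 1
      then show ?thesis using K.vlinD(4)[OF V(1)] by simp
    next
      case (2 k)
      then show ?thesis by (simp add: K.vlinD(2)[OF V(2)] dd)
    next
      case 3
      then obtain k k' where d: "d = scl k a + scl k' b" using mm(3) by blast
      have "psi g h a b a = 0" "psi g h a b b = 0" using dd[of a b] dd[of b a] cyc by metis+
      then show ?thesis unfolding d by (simp add: K.vlinD(1,2)[OF V(3)])
    qed
    moreover have "a - fixp h a \<in> moved h" for a using range_fixp[OF h] by blast
    ultimately show ?case by simp
    qed
  qed
qed

text \<open>For a pair \<open>(g, h)\<close> the differential of the circle product is a difference
  \<open>C1 - C2\<close> of two cup products. Invariance of the family rewrites \<open>C2\<close> at
  \<open>(g, h)\<close> as \<open>C1\<close> at \<open>(g h g\<^sup>-\<^sup>1, g)\<close>. This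
  reindexing keeps the product of the pair, so the two sums over \<open>g h = x\<close>
  cancel.\<close>

lemma gam_coc3: assumes x: "x \<in> CG" shows "coc3 (\<rho> x) (gam x)"
proof -
  have hC: "inv g \<otimes> x \<in> CG" if "g \<in> CG" for g using that x by simp
  have pg: "\<theta> h (th id u) = \<theta> h u" if "h \<in> CG" for h u by (rule th_pj[OF rho_lin[OF that]])
  show ?thesis
    unfolding coc3_def
  proof (intro conjI allI ballI)
    show "gam x (s + s') t u = gam x s t u + gam x s' t u" for s s' t u
      unfolding gam_def sum.distrib[symmetric]
      by (intro sum.cong refl) (simp add: plinD[OF c_l] plinD[OF c_r] hC)
    show "gam x s (t + t') u = gam x s t u + gam x s t' u" for s t t' u
      unfolding gam_def sum.distrib[symmetric]
      by (intro sum.cong refl) (simp add: plinD[OF c_l] plinD[OF c_r] hC)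
    show "gam x (pconst k * s) t u = pconst k * gam x s t u" for k s t u
      unfolding gam_def sum_distrib_left
      by (intro sum.cong refl) (simp add: plinD[OF c_l] plinD[OF c_r] hC right_diff_distrib)
    show "gam x s (pconst k * t) u = pconst k * gam x s t u" for k s t u
      unfolding gam_def sum_distrib_left
      by (intro sum.cong refl) (simp add: plinD[OF c_l] plinD[OF c_r] hC right_diff_distrib)
    show "gam x s t \<in> hom_bim" for s t
      unfolding hom_bim_def
    proof (intro CollectI conjI allI)
      show "gam x s t (u + u') = gam x s t u + gam x s t u'" for u u'
        unfolding gam_def sum.distrib[symmetric]
        by (intro sum.cong refl) (simp add: plinD[OF c_l] plinD[OF c_r] hC th_add)
      show "gam x s t (pconst k * u) = pconst k * gam x s t u" for k u
        unfolding gam_def sum_distrib_left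
        by (intro sum.cong refl) (simp add: plinD[OF c_l] plinD[OF c_r] hC th_mult right_diff_distrib)
      show "gam x s t u \<in> S" for u unfolding gam_def by (intro S_sum S_diff c_S)
      show "gam x s t (th id u) = gam x s t u" for u
        unfolding gam_def by (intro sum.cong refl) (simp add: hC pg c_pj_r)
      show "gam x s t 1 = 0" by (simp add: gam_def c_1 hC plinD[OF c_r] cong: sum.cong)
    qed
    fix s t u v assume S: "s \<in> S" "t \<in> S" "u \<in> S" "v \<in> S"
    define C1 where "C1 g h = c h s t * c g (\<theta> h u) (\<theta> h v)" for g h
    define C2 where "C2 g h = c g s t * \<theta> g (c h u v)" for g h
    define G where "G g h s t u = c g (c h s t) (\<theta> h u) - c g s (c h t u)" for g h s t u
    \<comment> \<open>Five cocycle identities combine: two for \<open>c h\<close>, inserted into an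
      argument of \<open>c g\<close>, and three for \<open>c g\<close> itself.\<close>
    have pair: "s * G g h t u v - G g h (s * t) u v + G g h s (t * u) v - G g h s t (u * v) + G g h s t u * \<theta> g (\<theta> h v)
        = C1 g h - C2 g h" if g: "g \<in> CG" and h: "h \<in> CG" for g h
    proof -
      note l = plinD[OF c_l[OF g]] and r = plinD[OF c_r[OF g]]
      let ?E = "\<lambda>g s t u. s * c g t u - c g (s * t) u + c g s (t * u) - c g s t * \<theta> g u"
      have "c g (?E h s t u) (\<theta> h v) = 0" "c g s (?E h t u v) = 0"
        using c_cocyc[OF h] S by (simp_all add: l r)
      moreover have "?E g (c h s t) (\<theta> h u) (\<theta> h v) = 0" "?E g s (c h t u) (\<theta> h v) = 0" "?E g s t (c h u v) = 0"
        using S by (intro c_cocyc[OF g] c_S[OF h] th_S; simp)+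
      moreover have "s * G g h t u v - G g h (s * t) u v + G g h s (t * u) v - G g h s t (u * v) + G g h s t u * \<theta> g (\<theta> h v)
        - (C1 g h - C2 g h) = c g (?E h s t u) (\<theta> h v) + c g s (?E h t u v)
           + ?E g s (c h t u) (\<theta> h v) - ?E g (c h s t) (\<theta> h u) (\<theta> h v) - ?E g s t (c h u v)"
        unfolding l r G_def C1_def C2_def th_mult by (simp add: algebra_simps)
      ultimately show ?thesis by simp
    qed
    have "(\<Sum>g\<in>CG. C1 g (inv g \<otimes> x)) = (\<Sum>g\<in>CG. C1 (x \<otimes> inv g) g)"
    proof (rule sum.reindex_bij_witness[where i = "\<lambda>h. x \<otimes> inv h" and j = "\<lambda>g. inv g \<otimes> x"])
      fix g assume g: "g \<in> CG"
      show 1: "x \<otimes> inv (inv g \<otimes> x) = g" using g x by (simp add: inv_mult_group m_assoc[symmetric])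
      show "C1 (x \<otimes> inv (inv g \<otimes> x)) (inv g \<otimes> x) = C1 g (inv g \<otimes> x)" unfolding 1 ..
      show "inv (x \<otimes> inv g) \<otimes> x = g" using g x by (simp add: inv_mult_group m_assoc)
    qed (use x in auto)
    also have "\<dots> = (\<Sum>g\<in>CG. C2 g (inv g \<otimes> x))"
    proof (rule sum.cong[OF refl])
      fix g assume g: "g \<in> CG"
      have "g \<otimes> (inv g \<otimes> x) \<otimes> inv g = x \<otimes> inv g" using g x by (simp add: m_assoc[symmetric])
      then show "C1 (x \<otimes> inv g) g = C2 g (inv g \<otimes> x)"
        unfolding C1_def C2_def using c_inv[OF g hC[OF g], of u v] by simp
    qed
    finally have C: "(\<Sum>g\<in>CG. C1 g (inv g \<otimes> x)) = (\<Sum>g\<in>CG. C2 g (inv g \<otimes> x))" .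
    have gG: "gam x s t u = (\<Sum>g\<in>CG. G g (inv g \<otimes> x) s t u)" for s t u by (simp add: gam_def G_def)
    have "s * gam x t u v - gam x (s * t) u v + gam x s (t * u) v - gam x s t (u * v) + gam x s t u * \<theta> x v
      = (\<Sum>g\<in>CG. s * G g (inv g \<otimes> x) t u v - G g (inv g \<otimes> x) (s * t) u v + G g (inv g \<otimes> x) s (t * u) v
           - G g (inv g \<otimes> x) s t (u * v) + G g (inv g \<otimes> x) s t u * \<theta> x v)"
      unfolding gG sum_distrib_left sum_distrib_right sum.distrib sum_subtractf ..
    also have "\<dots> = (\<Sum>g\<in>CG. C1 g (inv g \<otimes> x) - C2 g (inv g \<otimes> x))"
    proof (rule sum.cong[OF refl])
      fix g assume g: "g \<in> CG"
      have "\<theta> g (\<theta> (inv g \<otimes> x) v) = \<theta> x v" using g x by (simp add: theta_mult m_assoc[symmetric])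
      then show "s * G g (inv g \<otimes> x) t u v - G g (inv g \<otimes> x) (s * t) u v + G g (inv g \<otimes> x) s (t * u) v
           - G g (inv g \<otimes> x) s t (u * v) + G g (inv g \<otimes> x) s t u * \<theta> x v = C1 g (inv g \<otimes> x) - C2 g (inv g \<otimes> x)"
        using pair[OF g hC[OF g]] by simp
    qed
    also have "\<dots> = 0" using C by (simp add: sum_subtractf)
    finally show "s * gam x t u v - gam x (s * t) u v + gam x s (t * u) v - gam x s t (u * v) + gam x s t u * \<theta> x v = 0" .
  qed
qed

text \<open>A single transversal factorisation of \<open>x\<close> with both codimensions 2 gives
  \<open>codim x = 4\<close>. The whole alternating part, with all its summands at once, is then
  exact because it is closed; without such a factorisation it is zero.\<close>

theorem gam_exact:
  assumes x: "x \<in> CG"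
  shows "\<exists>h. (\<forall>s. h s \<in> hom_bim) \<and> (\<forall>s t u. h (s + t) u = h s u + h t u) \<and> (\<forall>k s u. h (pconst k * s) u = pconst k * h s u) \<and>
    (\<forall>s\<in>S. \<forall>t\<in>S. \<forall>u\<in>S. gam x s t u = s * h t u - h (s * t) u + h s (t * u) - h s t * \<theta> x u)"
proof (cases "\<exists>g\<in>CG. transversal g (inv g \<otimes> x) \<and> codim g = 2 \<and> codim (inv g \<otimes> x) = 2")
  case False
  have "coc3_alt (gam x) (emb u) (emb v) (emb w) = 0" for u v w
    unfolding gam_alt[OF x] by (rule sum.neutral, rule ballI, rule psi_zero) (use x False in auto)
  from this[of _ _ _] show ?thesis
    by (intro coc3_coboundary[OF rho_lin[OF x] coc3_cocyc[OF rho_lin[OF x] gam_coc3[OF x]]]) (metis emb_Bs)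
next
  case True
  then obtain g where g: "g \<in> CG" and tr: "transversal g (inv g \<otimes> x)" and cd: "codim g = 2" "codim (inv g \<otimes> x) = 2"
    by blast
  have hC: "inv g \<otimes> x \<in> CG" using g x by simp
  have "g \<otimes> (inv g \<otimes> x) = x" using g x by (simp add: m_assoc[symmetric])
  then have cx: "codim x = 4" using codim_mult[OF g hC] tr cd by simp
  interpret K: koszul scl Bs "\<rho> x" "fixp x" "resolv x" by (rule koszul[OF x])
  interpret N: bim scl Bs hom_bim "\<lambda>s \<phi> u. s * \<phi> u" "\<lambda>\<phi> s u. \<phi> (s * u) - \<phi> s * th (\<rho> x) u" by (rule hom_bim[OF rho_lin[OF x]])
  have Nc: "N.cocyc (gam x)" by (rule coc3_cocyc[OF rho_lin[OF x] gam_coc3[OF x]])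
  define \<eta> where "\<eta> u v w = coc3_alt (gam x) (emb u) (emb v) (emb w)" for u v w
  have f: "K.form3 \<eta>"
    unfolding K.form3_def
  proof (intro conjI allI)
    have V: "vl (\<lambda>u. psi g (inv g \<otimes> x) u v w)" "vl (\<lambda>v. psi g (inv g \<otimes> x) u v w)" "vl (\<lambda>w. psi g (inv g \<otimes> x) u v w)"
      if "g \<in> CG" for g u v w
      by (rule psi_vl; use that x in simp)+
    show "K.vlin (\<lambda>u. \<eta> u v w)" for v w unfolding \<eta>_def gam_alt[OF x] by (intro K.vlin_sum V(1)[folded vlin_vl])
    show "K.vlin (\<lambda>v. \<eta> u v w)" for u w unfolding \<eta>_def gam_alt[OF x] by (intro K.vlin_sum V(2)[folded vlin_vl])
    show "K.vlin (\<eta> u v)" for u v unfolding \<eta>_def[abs_def] gam_alt[OF x] by (intro K.vlin_sum V(3)[folded vlin_vl])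
    show "\<eta> u v w = - \<eta> v u w" "\<eta> u v w = - \<eta> u w v" for u v w by (simp_all add: \<eta>_def coc3_alt_def)
  qed
  have "K.closed3 \<eta>"
    unfolding K.closed3_def
  proof (intro allI)
    fix s' t' u' v'
    let ?s = "emb s'" and ?t = "emb t'" and ?u = "emb u'" and ?v = "emb v'"
    let ?a = "\<lambda>s t. gam x s t - gam x t s"
    \<comment> \<open>Closedness of the asymmetric part in \<open>hom_bim\<close>, evaluated at the
      fourth argument. The signed sum over the cyclic rotations of the four arguments is the
      closedness of the alternating part.\<close>
    define R where "R s t u v = s * ?a t u v - ?a t u (s * v) + ?a t u s * \<theta> x v
       + (t * ?a u s v - ?a u s (t * v) + ?a u s t * \<theta> x v) + (u * ?a s t v - ?a s t (u * v) + ?a s t u * \<theta> x v)" for s t u v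
    have R: "R s t u v = 0" if "s \<in> S" "t \<in> S" "u \<in> S" for s t u v
      using fun_cong[OF N.asym_closed[OF Nc that], of v] by (simp add: R_def N.dm_def algebra_simps)
    have "K.N s' * \<eta> t' u' v' - K.N t' * \<eta> s' u' v' + K.N u' * \<eta> s' t' v' - K.N v' * \<eta> s' t' u'
        = R ?s ?t ?u ?v - R ?t ?u ?v ?s + R ?u ?v ?s ?t - R ?v ?s ?t ?u"
      by (simp add: R_def \<eta>_def coc3_alt_def K.N_def th_emb rho_lin x emb_diff algebra_simps)
    also have "\<dots> = 0" by (simp add: R)
    finally show "K.N s' * \<eta> t' u' v' - K.N t' * \<eta> s' u' v' + K.N u' * \<eta> s' t' v' - K.N v' * \<eta> s' t' u' = 0" .
  qed
  then have "K.exact3 \<eta>" by (rule K.exact3_of_codim[OF f _ trace_codim[OF x]]) (simp add: cx)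
  then obtain \<beta> where \<beta>: "K.form2 \<beta>" and e: "\<And>u v w. \<eta> u v w = K.N u * \<beta> v w - K.N v * \<beta> u w + K.N w * \<beta> u v"
    unfolding K.exact3_def by blast
  have \<beta>v: "K.vlin (\<beta> u)" and \<beta>a: "\<beta> u v = - \<beta> v u" for u v using \<beta> unfolding K.form2_def by blast+
  show ?thesis
  proof (rule coc3_coboundary_exact[OF rho_lin[OF x] Nc, of \<beta>])
    show "\<beta> i j \<in> S" for i j by (rule K.vlinD(3)[OF \<beta>v])
    show "\<beta> i j = - \<beta> j i" for i j by (rule \<beta>a)
    fix i j k assume "i \<in> Bs" "j \<in> Bs" "k \<in> Bs"
    then show "coc3_alt (gam x) (pvar i) (pvar j) (pvar k) =
      (pvar i - \<theta> x (pvar i)) * \<beta> j k + (pvar j - \<theta> x (pvar j)) * \<beta> k i + (pvar k - \<theta> x (pvar k)) * \<beta> i j"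
      using e[of i j k] \<beta>a[of k i] by (simp add: \<eta>_def K.N_def emb_diff emb_Bs th_pvar)
  qed
qed

end

lemma poly_mapping_add_induct [case_names single add]:
  fixes a :: "'a \<Rightarrow>\<^sub>0 'b::comm_monoid_add"
  assumes "\<And>k s. P (Poly_Mapping.single k s)" "\<And>a b. P a \<Longrightarrow> P b \<Longrightarrow> P (a + b)"
  shows "P a"
proof -
  have 0: "P 0" using assms(1)[of _ 0] by simp
  have sum: "P (sum f I)" if "\<And>i. i \<in> I \<Longrightarrow> P (f i)" for f and I :: "'a set"
    using that by (induction I rule: infinite_finite_induct) (auto intro: 0 assms(2))
  have "a = (\<Sum>k\<in>Poly_Mapping.keys a. Poly_Mapping.single k (Poly_Mapping.lookup a k))"
    by (rule poly_mapping_eqI) (simp add: lookup_sum lookup_single when_def sum.delta in_keys_iff)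
  then show ?thesis using sum[of "Poly_Mapping.keys a"] assms(1) by metis
qed

section \<open>Cochains of the skew group algebra\<close>

context skew
begin

abbreviation sg :: "'g \<Rightarrow> 'v cpoly \<Rightarrow> ('g \<Rightarrow>\<^sub>0 'v cpoly)" where "sg \<equiv> Poly_Mapping.single"
abbreviation AA :: "('g \<Rightarrow>\<^sub>0 'v cpoly) cx_algebra" where "AA \<equiv> skew_group_algebra G scl Bs \<rho>"
abbreviation mul :: "('g \<Rightarrow>\<^sub>0 'v cpoly) \<Rightarrow> ('g \<Rightarrow>\<^sub>0 'v cpoly) \<Rightarrow> ('g \<Rightarrow>\<^sub>0 'v cpoly)" (infixl "\<star>" 70)
  where "mul \<equiv> skew_mult G scl Bs \<rho>"
definition sc :: "complex \<Rightarrow> ('g \<Rightarrow>\<^sub>0 'v cpoly) \<Rightarrow> ('g \<Rightarrow>\<^sub>0 'v cpoly)"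
  where "sc k = Poly_Mapping.map (\<lambda>s. pconst k * s)"

definition AS :: "('g \<Rightarrow>\<^sub>0 'v cpoly) set" where
  "AS = {a. Poly_Mapping.keys a \<subseteq> CG \<and> (\<forall>g\<in>CG. Poly_Mapping.lookup a g \<in> S)}"

lemma AA_sel: "aspace AA = AS" "amult AA = mul" "ascale AA = sc"
  by (simp_all add: skew_group_algebra_def AS_def sc_def[abs_def])

lemma AS_iff: "a \<in> AS \<longleftrightarrow> (\<forall>g\<in>CG. Poly_Mapping.lookup a g \<in> S) \<and> (\<forall>g. g \<notin> CG \<longrightarrow> Poly_Mapping.lookup a g = 0)"
  by (auto simp: AS_def in_keys_iff)

lemma lookup_sc: "Poly_Mapping.lookup (sc k a) g = pconst k * Poly_Mapping.lookup a g"
  by (simp add: sc_def map.rep_eq when_def)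
lemma sc_add: "sc k (a + b) = sc k a + sc k b"
  by (rule poly_mapping_eqI) (simp add: lookup_sc lookup_add distrib_left)
lemma sc_single: "sc k (sg g s) = sg g (pconst k * s)" by (simp add: sc_def map_single)
lemma sc_0 [simp]: "sc k 0 = 0" using sc_add[of k 0 0] by simp
lemma sc_uminus: "sc k (- a) = - sc k a"
  using sc_add[of k a "- a"] by (simp add: eq_neg_iff_add_eq_0 add.commute)
lemma sc_diff: "sc k (a - b) = sc k a - sc k b"
  using sc_add[of k a "- b"] by (simp add: sc_uminus)
lemma sc_sum: "sc k (sum f I) = (\<Sum>i\<in>I. sc k (f i))"
  by (induction I rule: infinite_finite_induct) (simp_all add: sc_add)
lemma sc_sc: "sc k (sc l a) = sc (k * l) a"
  by (rule poly_mapping_eqI) (simp add: lookup_sc pconst_mult mult.assoc)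
lemma sc_1 [simp]: "sc 1 a = a"
  by (rule poly_mapping_eqI) (simp add: lookup_sc)
lemma sc_m1: "sc (- 1) a = - a"
  by (rule poly_mapping_eqI) (simp add: lookup_sc pconst_uminus)

lemma mul_add: "(a + a') \<star> b = a \<star> b + a' \<star> b" "a \<star> (b + b') = a \<star> b + a \<star> b'"
proof -
  show "(a + a') \<star> b = a \<star> b + a' \<star> b"
    unfolding skew_mult_def
    by (rule setsum_keys_plus_distrib) (simp_all add: single_add distrib_right sum.distrib)
  have "(\<Sum>h\<in>Poly_Mapping.keys (b + b'). sg (g \<otimes> h) (Poly_Mapping.lookup a g * \<theta> g (Poly_Mapping.lookup (b + b') h)))
     = (\<Sum>h\<in>Poly_Mapping.keys b. sg (g \<otimes> h) (Poly_Mapping.lookup a g * \<theta> g (Poly_Mapping.lookup b h)))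
      + (\<Sum>h\<in>Poly_Mapping.keys b'. sg (g \<otimes> h) (Poly_Mapping.lookup a g * \<theta> g (Poly_Mapping.lookup b' h)))" for g
    by (rule setsum_keys_plus_distrib) (simp_all add: single_add distrib_left th_add)
  then show "a \<star> (b + b') = a \<star> b + a \<star> b'"
    by (simp add: skew_mult_def sum.distrib)
qed

lemma mul_0 [simp]: "0 \<star> b = 0" "a \<star> 0 = 0"
  by (simp_all add: skew_mult_def)
lemma mul_uminus: "(- a) \<star> b = - (a \<star> b)" "a \<star> (- b) = - (a \<star> b)"
  using mul_add(1)[of a "- a" b] mul_add(2)[of a b "- b"] by (simp_all add: eq_neg_iff_add_eq_0 add.commute)
lemma mul_diff: "(a - a') \<star> b = a \<star> b - a' \<star> b" "a \<star> (b - b') = a \<star> b - a \<star> b'"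
  using mul_add(1)[of a "- a'" b] mul_add(2)[of a b "- b'"] by (simp_all add: mul_uminus)
lemma mul_sum: "sum f I \<star> b = (\<Sum>i\<in>I. f i \<star> b)" "b \<star> sum f I = (\<Sum>i\<in>I. b \<star> f i)"
  by (induction I rule: infinite_finite_induct) (simp_all add: mul_add)

lemma mul_single: "sg g s \<star> sg h t = sg (g \<otimes> h) (s * \<theta> g t)"
  by (cases "s = 0"; cases "t = 0") (simp_all add: skew_mult_def)

lemma mul_sc: "sc k a \<star> b = sc k (a \<star> b)" "a \<star> sc k b = sc k (a \<star> b)"
proof -
  have "sc k (sg g s) \<star> b = sc k (sg g s \<star> b)" "sg g s \<star> sc k b = sc k (sg g s \<star> b)" for g s
    by (induction b rule: poly_mapping_add_induct)
      (simp_all add: mul_add sc_add sc_single mul_single th_mult mult.assoc mult.left_commute)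
  then show "sc k a \<star> b = sc k (a \<star> b)" "a \<star> sc k b = sc k (a \<star> b)"
    by (induction a rule: poly_mapping_add_induct) (simp_all add: mul_add sc_add)
qed

lemma AS_single [simp]: "g \<in> CG \<Longrightarrow> s \<in> S \<Longrightarrow> sg g s \<in> AS"
  by (auto simp: AS_iff lookup_single when_def)
lemma AS_add [simp]: "a \<in> AS \<Longrightarrow> b \<in> AS \<Longrightarrow> a + b \<in> AS"
  by (simp add: AS_iff lookup_add)
lemma AS_0 [simp]: "0 \<in> AS" by (simp add: AS_iff)
lemma AS_sum [simp]: "(\<And>i. i \<in> I \<Longrightarrow> f i \<in> AS) \<Longrightarrow> sum f I \<in> AS"
  by (induction I rule: infinite_finite_induct) simp_all
lemma AS_sc [simp]: "a \<in> AS \<Longrightarrow> sc k a \<in> AS"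
  by (simp add: AS_iff lookup_sc)
lemma AS_uminus [simp]: "a \<in> AS \<Longrightarrow> - a \<in> AS"
  using AS_sc[of a "- 1"] by (simp add: sc_m1)
lemma AS_diff [simp]: "a \<in> AS \<Longrightarrow> b \<in> AS \<Longrightarrow> a - b \<in> AS"
  using AS_add[of a "- b"] by simp

lemma AS_expand: "a \<in> AS \<Longrightarrow> a = (\<Sum>g\<in>CG. sg g (Poly_Mapping.lookup a g))"
proof (rule poly_mapping_eqI)
  fix k assume "a \<in> AS"
  then show "Poly_Mapping.lookup a k = Poly_Mapping.lookup (\<Sum>g\<in>CG. sg g (Poly_Mapping.lookup a g)) k"
    using fin by (auto simp: lookup_sum lookup_single when_def sum.delta AS_iff)
qed

lemma AS_induct [consumes 1, case_names single add]:
  assumes "a \<in> AS" "\<And>g s. g \<in> CG \<Longrightarrow> s \<in> S \<Longrightarrow> P (sg g s)" "\<And>a b. a \<in> AS \<Longrightarrow> b \<in> AS \<Longrightarrow> P a \<Longrightarrow> P b \<Longrightarrow> P (a + b)"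
  shows "P a"
proof -
  have 0: "P 0" using assms(2)[of \<one> 0] by simp
  have "sum f I \<in> AS \<and> P (sum f I)" if "\<And>i. i \<in> I \<Longrightarrow> f i \<in> AS \<and> P (f i)" for f and I :: "'g set"
    using that by (induction I rule: infinite_finite_induct) (auto intro: 0 assms(3))
  then have "P (\<Sum>g\<in>CG. sg g (Poly_Mapping.lookup a g))"
    using assms(1,2) by (simp add: AS_iff AS_single[unfolded AS_iff])
  then show ?thesis using AS_expand[OF assms(1)] by simp
qed

lemma AS_mul [simp]: assumes "a \<in> AS" "b \<in> AS" shows "a \<star> b \<in> AS"
  using assms
proof (induction a rule: AS_induct)
  case (single g s)
  from single(3,1,2) show ?case
    by (induction b rule: AS_induct) (simp_all add: mul_single mul_add)
qed (simp add: mul_add)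

lemma mul_assoc: assumes "a \<in> AS" "b \<in> AS" "c \<in> AS" shows "a \<star> b \<star> c = a \<star> (b \<star> c)"
  using assms
proof (induction a rule: AS_induct)
  case (single g s)
  from single(3,1,2,4) show ?case
  proof (induction b rule: AS_induct)
    case (single h t)
    from single(5,1-4) show ?case
      by (induction c rule: AS_induct) (simp_all add: mul_single mul_add m_assoc th_mult theta_mult mult.assoc)
  qed (simp add: mul_add)
qed (simp add: mul_add)

abbreviation ux :: "'g \<Rightarrow> ('g \<Rightarrow>\<^sub>0 'v cpoly)" where "ux x \<equiv> sg x 1"
abbreviation inc :: "'v cpoly \<Rightarrow> ('g \<Rightarrow>\<^sub>0 'v cpoly)" where "inc s \<equiv> sg \<one> s"

lemma mul_one: assumes "a \<in> AS" shows "a \<star> ux \<one> = a" "ux \<one> \<star> a = a"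
  using assms by (induction a rule: AS_induct) (simp_all add: mul_single mul_add theta_one)

section \<open>Multilinear cochains, differentials and circle products in low degree\<close>

definition lin1 :: "(('g \<Rightarrow>\<^sub>0 'v cpoly) \<Rightarrow> ('g \<Rightarrow>\<^sub>0 'v cpoly)) \<Rightarrow> bool" where
  "lin1 k \<longleftrightarrow> (\<forall>a\<in>AS. k a \<in> AS) \<and> (\<forall>a\<in>AS. \<forall>b\<in>AS. k (a + b) = k a + k b) \<and> (\<forall>a\<in>AS. \<forall>c. k (sc c a) = sc c (k a))"

lemma lin1D:
  assumes "lin1 k"
  shows "a \<in> AS \<Longrightarrow> k a \<in> AS" "a \<in> AS \<Longrightarrow> b \<in> AS \<Longrightarrow> k (a + b) = k a + k b" "a \<in> AS \<Longrightarrow> k (sc c a) = sc c (k a)"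
    "k 0 = 0" "a \<in> AS \<Longrightarrow> k (- a) = - k a" "a \<in> AS \<Longrightarrow> b \<in> AS \<Longrightarrow> k (a - b) = k a - k b"
    "(\<And>i. i \<in> I \<Longrightarrow> f i \<in> AS) \<Longrightarrow> k (sum f I) = (\<Sum>i\<in>I. k (f i))"
proof -
  show 1: "a \<in> AS \<Longrightarrow> k a \<in> AS" "a \<in> AS \<Longrightarrow> b \<in> AS \<Longrightarrow> k (a + b) = k a + k b" "a \<in> AS \<Longrightarrow> k (sc c a) = sc c (k a)" for a b c
    using assms by (auto simp: lin1_def)
  show 0: "k 0 = 0" using 1(2)[of 0 0] by simp
  show m: "a \<in> AS \<Longrightarrow> k (- a) = - k a" for a using 1(2)[of a "- a"] by (simp add: 0 eq_neg_iff_add_eq_0 add.commute)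
  show "a \<in> AS \<Longrightarrow> b \<in> AS \<Longrightarrow> k (a - b) = k a - k b" using 1(2)[of a "- b"] by (simp add: m)
  show "(\<And>i. i \<in> I \<Longrightarrow> f i \<in> AS) \<Longrightarrow> k (sum f I) = (\<Sum>i\<in>I. k (f i))"
    by (induction I rule: infinite_finite_induct) (simp_all add: 0 1)
qed

lemma lin1I: "(\<And>a. a \<in> AS \<Longrightarrow> k a \<in> AS) \<Longrightarrow> (\<And>a b. a \<in> AS \<Longrightarrow> b \<in> AS \<Longrightarrow> k (a + b) = k a + k b) \<Longrightarrow>
    (\<And>a c. a \<in> AS \<Longrightarrow> k (sc c a) = sc c (k a)) \<Longrightarrow> lin1 k"
  by (simp add: lin1_def)

lemma lin1_add: "lin1 k \<Longrightarrow> lin1 l \<Longrightarrow> lin1 (\<lambda>a. k a + l a)"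
  by (intro lin1I) (simp_all add: lin1D sc_add)
lemma lin1_diff: "lin1 k \<Longrightarrow> lin1 l \<Longrightarrow> lin1 (\<lambda>a. k a - l a)"
  by (intro lin1I) (simp_all add: lin1D sc_diff)
lemma lin1_uminus: "lin1 k \<Longrightarrow> lin1 (\<lambda>a. - k a)"
  by (intro lin1I) (simp_all add: lin1D sc_uminus)
lemma lin1_mul: "lin1 k \<Longrightarrow> b \<in> AS \<Longrightarrow> lin1 (\<lambda>a. k a \<star> b)" "lin1 k \<Longrightarrow> b \<in> AS \<Longrightarrow> lin1 (\<lambda>a. b \<star> k a)"
  by (intro lin1I; simp add: lin1D mul_add mul_sc)+
lemma lin1_comp: "lin1 k \<Longrightarrow> lin1 l \<Longrightarrow> lin1 (\<lambda>a. k (l a))"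
  by (intro lin1I) (simp_all add: lin1D)
lemma lin1_id: "lin1 (\<lambda>a. a)" by (intro lin1I) simp_all
lemma lin1_sum: "(\<And>i. i \<in> I \<Longrightarrow> lin1 (k i)) \<Longrightarrow> lin1 (\<lambda>a. \<Sum>i\<in>I. k i a)"
  by (intro lin1I) (simp_all add: lin1D sum.distrib sc_sum)

lemma lin1_eqI:
  assumes "lin1 k" "lin1 l" "a \<in> AS" "\<And>g s. g \<in> CG \<Longrightarrow> s \<in> S \<Longrightarrow> k (sg g s) = l (sg g s)"
  shows "k a = l a"
  using assms(3) by (induction a rule: AS_induct) (simp_all add: assms(4) lin1D[OF assms(1)] lin1D[OF assms(2)])

definition lin2 :: "(('g \<Rightarrow>\<^sub>0 'v cpoly) \<Rightarrow> ('g \<Rightarrow>\<^sub>0 'v cpoly) \<Rightarrow> ('g \<Rightarrow>\<^sub>0 'v cpoly)) \<Rightarrow> bool" where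
  "lin2 F \<longleftrightarrow> (\<forall>b\<in>AS. lin1 (\<lambda>a. F a b)) \<and> (\<forall>a\<in>AS. lin1 (F a))"

definition lin3 :: "(('g \<Rightarrow>\<^sub>0 'v cpoly) \<Rightarrow> ('g \<Rightarrow>\<^sub>0 'v cpoly) \<Rightarrow> ('g \<Rightarrow>\<^sub>0 'v cpoly) \<Rightarrow> ('g \<Rightarrow>\<^sub>0 'v cpoly)) \<Rightarrow> bool" where
  "lin3 F \<longleftrightarrow> (\<forall>c\<in>AS. lin2 (\<lambda>a b. F a b c)) \<and> (\<forall>a\<in>AS. lin2 (F a))"

lemma lin2D: "lin2 F \<Longrightarrow> b \<in> AS \<Longrightarrow> lin1 (\<lambda>a. F a b)" "lin2 F \<Longrightarrow> b \<in> AS \<Longrightarrow> lin1 (F b)"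
  "lin2 F \<Longrightarrow> a \<in> AS \<Longrightarrow> b \<in> AS \<Longrightarrow> F a b \<in> AS"
  by (auto simp: lin2_def dest: lin1D(1))

lemma lin3D: "lin3 F \<Longrightarrow> b \<in> AS \<Longrightarrow> c \<in> AS \<Longrightarrow> lin1 (\<lambda>a. F a b c)" "lin3 F \<Longrightarrow> a \<in> AS \<Longrightarrow> c \<in> AS \<Longrightarrow> lin1 (\<lambda>b. F a b c)"
   "lin3 F \<Longrightarrow> a \<in> AS \<Longrightarrow> b \<in> AS \<Longrightarrow> lin1 (F a b)" "lin3 F \<Longrightarrow> a \<in> AS \<Longrightarrow> b \<in> AS \<Longrightarrow> c \<in> AS \<Longrightarrow> F a b c \<in> AS"
  by (auto simp: lin3_def dest: lin2D)

definition d1 where "d1 k a b = a \<star> k b - k (a \<star> b) + k a \<star> b"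
  for k :: "('g \<Rightarrow>\<^sub>0 'v cpoly) \<Rightarrow> ('g \<Rightarrow>\<^sub>0 'v cpoly)"
definition d2 where "d2 F a b c = a \<star> F b c - F (a \<star> b) c + F a (b \<star> c) - F a b \<star> c"
  for F :: "('g \<Rightarrow>\<^sub>0 'v cpoly) \<Rightarrow> ('g \<Rightarrow>\<^sub>0 'v cpoly) \<Rightarrow> ('g \<Rightarrow>\<^sub>0 'v cpoly)"
definition d3 where "d3 F a b c e = a \<star> F b c e - F (a \<star> b) c e + F a (b \<star> c) e - F a b (c \<star> e) + F a b c \<star> e"
  for F :: "('g \<Rightarrow>\<^sub>0 'v cpoly) \<Rightarrow> ('g \<Rightarrow>\<^sub>0 'v cpoly) \<Rightarrow> ('g \<Rightarrow>\<^sub>0 'v cpoly) \<Rightarrow> ('g \<Rightarrow>\<^sub>0 'v cpoly)"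

lemma d1_lin2: assumes "lin1 k" shows "lin2 (d1 k)"
  unfolding lin2_def d1_def[abs_def]
  by (intro ballI conjI lin1_add lin1_diff lin1_mul lin1_comp[OF assms] lin1_id assms)
    (simp_all add: lin1D[OF assms])

lemma d2_lin3: assumes F: "lin2 F" shows "lin3 (d2 F)"
proof -
  note F1 = lin2D(1)[OF F] and F2 = lin2D(2)[OF F] and F3 [simp] = lin2D(3)[OF F]
  show ?thesis
    unfolding lin3_def lin2_def d2_def[abs_def]
    by (intro ballI conjI lin1_add lin1_diff lin1_mul F1 F2
        lin1_comp[OF F1] lin1_comp[OF F2] lin1_id) simp_all
qed

lemma d2_d1: assumes k: "lin1 k" and S: "a \<in> AS" "b \<in> AS" "c \<in> AS" shows "d2 (d1 k) a b c = 0"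
  using S by (simp add: d2_def d1_def mul_add mul_diff mul_assoc lin1D[OF k])

lemma d3_d2: assumes F: "lin2 F" and S: "a \<in> AS" "b \<in> AS" "c \<in> AS" "e \<in> AS" shows "d3 (d2 F) a b c e = 0"
  using S by (simp add: d3_def d2_def mul_add mul_diff mul_assoc lin2D[OF F])

text \<open>The circle product of two 2-cochains; the bracket of \<open>F\<close> and
  \<open>E\<close> is \<open>cp F E + cp E F\<close>.\<close>

definition cp where "cp F E a b c = F (E a b) c - F a (E b c)"
  for F E :: "('g \<Rightarrow>\<^sub>0 'v cpoly) \<Rightarrow> ('g \<Rightarrow>\<^sub>0 'v cpoly) \<Rightarrow> ('g \<Rightarrow>\<^sub>0 'v cpoly)"

definition cocy2 where "cocy2 F \<longleftrightarrow> lin2 F \<and> (\<forall>a\<in>AS. \<forall>b\<in>AS. \<forall>c\<in>AS. d2 F a b c = 0)"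

lemma cp_lin3: assumes F: "lin2 F" and E: "lin2 E" shows "lin3 (cp F E)"
proof -
  note D = lin2D[OF F] lin2D[OF E]
  show ?thesis
    unfolding lin3_def lin2_def cp_def[abs_def]
    by (intro ballI conjI lin1_diff lin1_comp[OF lin2D(1)[OF F]] lin1_comp[OF lin2D(2)[OF F]] D)
qed

text \<open>The two cup-product terms cancel, and the differential of \<open>cp F F\<close> reduces
  to five terms, each of which contains \<open>d2 F\<close>.\<close>

lemma cp_cocycle: assumes F: "cocy2 F" and S: "a \<in> AS" "b \<in> AS" "c \<in> AS" "e \<in> AS"
  shows "d3 (cp F F) a b c e = 0"
proof -
  have l: "lin2 F" and z: "\<And>a b c. a \<in> AS \<Longrightarrow> b \<in> AS \<Longrightarrow> c \<in> AS \<Longrightarrow> d2 F a b c = 0" using F by (auto simp: cocy2_def)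
  note l1 = lin1D[OF lin2D(1)[OF l]] and l2 = lin1D[OF lin2D(2)[OF l]] and l3 [simp] = lin2D(3)[OF l]
  have "F (d2 F a b c) e = 0" "F a (d2 F b c e) = 0"
    using S by (simp_all add: z l1(4) l2(4))
  moreover have "d3 (cp F F) a b c e = F (d2 F a b c) e + F a (d2 F b c e) + d2 F a (F b c) e - d2 F (F a b) c e - d2 F a b (F c e)"
    using S by (simp add: d3_def cp_def d2_def mul_add mul_diff l1 l2)
  ultimately show ?thesis using S by (simp add: z)
qed

text \<open>The bracket with a coboundary is a coboundary; the primitive on the right is the bracket
  of \<open>F\<close> with the 1-cochain \<open>k\<close>.\<close>

lemma cp_d1:
  assumes F: "cocy2 F" and k: "lin1 k" and S: "a \<in> AS" "b \<in> AS" "c \<in> AS"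
  shows "cp F (d1 k) a b c + cp (d1 k) F a b c = d2 (\<lambda>a b. F (k a) b + F a (k b) - k (F a b)) a b c"
proof -
  have l: "lin2 F" and z: "\<And>a b c. a \<in> AS \<Longrightarrow> b \<in> AS \<Longrightarrow> c \<in> AS \<Longrightarrow> d2 F a b c = 0" using F by (auto simp: cocy2_def)
  note l1 = lin1D[OF lin2D(1)[OF l]] and l2 = lin1D[OF lin2D(2)[OF l]] and l3 [simp] = lin2D(3)[OF l] and kD = lin1D[OF k]
  have "d2 (\<lambda>a b. F (k a) b + F a (k b) - k (F a b)) a b c - (cp F (d1 k) a b c + cp (d1 k) F a b c) =
     d2 F (k a) b c + d2 F a (k b) c + d2 F a b (k c) - k (d2 F a b c)"
    using S by (simp add: d2_def cp_def d1_def mul_add mul_diff l1 l2 kD)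
  also have "\<dots> = 0" using S by (simp add: z kD)
  finally show ?thesis by simp
qed

section \<open>Averaging cocycles over the group\<close>

definition slin :: "('v cpoly \<Rightarrow> ('g \<Rightarrow>\<^sub>0 'v cpoly)) \<Rightarrow> bool" where
  "slin \<Phi> \<longleftrightarrow> (\<forall>s\<in>S. \<Phi> s \<in> AS) \<and> (\<forall>s\<in>S. \<forall>t\<in>S. \<Phi> (s + t) = \<Phi> s + \<Phi> t) \<and> (\<forall>s\<in>S. \<forall>k. \<Phi> (pconst k * s) = sc k (\<Phi> s))"

lemma slinD: assumes "slin \<Phi>"
  shows "s \<in> S \<Longrightarrow> \<Phi> s \<in> AS" "s \<in> S \<Longrightarrow> t \<in> S \<Longrightarrow> \<Phi> (s + t) = \<Phi> s + \<Phi> t" "s \<in> S \<Longrightarrow> \<Phi> (pconst k * s) = sc k (\<Phi> s)" "\<Phi> 0 = 0"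
proof -
  show 1: "s \<in> S \<Longrightarrow> \<Phi> s \<in> AS" "s \<in> S \<Longrightarrow> t \<in> S \<Longrightarrow> \<Phi> (s + t) = \<Phi> s + \<Phi> t" "s \<in> S \<Longrightarrow> \<Phi> (pconst k * s) = sc k (\<Phi> s)" for s t k
    using assms by (auto simp: slin_def)
  show "\<Phi> 0 = 0" using 1(2)[of 0 0] by simp
qed

lemma slin_lin1: "lin1 k \<Longrightarrow> g \<in> CG \<Longrightarrow> slin (\<lambda>s. k (sg g s))"
  by (simp add: slin_def lin1D single_add sc_single[symmetric])

lemma slin_theta: "slin \<Phi> \<Longrightarrow> slin (\<lambda>s. \<Phi> (\<theta> g s))"
  by (simp add: slin_def th_add th_mult)

lemma slin_ops: "slin \<Phi> \<Longrightarrow> slin \<Psi> \<Longrightarrow> slin (\<lambda>s. \<Phi> s + \<Psi> s)" "slin \<Phi> \<Longrightarrow> slin \<Psi> \<Longrightarrow> slin (\<lambda>s. \<Phi> s - \<Psi> s)"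
  "slin \<Phi> \<Longrightarrow> slin (\<lambda>s. sc k (\<Phi> s))" "slin \<Phi> \<Longrightarrow> b \<in> AS \<Longrightarrow> slin (\<lambda>s. \<Phi> s \<star> b)"
  by (simp_all add: slin_def sc_add sc_diff sc_sc mul_add mul_sc mult.commute[of k])

lemma slin_sum: "(\<And>i. i \<in> I \<Longrightarrow> slin (\<Phi> i)) \<Longrightarrow> slin (\<lambda>s. \<Sum>i\<in>I. \<Phi> i s)"
  by (simp add: slin_def sum.distrib sc_sum)

lemma slin_plin: "plin f \<Longrightarrow> g \<in> CG \<Longrightarrow> slin (\<lambda>s. sg g (f s))"
  by (simp add: slin_def plinD single_add sc_single)

lemma AS_lookup: "a \<in> AS \<Longrightarrow> g \<in> CG \<Longrightarrow> Poly_Mapping.lookup a g \<in> S"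
  by (simp add: AS_iff)

definition ext :: "('g \<Rightarrow> 'v cpoly \<Rightarrow> ('g \<Rightarrow>\<^sub>0 'v cpoly)) \<Rightarrow> ('g \<Rightarrow>\<^sub>0 'v cpoly) \<Rightarrow> ('g \<Rightarrow>\<^sub>0 'v cpoly)" where
  "ext \<Phi> a = (\<Sum>g\<in>CG. \<Phi> g (Poly_Mapping.lookup a g))"

lemma ext_lin1: "(\<And>g. g \<in> CG \<Longrightarrow> slin (\<Phi> g)) \<Longrightarrow> lin1 (ext \<Phi>)"
  by (intro lin1I) (simp_all add: ext_def lookup_add lookup_sc slinD AS_lookup sum.distrib sc_sum)

lemma ext_single: assumes "\<And>g. g \<in> CG \<Longrightarrow> \<Phi> g 0 = 0" "g \<in> CG" shows "ext \<Phi> (sg g s) = \<Phi> g s"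
proof -
  have "ext \<Phi> (sg g s) = (\<Sum>h\<in>CG. if h = g then \<Phi> g s else 0)"
    unfolding ext_def by (rule sum.cong) (auto simp: lookup_single when_def assms(1))
  then show ?thesis using assms(2) fin by simp
qed

lemma ext2_lin2:
  assumes "\<And>g h t. g \<in> CG \<Longrightarrow> h \<in> CG \<Longrightarrow> t \<in> S \<Longrightarrow> slin (\<lambda>s. \<Phi> g s h t)"
    "\<And>g h s. g \<in> CG \<Longrightarrow> h \<in> CG \<Longrightarrow> s \<in> S \<Longrightarrow> slin (\<lambda>t. \<Phi> g s h t)"
  shows "lin2 (\<lambda>a b. ext (\<lambda>g s. ext (\<lambda>h t. \<Phi> g s h t) b) a)"
  unfolding lin2_def
proof (intro ballI conjI)
  fix a assume a: "a \<in> AS"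
  show "lin1 (\<lambda>b. ext (\<lambda>g s. ext (\<lambda>h t. \<Phi> g s h t) b) a)"
    unfolding ext_def[of _ a] by (intro lin1_sum ext_lin1 assms(2) AS_lookup a)
  show "lin1 (\<lambda>b. ext (\<lambda>g s. ext (\<lambda>h t. \<Phi> g s h t) a) b)"
    by (intro ext_lin1) (unfold ext_def, intro slin_sum assms(1) AS_lookup a)
qed

lemma ext2_single:
  assumes "\<And>g h t. g \<in> CG \<Longrightarrow> h \<in> CG \<Longrightarrow> t \<in> S \<Longrightarrow> slin (\<lambda>s. \<Phi> g s h t)"
    "\<And>g h s. g \<in> CG \<Longrightarrow> h \<in> CG \<Longrightarrow> s \<in> S \<Longrightarrow> slin (\<lambda>t. \<Phi> g s h t)"
    and g: "g \<in> CG" "h \<in> CG" "s \<in> S" "t \<in> S"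
  shows "ext (\<lambda>g s. ext (\<lambda>h t. \<Phi> g s h t) (sg h t)) (sg g s) = \<Phi> g s h t"
proof -
  have 1: "ext (\<lambda>h t. \<Phi> g s h t) (sg h t) = \<Phi> g s h t" if "g \<in> CG" "s \<in> S" for g s
    by (rule ext_single) (simp_all add: g slinD(4)[OF assms(2)] that)
  have "ext (\<lambda>g s. ext (\<lambda>h t. \<Phi> g s h t) (sg h t)) (sg g s) = ext (\<lambda>h t. \<Phi> g s h t) (sg h t)"
    by (rule ext_single[of "\<lambda>g s. ext (\<lambda>h t. \<Phi> g s h t) (sg h t)"])
      (simp_all add: 1 g slinD(4)[OF assms(1)])
  then show ?thesis using 1 g by simp
qed

text \<open>Extends \<open>s \<mapsto> \<Sum>\<^sub>k b\<^sub>k(s) k\<close> from \<open>S\<close>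
  to the skew group algebra so that it commutes with right multiplication by group elements.\<close>

definition E1 :: "('g \<Rightarrow> 'v cpoly \<Rightarrow> 'v cpoly) \<Rightarrow> ('g \<Rightarrow>\<^sub>0 'v cpoly) \<Rightarrow> ('g \<Rightarrow>\<^sub>0 'v cpoly)" where
  "E1 b = ext (\<lambda>g s. \<Sum>k\<in>CG. sg (k \<otimes> g) (b k s))"

lemma E1_lin1: "(\<And>k. k \<in> CG \<Longrightarrow> plin (b k)) \<Longrightarrow> lin1 (E1 b)"
  unfolding E1_def by (intro ext_lin1 slin_sum slin_plin) auto

lemma E1_single: "(\<And>k. k \<in> CG \<Longrightarrow> plin (b k)) \<Longrightarrow> g \<in> CG \<Longrightarrow> E1 b (sg g s) = (\<Sum>k\<in>CG. sg (k \<otimes> g) (b k s))"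
  unfolding E1_def by (rule ext_single) (simp_all add: plinD)

text \<open>The candidate for an inverse of restriction to \<open>S\<close>: in the arguments
  \<open>s g\<close> and \<open>t h\<close> the element \<open>g\<close> is moved past
  \<open>t\<close>, and all group elements are collected on the right.\<close>

definition E2 :: "('g \<Rightarrow> 'v cpoly \<Rightarrow> 'v cpoly \<Rightarrow> 'v cpoly) \<Rightarrow> ('g \<Rightarrow>\<^sub>0 'v cpoly) \<Rightarrow> ('g \<Rightarrow>\<^sub>0 'v cpoly) \<Rightarrow> ('g \<Rightarrow>\<^sub>0 'v cpoly)" where
  "E2 c a b = ext (\<lambda>g s. ext (\<lambda>h t. \<Sum>k\<in>CG. sg (k \<otimes> g \<otimes> h) (c k s (\<theta> g t))) b) a"

lemma E2:
  assumes c: "\<And>k t. k \<in> CG \<Longrightarrow> plin (\<lambda>s. c k s t)" "\<And>k s. k \<in> CG \<Longrightarrow> plin (c k s)"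
  shows "lin2 (E2 c)"
    and "g \<in> CG \<Longrightarrow> h \<in> CG \<Longrightarrow> s \<in> S \<Longrightarrow> t \<in> S \<Longrightarrow> E2 c (sg g s) (sg h t) = (\<Sum>k\<in>CG. sg (k \<otimes> g \<otimes> h) (c k s (\<theta> g t)))"
proof -
  have 1: "slin (\<lambda>s. \<Sum>k\<in>CG. sg (k \<otimes> g \<otimes> h) (c k s (\<theta> g t)))" if "g \<in> CG" "h \<in> CG" for g h t
    using that by (intro slin_sum slin_plin c) auto
  have 2: "slin (\<lambda>t. \<Sum>k\<in>CG. sg (k \<otimes> g \<otimes> h) (c k s (\<theta> g t)))" if "g \<in> CG" "h \<in> CG" for g h s
    using that by (intro slin_sum slin_plin plin_theta c) auto
  show "lin2 (E2 c)" unfolding E2_def[abs_def] by (rule ext2_lin2[OF 1 2])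
  show "g \<in> CG \<Longrightarrow> h \<in> CG \<Longrightarrow> s \<in> S \<Longrightarrow> t \<in> S \<Longrightarrow> E2 c (sg g s) (sg h t) = (\<Sum>k\<in>CG. sg (k \<otimes> g \<otimes> h) (c k s (\<theta> g t)))"
    unfolding E2_def by (rule ext2_single[OF 1 2])
qed

text \<open>The homotopy between the identity and conjugation by units, with the units kept
  abstract. The relations say that \<open>p0\<close>, \<open>p1\<close>, \<open>p2\<close> transport
  the string \<open>\<alpha>, \<beta>\<close> to \<open>a, b\<close>, with \<open>q2\<close> undoing
  \<open>p2\<close>. The identity combines the three cocycle identities obtained by inserting a
  \<open>p\<close> at each of the three places of the string.\<close>

lemma hom2_identity:
  assumes F: "cocy2 F" and AS: "a \<in> AS" "b \<in> AS" "p0 \<in> AS" "p1 \<in> AS" "p2 \<in> AS" "q1 \<in> AS" "q2 \<in> AS" "\<alpha> \<in> AS" "\<beta> \<in> AS"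
    and r: "a \<star> p1 = p0 \<star> \<alpha>" "b \<star> p2 = p1 \<star> \<beta>" "q1 \<star> b = \<beta> \<star> q2" "p2 \<star> q2 = ux \<one>"
  shows "a \<star> ((F p1 \<beta> - F b p2) \<star> q2) - (F p0 (\<alpha> \<star> \<beta>) - F (a \<star> b) p2) \<star> q2 + (F p0 \<alpha> - F a p1) \<star> q1 \<star> b
    = p0 \<star> F \<alpha> \<beta> \<star> q2 - F a b"
proof -
  have l: "lin2 F" and z: "\<And>a b c. a \<in> AS \<Longrightarrow> b \<in> AS \<Longrightarrow> c \<in> AS \<Longrightarrow> d2 F a b c = 0" using F by (auto simp: cocy2_def)
  note l3 [simp] = lin2D(3)[OF l]
  have "a \<star> ((F p1 \<beta> - F b p2) \<star> q2) = a \<star> (F p1 \<beta> - F b p2) \<star> q2" using AS by (simp add: mul_assoc)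
  moreover have "(F p0 \<alpha> - F a p1) \<star> q1 \<star> b = (F p0 \<alpha> - F a p1) \<star> \<beta> \<star> q2"
    using AS by (simp add: mul_assoc r)
  moreover have "F a b = F a b \<star> p2 \<star> q2" using AS mul_one(1)[of "F a b"] by (simp add: mul_assoc r)
  moreover have "a \<star> (F p1 \<beta> - F b p2) - (F p0 (\<alpha> \<star> \<beta>) - F (a \<star> b) p2) + (F p0 \<alpha> - F a p1) \<star> \<beta> - (p0 \<star> F \<alpha> \<beta> - F a b \<star> p2)
     = d2 F a p1 \<beta> - d2 F a b p2 - d2 F p0 \<alpha> \<beta>"
    unfolding d2_def r by (simp add: mul_add mul_diff)
  then have "a \<star> (F p1 \<beta> - F b p2) - (F p0 (\<alpha> \<star> \<beta>) - F (a \<star> b) p2) + (F p0 \<alpha> - F a p1) \<star> \<beta> = p0 \<star> F \<alpha> \<beta> - F a b \<star> p2"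
    using AS by (simp add: z)
  then have "(a \<star> (F p1 \<beta> - F b p2) - (F p0 (\<alpha> \<star> \<beta>) - F (a \<star> b) p2) + (F p0 \<alpha> - F a p1) \<star> \<beta>) \<star> q2 = (p0 \<star> F \<alpha> \<beta> - F a b \<star> p2) \<star> q2"
    by simp
  ultimately show ?thesis by (simp add: mul_add mul_diff)
qed

text \<open>The same homotopy one degree higher, from four cocycle identities with a
  \<open>p\<close> at each of the four places.\<close>

lemma hom3_identity:
  assumes F: "lin3 F" and z: "\<And>a b c e. a \<in> AS \<Longrightarrow> b \<in> AS \<Longrightarrow> c \<in> AS \<Longrightarrow> e \<in> AS \<Longrightarrow> d3 F a b c e = 0"
    and AS: "a \<in> AS" "b \<in> AS" "c \<in> AS" "p0 \<in> AS" "p1 \<in> AS" "p2 \<in> AS" "p3 \<in> AS" "q2 \<in> AS" "q3 \<in> AS" "\<alpha> \<in> AS" "\<beta> \<in> AS" "\<gamma> \<in> AS"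
    and r: "a \<star> p1 = p0 \<star> \<alpha>" "b \<star> p2 = p1 \<star> \<beta>" "c \<star> p3 = p2 \<star> \<gamma>" "q2 \<star> c = \<gamma> \<star> q3" "p3 \<star> q3 = ux \<one>"
  shows "a \<star> ((F p1 \<beta> \<gamma> - F b p2 \<gamma> + F b c p3) \<star> q3) - (F p0 (\<alpha> \<star> \<beta>) \<gamma> - F (a \<star> b) p2 \<gamma> + F (a \<star> b) c p3) \<star> q3
      + (F p0 \<alpha> (\<beta> \<star> \<gamma>) - F a p1 (\<beta> \<star> \<gamma>) + F a (b \<star> c) p3) \<star> q3 - (F p0 \<alpha> \<beta> - F a p1 \<beta> + F a b p2) \<star> q2 \<star> c
    = p0 \<star> F \<alpha> \<beta> \<gamma> \<star> q3 - F a b c"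
proof -
  note l3 [simp] = lin3D(4)[OF F]
  have "a \<star> ((F p1 \<beta> \<gamma> - F b p2 \<gamma> + F b c p3) \<star> q3) = a \<star> (F p1 \<beta> \<gamma> - F b p2 \<gamma> + F b c p3) \<star> q3" using AS by (simp add: mul_assoc)
  moreover have "(F p0 \<alpha> \<beta> - F a p1 \<beta> + F a b p2) \<star> q2 \<star> c = (F p0 \<alpha> \<beta> - F a p1 \<beta> + F a b p2) \<star> \<gamma> \<star> q3"
    using AS by (simp add: mul_assoc r)
  moreover have "F a b c = F a b c \<star> p3 \<star> q3" using AS mul_one(1)[of "F a b c"] by (simp add: mul_assoc r)
  moreover have "a \<star> (F p1 \<beta> \<gamma> - F b p2 \<gamma> + F b c p3) - (F p0 (\<alpha> \<star> \<beta>) \<gamma> - F (a \<star> b) p2 \<gamma> + F (a \<star> b) c p3)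
      + (F p0 \<alpha> (\<beta> \<star> \<gamma>) - F a p1 (\<beta> \<star> \<gamma>) + F a (b \<star> c) p3) - (F p0 \<alpha> \<beta> - F a p1 \<beta> + F a b p2) \<star> \<gamma>
      - (p0 \<star> F \<alpha> \<beta> \<gamma> - F a b c \<star> p3)
     = d3 F a p1 \<beta> \<gamma> - d3 F a b p2 \<gamma> + d3 F a b c p3 - d3 F p0 \<alpha> \<beta> \<gamma>"
    unfolding d3_def r by (simp add: mul_add mul_diff)
  then have "a \<star> (F p1 \<beta> \<gamma> - F b p2 \<gamma> + F b c p3) - (F p0 (\<alpha> \<star> \<beta>) \<gamma> - F (a \<star> b) p2 \<gamma> + F (a \<star> b) c p3)
      + (F p0 \<alpha> (\<beta> \<star> \<gamma>) - F a p1 (\<beta> \<star> \<gamma>) + F a (b \<star> c) p3) - (F p0 \<alpha> \<beta> - F a p1 \<beta> + F a b p2) \<star> \<gamma> = p0 \<star> F \<alpha> \<beta> \<gamma> - F a b c \<star> p3"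
    using AS by (simp add: z)
  then have "(a \<star> (F p1 \<beta> \<gamma> - F b p2 \<gamma> + F b c p3) - (F p0 (\<alpha> \<star> \<beta>) \<gamma> - F (a \<star> b) p2 \<gamma> + F (a \<star> b) c p3)
      + (F p0 \<alpha> (\<beta> \<star> \<gamma>) - F a p1 (\<beta> \<star> \<gamma>) + F a (b \<star> c) p3) - (F p0 \<alpha> \<beta> - F a p1 \<beta> + F a b p2) \<star> \<gamma>) \<star> q3 = (p0 \<star> F \<alpha> \<beta> \<gamma> - F a b c \<star> p3) \<star> q3"
    by simp
  ultimately show ?thesis by (simp add: mul_add mul_diff)
qed

lemma inv_cancel [simp]: "g \<in> CG \<Longrightarrow> x \<in> CG \<Longrightarrow> g \<otimes> (inv g \<otimes> x) = x" "g \<in> CG \<Longrightarrow> x \<in> CG \<Longrightarrow> inv g \<otimes> (g \<otimes> x) = x"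
  by (simp_all add: m_assoc[symmetric])

lemma inc_mult: "s \<in> S \<Longrightarrow> t \<in> S \<Longrightarrow> inc s \<star> inc t = inc (s * t)"
  by (simp add: mul_single theta_one)

lemma sc_card: "sc (1 / of_nat (card CG)) (\<Sum>x\<in>CG. a) = a"
proof -
  have "(\<Sum>x\<in>CG. a) = sc (of_nat (card CG)) a"
    by (rule poly_mapping_eqI) (simp add: lookup_sum lookup_sc pconst_of_nat)
  then show ?thesis using card_pos by (simp add: sc_sc)
qed

definition cmp :: "(('g \<Rightarrow>\<^sub>0 'v cpoly) \<Rightarrow> ('g \<Rightarrow>\<^sub>0 'v cpoly) \<Rightarrow> ('g \<Rightarrow>\<^sub>0 'v cpoly)) \<Rightarrow> 'g \<Rightarrow> 'v cpoly \<Rightarrow> 'v cpoly \<Rightarrow> 'v cpoly" where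
  "cmp F k s t = Poly_Mapping.lookup (F (inc (th id s)) (inc (th id t))) k"

lemma cmp_plin: assumes F: "lin2 F" and k: "k \<in> CG" shows "plin (\<lambda>s. cmp F k s t)" "plin (cmp F k s)"
proof -
  have "cmp F k s t \<in> S" for s t
    unfolding cmp_def by (intro AS_lookup lin2D(3)[OF F] AS_single k) auto
  then show "plin (\<lambda>s. cmp F k s t)" "plin (cmp F k s)"
    by (simp_all add: plin_def cmp_def th_add th_mult single_add sc_single[symmetric] lin1D[OF lin2D(1)[OF F]] lin1D[OF lin2D(2)[OF F]]
       lookup_add lookup_sc)
qed

lemma lookup_mul_inc:
  assumes "a \<in> AS" "s \<in> S" "k \<in> CG"
  shows "Poly_Mapping.lookup (inc s \<star> a) k = s * Poly_Mapping.lookup a k"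
    "Poly_Mapping.lookup (a \<star> inc s) k = Poly_Mapping.lookup a k * \<theta> k s"
  using assms
  by (induction a rule: AS_induct) (auto simp: mul_single mul_add theta_one lookup_add lookup_single when_def distrib_left distrib_right)

lemma cmp_coc: assumes F: "cocy2 F" and k: "k \<in> CG" shows "coc k (cmp F k)"
proof -
  have l: "lin2 F" and z: "\<And>a b c. a \<in> AS \<Longrightarrow> b \<in> AS \<Longrightarrow> c \<in> AS \<Longrightarrow> d2 F a b c = 0" using F by (auto simp: cocy2_def)
  have "s * cmp F k t u - cmp F k (s * t) u + cmp F k s (t * u) - cmp F k s t * \<theta> k u = 0" if S: "s \<in> S" "t \<in> S" "u \<in> S" for s t u
  proof -
    have "Poly_Mapping.lookup (d2 F (inc s) (inc t) (inc u)) k = 0" using z S by simp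
    then show ?thesis
      using S k by (simp add: d2_def cmp_def inc_mult lookup_add lookup_minus lookup_mul_inc lin2D(3)[OF l])
  qed
  then show ?thesis unfolding coc_def using cmp_plin[OF l k] by blast
qed

lemma conj_bij: assumes x: "x \<in> CG" shows "bij_betw (\<lambda>k. x \<otimes> k \<otimes> inv x) CG CG"
  by (rule bij_betw_byWitness[where f' = "\<lambda>k. inv x \<otimes> k \<otimes> x"]) (use x in \<open>auto simp: m_assoc\<close>)

text \<open>The homotopy is used with \<open>p0 = x\<close>, \<open>p1 = g\<^sup>-\<^sup>1 x\<close>
  and \<open>p2 = h\<^sup>-\<^sup>1 g\<^sup>-\<^sup>1 x\<close>, which transports
  \<open>s g, t h\<close> to arguments in \<open>S\<close>. For a single \<open>x\<close> it does
  not close up, because the differential also meets the base point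
  \<open>g\<^sup>-\<^sup>1 x\<close>; the mean over all \<open>x\<close> absorbs this shift and
  turns the transported values into \<open>avg (cmp F)\<close>.\<close>

theorem homotopy2:
  assumes F: "cocy2 F"
  shows "\<exists>H. lin1 H \<and> (\<forall>a\<in>AS. \<forall>b\<in>AS. F a b = E2 (avg (cmp F)) a b + d1 H a b)"
proof -
  have l: "lin2 F" using F by (simp add: cocy2_def)
  note l1 = lin2D(1)[OF l] and l2 = lin2D(2)[OF l] and l3 [simp] = lin2D(3)[OF l]
  define W where "W g s x = (F (ux x) (inc (\<theta> (inv x) s)) - F (sg g s) (ux (inv g \<otimes> x))) \<star> ux (inv x \<otimes> g)" for g s x
  define hh where "hh g s = sc (1 / of_nat (card CG)) (\<Sum>x\<in>CG. W g s x)" for g s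
  have sl: "slin (hh g)" if g: "g \<in> CG" for g
    unfolding hh_def[abs_def] W_def
    by (intro slin_ops slin_sum slin_lin1[OF l1] slin_theta[of "\<lambda>s. F (ux _) (inc s)"] slin_lin1[OF l2]) (use g in simp_all)
  define H where "H = ext hh"
  have H: "lin1 H" unfolding H_def by (rule ext_lin1[OF sl])
  have Hs: "H (sg g s) = hh g s" if "g \<in> CG" for g s unfolding H_def by (rule ext_single[of hh, OF slinD(4)[OF sl] that])
  note cF = avg_coc[OF cmp_coc[OF F]]
  note E = E2[of "avg (cmp F)", OF cocD(1)[OF cF] cocD(2)[OF cF]]
  have single: "d1 H (sg g s) (sg h t) = E2 (avg (cmp F)) (sg g s) (sg h t) - F (sg g s) (sg h t)"
    if g: "g \<in> CG" "h \<in> CG" and s: "s \<in> S" "t \<in> S" for g h s t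
  proof -
    let ?N = "1 / of_nat (card CG) :: complex"
    let ?a = "sg g s" and ?b = "sg h t"
    have ab: "?a \<star> ?b = sg (g \<otimes> h) (s * \<theta> g t)" by (rule mul_single)
    have "d1 H ?a ?b = sc ?N ((\<Sum>x\<in>CG. ?a \<star> W h t x) - (\<Sum>x\<in>CG. W (g \<otimes> h) (s * \<theta> g t) x) + (\<Sum>x\<in>CG. W g s x \<star> ?b))"
      using g s by (simp add: d1_def ab Hs hh_def mul_sc mul_sum sc_add sc_diff)
    \<comment> \<open>After multiplication by \<open>s g\<close> the base point of this term is
      \<open>g\<^sup>-\<^sup>1 x\<close>; the shift of the summation index makes the three sums
      comparable term by term.\<close>
    also have "(\<Sum>x\<in>CG. ?a \<star> W h t x) = (\<Sum>x\<in>CG. ?a \<star> W h t (inv g \<otimes> x))"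
      by (rule sum.reindex_bij_betw[OF bij_left_mult, symmetric]) (use g in simp)
    also have "(\<Sum>x\<in>CG. ?a \<star> W h t (inv g \<otimes> x)) - (\<Sum>x\<in>CG. W (g \<otimes> h) (s * \<theta> g t) x) + (\<Sum>x\<in>CG. W g s x \<star> ?b)
      = (\<Sum>x\<in>CG. ux x \<star> F (inc (\<theta> (inv x) s)) (inc (\<theta> (inv x \<otimes> g) t)) \<star> ux (inv x \<otimes> g \<otimes> h) - F ?a ?b)"
      unfolding sum.distrib[symmetric] sum_subtractf[symmetric]
    proof (rule sum.cong[OF refl])
      fix x assume x: "x \<in> CG"
      have e1: "inv (inv g \<otimes> x) = inv x \<otimes> g" using g x by (simp add: inv_mult_group)
      have e2: "inv (g \<otimes> h) \<otimes> x = inv h \<otimes> (inv g \<otimes> x)" using g x by (simp add: inv_mult_group m_assoc)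
      have e3: "inv x \<otimes> (g \<otimes> h) = inv x \<otimes> g \<otimes> h" using g x by (simp add: m_assoc)
      have e4: "inc (\<theta> (inv x) (s * \<theta> g t)) = inc (\<theta> (inv x) s) \<star> inc (\<theta> (inv x \<otimes> g) t)"
        using g x by (simp add: inc_mult th_mult theta_mult)
      have "?a \<star> ((F (ux (inv g \<otimes> x)) (inc (\<theta> (inv x \<otimes> g) t)) - F ?b (ux (inv h \<otimes> (inv g \<otimes> x)))) \<star> ux (inv x \<otimes> g \<otimes> h))
        - (F (ux x) (inc (\<theta> (inv x) s) \<star> inc (\<theta> (inv x \<otimes> g) t)) - F (?a \<star> ?b) (ux (inv h \<otimes> (inv g \<otimes> x)))) \<star> ux (inv x \<otimes> g \<otimes> h)
        + (F (ux x) (inc (\<theta> (inv x) s)) - F ?a (ux (inv g \<otimes> x))) \<star> ux (inv x \<otimes> g) \<star> ?b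
        = ux x \<star> F (inc (\<theta> (inv x) s)) (inc (\<theta> (inv x \<otimes> g) t)) \<star> ux (inv x \<otimes> g \<otimes> h) - F ?a ?b"
      proof (rule hom2_identity[OF F])
        have "inv g \<otimes> x \<otimes> (inv x \<otimes> g) = \<one>" "inv h \<otimes> (inv g \<otimes> x) \<otimes> (inv x \<otimes> g \<otimes> h) = \<one>"
          using g x by (simp_all add: m_assoc)
        then show "?b \<star> ux (inv h \<otimes> (inv g \<otimes> x)) = ux (inv g \<otimes> x) \<star> inc (\<theta> (inv x \<otimes> g) t)"
          "ux (inv h \<otimes> (inv g \<otimes> x)) \<star> ux (inv x \<otimes> g \<otimes> h) = ux \<one>"
          using g x s by (simp_all add: mul_single theta_mult theta_one)
        show "?a \<star> ux (inv g \<otimes> x) = ux x \<star> inc (\<theta> (inv x) s)"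
          using g x s by (simp add: mul_single theta_mult theta_one)
        show "ux (inv x \<otimes> g) \<star> ?b = inc (\<theta> (inv x \<otimes> g) t) \<star> ux (inv x \<otimes> g \<otimes> h)"
          using g x s by (simp add: mul_single)
      qed (use g x s in simp_all)
      then show "?a \<star> W h t (inv g \<otimes> x) - W (g \<otimes> h) (s * \<theta> g t) x + W g s x \<star> ?b
        = ux x \<star> F (inc (\<theta> (inv x) s)) (inc (\<theta> (inv x \<otimes> g) t)) \<star> ux (inv x \<otimes> g \<otimes> h) - F ?a ?b"
        unfolding W_def e1 e2 e3 e4 ab[symmetric] .
    qed
    also have "sc ?N \<dots> = sc ?N (\<Sum>x\<in>CG. ux x \<star> F (inc (\<theta> (inv x) s)) (inc (\<theta> (inv x \<otimes> g) t)) \<star> ux (inv x \<otimes> g \<otimes> h)) - F ?a ?b"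
      by (simp only: sum_subtractf sc_diff sc_card)
    also have "(\<Sum>x\<in>CG. ux x \<star> F (inc (\<theta> (inv x) s)) (inc (\<theta> (inv x \<otimes> g) t)) \<star> ux (inv x \<otimes> g \<otimes> h))
      = (\<Sum>x\<in>CG. \<Sum>k\<in>CG. sg (k \<otimes> g \<otimes> h) (\<theta> x (cmp F (inv x \<otimes> k \<otimes> x) (\<theta> (inv x) s) (\<theta> (inv x) (\<theta> g t)))))"
    proof (rule sum.cong[OF refl])
      fix x assume x: "x \<in> CG"
      have "F (inc (\<theta> (inv x) s)) (inc (\<theta> (inv x \<otimes> g) t)) = (\<Sum>k\<in>CG. sg k (cmp F k (\<theta> (inv x) s) (\<theta> (inv x) (\<theta> g t))))"
        using AS_expand[OF l3, of "inc (\<theta> (inv x) s)" "inc (\<theta> (inv x \<otimes> g) t)"] g x by (simp add: cmp_def theta_mult)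
      then have "ux x \<star> F (inc (\<theta> (inv x) s)) (inc (\<theta> (inv x \<otimes> g) t)) \<star> ux (inv x \<otimes> g \<otimes> h)
         = (\<Sum>k\<in>CG. sg (x \<otimes> k \<otimes> (inv x \<otimes> g \<otimes> h)) (\<theta> x (cmp F k (\<theta> (inv x) s) (\<theta> (inv x) (\<theta> g t)))))"
        by (simp add: mul_sum mul_single)
      also have "\<dots> = (\<Sum>k\<in>CG. sg (x \<otimes> k \<otimes> inv x \<otimes> g \<otimes> h) (\<theta> x (cmp F (inv x \<otimes> (x \<otimes> k \<otimes> inv x) \<otimes> x) (\<theta> (inv x) s) (\<theta> (inv x) (\<theta> g t)))))"
        by (rule sum.cong) (use g x in \<open>simp_all add: m_assoc\<close>)
      also have "\<dots> = (\<Sum>k\<in>CG. sg (k \<otimes> g \<otimes> h) (\<theta> x (cmp F (inv x \<otimes> k \<otimes> x) (\<theta> (inv x) s) (\<theta> (inv x) (\<theta> g t)))))"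
        by (rule sum.reindex_bij_betw[OF conj_bij[OF x]])
      finally show "ux x \<star> F (inc (\<theta> (inv x) s)) (inc (\<theta> (inv x \<otimes> g) t)) \<star> ux (inv x \<otimes> g \<otimes> h) = \<dots>" .
    qed
    also have "sc ?N \<dots> = E2 (avg (cmp F)) ?a ?b"
    proof -
      have sgsum: "(\<Sum>x\<in>CG. sg m (f x)) = sg m (\<Sum>x\<in>CG. f x)" for m f
        by (rule poly_mapping_eqI) (auto simp: lookup_sum lookup_single when_def)
      show ?thesis using g s by (subst sum.swap) (simp add: E(2) sgsum sc_sum sc_single avg_def)
    qed
    finally show ?thesis .
  qed
  have "E2 (avg (cmp F)) a b - F a b = d1 H a b" if a: "a \<in> AS" and b: "b \<in> AS" for a b
  proof (rule lin1_eqI[OF _ _ a])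
    show "lin1 (\<lambda>a. E2 (avg (cmp F)) a b - F a b)"
      by (intro lin1_diff lin2D(1)[OF E(1)] l1 b)
    show "lin1 (\<lambda>a. d1 H a b)"
      by (rule lin2D(1)[OF d1_lin2[OF H] b])
    fix g s assume g: "g \<in> CG" "s \<in> S"
    show "E2 (avg (cmp F)) (sg g s) b - F (sg g s) b = d1 H (sg g s) b"
    proof (rule lin1_eqI[OF _ _ b])
      show "lin1 (\<lambda>b. E2 (avg (cmp F)) (sg g s) b - F (sg g s) b)"
        using g by (intro lin1_diff lin2D(2)[OF E(1)] l2; simp)
      show "lin1 (d1 H (sg g s))"
        using g by (intro lin2D(2)[OF d1_lin2[OF H]]) simp
    qed (simp add: single g)
  qed
  then have "F a b = E2 (avg (cmp F)) a b + d1 (\<lambda>a. - H a) a b" if "a \<in> AS" "b \<in> AS" for a b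
    using that by (simp add: d1_def mul_uminus algebra_simps)
  then show ?thesis using lin1_uminus[OF H] by blast
qed

text \<open>A cocycle in degree three is determined up to coboundary by its restriction to
  \<open>S\<close>: the averaged homotopy leaves only transported values on arguments in
  \<open>S\<close>, and these vanish by hypothesis.\<close>

theorem homotopy3:
  assumes F: "lin3 F" and z: "\<And>a b c e. a \<in> AS \<Longrightarrow> b \<in> AS \<Longrightarrow> c \<in> AS \<Longrightarrow> e \<in> AS \<Longrightarrow> d3 F a b c e = 0"
    and v: "\<And>s t u. s \<in> S \<Longrightarrow> t \<in> S \<Longrightarrow> u \<in> S \<Longrightarrow> F (inc s) (inc t) (inc u) = 0"
  shows "\<exists>H. lin2 H \<and> (\<forall>a\<in>AS. \<forall>b\<in>AS. \<forall>c\<in>AS. F a b c = d2 H a b c)"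
proof -
  note l1 = lin3D(1)[OF F] and l2 = lin3D(2)[OF F] and l3 = lin3D(3)[OF F] and l4 [simp] = lin3D(4)[OF F]
  define W where "W g s h t x = (F (ux x) (inc (\<theta> (inv x) s)) (inc (\<theta> (inv x \<otimes> g) t))
     - F (sg g s) (ux (inv g \<otimes> x)) (inc (\<theta> (inv x \<otimes> g) t)) + F (sg g s) (sg h t) (ux (inv h \<otimes> (inv g \<otimes> x)))) \<star> ux (inv x \<otimes> g \<otimes> h)" for g s h t x
  define hh where "hh g s h t = sc (1 / of_nat (card CG)) (\<Sum>x\<in>CG. W g s h t x)" for g s h t
  have sl1: "slin (\<lambda>s. hh g s h t)" if g: "g \<in> CG" "h \<in> CG" "t \<in> S" for g h t
    unfolding hh_def[abs_def] W_def
    by (intro slin_ops slin_sum slin_lin1[OF l1] slin_theta[of "\<lambda>s. F (ux _) (inc s) _"] slin_lin1[OF l2]) (use g in simp_all)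
  have sl2: "slin (\<lambda>t. hh g s h t)" if g: "g \<in> CG" "h \<in> CG" "s \<in> S" for g h s
    unfolding hh_def[abs_def] W_def
    by (intro slin_ops slin_sum slin_lin1[OF l2] slin_theta[of "\<lambda>s. F (ux _) _ (inc s)"] slin_theta[of "\<lambda>s. F (sg _ _) _ (inc s)"] slin_lin1[OF l3])
      (use g in simp_all)
  define H where "H a b = ext (\<lambda>g s. ext (\<lambda>h t. hh g s h t) b) a" for a b
  have H: "lin2 H" unfolding H_def[abs_def] by (rule ext2_lin2[OF sl1 sl2])
  have Hs: "H (sg g s) (sg h t) = hh g s h t" if "g \<in> CG" "h \<in> CG" "s \<in> S" "t \<in> S" for g s h t
    unfolding H_def by (rule ext2_single[OF sl1 sl2 that])
  have single: "d2 H (sg g s) (sg h t) (sg k u) = - F (sg g s) (sg h t) (sg k u)"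
    if g: "g \<in> CG" "h \<in> CG" "k \<in> CG" and s: "s \<in> S" "t \<in> S" "u \<in> S" for g h k s t u
  proof -
    let ?N = "1 / of_nat (card CG) :: complex"
    let ?a = "sg g s" and ?b = "sg h t" and ?c = "sg k u"
    have ab: "?a \<star> ?b = sg (g \<otimes> h) (s * \<theta> g t)" and bc: "?b \<star> ?c = sg (h \<otimes> k) (t * \<theta> h u)" by (rule mul_single)+
    have "d2 H ?a ?b ?c = sc ?N ((\<Sum>x\<in>CG. ?a \<star> W h t k u x) - (\<Sum>x\<in>CG. W (g \<otimes> h) (s * \<theta> g t) k u x)
        + (\<Sum>x\<in>CG. W g s (h \<otimes> k) (t * \<theta> h u) x) - (\<Sum>x\<in>CG. W g s h t x \<star> ?c))"
      using g s by (simp add: d2_def ab bc Hs hh_def mul_sc mul_sum sc_add sc_diff)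
    also have "(\<Sum>x\<in>CG. ?a \<star> W h t k u x) = (\<Sum>x\<in>CG. ?a \<star> W h t k u (inv g \<otimes> x))"
      by (rule sum.reindex_bij_betw[OF bij_left_mult, symmetric]) (use g in simp)
    also have "(\<Sum>x\<in>CG. ?a \<star> W h t k u (inv g \<otimes> x)) - (\<Sum>x\<in>CG. W (g \<otimes> h) (s * \<theta> g t) k u x)
        + (\<Sum>x\<in>CG. W g s (h \<otimes> k) (t * \<theta> h u) x) - (\<Sum>x\<in>CG. W g s h t x \<star> ?c)
      = (\<Sum>x\<in>CG. - F ?a ?b ?c)"
      unfolding sum.distrib[symmetric] sum_subtractf[symmetric]
    proof (rule sum.cong[OF refl])
      fix x assume x: "x \<in> CG"
      let ?p3 = "inv k \<otimes> (inv h \<otimes> (inv g \<otimes> x))"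
      let ?\<alpha> = "inc (\<theta> (inv x) s)" and ?\<beta> = "inc (\<theta> (inv x \<otimes> g) t)" and ?\<gamma> = "inc (\<theta> (inv x \<otimes> g \<otimes> h) u)"
      have e1: "inv (inv g \<otimes> x) = inv x \<otimes> g" using g x by (simp add: inv_mult_group)
      have e2: "inv (g \<otimes> h) \<otimes> x = inv h \<otimes> (inv g \<otimes> x)" using g x by (simp add: inv_mult_group m_assoc)
      have e2': "inv (h \<otimes> k) \<otimes> (inv g \<otimes> x) = ?p3" using g x by (simp add: inv_mult_group m_assoc)
      have e3: "inv x \<otimes> (g \<otimes> h) = inv x \<otimes> g \<otimes> h" "inv x \<otimes> g \<otimes> (h \<otimes> k) = inv x \<otimes> g \<otimes> h \<otimes> k" using g x by (simp_all add: m_assoc)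
      have e4: "inc (\<theta> (inv x) (s * \<theta> g t)) = ?\<alpha> \<star> ?\<beta>" "inc (\<theta> (inv x \<otimes> g) (t * \<theta> h u)) = ?\<beta> \<star> ?\<gamma>"
        using g x by (simp_all add: inc_mult th_mult theta_mult)
      have "?a \<star> ((F (ux (inv g \<otimes> x)) ?\<beta> ?\<gamma> - F ?b (ux (inv h \<otimes> (inv g \<otimes> x))) ?\<gamma> + F ?b ?c (ux ?p3)) \<star> ux (inv x \<otimes> g \<otimes> h \<otimes> k))
        - (F (ux x) (?\<alpha> \<star> ?\<beta>) ?\<gamma> - F (?a \<star> ?b) (ux (inv h \<otimes> (inv g \<otimes> x))) ?\<gamma> + F (?a \<star> ?b) ?c (ux ?p3)) \<star> ux (inv x \<otimes> g \<otimes> h \<otimes> k)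
        + (F (ux x) ?\<alpha> (?\<beta> \<star> ?\<gamma>) - F ?a (ux (inv g \<otimes> x)) (?\<beta> \<star> ?\<gamma>) + F ?a (?b \<star> ?c) (ux ?p3)) \<star> ux (inv x \<otimes> g \<otimes> h \<otimes> k)
        - (F (ux x) ?\<alpha> ?\<beta> - F ?a (ux (inv g \<otimes> x)) ?\<beta> + F ?a ?b (ux (inv h \<otimes> (inv g \<otimes> x)))) \<star> ux (inv x \<otimes> g \<otimes> h) \<star> ?c
        = ux x \<star> F ?\<alpha> ?\<beta> ?\<gamma> \<star> ux (inv x \<otimes> g \<otimes> h \<otimes> k) - F ?a ?b ?c"
      proof (rule hom3_identity[OF F z])
        have "inv g \<otimes> x \<otimes> (inv x \<otimes> g) = \<one>" "inv h \<otimes> (inv g \<otimes> x) \<otimes> (inv x \<otimes> g \<otimes> h) = \<one>"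
          "?p3 \<otimes> (inv x \<otimes> g \<otimes> h \<otimes> k) = \<one>"
          using g x by (simp_all add: m_assoc)
        then show "?b \<star> ux (inv h \<otimes> (inv g \<otimes> x)) = ux (inv g \<otimes> x) \<star> ?\<beta>"
          "?c \<star> ux ?p3 = ux (inv h \<otimes> (inv g \<otimes> x)) \<star> ?\<gamma>"
          "ux ?p3 \<star> ux (inv x \<otimes> g \<otimes> h \<otimes> k) = ux \<one>"
          using g x s by (simp_all add: mul_single theta_mult theta_one)
        show "?a \<star> ux (inv g \<otimes> x) = ux x \<star> ?\<alpha>"
          using g x s by (simp add: mul_single theta_mult theta_one)
        show "ux (inv x \<otimes> g \<otimes> h) \<star> ?c = ?\<gamma> \<star> ux (inv x \<otimes> g \<otimes> h \<otimes> k)"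
          using g x s by (simp add: mul_single)
      qed (use g x s in simp_all)
      moreover have "F ?\<alpha> ?\<beta> ?\<gamma> = 0" by (rule v) auto
      ultimately show "?a \<star> W h t k u (inv g \<otimes> x) - W (g \<otimes> h) (s * \<theta> g t) k u x
        + W g s (h \<otimes> k) (t * \<theta> h u) x - W g s h t x \<star> ?c = - F ?a ?b ?c"
        unfolding W_def e1 e2 e2' e3 e4 ab[symmetric] bc[symmetric] by simp
    qed
    finally show ?thesis by (simp only: sc_card)
  qed
  have "d2 H a b c = - F a b c" if a: "a \<in> AS" and b: "b \<in> AS" and c: "c \<in> AS" for a b c
  proof (rule lin1_eqI[OF _ _ a])
    note D = d2_lin3[OF H]
    show "lin1 (\<lambda>a. d2 H a b c)" "lin1 (\<lambda>a. - F a b c)"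
      by (intro lin1_uminus lin3D(1)[OF D] l1 b c)+
    fix g s assume g: "g \<in> CG" "s \<in> S"
    then have gs: "sg g s \<in> AS" by simp
    show "d2 H (sg g s) b c = - F (sg g s) b c"
    proof (rule lin1_eqI[OF _ _ b])
      show "lin1 (\<lambda>b. d2 H (sg g s) b c)" "lin1 (\<lambda>b. - F (sg g s) b c)"
        by (intro lin1_uminus lin3D(2)[OF D] l2 gs c)+
      fix h t assume h: "h \<in> CG" "t \<in> S"
      then have ht: "sg h t \<in> AS" by simp
      show "d2 H (sg g s) (sg h t) c = - F (sg g s) (sg h t) c"
      proof (rule lin1_eqI[OF _ _ c])
        show "lin1 (d2 H (sg g s) (sg h t))" "lin1 (\<lambda>c. - F (sg g s) (sg h t) c)"
          by (intro lin1_uminus lin3D(3)[OF D] l3 gs ht)+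
      qed (rule single; use g h in simp)
    qed
  qed
  then have "F a b c = d2 (\<lambda>a b. - H a b) a b c" if "a \<in> AS" "b \<in> AS" "c \<in> AS" for a b c
    using that by (simp add: d2_def mul_uminus algebra_simps)
  moreover have "lin2 (\<lambda>a b. - H a b)" unfolding lin2_def by (intro ballI conjI lin1_uminus lin2D[OF H])
  ultimately show ?thesis by blast
qed

section \<open>The bracket on the skew group algebra\<close>

text \<open>The corrections of the components are chosen independently, and \<open>E1\<close>
  bundles them into one cochain whose coboundary acts on all components at once. Components at
  elements that act trivially become zero. Averaging restores the invariance that independent
  choices destroy, and \<open>homotopy2\<close> shows that the class is kept.\<close>

lemma good_representative:
  assumes F: "cocy2 F"
    and triv: "\<And>g. g \<in> CG \<Longrightarrow> (\<And>v. \<rho> g v = v) \<Longrightarrow> \<exists>b. plin b \<and> (\<forall>s\<in>S. \<forall>t\<in>S. cmp F g s t = dcob g b s t)"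
  shows "\<exists>c K. skew_family G scl Bs \<rho> c \<and> lin1 K \<and> (\<forall>a\<in>AS. \<forall>b\<in>AS. F a b = E2 c a b + d1 K a b)"
proof -
  have l: "lin2 F" using F by (simp add: cocy2_def)
  let ?nt = "\<lambda>g. \<exists>v. \<rho> g v \<noteq> v"
  let ?c = "\<lambda>g b s t. cmp F g s t + dcob g b (th id s) (th id t)"
  have pjF: "pjinv (cmp F g)" for g by (simp add: pjinv_def cmp_def)
  define good where "good g b \<longleftrightarrow> plin b \<and> coc g (?c g b) \<and> radial (?c g b) \<and> pjinv (?c g b) \<and> (?nt g \<longrightarrow> harm g (om (?c g b))) \<and>
      (\<not> ?nt g \<longrightarrow> (\<forall>s t. ?c g b s t = 0))" for g b
  have ex: "\<exists>b. good g b" if g: "g \<in> CG" for g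
  proof (cases "?nt g")
    case True
    obtain b c' where b: "plin b" and c': "c' = ?c g b" and r: "coc g c'" "radial c'" "pjinv c'" "harm g (om c')"
      using normal_form[OF g cmp_coc[OF F g] pjF True] by (elim exE conjE) (rule that)
    have "good g b"
      unfolding good_def using b r[unfolded c'] True by (intro conjI impI) simp_all
    then show ?thesis by (intro exI)
  next
    case False
    then obtain b where b: "plin b" "\<forall>s\<in>S. \<forall>t\<in>S. cmp F g s t = dcob g b s t" using triv[OF g] by blast
    have b': "plin (\<lambda>s. - b s)" using b(1) by (simp add: plin_def)
    have z: "?c g (\<lambda>s. - b s) s t = 0" for s t
    proof -
      have "cmp F g s t = cmp F g (th id s) (th id t)" by (simp add: cmp_def)
      also have "\<dots> = dcob g b (th id s) (th id t)" using b(2) by simp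
      finally show ?thesis by (simp add: dcob_def)
    qed
    have "coc g (\<lambda>s t. 0)" "radial (\<lambda>s t. 0)" "pjinv (\<lambda>s t. 0)"
      by (simp_all add: coc_def plin_def radial_def pjinv_def)
    then have "good g (\<lambda>s. - b s)" unfolding good_def z using False b' by (intro conjI) simp_all
    then show ?thesis by (intro exI)
  qed
  define bb where "bb g = (SOME b. good g b)" for g
  have bb: "plin (bb g) \<and> coc g (?c g (bb g)) \<and> radial (?c g (bb g)) \<and> pjinv (?c g (bb g)) \<and> (?nt g \<longrightarrow> harm g (om (?c g (bb g)))) \<and>
      (\<not> ?nt g \<longrightarrow> (\<forall>s t. ?c g (bb g) s t = 0))" if "g \<in> CG" for g
    using someI_ex[OF ex[OF that], folded bb_def] unfolding good_def .
  define F' where "F' a b = F a b + d1 (E1 bb) a b" for a b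
  have E1l: "lin1 (E1 bb)" by (rule E1_lin1) (use bb in blast)
  have F': "cocy2 F'"
    unfolding cocy2_def
  proof (intro conjI ballI)
    show "lin2 F'" unfolding lin2_def F'_def[abs_def]
      by (intro ballI conjI lin1_add lin2D[OF l] lin2D[OF d1_lin2[OF E1l]])
    fix a b c assume S: "a \<in> AS" "b \<in> AS" "c \<in> AS"
    then have "d2 F a b c = 0" "d2 (d1 (E1 bb)) a b c = 0" using F d2_d1[OF E1l] by (auto simp: cocy2_def)
    moreover have "d2 F' a b c = d2 F a b c + d2 (d1 (E1 bb)) a b c" by (simp add: d2_def F'_def mul_add)
    ultimately show "d2 F' a b c = 0" by simp
  qed
  have lk: "Poly_Mapping.lookup (\<Sum>x\<in>CG. sg x (f x)) k = f k" if "k \<in> CG" for f k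
    using that fin by (simp add: lookup_sum lookup_single when_def sum.delta)
  have E1i: "E1 bb (inc s) = (\<Sum>k\<in>CG. sg k (bb k s))" for s
    using E1_single[of bb \<one> s] bb by simp
  have cF': "cmp F' k = ?c k (bb k)" if k: "k \<in> CG" for k
  proof (intro ext)
    fix s t
    have "Poly_Mapping.lookup (d1 (E1 bb) (inc (th id s)) (inc (th id t))) k = dcob k (bb k) (th id s) (th id t)"
      using k lin1D(1)[OF E1l, of "inc (th id _)"]
      by (simp add: d1_def dcob_def inc_mult lookup_add lookup_minus lookup_mul_inc) (simp add: E1i lk)
    then show "cmp F' k s t = ?c k (bb k) s t" by (simp add: cmp_def F'_def lookup_add)
  qed
  let ?C = "avg (cmp F')"
  have rad: "radial (cmp F' g)" and hm: "?nt g \<Longrightarrow> harm g (om (cmp F' g))" and zz: "\<not> ?nt g \<Longrightarrow> cmp F' g s t = 0"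
    if "g \<in> CG" for g s t using bb[OF that] cF'[OF that] by simp_all
  have fam: "skew_family G scl Bs \<rho> ?C"
  proof unfold_locales
    fix g assume g: "g \<in> CG"
    show cc: "coc g (?C g)" by (rule avg_coc[OF cmp_coc[OF F'] g])
    show "radial (?C g)" by (rule avg_radial[OF cmp_coc[OF F'] rad g])
    show "pjinv (?C g)" by (simp add: pjinv_def avg_def th_pj rho_lin)
    show i: "\<theta> y (?C g s t) = ?C (y \<otimes> g \<otimes> inv y) (\<theta> y s) (\<theta> y t)" if "y \<in> CG" for y s t
      by (rule avg_invariant[OF that g])
    show "(\<forall>u v. om (?C g) u v = 0) \<or>
      (codim g = 2 \<and> (\<forall>u v. \<rho> g u = u \<longrightarrow> om (?C g) u v = 0) \<and> (\<forall>u v. th (fixp g) (om (?C g) u v) = om (?C g) u v))"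
    proof (cases "?nt g")
      case True
      have h: "harm g (om (?C g))" by (rule avg_harm[OF hm g True])
      have "\<theta> g (?C g s t) = ?C g (\<theta> g s) (\<theta> g t)" for s t using i[OF g, of s t] g by (simp add: m_assoc)
      from om_cases[OF g cc h True this] h show ?thesis unfolding harm_def by blast
    next
      case False
      have "\<rho> (inv x \<otimes> g \<otimes> x) v = v" if "x \<in> CG" for x v
        using False g that by (simp add: rho_mult)
      then have "?C g s t = 0" for s t using zz g by (simp add: avg_def)
      then show ?thesis by (simp add: om_def)
    qed
  qed
  obtain H where H: "lin1 H" "\<And>a b. a \<in> AS \<Longrightarrow> b \<in> AS \<Longrightarrow> F' a b = E2 ?C a b + d1 H a b"
    using homotopy2[OF F'] by (elim exE conjE) (rule that, simp_all)
  have "F a b = E2 ?C a b + d1 (\<lambda>a. H a - E1 bb a) a b" if "a \<in> AS" "b \<in> AS" for a b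
    using H(2)[OF that] by (simp add: F'_def d1_def mul_diff algebra_simps)
  then show ?thesis using fam lin1_diff[OF H(1) E1l] by blast
qed

end

context skew_family
begin

text \<open>The primitives of the \<open>gam x\<close> are chosen without regard to invariance, so
  \<open>d2 (E2 hh)\<close> is known to match the circle product only on \<open>S\<close>. The
  difference is a cocycle that vanishes there, and \<open>homotopy3\<close> takes care of
  it.\<close>

lemma E2_bracket_exact:
  assumes F: "cocy2 (E2 c)"
  shows "\<exists>H. lin2 H \<and> (\<forall>a\<in>AS. \<forall>b\<in>AS. \<forall>e\<in>AS. cp (E2 c) (E2 c) a b e = d2 H a b e)"
proof -
  note E = E2[of c, OF c_l c_r]
  define exact where "exact x h \<longleftrightarrow> (\<forall>s. h s \<in> hom_bim) \<and> (\<forall>s t u. h (s + t) u = h s u + h t u) \<and>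
      (\<forall>k s u. h (pconst k * s) u = pconst k * h s u) \<and>
      (\<forall>s\<in>S. \<forall>t\<in>S. \<forall>u\<in>S. gam x s t u = s * h t u - h (s * t) u + h s (t * u) - h s t * \<theta> x u)" for x h
  define hh where "hh x = (SOME h. exact x h)" for x
  have hh: "exact x (hh x)" if "x \<in> CG" for x
    unfolding hh_def by (rule someI_ex[where P = "exact x"]) (unfold exact_def, rule gam_exact[OF that])
  note hh = hh[unfolded exact_def]
  have hl: "plin (\<lambda>s. hh x s t)" and hr: "plin (hh x s)" if "x \<in> CG" for x s t
    using hh[OF that] hom_bimD[of "hh x _"] by (auto simp: plin_def)
  note EH = E2[of hh, OF hl hr]
  \<comment> \<open>Collects a sum over pairs by the product \<open>x = g h\<close> of the
    pair.\<close>
  have red: "(\<Sum>h\<in>CG. \<Sum>g\<in>CG. sg (g \<otimes> h) (f g h)) = (\<Sum>x\<in>CG. sg x (\<Sum>g\<in>CG. f g (inv g \<otimes> x)))" for f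
  proof -
    have sgsum: "(\<Sum>x\<in>CG. sg m (f x)) = sg m (\<Sum>x\<in>CG. f x)" for m f
      by (rule poly_mapping_eqI) (auto simp: lookup_sum lookup_single when_def)
    have "(\<Sum>h\<in>CG. sg (g \<otimes> h) (f g h)) = (\<Sum>x\<in>CG. sg x (f g (inv g \<otimes> x)))" if g: "g \<in> CG" for g
    proof -
      have "(\<Sum>h\<in>CG. sg (g \<otimes> h) (f g h)) = (\<Sum>h\<in>CG. sg (g \<otimes> h) (f g (inv g \<otimes> (g \<otimes> h))))"
        by (rule sum.cong) (use g in simp_all)
      also have "\<dots> = (\<Sum>x\<in>CG. sg x (f g (inv g \<otimes> x)))" by (rule sum.reindex_bij_betw[OF bij_left_mult[OF g]])
      finally show ?thesis .
    qed
    then have "(\<Sum>h\<in>CG. \<Sum>g\<in>CG. sg (g \<otimes> h) (f g h)) = (\<Sum>g\<in>CG. \<Sum>x\<in>CG. sg x (f g (inv g \<otimes> x)))"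
      by (subst sum.swap) simp
    also have "\<dots> = (\<Sum>x\<in>CG. \<Sum>g\<in>CG. sg x (f g (inv g \<otimes> x)))" by (rule sum.swap)
    finally show ?thesis by (simp add: sgsum)
  qed
  have Ei: "E2 c (inc s) (inc t) = (\<Sum>k\<in>CG. sg k (c k s t))" if "s \<in> S" "t \<in> S" for s t
    using E(2)[of \<one> \<one> s t] that by (simp add: theta_one)
  have EHi: "E2 hh (inc s) (inc t) = (\<Sum>k\<in>CG. sg k (hh k s t))" if "s \<in> S" "t \<in> S" for s t
    using EH(2)[of \<one> \<one> s t] that by (simp add: theta_one)
  have cpi: "cp (E2 c) (E2 c) (inc s) (inc t) (inc u) = (\<Sum>x\<in>CG. sg x (gam x s t u))" if S: "s \<in> S" "t \<in> S" "u \<in> S" for s t u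
  proof -
    have "E2 c (E2 c (inc s) (inc t)) (inc u) = (\<Sum>h\<in>CG. E2 c (sg h (c h s t)) (inc u))"
      using S lin1D(7)[OF lin2D(1)[OF E(1)], of "inc u" CG "\<lambda>h. sg h (c h s t)"] by (simp add: Ei c_S)
    also have "\<dots> = (\<Sum>h\<in>CG. \<Sum>g\<in>CG. sg (g \<otimes> h) (c g (c h s t) (\<theta> h u)))"
      by (rule sum.cong) (use S E(2)[of _ \<one> _ u] in \<open>simp_all add: c_S\<close>)
    finally have 1: "E2 c (E2 c (inc s) (inc t)) (inc u) = (\<Sum>x\<in>CG. sg x (\<Sum>g\<in>CG. c g (c (inv g \<otimes> x) s t) (\<theta> (inv g \<otimes> x) u)))"
      by (simp only: red)
    have "E2 c (inc s) (E2 c (inc t) (inc u)) = (\<Sum>h\<in>CG. E2 c (inc s) (sg h (c h t u)))"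
      using S lin1D(7)[OF lin2D(2)[OF E(1)], of "inc s" CG "\<lambda>h. sg h (c h t u)"] by (simp add: Ei c_S)
    also have "\<dots> = (\<Sum>h\<in>CG. \<Sum>g\<in>CG. sg (g \<otimes> h) (c g s (c h t u)))"
      by (rule sum.cong) (use S E(2)[of \<one> _ s] in \<open>simp_all add: c_S theta_one\<close>)
    finally have 2: "E2 c (inc s) (E2 c (inc t) (inc u)) = (\<Sum>x\<in>CG. sg x (\<Sum>g\<in>CG. c g s (c (inv g \<otimes> x) t u)))"
      by (simp only: red)
    show ?thesis
      unfolding cp_def 1 2 by (simp add: sum_subtractf[symmetric] single_diff[symmetric] gam_def)
  qed
  have di: "d2 (E2 hh) (inc s) (inc t) (inc u) = (\<Sum>x\<in>CG. sg x (gam x s t u))" if S: "s \<in> S" "t \<in> S" "u \<in> S" for s t u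
  proof -
    have "d2 (E2 hh) (inc s) (inc t) (inc u) = (\<Sum>x\<in>CG. sg x (s * hh x t u) - sg x (hh x (s * t) u) + sg x (hh x s (t * u)) - sg x (hh x s t * \<theta> x u))"
      using S by (simp add: d2_def inc_mult EHi mul_sum mul_single theta_one plinD(3)[OF hr] sum.distrib sum_subtractf)
    also have "\<dots> = (\<Sum>x\<in>CG. sg x (gam x s t u))"
      by (rule sum.cong) (use hh S in \<open>simp_all add: single_diff single_add\<close>)
    finally show ?thesis .
  qed
  let ?G = "\<lambda>a b e. cp (E2 c) (E2 c) a b e - d2 (E2 hh) a b e"
  have "\<exists>H. lin2 H \<and> (\<forall>a\<in>AS. \<forall>b\<in>AS. \<forall>e\<in>AS. ?G a b e = d2 H a b e)"
  proof (rule homotopy3)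
    show "lin3 ?G"
      unfolding lin3_def lin2_def
      by (intro ballI conjI lin1_diff lin3D[OF cp_lin3[OF E(1) E(1)]] lin3D[OF d2_lin3[OF EH(1)]])
    show "d3 ?G a b e f = 0" if "a \<in> AS" "b \<in> AS" "e \<in> AS" "f \<in> AS" for a b e f
    proof -
      have "d3 ?G a b e f = d3 (cp (E2 c) (E2 c)) a b e f - d3 (d2 (E2 hh)) a b e f"
        by (simp add: d3_def mul_diff)
      then show ?thesis using cp_cocycle[OF F that] d3_d2[OF EH(1) that] by simp
    qed
    show "?G (inc s) (inc t) (inc u) = 0" if "s \<in> S" "t \<in> S" "u \<in> S" for s t u
      using cpi[OF that] di[OF that] by simp
  qed
  then obtain H where H: "lin2 H" "\<And>a b e. a \<in> AS \<Longrightarrow> b \<in> AS \<Longrightarrow> e \<in> AS \<Longrightarrow> ?G a b e = d2 H a b e" by blast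
  have "cp (E2 c) (E2 c) a b e = d2 (\<lambda>a b. H a b + E2 hh a b) a b e" if "a \<in> AS" "b \<in> AS" "e \<in> AS" for a b e
  proof -
    have "d2 (\<lambda>a b. H a b + E2 hh a b) a b e = d2 H a b e + d2 (E2 hh) a b e" by (simp add: d2_def mul_add)
    then show ?thesis by (simp add: H(2)[OF that, symmetric])
  qed
  moreover have "lin2 (\<lambda>a b. H a b + E2 hh a b)" unfolding lin2_def by (intro ballI conjI lin1_add lin2D[OF H(1)] lin2D[OF EH(1)])
  ultimately show ?thesis by blast
qed

end

context skew
begin

text \<open>Two representatives occur because the bracket of classes ranges over all pairs of them.
  Writing both as \<open>E\<close> plus a coboundary leaves twice \<open>cp E E\<close> and two
  brackets with coboundaries. The latter are exact by \<open>cp_d1\<close>, applied to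
  \<open>E\<close> for \<open>l2\<close> and to \<open>F2\<close> for \<open>l1\<close>, so that no
  product of two coboundaries is left over.\<close>

theorem bracket_exact:
  assumes F: "cocy2 F0" "cocy2 F1" "cocy2 F2"
    and triv: "\<And>g. g \<in> CG \<Longrightarrow> (\<And>v. \<rho> g v = v) \<Longrightarrow> \<exists>b. plin b \<and> (\<forall>s\<in>S. \<forall>t\<in>S. cmp F0 g s t = dcob g b s t)"
    and k1: "lin1 k1" "\<And>a b. a \<in> AS \<Longrightarrow> b \<in> AS \<Longrightarrow> F1 a b = F0 a b + d1 k1 a b"
    and k2: "lin1 k2" "\<And>a b. a \<in> AS \<Longrightarrow> b \<in> AS \<Longrightarrow> F2 a b = F0 a b + d1 k2 a b"
  shows "\<exists>H. lin2 H \<and> (\<forall>a\<in>AS. \<forall>b\<in>AS. \<forall>e\<in>AS. cp F1 F2 a b e + cp F2 F1 a b e = d2 H a b e)"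
proof -
  obtain c K where c: "skew_family G scl Bs \<rho> c" and K: "lin1 K" "\<And>a b. a \<in> AS \<Longrightarrow> b \<in> AS \<Longrightarrow> F0 a b = E2 c a b + d1 K a b"
    using good_representative[OF F(1) triv] by blast
  interpret skew_family G scl Bs \<rho> c by (rule c)
  define E where "E = E2 c"
  have El: "lin2 E" unfolding E_def by (rule E2(1)[OF c_l c_r])
  define l1 where "l1 a = k1 a + K a" for a
  define l2 where "l2 a = k2 a + K a" for a
  have l1: "lin1 l1" and l2: "lin1 l2" unfolding l1_def[abs_def] l2_def[abs_def] by (intro lin1_add k1 k2 K)+
  have e1: "F1 a b = E a b + d1 l1 a b" and e2: "F2 a b = E a b + d1 l2 a b" if "a \<in> AS" "b \<in> AS" for a b
    using that by (simp_all add: k1 k2 K E_def l1_def l2_def d1_def mul_add)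
  have F1l: "lin2 F1" and F2l: "lin2 F2" using F by (simp_all add: cocy2_def)
  have Ec: "cocy2 E"
    unfolding cocy2_def
  proof (intro conjI ballI El)
    fix a b e assume S: "a \<in> AS" "b \<in> AS" "e \<in> AS"
    have "d2 F1 a b e = d2 E a b e + d2 (d1 l1) a b e"
      using S by (simp add: d2_def e1 mul_add)
    then show "d2 E a b e = 0" using F(2) S d2_d1[OF l1 S] by (simp add: cocy2_def)
  qed
  obtain H where H: "lin2 H" "\<And>a b e. a \<in> AS \<Longrightarrow> b \<in> AS \<Longrightarrow> e \<in> AS \<Longrightarrow> cp E E a b e = d2 H a b e"
    using E2_bracket_exact Ec unfolding E_def by blast
  let ?p = "\<lambda>F k a b. F (k a) b + F a (k b) - k (F a b)"
  have pl: "lin2 (?p F k)" if Fl: "lin2 F" and k: "lin1 k" for F k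
    unfolding lin2_def
    by (intro ballI conjI lin1_add lin1_diff lin1_comp[OF lin2D(1)[OF Fl] k] lin1_comp[OF lin2D(2)[OF Fl] k]
        lin1_comp[OF k lin2D(1)[OF Fl]] lin1_comp[OF k lin2D(2)[OF Fl]] lin2D[OF Fl] lin1D(1)[OF k])
  note D = lin2D(3)[OF El] lin2D(3)[OF F1l] lin2D(3)[OF F2l] lin2D(3)[OF d1_lin2[OF l1]] lin2D(3)[OF d1_lin2[OF l2]]
  have main: "cp F1 F2 a b e + cp F2 F1 a b e = d2 (\<lambda>a b. H a b + H a b + ?p E l2 a b + ?p F2 l1 a b) a b e"
    if S: "a \<in> AS" "b \<in> AS" "e \<in> AS" for a b e
  proof -
    have 1: "cp F1 F2 a b e = cp E F2 a b e + cp (d1 l1) F2 a b e"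
      using S by (simp add: cp_def e1 D)
    have 2: "cp F2 F1 a b e = cp F2 E a b e + cp F2 (d1 l1) a b e"
      using S by (simp add: cp_def e1 D lin1D(2)[OF lin2D(1)[OF F2l]] lin1D(2)[OF lin2D(2)[OF F2l]])
    have 3: "cp E F2 a b e = cp E E a b e + cp E (d1 l2) a b e"
      using S by (simp add: cp_def e2 D lin1D(2)[OF lin2D(1)[OF El]] lin1D(2)[OF lin2D(2)[OF El]])
    have 4: "cp F2 E a b e = cp E E a b e + cp (d1 l2) E a b e"
      using S by (simp add: cp_def e2 D)
    have "cp F1 F2 a b e + cp F2 F1 a b e = cp E E a b e + cp E E a b e + (cp E (d1 l2) a b e + cp (d1 l2) E a b e)
        + (cp F2 (d1 l1) a b e + cp (d1 l1) F2 a b e)"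
      unfolding 1 2 3 4 by simp
    also have "\<dots> = d2 H a b e + d2 H a b e + d2 (?p E l2) a b e + d2 (?p F2 l1) a b e"
      by (simp only: H(2)[OF S] cp_d1[OF Ec l2 S] cp_d1[OF F(3) l1 S])
    also have "\<dots> = d2 (\<lambda>a b. H a b + H a b + ?p E l2 a b + ?p F2 l1 a b) a b e"
      by (simp add: d2_def mul_add)
    finally show ?thesis .
  qed
  moreover have "lin2 (\<lambda>a b. H a b + H a b + ?p E l2 a b + ?p F2 l1 a b)"
    using pl[OF El l2] pl[OF F2l l1] unfolding lin2_def
    by (intro ballI conjI lin1_add lin2D[OF H(1)]; blast)
  ultimately show ?thesis by blast
qed

section \<open>Translation between cochains on lists and curried multilinear maps\<close>

lemma tuples_1: "tuples B 1 = {[a] |a. a \<in> B}"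
  by (auto simp: tuples_def length_Suc_conv)
lemma tuples_2: "tuples B 2 = {[a, b] |a b. a \<in> B \<and> b \<in> B}"
  by (auto simp: tuples_def length_Suc_conv numeral_2_eq_2)
lemma tuples_3: "tuples B 3 = {[a, b, c] |a b c. a \<in> B \<and> b \<in> B \<and> c \<in> B}"
  by (auto simp: tuples_def length_Suc_conv numeral_3_eq_3)
lemma tuples_4: "tuples B 4 = {[a, b, c, e] |a b c e. a \<in> B \<and> b \<in> B \<and> c \<in> B \<and> e \<in> B}"
  by (auto simp: tuples_def length_Suc_conv numeral_eq_Suc)

lemma ball_tuples:
  "(\<forall>xs\<in>tuples B 1. P xs) \<longleftrightarrow> (\<forall>a\<in>B. P [a])"
  "(\<forall>xs\<in>tuples B 2. P xs) \<longleftrightarrow> (\<forall>a\<in>B. \<forall>b\<in>B. P [a, b])"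
  "(\<forall>xs\<in>tuples B 3. P xs) \<longleftrightarrow> (\<forall>a\<in>B. \<forall>b\<in>B. \<forall>c\<in>B. P [a, b, c])"
  "(\<forall>xs\<in>tuples B 4. P xs) \<longleftrightarrow> (\<forall>a\<in>B. \<forall>b\<in>B. \<forall>c\<in>B. \<forall>e\<in>B. P [a, b, c, e])"
  unfolding tuples_1 tuples_2 tuples_3 tuples_4 by blast+

lemma lessThan_23: "{..<2} = {0, 1 :: nat}" "{..<3} = {0, 1, 2 :: nat}"
  by auto

lemma cochains_1: "f \<in> cochains AA B M 1 \<longleftrightarrow> (\<forall>a\<in>B. f [a] \<in> M) \<and> (B \<noteq> {} \<longrightarrow>
    (\<forall>a\<in>B. \<forall>b\<in>B. f [a + b] = f [a] + f [b]) \<and> (\<forall>a\<in>B. \<forall>k. f [sc k a] = sc k (f [a])))"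
  unfolding cochains_def tuples_1 AA_sel by fastforce

lemma cochains_2: "f \<in> cochains AA B M 2 \<longleftrightarrow> (\<forall>a\<in>B. \<forall>b\<in>B. f [a, b] \<in> M) \<and>
    (\<forall>e\<in>B. \<forall>a\<in>B. \<forall>b\<in>B. f [a + b, e] = f [a, e] + f [b, e] \<and> f [e, a + b] = f [e, a] + f [e, b]) \<and>
    (\<forall>e\<in>B. \<forall>a\<in>B. \<forall>k. f [sc k a, e] = sc k (f [a, e]) \<and> f [e, sc k a] = sc k (f [e, a]))"
proof -
  have all2: "(\<forall>i<2. P i) \<longleftrightarrow> P 0 \<and> P (1::nat)" for P by (auto simp: less_2_cases_iff)
  have u: "[a, b][0 := x] = [x, b]" "[a, b][1 := x] = [a, x]" for a b x by simp_all
  show ?thesis unfolding cochains_def mem_Collect_eq ball_tuples AA_sel all2 u by blast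
qed

lemma lin1_cochains: "f \<in> cochains AA AS AS 1 \<longleftrightarrow> lin1 (\<lambda>a. f [a])"
  unfolding cochains_1 lin1_def using AS_0 by blast

lemma lin2_cochains: "f \<in> cochains AA AS AS 2 \<longleftrightarrow> lin2 (\<lambda>a b. f [a, b])"
  unfolding cochains_2 lin2_def lin1_def by blast

lemma lin3_cochains: "lin3 (\<lambda>a b c. f [a, b, c]) \<Longrightarrow> f \<in> cochains AA AS AS 3"
proof -
  assume f: "lin3 (\<lambda>a b c. f [a, b, c])"
  have all3: "(\<forall>i<3. P i) \<longleftrightarrow> P 0 \<and> P 1 \<and> P (2::nat)" for P by (auto simp: numeral_3_eq_3 numeral_2_eq_2 less_Suc_eq)
  have u: "[a, b, c][0 := x] = [x, b, c]" "[a, b, c][1 := x] = [a, x, c]" "[a, b, c][2 := x] = [a, b, x]" for a b c x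
    by (simp_all add: numeral_2_eq_2)
  show ?thesis unfolding cochains_def mem_Collect_eq ball_tuples AA_sel all3 u
    by (intro ballI conjI allI lin3D(4)[OF f] lin1D(2,3)[OF lin3D(1)[OF f]] lin1D(2,3)[OF lin3D(2)[OF f]]
        lin1D(2,3)[OF lin3D(3)[OF f]])
qed

lemma hh_diff_1: "hh_diff AA 1 f [a, b] = d1 (\<lambda>a. f [a]) a b"
  by (simp add: hh_diff_def d1_def signed_def AA_sel)
lemma hh_diff_2: "hh_diff AA 2 f [a, b, c] = d2 (\<lambda>a b. f [a, b]) a b c"
  by (simp add: hh_diff_def d2_def signed_def AA_sel lessThan_23)
lemma hh_diff_3: "hh_diff AA 3 f [a, b, c, e] = d3 (\<lambda>a b c. f [a, b, c]) a b c e"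
  by (simp add: hh_diff_def d3_def signed_def AA_sel lessThan_23)

lemma cocycles_2: "f \<in> cocycles AA AS AS 2 \<longleftrightarrow> cocy2 (\<lambda>a b. f [a, b])"
proof -
  have e: "(2::nat) + 1 = 3" by simp
  show ?thesis
    unfolding cocycles_def cocy2_def mem_Collect_eq lin2_cochains e ball_tuples hh_diff_2 ..
qed

lemma coboundaries_2: "f \<in> coboundaries AA AS AS 2 \<longleftrightarrow> (\<exists>k. lin1 k \<and> (\<forall>a\<in>AS. \<forall>b\<in>AS. f [a, b] = d1 k a b))"
proof -
  have "f \<in> coboundaries AA AS AS 2 \<longleftrightarrow> (\<exists>h\<in>cochains AA AS AS 1. \<forall>xs\<in>tuples AS 2. f xs = hh_diff AA 1 h xs)"
    by (simp add: coboundaries_def numeral_2_eq_2)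
  also have "\<dots> \<longleftrightarrow> (\<exists>h. lin1 (\<lambda>a. h [a]) \<and> (\<forall>a\<in>AS. \<forall>b\<in>AS. f [a, b] = d1 (\<lambda>a. h [a]) a b))"
    unfolding Bex_def lin1_cochains ball_tuples hh_diff_1 ..
  also have "\<dots> \<longleftrightarrow> (\<exists>k. lin1 k \<and> (\<forall>a\<in>AS. \<forall>b\<in>AS. f [a, b] = d1 k a b))" (is "?l \<longleftrightarrow> ?r")
  proof
    assume ?r
    then obtain k where "lin1 k" "\<forall>a\<in>AS. \<forall>b\<in>AS. f [a, b] = d1 k a b" by blast
    then show ?l by (intro exI[of _ "\<lambda>xs. k (hd xs)"]) simp
  qed blast
  finally show ?thesis .
qed

lemma coboundaries_3: "f \<in> coboundaries AA AS AS 3 \<longleftrightarrow> (\<exists>H. lin2 H \<and> (\<forall>a\<in>AS. \<forall>b\<in>AS. \<forall>c\<in>AS. f [a, b, c] = d2 H a b c))"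
proof -
  have "f \<in> coboundaries AA AS AS 3 \<longleftrightarrow> (\<exists>h\<in>cochains AA AS AS 2. \<forall>xs\<in>tuples AS 3. f xs = hh_diff AA 2 h xs)"
    by (simp add: coboundaries_def numeral_3_eq_3 numeral_2_eq_2)
  also have "\<dots> \<longleftrightarrow> (\<exists>h. lin2 (\<lambda>a b. h [a, b]) \<and> (\<forall>a\<in>AS. \<forall>b\<in>AS. \<forall>c\<in>AS. f [a, b, c] = d2 (\<lambda>a b. h [a, b]) a b c))"
    unfolding Bex_def lin2_cochains ball_tuples hh_diff_2 ..
  also have "\<dots> \<longleftrightarrow> (\<exists>H. lin2 H \<and> (\<forall>a\<in>AS. \<forall>b\<in>AS. \<forall>c\<in>AS. f [a, b, c] = d2 H a b c))" (is "?l \<longleftrightarrow> ?r")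
  proof
    assume ?r
    then obtain H where "lin2 H" "\<forall>a\<in>AS. \<forall>b\<in>AS. \<forall>c\<in>AS. f [a, b, c] = d2 H a b c" by blast
    then show ?l by (intro exI[of _ "\<lambda>xs. H (hd xs) (hd (tl xs))"]) simp
  qed blast
  finally show ?thesis .
qed

lemma gerstenhaber_22: "gerstenhaber 2 2 f f' [a, b, c] = cp (\<lambda>a b. f [a, b]) (\<lambda>a b. f' [a, b]) a b c + cp (\<lambda>a b. f' [a, b]) (\<lambda>a b. f [a, b]) a b c"
  by (simp add: gerstenhaber_def circ_def cp_def signed_def lessThan_23)

text \<open>\<open>hh_rel\<close> relates cocycles only, so \<open>f\<close> is first seen to be one
  by \<open>d3_d2\<close>. Adding or subtracting its primitive then converts primitives of
  \<open>0 - f'\<close> into primitives of \<open>f - f'\<close> and back.\<close>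

lemma HH_zero_eq:
  assumes H: "lin2 H" "\<And>a b c. a \<in> AS \<Longrightarrow> b \<in> AS \<Longrightarrow> c \<in> AS \<Longrightarrow> f [a, b, c] = d2 H a b c"
  shows "hh_rel AA AS AS 3 `` {f} = HH_zero AA AS AS 3"
proof -
  have f: "f \<in> cocycles AA AS AS 3" if H: "lin2 H" and e: "\<And>a b c. a \<in> AS \<Longrightarrow> b \<in> AS \<Longrightarrow> c \<in> AS \<Longrightarrow> f [a, b, c] = d2 H a b c" for f H
  proof -
    note D = d2_lin3[OF H]
    have l: "lin3 (\<lambda>a b c. f [a, b, c])"
      unfolding lin3_def lin2_def lin1_def
      using e lin3D(4)[OF D] lin1D(2,3)[OF lin3D(1)[OF D]] lin1D(2,3)[OF lin3D(2)[OF D]] lin1D(2,3)[OF lin3D(3)[OF D]]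
      by simp
    have "d3 (\<lambda>a b c. f [a, b, c]) a b c x = 0" if S: "a \<in> AS" "b \<in> AS" "c \<in> AS" "x \<in> AS" for a b c x
      using d3_d2[OF H S] S by (simp add: d3_def e)
    moreover have "(3::nat) + 1 = 4" by simp
    ultimately show ?thesis
      unfolding cocycles_def mem_Collect_eq \<open>(3::nat) + 1 = 4\<close> ball_tuples hh_diff_3
      using lin3_cochains[OF l] by blast
  qed
  have fc: "f \<in> cocycles AA AS AS 3" using f[OF H] .
  have z: "(\<lambda>_. 0) \<in> cocycles AA AS AS 3"
  proof (rule f)
    show "lin2 (\<lambda>a b. 0)" by (simp add: lin2_def lin1_def)
  qed (simp add: d2_def)
  have "(\<lambda>xs. f xs - f' xs) \<in> coboundaries AA AS AS 3 \<longleftrightarrow> (\<lambda>xs. 0 - f' xs) \<in> coboundaries AA AS AS 3" for f'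
    unfolding coboundaries_3
  proof
    assume "\<exists>H. lin2 H \<and> (\<forall>a\<in>AS. \<forall>b\<in>AS. \<forall>c\<in>AS. f [a, b, c] - f' [a, b, c] = d2 H a b c)"
    then obtain H' where H': "lin2 H'" "\<And>a b c. a \<in> AS \<Longrightarrow> b \<in> AS \<Longrightarrow> c \<in> AS \<Longrightarrow> f [a, b, c] - f' [a, b, c] = d2 H' a b c" by blast
    have "0 - f' [a, b, c] = d2 (\<lambda>a b. H' a b - H a b) a b c" if "a \<in> AS" "b \<in> AS" "c \<in> AS" for a b c
    proof -
      have "d2 (\<lambda>a b. H' a b - H a b) a b c = d2 H' a b c - d2 H a b c" by (simp add: d2_def mul_diff)
      then show ?thesis by (simp add: H'(2)[OF that, symmetric] H(2)[OF that, symmetric])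
    qed
    moreover have "lin2 (\<lambda>a b. H' a b - H a b)" unfolding lin2_def by (intro ballI conjI lin1_diff lin2D[OF H(1)] lin2D[OF H'(1)])
    ultimately show "\<exists>H. lin2 H \<and> (\<forall>a\<in>AS. \<forall>b\<in>AS. \<forall>c\<in>AS. 0 - f' [a, b, c] = d2 H a b c)" by blast
  next
    assume "\<exists>H. lin2 H \<and> (\<forall>a\<in>AS. \<forall>b\<in>AS. \<forall>c\<in>AS. 0 - f' [a, b, c] = d2 H a b c)"
    then obtain H' where H': "lin2 H'" "\<And>a b c. a \<in> AS \<Longrightarrow> b \<in> AS \<Longrightarrow> c \<in> AS \<Longrightarrow> 0 - f' [a, b, c] = d2 H' a b c" by blast
    have "f [a, b, c] - f' [a, b, c] = d2 (\<lambda>a b. H' a b + H a b) a b c" if "a \<in> AS" "b \<in> AS" "c \<in> AS" for a b c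
    proof -
      have "d2 (\<lambda>a b. H' a b + H a b) a b c = d2 H' a b c + d2 H a b c" by (simp add: d2_def mul_add)
      then show ?thesis by (simp add: H'(2)[OF that, symmetric] H(2)[OF that, symmetric])
    qed
    moreover have "lin2 (\<lambda>a b. H' a b + H a b)" unfolding lin2_def by (intro ballI conjI lin1_add lin2D[OF H(1)] lin2D[OF H'(1)])
    ultimately show "\<exists>H. lin2 H \<and> (\<forall>a\<in>AS. \<forall>b\<in>AS. \<forall>c\<in>AS. f [a, b, c] - f' [a, b, c] = d2 H a b c)" by blast
  qed
  then show ?thesis using fc z unfolding HH_zero_def hh_rel_def by auto
qed

text \<open>By reflexivity the projected cocycle \<open>fg\<close> itself belongs to the union
  \<open>HH_component\<close>, so equality with the zero class makes it a coboundary. The zero class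
  compares 0 with \<open>fg\<close>; what is obtained is therefore a primitive of
  \<open>- fg\<close>, whence the sign in front of \<open>\<beta>\<close>.\<close>

lemma component_coboundary:
  assumes f: "f \<in> cocycles AA AS AS 2" and g: "g \<in> CG" and fa: "f \<in> \<alpha>"
    and s: "HH_component G scl Bs \<rho> 2 g \<alpha> = HH_zero AA (skew_component Bs \<one>) (skew_component Bs g) 2"
  shows "\<exists>b. plin b \<and> (\<forall>s\<in>S. \<forall>t\<in>S. cmp (\<lambda>a b. f [a, b]) g s t = dcob g b s t)"
proof -
  let ?B = "skew_component Bs \<one>" and ?M = "skew_component Bs g"
  let ?F = "\<lambda>a b. f [a, b]"
  have F: "cocy2 ?F" using f by (simp add: cocycles_2)
  then have l: "lin2 ?F" by (simp add: cocy2_def)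
  have B: "?B = {inc s |s. s \<in> S}" and M: "?M = {sg g s |s. s \<in> S}" by (auto simp: skew_component_def)
  define fg where "fg xs = sg g (Poly_Mapping.lookup (f xs) g)" for xs
  have fgi: "fg [inc s, inc t] = sg g (cmp ?F g s t)" if "s \<in> S" "t \<in> S" for s t
    using that by (simp add: fg_def cmp_def)
  note pl = plinD[OF cmp_plin(1)[OF l g]] plinD[OF cmp_plin(2)[OF l g]]
  have "fg \<in> cochains AA ?B ?M 2"
    unfolding cochains_2 B M
    by (auto simp: fgi single_add[symmetric] sc_single pl)
  moreover have "hh_diff AA 2 fg [inc s, inc t, inc u] = 0" if S: "s \<in> S" "t \<in> S" "u \<in> S" for s t u
  proof -
    have "hh_diff AA 2 fg [inc s, inc t, inc u] = sg g (s * cmp ?F g t u - cmp ?F g (s * t) u + cmp ?F g s (t * u) - cmp ?F g s t * \<theta> g u)"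
      using S g by (simp add: hh_diff_2 d2_def inc_mult fgi mul_single theta_one pl single_diff single_add)
    also have "\<dots> = 0" using cocD(3)[OF cmp_coc[OF F g] S] by simp
    finally show ?thesis .
  qed
  ultimately have "fg \<in> cocycles AA ?B ?M 2"
  proof -
    assume a: "fg \<in> cochains AA ?B ?M 2" and b: "\<And>s t u. s \<in> S \<Longrightarrow> t \<in> S \<Longrightarrow> u \<in> S \<Longrightarrow> hh_diff AA 2 fg [inc s, inc t, inc u] = 0"
    have "(2::nat) + 1 = 3" by simp
    then show ?thesis unfolding cocycles_def mem_Collect_eq \<open>(2::nat) + 1 = 3\<close> tuples_3 using a b by (auto simp: B)
  qed
  moreover have "(\<lambda>xs. fg xs - fg xs) \<in> coboundaries AA ?B ?M 2"
  proof -
    have "(\<lambda>_. 0) \<in> cochains AA ?B ?M 1"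
      using sc_0 S_0 unfolding cochains_1 M by (auto intro: exI[of _ 0])
    moreover have "\<forall>xs\<in>tuples ?B 2. 0 = hh_diff AA 1 (\<lambda>_. 0) xs"
      unfolding tuples_2 using hh_diff_1[of "\<lambda>_. 0"] by (auto simp: d1_def)
    ultimately show ?thesis by (auto simp: coboundaries_def numeral_2_eq_2)
  qed
  ultimately have "(fg, fg) \<in> hh_rel AA ?B ?M 2" by (simp add: hh_rel_def)
  then have "fg \<in> HH_component G scl Bs \<rho> 2 g \<alpha>"
    unfolding HH_component_def using fa by (auto simp: fg_def[abs_def])
  then have "(\<lambda>xs. 0 - fg xs) \<in> coboundaries AA ?B ?M 2"
    unfolding s HH_zero_def hh_rel_def by auto
  then have "\<exists>h\<in>cochains AA ?B ?M 1. \<forall>xs\<in>tuples ?B 2. - fg xs = hh_diff AA 1 h xs"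
    by (simp add: coboundaries_def numeral_2_eq_2)
  then obtain h where h: "h \<in> cochains AA ?B ?M 1" and e: "\<And>s t. s \<in> S \<Longrightarrow> t \<in> S \<Longrightarrow> - fg [inc s, inc t] = hh_diff AA 1 h [inc s, inc t]"
    unfolding tuples_2 B by blast
  have "inc 0 \<in> ?B" unfolding B using S_0 by blast
  then have hD: "\<And>s. s \<in> S \<Longrightarrow> \<exists>m\<in>S. h [inc s] = sg g m" "\<And>s t. s \<in> S \<Longrightarrow> t \<in> S \<Longrightarrow> h [inc s + inc t] = h [inc s] + h [inc t]"
      "\<And>s k. s \<in> S \<Longrightarrow> h [sc k (inc s)] = sc k (h [inc s])"
    using h unfolding cochains_1 B M by blast+
  define \<beta> where "\<beta> s = Poly_Mapping.lookup (h [inc (th id s)]) g" for s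
  have hb: "h [inc s] = sg g (\<beta> s)" if "s \<in> S" for s
    using hD(1)[OF that] that by (auto simp: \<beta>_def)
  have bp: "plin \<beta>"
    unfolding plin_def
  proof (intro conjI allI)
    show "\<beta> (s + t) = \<beta> s + \<beta> t" for s t using hD(2)[of "th id s" "th id t"] by (simp add: \<beta>_def th_add single_add lookup_add)
    show "\<beta> (pconst k * s) = pconst k * \<beta> s" for k s using hD(3)[of "th id s" k] by (simp add: \<beta>_def th_mult sc_single lookup_sc)
    show "\<beta> s \<in> S" for s using hD(1)[of "th id s"] by (auto simp: \<beta>_def)
  qed
  have "cmp ?F g s t = dcob g (\<lambda>s. - \<beta> s) s t" if S: "s \<in> S" "t \<in> S" for s t
  proof -
    have "- sg g (cmp ?F g s t) = sg g (s * \<beta> t - \<beta> (s * t) + \<beta> s * \<theta> g t)"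
      using e[OF S] S g by (simp add: fgi hh_diff_1[simplified] d1_def inc_mult hb mul_single theta_one plinD[OF bp] single_diff single_add)
    from arg_cong[OF this, of "\<lambda>a. - Poly_Mapping.lookup a g"] show ?thesis by (simp add: dcob_def)
  qed
  moreover have "plin (\<lambda>s. - \<beta> s)" using bp by (simp add: plin_def)
  ultimately show ?thesis by blast
qed

end

theorem corollary9p7:
  fixes G :: "('g, 'm) monoid_scheme"
    and scl :: "complex \<Rightarrow> 'v::ab_group_add \<Rightarrow> 'v"
    and Bs :: "'v set"
    and \<rho> :: "'g \<Rightarrow> 'v \<Rightarrow> 'v"
    and \<alpha> :: "(('g \<Rightarrow>\<^sub>0 'v cpoly) list \<Rightarrow> ('g \<Rightarrow>\<^sub>0 'v cpoly)) set"
  assumes "group G" and "finite (carrier G)"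
    and "finite_dimensional_vector_space scl Bs"
    and "group_action G UNIV \<rho>"
    and "\<And>g. g \<in> carrier G \<Longrightarrow> Vector_Spaces.linear scl scl (\<rho> g)"
    and "\<alpha> \<in> HH_self (skew_group_algebra G scl Bs \<rho>) 2"
    and "supported_on G scl Bs \<rho> 2 (carrier G - kernel G (BijGroup UNIV) \<rho>) \<alpha>"
  shows "HH_bracket (skew_group_algebra G scl Bs \<rho>) 2 2 \<alpha> \<alpha>
           = HH_zero (skew_group_algebra G scl Bs \<rho>)
               (aspace (skew_group_algebra G scl Bs \<rho>))
               (aspace (skew_group_algebra G scl Bs \<rho>)) 3
         \<and> noncommutative_poisson (skew_group_algebra G scl Bs \<rho>) \<alpha>"
proof -
  interpret skew G scl Bs \<rho>
  proof (intro skew.intro fdvs.intro skew_axioms.intro assms)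
    show "\<rho> (g \<otimes>\<^bsub>G\<^esub> h) v = \<rho> g (\<rho> h v)" if "g \<in> carrier G" "h \<in> carrier G" for g h v
      using group_action.composition_rule[OF assms(4) _ that] by simp
    show "\<rho> \<one>\<^bsub>G\<^esub> v = v" for v
      using group_action.id_eq_one[OF assms(4)] by (metis UNIV_I restrict_apply)
  qed
  have sup: "HH_component G scl Bs \<rho> 2 g \<alpha> = HH_zero AA (skew_component Bs \<one>\<^bsub>G\<^esub>) (skew_component Bs g) 2"
    if "g \<in> CG" "\<And>v. \<rho> g v = v" for g
  proof -
    \<comment> \<open>The unit of \<open>BijGroup UNIV\<close> is the identity function, so an
      element that fixes every vector lies in the kernel, that is, outside the allowed
      support.\<close>
    have "g \<in> kernel G (BijGroup UNIV) \<rho>"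
      using that by (simp add: kernel_def BijGroup_def fun_eq_iff)
    then show ?thesis using assms(7) that(1) unfolding supported_on_def by blast
  qed
  obtain f0 where f0: "f0 \<in> cocycles AA AS AS 2" and a: "\<alpha> = hh_rel AA AS AS 2 `` {f0}"
    using assms(6) unfolding HH_def AA_sel by (rule quotientE)
  have al: "f \<in> cocycles AA AS AS 2 \<and> (\<lambda>xs. f0 xs - f xs) \<in> coboundaries AA AS AS 2" if "f \<in> \<alpha>" for f
    using that unfolding a hh_rel_def by auto
  \<comment> \<open>Besides providing a reference representative, this shows that
    \<open>\<alpha>\<close> is nonempty, so that the union in \<open>HH_bracket\<close> is not empty
    and equals the common class found for every pair.\<close>
  have ref: "f0 \<in> \<alpha>"
  proof -
    have "\<exists>k. lin1 k \<and> (\<forall>a\<in>AS. \<forall>b\<in>AS. 0 = d1 k a b)"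
      by (rule exI[of _ "\<lambda>_. 0"]) (simp add: lin1_def d1_def)
    then show ?thesis using f0 unfolding a hh_rel_def by (auto simp: coboundaries_2)
  qed
  note triv = component_coboundary[OF f0 _ ref sup]
  have zero: "hh_rel AA AS AS 3 `` {gerstenhaber 2 2 f f'} = HH_zero AA AS AS 3" if f: "f \<in> \<alpha>" "f' \<in> \<alpha>" for f f'
  proof -
    have k: "\<exists>k. lin1 k \<and> (\<forall>a\<in>AS. \<forall>b\<in>AS. f [a, b] = f0 [a, b] + d1 k a b)" if ff: "f \<in> \<alpha>" for f
    proof -
      obtain k where "lin1 k" and k: "\<And>a b. a \<in> AS \<Longrightarrow> b \<in> AS \<Longrightarrow> f0 [a, b] - f [a, b] = d1 k a b"
        using al[OF ff] unfolding coboundaries_2 by blast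
      have "f [a, b] = f0 [a, b] + d1 (\<lambda>a. - k a) a b" if "a \<in> AS" "b \<in> AS" for a b
      proof -
        have "d1 (\<lambda>a. - k a) a b = - d1 k a b" by (simp add: d1_def mul_uminus)
        then show ?thesis by (simp add: k[OF that, symmetric])
      qed
      then show ?thesis using lin1_uminus[OF \<open>lin1 k\<close>] by blast
    qed
    obtain k1 k2 where k1: "lin1 k1" "\<And>a b. a \<in> AS \<Longrightarrow> b \<in> AS \<Longrightarrow> f [a, b] = f0 [a, b] + d1 k1 a b"
      and k2: "lin1 k2" "\<And>a b. a \<in> AS \<Longrightarrow> b \<in> AS \<Longrightarrow> f' [a, b] = f0 [a, b] + d1 k2 a b"
      using k[OF f(1)] k[OF f(2)] by blast
    have c: "cocy2 (\<lambda>a b. f0 [a, b])" "cocy2 (\<lambda>a b. f [a, b])" "cocy2 (\<lambda>a b. f' [a, b])"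
      using f0 al[OF f(1)] al[OF f(2)] by (simp_all add: cocycles_2)
    obtain H where "lin2 H" "\<forall>a\<in>AS. \<forall>b\<in>AS. \<forall>e\<in>AS. cp (\<lambda>a b. f [a, b]) (\<lambda>a b. f' [a, b]) a b e
        + cp (\<lambda>a b. f' [a, b]) (\<lambda>a b. f [a, b]) a b e = d2 H a b e"
      using bracket_exact[OF c triv k1 k2] by blast
    then show ?thesis by (intro HH_zero_eq[of H]) (simp_all add: gerstenhaber_22)
  qed
  have "(2::nat) + 2 - 1 = 3" by simp
  then have "HH_bracket AA 2 2 \<alpha> \<alpha> = HH_zero AA (aspace AA) (aspace AA) 3"
    unfolding HH_bracket_def AA_sel \<open>(2::nat) + 2 - 1 = 3\<close> using zero ref by auto
  then show ?thesis using assms(6) unfolding noncommutative_poisson_def by blast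
qed

end
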